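(* Fix $\xi\in\mathbb{R}^n\setminus\{0\}$, $\eta\in\mathbb S^{n-1}$ with $\eta\cdot\xi=0$, and $y\in\mathbb S^{n-1}\cap\eta^\perp$. With $\lambda=\lambda(\tau)$, $\sqrt\lambda=\tau+\mathrm{i}$, $\eta_1=\eta_1(\tau)$, $\eta_2=\eta_2(\tau)$, the function $b_2$ (depending on $\tau$), the functions $b$ and $\psi$, and the quantities $S_j=S_j(\lambda(\tau),\eta_1(\tau),\eta_2(\tau))$, $j=1,2$, defined in the context, we have $$\lim_{\tau\to+\infty}\frac{S_1-S_2}{\sqrt\lambda}=2\int_\Omega\eta\cdot(A_1-A_2)\,e^{-\mathrm{i}\xi\cdot x}\,b(x)\,e^{\mathrm{i}\psi(x)}\,dx.$$
   Context: Let $n\ge2$, $\Omega\subset\mathbb{R}^n$ a bounded connected $\mathcal C^{1,1}$ domain with $\mathbb{R}^n\setminus\Omega$ connected, $\Gamma=\partial\Omega$, $\nu$ the unit outward normal, and $\Omega_1\subsetneq\Omega$ an open neighborhood of $\Gamma$ in $\Omega$ (i.e. $\Omega_1=U\cap\Omega$ with $U\subset\mathbb{R}^n$ open, $\Gamma\subset U$). For $j=1,2$ let $V_j\in L^\infty(\Omega,\mathbb{R})$ and $A_j\in\mathcal C^1(\overline\Omega,\mathbb{R}^n)$, with $A_1=A_2$ on $\Omega_1$. For $x,y\in\mathbb{C}^n$, $x\cdot y=\sum_k x_ky_k$ (no conjugation); for $x\in\mathbb{R}^n$, $x^\perp=\{z\in\mathbb{R}^n: z\cdot x=0\}$. Dirichlet-to-Neumann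 maps: for $\lambda\in\mathbb{C}\setminus\mathbb{R}$ and $f\in H^{1/2}(\Gamma)$ let $u_{j,\lambda}\in H^1(\Omega)$ be the unique solution of $(-\mathrm{i}\nabla+A_j)^2u+V_ju-\lambda u=0$ in $\Omega$, $u=f$ on $\Gamma$, and set $\Lambda_{j,\lambda}f=(\partial_\nu+\mathrm{i}A_j\cdot\nu)u_{j,\lambda}|_\Gamma$. Parameters: for $\tau>|\xi|$, $B_\tau=\sqrt{1-\frac{|\xi|^2}{4\tau^2}}$, $\eta_1=B_\tau\eta-\frac{\xi}{2\tau}$, $\eta_2=B_\tau\eta+\frac{\xi}{2\tau}$, $\lambda=(\tau+\mathrm{i})^2$, $\sqrt\lambda=\tau+\mathrm{i}$. Mollified potentials: let $\tilde\Omega$ be a bounded open set with $\overline\Omega\subset\tilde\Omega$, $\tilde A_1\in\mathcal C^1_0(\tilde\Omega,\mathbb{R}^n)$ with $\tilde A_1=A_1$ on $\Omega$, and $\tilde A_2=A_2$ on $\Omega$, $\tilde A_2=\tilde A_1$ on $\tilde\Omega\setminus\Omega$ (both extended by $0$ to $\mathbb{R}^n$). Let $\chi\in\mathcal C^\infty_0(\mathbb{R}^n)$, $\chi\ge0$, $\operatorname{supp}\chi\subset\{|x|\le1\}$, $\int\chi=1$, $\chi_\delta(x)=\delta^{-n}\chi(x/\delta)$, with $\delta=\tau^{-1/3}$. Set $A_{j,\sharp}=\chi_\delta*\tilde A_j$, $A_\sharp=A_{2,\sharp}-A_{1,\sharp}$, and $\psi_j(x)=-\int_{-\infty}^0\eta_j\cdot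 A_{j,\sharp}(x+s\eta_j)\,ds$. Let $A$ be $A_2-A_1$ on $\Omega$ extended by $0$ to $\mathbb{R}^n$. Amplitudes: with $\omega=B_\tau\xi-\frac{|\xi|^2}{2\tau}\eta\in\eta_2^\perp$ and $y\cdot\nabla=\sum_jy_j\partial_{x_j}$, $$b_2(x)=e^{\mathrm{i}\omega\cdot x}\,y\cdot\nabla\Big[\exp\Big(-\mathrm{i}\int_{\mathbb{R}}\eta_2\cdot A_\sharp(x+s\eta_2)ds\Big)e^{-\mathrm{i}\omega\cdot x}\Big],$$ $$b(x)=e^{\mathrm{i}x\cdot\xi}\,y\cdot\nabla\Big[\exp\Big(-\mathrm{i}\int_{\mathbb{R}}\eta\cdot A(x+s\eta)ds\Big)e^{-\mathrm{i}x\cdot\xi}\Big],\qquad \psi(x)=\int_{-\infty}^0\eta\cdot A(x+s\eta)\,ds.$$ Ansatz: $\Phi_1(x)=e^{\mathrm{i}\sqrt\lambda\,\eta_1\cdot x}e^{\mathrm{i}\psi_1(x)}$, $\Phi_2(x)=e^{-\mathrm{i}\sqrt\lambda\,\eta_2\cdot x}b_2(x)e^{-\mathrm{i}\psi_2(x)}$, and $S_j(\lambda,\eta_1,\eta_2)=\int_\Gamma(\Lambda_{j,\lambda}\Phi_1)\,\Phi_2\,d\sigma$. *)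

theory Defs
  imports "HOL-Analysis.Analysis"
begin

section \<open>Classical differentiability\<close>

definition partial :: "'n::finite \<Rightarrow> (real^'n \<Rightarrow> 'b::real_normed_vector) \<Rightarrow> real^'n \<Rightarrow> 'b" where
  "partial k f x = frechet_derivative f (at x) (axis k 1)"

primrec C_diff :: "nat \<Rightarrow> (real^'n::finite \<Rightarrow> 'b::real_normed_vector) \<Rightarrow> bool" where
  "C_diff 0 f \<longleftrightarrow> continuous_on UNIV f"
| "C_diff (Suc m) f \<longleftrightarrow> (\<forall>x. f differentiable at x) \<and> (\<forall>k. C_diff m (partial k f))"

definition smooth :: "(real^'n::finite \<Rightarrow> 'b::real_normed_vector) \<Rightarrow> bool" where
  "smooth f \<longleftrightarrow> (\<forall>m. C_diff m f)"

definition supp :: "(real^'n::finite \<Rightarrow> 'b::real_normed_vector) \<Rightarrow> (real^'n) set" where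
  "supp f = closure {x. f x \<noteq> 0}"

definition test_function :: "(real^'n::finite) set \<Rightarrow> (real^'n \<Rightarrow> 'b::real_normed_vector) \<Rightarrow> bool" where
  "test_function \<Omega> \<phi> \<longleftrightarrow> smooth \<phi> \<and> compact (supp \<phi>) \<and> supp \<phi> \<subseteq> \<Omega>"

text \<open>The space \<open>C\<^sup>1\<close> on the closure of an open set: the function and its derivative on
  \<open>\<Omega>\<close> extend continuously to the closure.\<close>

definition C1_closure :: "(real^'n::finite) set \<Rightarrow> (real^'n \<Rightarrow> real^'n) \<Rightarrow> bool" where
  "C1_closure \<Omega> A \<longleftrightarrow> continuous_on (closure \<Omega>) A \<and>
     (\<exists>D :: real^'n \<Rightarrow> ((real^'n) \<Rightarrow>\<^sub>L (real^'n)).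
        continuous_on (closure \<Omega>) D \<and>
        (\<forall>x\<in>\<Omega>. (A has_derivative blinfun_apply (D x)) (at x)))"

section \<open>Complex vectors\<close>

definition cdot :: "complex^'n::finite \<Rightarrow> complex^'n \<Rightarrow> complex" where
  "cdot z w = (\<Sum>k\<in>UNIV. z $ k * w $ k)"

definition cvec :: "real^'n::finite \<Rightarrow> complex^'n" where
  "cvec x = (\<chi> k. complex_of_real (x $ k))"

definition grad :: "(real^'n::finite \<Rightarrow> real) \<Rightarrow> real^'n \<Rightarrow> real^'n" where
  "grad f x = (\<chi> k. partial k f x)"

definition cgrad :: "(real^'n::finite \<Rightarrow> complex) \<Rightarrow> real^'n \<Rightarrow> complex^'n" where
  "cgrad f x = (\<chi> k. partial k f x)"

definition cdiv :: "(real^'n::finite \<Rightarrow> complex^'n) \<Rightarrow> real^'n \<Rightarrow> complex" where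
  "cdiv F x = (\<Sum>k\<in>UNIV. partial k F x $ k)"

section \<open>Domains of class \<open>C\<^sup>1\<^sup>,\<^sup>1\<close>, outward normal, surface measure\<close>

text \<open>Inside the open set \<open>U\<close> the set \<open>\<Omega>\<close> is the part strictly above the graph of \<open>\<gamma>\<close> in the
  unit direction \<open>e\<close>.  A function on the hyperplane \<open>e\<^sup>\<bottom>\<close> (of dimension \<open>n - 1\<close>) is encoded as a
  function on the whole space that is invariant under translations along \<open>e\<close>.\<close>

definition C11_chart ::
    "(real^'n::finite) set \<Rightarrow> (real^'n) set \<Rightarrow> real^'n \<Rightarrow> (real^'n \<Rightarrow> real) \<Rightarrow> bool" where
  "C11_chart \<Omega> U e \<gamma> \<longleftrightarrow> open U \<and> norm e = 1 \<and>
     (\<forall>x t. \<gamma> (x + t *\<^sub>R e) = \<gamma> x) \<and>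
     (\<forall>x. \<gamma> differentiable at x) \<and> (\<exists>L. L-lipschitz_on UNIV (grad \<gamma>)) \<and>
     \<Omega> \<inter> U = {x\<in>U. x \<bullet> e > \<gamma> x}"

definition C11_domain :: "(real^'n::finite) set \<Rightarrow> bool" where
  "C11_domain \<Omega> \<longleftrightarrow> open \<Omega> \<and> (\<forall>p\<in>frontier \<Omega>. \<exists>U e \<gamma>. p \<in> U \<and> C11_chart \<Omega> U e \<gamma>)"

definition outward_unit_normal :: "(real^'n::finite) set \<Rightarrow> (real^'n \<Rightarrow> real^'n) \<Rightarrow> bool" where
  "outward_unit_normal \<Omega> \<nu> \<longleftrightarrow>
     (\<forall>U e \<gamma>. C11_chart \<Omega> U e \<gamma> \<longrightarrow>
        (\<forall>p\<in>U \<inter> frontier \<Omega>. \<nu> p = (grad \<gamma> p - e) /\<^sub>R sqrt (1 + (norm (grad \<gamma> p))\<^sup>2)))"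

text \<open>The surface measure is the Borel measure on the boundary which in every graph chart is
  \<open>sqrt (1 + |\<nabla>\<gamma>|\<^sup>2) dx'\<close>.  The point of the graph above or below \<open>x\<close> is
  \<open>x + (\<gamma> x - x \<bullet> e) e\<close>, and \<open>dx'\<close> on the hyperplane \<open>e\<^sup>\<bottom>\<close> is obtained by integrating
  functions invariant along \<open>e\<close> over the slab of width 1.\<close>

definition surface_measure :: "(real^'n::finite) set \<Rightarrow> (real^'n) measure \<Rightarrow> bool" where
  "surface_measure \<Omega> \<sigma> \<longleftrightarrow> sets \<sigma> = sets (restrict_space borel (frontier \<Omega>)) \<and>
     (\<forall>U e \<gamma>. C11_chart \<Omega> U e \<gamma> \<longrightarrow>
        (\<forall>E\<in>sets \<sigma>. E \<subseteq> U \<longrightarrow>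
           emeasure \<sigma> E =
             (\<integral>\<^sup>+x. indicator {x. 0 < x \<bullet> e \<and> x \<bullet> e < 1} x
                   * indicator E (x + (\<gamma> x - x \<bullet> e) *\<^sub>R e)
                   * ennreal (sqrt (1 + (norm (grad \<gamma> x))\<^sup>2)) \<partial>lborel)))"

section \<open>Lebesgue and Sobolev spaces, traces\<close>

definition in_L2 :: "'a measure \<Rightarrow> ('a \<Rightarrow> 'b::euclidean_space) \<Rightarrow> bool" where
  "in_L2 M f \<longleftrightarrow> f \<in> borel_measurable M \<and> integrable M (\<lambda>x. (norm (f x))\<^sup>2)"

definition L2_tendsto :: "'a measure \<Rightarrow> (nat \<Rightarrow> 'a \<Rightarrow> 'b::euclidean_space) \<Rightarrow> ('a \<Rightarrow> 'b) \<Rightarrow> bool" where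
  "L2_tendsto M F f \<longleftrightarrow> (\<forall>m. in_L2 M (F m)) \<and> in_L2 M f \<and>
     (\<lambda>m. LINT x|M. (norm (F m x - f x))\<^sup>2) \<longlonglongrightarrow> 0"

definition in_Linfty :: "(real^'n::finite) set \<Rightarrow> (real^'n \<Rightarrow> real) \<Rightarrow> bool" where
  "in_Linfty \<Omega> V \<longleftrightarrow> V \<in> borel_measurable (lebesgue_on \<Omega>) \<and>
     (\<exists>C. AE x in lebesgue_on \<Omega>. \<bar>V x\<bar> \<le> C)"

text \<open>\<open>H1_fun \<Omega> u G\<close>: \<open>u \<in> H\<^sup>1(\<Omega>)\<close> with weak gradient \<open>G\<close>.\<close>

definition H1_fun ::
    "(real^'n::finite) set \<Rightarrow> (real^'n \<Rightarrow> complex) \<Rightarrow> (real^'n \<Rightarrow> complex^'n) \<Rightarrow> bool" where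
  "H1_fun \<Omega> u G \<longleftrightarrow> in_L2 (lebesgue_on \<Omega>) u \<and> in_L2 (lebesgue_on \<Omega>) G \<and>
     (\<forall>\<phi>::real^'n \<Rightarrow> complex. test_function \<Omega> \<phi> \<longrightarrow>
        (\<forall>k. (LINT x|lebesgue_on \<Omega>. u x * partial k \<phi> x) = - (LINT x|lebesgue_on \<Omega>. G x $ k * \<phi> x)))"

definition weak_divergence ::
    "(real^'n::finite) set \<Rightarrow> (real^'n \<Rightarrow> complex^'n) \<Rightarrow> (real^'n \<Rightarrow> complex) \<Rightarrow> bool" where
  "weak_divergence \<Omega> F d \<longleftrightarrow> in_L2 (lebesgue_on \<Omega>) F \<and> in_L2 (lebesgue_on \<Omega>) d \<and>
     (\<forall>\<phi>::real^'n \<Rightarrow> complex. test_function \<Omega> \<phi> \<longrightarrow>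
        (LINT x|lebesgue_on \<Omega>. cdot (F x) (cgrad \<phi> x)) = - (LINT x|lebesgue_on \<Omega>. d x * \<phi> x))"

text \<open>The trace operator from \<open>H\<^sup>1(\<Omega>)\<close> to functions on the boundary, as the continuous extension
  of the restriction map on functions smooth up to the boundary; \<open>H\<^sup>1\<^sup>/\<^sup>2\<close> of the boundary is its
  range.\<close>

definition has_trace ::
    "(real^'n::finite) set \<Rightarrow> (real^'n) measure \<Rightarrow> (real^'n \<Rightarrow> complex) \<Rightarrow> (real^'n \<Rightarrow> complex^'n)
      \<Rightarrow> (real^'n \<Rightarrow> complex) \<Rightarrow> bool" where
  "has_trace \<Omega> \<sigma> u G f \<longleftrightarrow> (\<exists>\<phi> :: nat \<Rightarrow> real^'n \<Rightarrow> complex. (\<forall>m. smooth (\<phi> m)) \<and>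
     L2_tendsto (lebesgue_on \<Omega>) \<phi> u \<and> L2_tendsto (lebesgue_on \<Omega>) (\<lambda>m. cgrad (\<phi> m)) G \<and>
     L2_tendsto \<sigma> \<phi> f)"

text \<open>The value \<open>s\<close> of the boundary integral of \<open>(F \<cdot> \<nu>) g\<close> for a square integrable field \<open>F\<close> with
  square integrable divergence and \<open>g \<in> H\<^sup>1\<^sup>/\<^sup>2\<close>.  The normal trace \<open>F \<cdot> \<nu>\<close> only lies in
  \<open>H\<^sup>-\<^sup>1\<^sup>/\<^sup>2\<close>; it is the continuous extension of the pointwise normal component from fields smooth up
  to the boundary, with respect to the graph norm of the divergence.\<close>

definition normal_trace_pairing ::
    "(real^'n::finite) set \<Rightarrow> (real^'n) measure \<Rightarrow> (real^'n \<Rightarrow> real^'n) \<Rightarrow> (real^'n \<Rightarrow> complex^'n)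
      \<Rightarrow> (real^'n \<Rightarrow> complex) \<Rightarrow> complex \<Rightarrow> bool" where
  "normal_trace_pairing \<Omega> \<sigma> \<nu> F g s \<longleftrightarrow>
     (\<exists>d. \<exists>\<Phi> :: nat \<Rightarrow> real^'n \<Rightarrow> complex^'n. weak_divergence \<Omega> F d \<and> (\<forall>m. smooth (\<Phi> m)) \<and>
        L2_tendsto (lebesgue_on \<Omega>) \<Phi> F \<and> L2_tendsto (lebesgue_on \<Omega>) (\<lambda>m. cdiv (\<Phi> m)) d \<and>
        (\<lambda>m. LINT x|\<sigma>. cdot (\<Phi> m x) (cvec (\<nu> x)) * g x) \<longlonglongrightarrow> s)"

section \<open>The Dirichlet-to-Neumann map\<close>

text \<open>\<open>u \<in> H\<^sup>1(\<Omega>)\<close>, with weak gradient \<open>G\<close>, solves \<open>(-\<i>\<nabla> + A)\<^sup>2 u + V u - lam u = 0\<close> in the sense of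
  distributions and has trace \<open>f\<close>.  The outer factor \<open>-\<i>\<nabla> + A\<close>, acting on the field
  \<open>-\<i>G + u A\<close>, is moved to the test function, where it becomes \<open>\<i>\<nabla> + A\<close> because the pairing is
  bilinear.\<close>

definition bvp_solution ::
    "(real^'n::finite) set \<Rightarrow> (real^'n) measure \<Rightarrow> (real^'n \<Rightarrow> real^'n) \<Rightarrow> (real^'n \<Rightarrow> real) \<Rightarrow> complex
      \<Rightarrow> (real^'n \<Rightarrow> complex) \<Rightarrow> (real^'n \<Rightarrow> complex) \<Rightarrow> (real^'n \<Rightarrow> complex^'n) \<Rightarrow> bool" where
  "bvp_solution \<Omega> \<sigma> A V lam f u G \<longleftrightarrow> H1_fun \<Omega> u G \<and>
     (\<forall>\<phi>::real^'n \<Rightarrow> complex. test_function \<Omega> \<phi> \<longrightarrow>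
        (LINT x|lebesgue_on \<Omega>.
            cdot (- \<i> *s G x + u x *s cvec (A x)) (\<i> *s cgrad \<phi> x + \<phi> x *s cvec (A x))
            + (of_real (V x) - lam) * u x * \<phi> x) = 0) \<and>
     has_trace \<Omega> \<sigma> u G f"

text \<open>\<open>DN_map \<dots> f\<close> is the functional \<open>g \<mapsto> \<integral> (\<partial>\<^sub>\<nu> + \<i> A \<cdot> \<nu>) u g d\<sigma>\<close>, an element of \<open>H\<^sup>-\<^sup>1\<^sup>/\<^sup>2\<close>; note
  \<open>(\<partial>\<^sub>\<nu> + \<i> A \<cdot> \<nu>) u = (\<nabla>u + \<i> u A) \<cdot> \<nu>\<close>.\<close>

definition DN_map ::
    "(real^'n::finite) set \<Rightarrow> (real^'n) measure \<Rightarrow> (real^'n \<Rightarrow> real^'n) \<Rightarrow> (real^'n \<Rightarrow> real^'n)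
      \<Rightarrow> (real^'n \<Rightarrow> real) \<Rightarrow> complex \<Rightarrow> (real^'n \<Rightarrow> complex) \<Rightarrow> (real^'n \<Rightarrow> complex) \<Rightarrow> complex" where
  "DN_map \<Omega> \<sigma> \<nu> A V lam f g =
     (THE s. \<exists>u G. bvp_solution \<Omega> \<sigma> A V lam f u G \<and>
        normal_trace_pairing \<Omega> \<sigma> \<nu> (\<lambda>x. G x + (\<i> * u x) *s cvec (A x)) g s)"

section \<open>Parameters, mollified potentials and amplitudes\<close>

definition sqrt_lam :: "real \<Rightarrow> complex" where
  "sqrt_lam \<tau> = complex_of_real \<tau> + \<i>"

definition B_par :: "real^'n::finite \<Rightarrow> real \<Rightarrow> real" where
  "B_par \<xi> \<tau> = sqrt (1 - (norm \<xi>)\<^sup>2 / (4 * \<tau>\<^sup>2))"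

definition eta1 :: "real^'n::finite \<Rightarrow> real^'n \<Rightarrow> real \<Rightarrow> real^'n" where
  "eta1 \<xi> \<eta> \<tau> = B_par \<xi> \<tau> *\<^sub>R \<eta> - (1 / (2 * \<tau>)) *\<^sub>R \<xi>"

definition eta2 :: "real^'n::finite \<Rightarrow> real^'n \<Rightarrow> real \<Rightarrow> real^'n" where
  "eta2 \<xi> \<eta> \<tau> = B_par \<xi> \<tau> *\<^sub>R \<eta> + (1 / (2 * \<tau>)) *\<^sub>R \<xi>"

definition omega :: "real^'n::finite \<Rightarrow> real^'n \<Rightarrow> real \<Rightarrow> real^'n" where
  "omega \<xi> \<eta> \<tau> = B_par \<xi> \<tau> *\<^sub>R \<xi> - ((norm \<xi>)\<^sup>2 / (2 * \<tau>)) *\<^sub>R \<eta>"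

definition mollify :: "(real^'n::finite \<Rightarrow> real) \<Rightarrow> real \<Rightarrow> (real^'n \<Rightarrow> real^'n) \<Rightarrow> real^'n \<Rightarrow> real^'n" where
  "mollify \<rho> \<delta> A x = (LINT z|lborel. (\<rho> ((x - z) /\<^sub>R \<delta>) / \<delta> ^ CARD('n)) *\<^sub>R A z)"

definition A_moll :: "(real^'n::finite \<Rightarrow> real) \<Rightarrow> (real^'n \<Rightarrow> real^'n) \<Rightarrow> real \<Rightarrow> real^'n \<Rightarrow> real^'n" where
  "A_moll \<rho> A \<tau> = mollify \<rho> (\<tau> powr (- 1 / 3)) A"

definition half_line_integral :: "real^'n::finite \<Rightarrow> (real^'n \<Rightarrow> real^'n) \<Rightarrow> real^'n \<Rightarrow> real" where
  "half_line_integral \<theta> A x = (LINT s:{..0}|lborel. \<theta> \<bullet> A (x + s *\<^sub>R \<theta>))"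

definition line_integral :: "real^'n::finite \<Rightarrow> (real^'n \<Rightarrow> real^'n) \<Rightarrow> real^'n \<Rightarrow> real" where
  "line_integral \<theta> A x = (LINT s|lborel. \<theta> \<bullet> A (x + s *\<^sub>R \<theta>))"

definition amplitude ::
    "real^'n::finite \<Rightarrow> (real^'n \<Rightarrow> real^'n) \<Rightarrow> real^'n \<Rightarrow> real^'n \<Rightarrow> real^'n \<Rightarrow> complex" where
  "amplitude \<theta> A \<zeta> y x =
     exp (\<i> * of_real (\<zeta> \<bullet> x)) *
     (\<Sum>k\<in>UNIV. of_real (y $ k) *
        partial k (\<lambda>z. exp (- \<i> * of_real (line_integral \<theta> A z)) * exp (- \<i> * of_real (\<zeta> \<bullet> z))) x)"

definition b2_amp ::
    "(real^'n::finite \<Rightarrow> real) \<Rightarrow> (real^'n \<Rightarrow> real^'n) \<Rightarrow> (real^'n \<Rightarrow> real^'n)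
      \<Rightarrow> real^'n \<Rightarrow> real^'n \<Rightarrow> real^'n \<Rightarrow> real \<Rightarrow> real^'n \<Rightarrow> complex" where
  "b2_amp \<rho> At1 At2 \<xi> \<eta> y \<tau> =
     amplitude (eta2 \<xi> \<eta> \<tau>) (\<lambda>x. A_moll \<rho> At2 \<tau> x - A_moll \<rho> At1 \<tau> x) (omega \<xi> \<eta> \<tau>) y"

definition Phi1 ::
    "(real^'n::finite \<Rightarrow> real) \<Rightarrow> (real^'n \<Rightarrow> real^'n) \<Rightarrow> real^'n \<Rightarrow> real^'n \<Rightarrow> real \<Rightarrow> real^'n \<Rightarrow> complex" where
  "Phi1 \<rho> At1 \<xi> \<eta> \<tau> x =
     (let \<psi>1 = - half_line_integral (eta1 \<xi> \<eta> \<tau>) (A_moll \<rho> At1 \<tau>) x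
      in exp (\<i> * sqrt_lam \<tau> * of_real (eta1 \<xi> \<eta> \<tau> \<bullet> x)) * exp (\<i> * of_real \<psi>1))"

definition Phi2 ::
    "(real^'n::finite \<Rightarrow> real) \<Rightarrow> (real^'n \<Rightarrow> real^'n) \<Rightarrow> (real^'n \<Rightarrow> real^'n)
      \<Rightarrow> real^'n \<Rightarrow> real^'n \<Rightarrow> real^'n \<Rightarrow> real \<Rightarrow> real^'n \<Rightarrow> complex" where
  "Phi2 \<rho> At1 At2 \<xi> \<eta> y \<tau> x =
     (let \<psi>2 = - half_line_integral (eta2 \<xi> \<eta> \<tau>) (A_moll \<rho> At2 \<tau>) x
      in exp (- \<i> * sqrt_lam \<tau> * of_real (eta2 \<xi> \<eta> \<tau> \<bullet> x)) * b2_amp \<rho> At1 At2 \<xi> \<eta> y \<tau> x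
         * exp (- \<i> * of_real \<psi>2))"

end

theory Submission
  imports Defs
begin

text \<open>Green's formula turns \<open>S\<^sub>j\<close> into a boundary term plus the integral over \<open>\<Omega>\<close> of \<open>u\<^sub>j\<close> times the image of
  \<open>\<Phi>\<^sub>2\<close> under the operator with potential \<open>-A\<^sub>j\<close>. The boundary terms agree because \<open>A\<^sub>1 = A\<^sub>2\<close> near \<open>\<Gamma>\<close>.
  Since \<open>Im \<lambda> = 2\<tau>\<close>, the resolvent estimate gives \<open>u\<^sub>1 = \<Phi>\<^sub>1 + o(1)\<close> and \<open>u\<^sub>2 = \<Phi>\<^sub>1 + O(1)\<close> in \<open>L\<^sup>2\<close>: the
  phase \<open>\<psi>\<^sub>1\<close> solves the transport equation for the mollified \<open>A\<^sub>1\<close>, and \<open>\<delta> = \<tau> powr (-1/3)\<close> balances the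
  mollification error against the second derivatives of the amplitudes. For \<open>j = 2\<close> the image of \<open>\<Phi>\<^sub>2\<close> is \<open>o(\<tau>)\<close>;
  for \<open>j = 1\<close> it is \<open>2 \<surd>\<lambda> \<eta>\<^sub>2 \<bullet> (A\<^sub>1 - A\<^sub>2) \<Phi>\<^sub>2 + o(\<tau>)\<close>, so the quotient tends to the limit of
  \<open>2 \<integral> \<eta>\<^sub>2 \<bullet> (A\<^sub>1 - A\<^sub>2) \<Phi>\<^sub>1 \<Phi>\<^sub>2\<close>.\<close>

text \<open>Each error is a product of one small and one large factor. For j = 1 the operator
  applied to \<open>Phi1\<close> is O(\<tau> powr (2/3)) and the transposed operator applied to
  \<open>Phi2\<close> is O(\<tau>); for j = 2 the sizes are exchanged. After division by Im
  \<lambda> both products are o(\<surd>\<lambda>), so the ansatz functions need not be corrected to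
  exact solutions. The exponent 2/3 arises twice: as \<tau> \<delta>, the mollification error of a
  C^1 field times \<surd>\<lambda>, and as 1/\<delta>^2, since \<open>b2\<close> already contains
  first derivatives of ray integrals, which stay bounded because the mollified field is C^1, and its
  Laplacian costs two more. The exponentials are bounded on \<Omega> because Im \<surd>\<lambda> =
  1. The obstacle is the meaning of the boundary pairing: \<open>DN_map\<close> is a definite
  description, and its conormal derivative is a limit over smooth fields. This calls for existence
  and uniqueness of solutions, the divergence theorem on \<Omega>, and density of smooth fields
  among the square integrable fields with square integrable divergence.\<close>

lemmas LINT_cong = Bochner_Integration.integral_cong
lemmas LINT_add = Bochner_Integration.integral_add
lemmas LINT_diff = Bochner_Integration.integral_diff
lemmas bl_mult_right = bounded_linear_mult_right
lemmas bb_mult = bounded_bilinear_mult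

abbreviation (input) eventually_top :: "('a::linorder => bool) => bool" (binder "EV " 10) where
 "eventually_top P \<equiv> eventually P at_top"

abbreviation (input) tends (infixr "--->" 55) where "tends \<equiv> tendsto"
abbreviation (input) seq_tends (infixr "---->" 60) where "seq_tends X L \<equiv> (X ---> L) sequentially"

section \<open>Functions of class \<open>C\<^sup>m\<close>\<close>

lemma partial_eqI: "(f has_derivative f') (at x) ==> partial k f x = f' (axis k 1)"
 by (simp add: partial_def frechet_derivative_at[symmetric])

lemma frechet_derivative_eq_sum_partial:
 assumes "f differentiable at x"
 shows "frechet_derivative f (at x) h = (\<Sum>k\<in>UNIV. h $ k *\<^sub>R partial k f x)"
proof -
 interpret bounded_linear "frechet_derivative f (at x)"
  using assms frechet_derivative_works has_derivative_bounded_linear by blast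
 have "h = (\<Sum>k\<in>UNIV. h $ k *\<^sub>R axis k 1)"
  using basis_expansion[of h] by (simp add: scalar_mult_eq_scaleR)
 hence "frechet_derivative f (at x) h = frechet_derivative f (at x) (\<Sum>k\<in>UNIV. h $ k *\<^sub>R axis k 1)" by simp
 also have "... = (\<Sum>k\<in>UNIV. h $ k *\<^sub>R partial k f x)" by (simp add: sum scaleR partial_def)
 finally show ?thesis .
qed

lemma has_derivative_sum_partial:
 assumes "f differentiable at x"
 shows "(f has_derivative (%h. \<Sum>k\<in>UNIV. h $ k *\<^sub>R partial k f x)) (at x)"
proof -
 have "frechet_derivative f (at x) = (%h. \<Sum>k\<in>UNIV. h $ k *\<^sub>R partial k f x)"
  by (intro ext frechet_derivative_eq_sum_partial assms)
 thus ?thesis using assms[unfolded frechet_derivative_works] by simp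
qed

lemma partial_compose_has_derivative:
 assumes "f differentiable at x" "(g has_derivative g') (at (f x))"
 shows "partial k (%x. g (f x)) x = g' (partial k f x)"
 using diff_chain_at[OF assms(1)[unfolded frechet_derivative_works] assms(2)]
 by (subst partial_eqI) (auto simp: o_def partial_def)

lemma C_diff_cont: "C_diff m f ==> continuous_on UNIV f"
 by (cases m) (auto intro!: continuous_at_imp_continuous_on differentiable_imp_continuous_within)

lemma C_diff_Suc_imp: "C_diff (Suc m) f ==> C_diff m f"
proof (induction m arbitrary: f)
 case 0
 thus ?case using C_diff_cont[of "Suc 0" f] by simp
next
 case (Suc m)
 thus ?case using C_diff.simps(2) by blast
qed

lemma C_diff_mono: "C_diff n f ==> m \<le> n ==> C_diff m f"
proof (induction n)
 case (Suc n)
 thus ?case using C_diff_Suc_imp[of n f] by (cases "m = Suc n") auto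
qed simp

lemma C_diff_D: "C_diff m f ==> 0 < m ==> f differentiable at x"
 by (cases m) auto

lemma C_diff_partial: "C_diff (Suc m) f ==> C_diff m (partial k f)" by simp

lemma C_diff_cont_partial: "C_diff 1 f ==> continuous_on UNIV (partial k f)"
 by simp

lemma partial_const [simp]: "partial k (%x. c) = (%x. 0)"
 by (rule ext, rule partial_eqI[THEN trans], rule has_derivative_const) simp

lemma C_diff_const [simp]: "C_diff m (%x. c)"
 by (induction m arbitrary: c) auto

lemma partial_add:
 "f differentiable at x ==> g differentiable at x ==> partial k (%x. f x + g x) x = partial k f x + partial k g x"
 by (rule partial_eqI[THEN trans], rule has_derivative_add)
  (auto simp: partial_def frechet_derivative_works[symmetric])

lemma C_diff_add: "C_diff m f ==> C_diff m g ==> C_diff m (%x. f x + g x)"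
proof (induction m arbitrary: f g)
 case (Suc m)
 hence "partial k (%x. f x + g x) = (%x. partial k f x + partial k g x)" for k
  by (intro ext partial_add) auto
 with Suc show ?case by auto
qed (auto intro: continuous_intros)

lemma partial_linear:
 "bounded_linear L ==> f differentiable at x ==> partial k (%x. L (f x)) x = L (partial k f x)"
 using bounded_linear_imp_has_derivative by (intro partial_compose_has_derivative) auto

lemma C_diff_linear:
 assumes "bounded_linear L"
 shows "C_diff m f ==> C_diff m (%x. L (f x))"
proof (induction m arbitrary: f)
 case 0
 thus ?case using assms bounded_linear.continuous_on by auto
next
 case (Suc m)
 hence "partial k (%x. L (f x)) = (%x. L (partial k f x))" for k
  by (intro ext partial_linear assms) auto
 moreover have "(%x. L (f x)) differentiable at x" for x
 proof -
  have "L differentiable at (f x)" using assms by (rule bounded_linear_imp_differentiable)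
  moreover have "f differentiable at x" using Suc.prems by simp
  ultimately show ?thesis using differentiable_chain_at[of f x L] by (simp add: o_def)
 qed
 ultimately show ?case using Suc by auto
qed

lemma partial_bilinear:
 assumes "bounded_bilinear B" "f differentiable at x" "g differentiable at x"
 shows "partial k (%x. B (f x) (g x)) x = B (f x) (partial k g x) + B (partial k f x) (g x)"
 using bounded_bilinear.FDERIV[OF assms(1) assms(2,3)[unfolded frechet_derivative_works]]
 by (subst partial_eqI) (auto simp: partial_def)

lemma C_diff_bilinear:
 assumes "bounded_bilinear B"
 shows "C_diff m f ==> C_diff m g ==> C_diff m (%x. B (f x) (g x))"
proof (induction m arbitrary: f g)
 case 0
 thus ?case using assms bounded_bilinear.continuous_on by auto
next
 case (Suc m)
 hence "partial k (%x. B (f x) (g x)) = (%x. B (f x) (partial k g x) + B (partial k f x) (g x))" for k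
  by (intro ext partial_bilinear assms) auto
 moreover have "(%x. B (f x) (g x)) differentiable at x" for x
 proof -
  have "f differentiable at x" "g differentiable at x" using Suc.prems by auto
  thus ?thesis using bounded_bilinear.FDERIV[OF assms] unfolding differentiable_def by blast
 qed
 ultimately show ?case
  using Suc C_diff_Suc_imp[OF Suc.prems(1)] C_diff_Suc_imp[OF Suc.prems(2)] by (auto intro!: C_diff_add)
qed

lemmas C_diff_mult = C_diff_bilinear[OF bb_mult]
lemmas C_diff_scaleR = C_diff_bilinear[OF bounded_bilinear_scaleR]
lemmas C_diff_inner = C_diff_bilinear[OF bounded_bilinear_inner]
lemmas C_diff_of_real = C_diff_linear[OF bounded_linear_of_real]
lemmas C_diff_nth = C_diff_linear[OF bounded_linear_vec_nth]
lemmas partial_mult = partial_bilinear[OF bb_mult]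
lemmas partial_scaleR = partial_bilinear[OF bounded_bilinear_scaleR]
lemmas partial_of_real = partial_linear[OF bounded_linear_of_real]
lemmas partial_nth = partial_linear[OF bounded_linear_vec_nth]

lemma C_diff_minus: "C_diff m f ==> C_diff m (%x. - f x)"
 by (rule C_diff_linear[OF bounded_linear_minus[OF bounded_linear_ident]])

lemma C_diff_diff: "C_diff m f ==> C_diff m g ==> C_diff m (%x. f x - g x)"
 using C_diff_add[OF _ C_diff_minus] by simp

lemma C_diff_sum: "(!!i. i \<in> I ==> C_diff m (f i)) ==> C_diff m (%x. \<Sum>i\<in>I. f i x)"
 by (induction I rule: infinite_finite_induct) (auto intro!: C_diff_add)

lemma C_diff_prod:
 fixes f :: "'i => real^'n::finite => real"
 shows "(!!i. i \<in> I ==> C_diff m (f i)) ==> C_diff m (%x. \<Prod>i\<in>I. f i x)"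
 by (induction I rule: infinite_finite_induct) (auto intro!: C_diff_mult)

lemma C_diff_bounded_linear: "bounded_linear L ==> C_diff m L"
proof (cases m)
 case (Suc m')
 assume L: "bounded_linear L"
 hence "partial k L = (%x. L (axis k 1))" for k
  by (intro ext partial_eqI bounded_linear_imp_has_derivative)
 with L Suc show ?thesis by (auto simp: bounded_linear_imp_differentiable)
qed (auto intro: linear_continuous_on)

text \<open>The converse of \<open>C_diff_nth\<close>: the field is a finite sum of images of its
  components under the bounded linear maps \<open>axis k\<close>, so the linear and additive rules
  suffice.\<close>

lemma C_diff_vec:
 fixes f :: "real^'n::finite => 'b::real_normed_vector^'k::finite"
 assumes "!!k. C_diff m (%x. f x $ k)"
 shows "C_diff m f"
proof -
 have L: "bounded_linear (%z::'b. axis k z :: 'b^'k)" for k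
 proof (rule bounded_linear_intro[where K=1])
  show "axis k (a+b) = axis k a + (axis k b :: 'b^'k)" for a b by (auto simp: axis_def vec_eq_iff)
  show "axis k (r *\<^sub>R a) = r *\<^sub>R (axis k a :: 'b^'k)" for a r by (auto simp: axis_def vec_eq_iff)
  show "norm (axis k a :: 'b^'k) \<le> norm a * 1" for a
   by (simp add: norm_vec_def L2_set_def axis_def if_distrib[of norm] if_distrib[of "%x. x^2"] cong: if_cong)
 qed
 have "f = (%x. \<Sum>k\<in>UNIV. axis k (f x $ k))"
  by (auto simp: vec_eq_iff axis_def sum.delta if_distrib cong: if_cong)
 moreover have "C_diff m (%x. \<Sum>k\<in>UNIV. axis k (f x $ k) :: 'b^'k)"
  by (intro C_diff_sum C_diff_linear[OF L] assms)
 ultimately show ?thesis by simp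
qed

lemma C_diff_exp:
 fixes f :: "real^'n::finite => complex"
 shows "C_diff m f ==> C_diff m (%x. exp (f x))"
proof (induction m arbitrary: f)
 case 0
 thus ?case by (auto intro: continuous_intros)
next
 case (Suc m)
 have d: "(exp has_derivative (%h. exp z * h)) (at z)" for z :: complex
  using DERIV_exp has_field_derivative_def by blast
 have "partial k (%x. exp (f x)) = (%x. exp (f x) * partial k f x)" for k
  using Suc.prems by (intro ext partial_compose_has_derivative d) auto
 moreover have "(%x. exp (f x)) differentiable at x" for x
 proof -
  have "exp differentiable at (f x)" using d by (auto simp: differentiable_def)
  thus ?thesis using differentiable_chain_at[OF C_diff_D[OF Suc.prems, of x], of exp] by (simp add: o_def)
 qed
 ultimately show ?case using Suc C_diff_Suc_imp[OF Suc.prems] by (auto intro!: C_diff_mult)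
qed

lemma partial_exp:
 fixes f :: "real^'n::finite => complex"
 assumes "f differentiable at x"
 shows "partial k (%x. exp (f x)) x = exp (f x) * partial k f x"
proof -
 have d: "(exp has_derivative (%h. exp z * h)) (at z)" for z :: complex
  using DERIV_exp has_field_derivative_def by blast
 show ?thesis by (rule partial_compose_has_derivative[OF assms d])
qed

lemma partial_affine:
 assumes "f differentiable at (a + c *\<^sub>R x)"
 shows "partial k (%x. f (a + c *\<^sub>R x)) x = c *\<^sub>R partial k f (a + c *\<^sub>R x)"
proof -
 have "((%x. a + c *\<^sub>R x) has_derivative (%h. c *\<^sub>R h)) (at x)"
  by (auto intro!: derivative_eq_intros)
 from diff_chain_at[OF this assms[unfolded frechet_derivative_works]]
 have "partial k (%x. f (a + c *\<^sub>R x)) x = frechet_derivative f (at (a + c *\<^sub>R x)) (c *\<^sub>R axis k 1)"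
  by (subst partial_eqI) (auto simp: o_def)
 also have "... = c *\<^sub>R partial k f (a + c *\<^sub>R x)"
  unfolding partial_def using linear_frechet_derivative[OF assms] by (simp add: linear_scale)
 finally show ?thesis .
qed

lemma C_diff_affine: "C_diff m f ==> C_diff m (%x. f (a + c *\<^sub>R x))"
proof (induction m arbitrary: f)
 case 0
 thus ?case
  using continuous_on_compose2[of UNIV f UNIV "%x. a + c *\<^sub>R x"] by (simp add: continuous_intros)
next
 case (Suc m)
 hence "partial k (%x. f (a + c *\<^sub>R x)) = (%x. c *\<^sub>R partial k f (a + c *\<^sub>R x))" for k
  by (intro ext partial_affine) auto
 moreover have "(%x. f (a + c *\<^sub>R x)) differentiable at x" for x
 proof (rule differentiable_compose[of f])
  show "f differentiable at (a + c *\<^sub>R x)" using Suc.prems by simp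
  have "((%x. a + c *\<^sub>R x) has_derivative (%h. c *\<^sub>R h)) (at x)"
   by (auto intro!: derivative_eq_intros)
  thus "(%x. a + c *\<^sub>R x) differentiable at x" by (auto simp: differentiable_def)
 qed
 ultimately show ?case using Suc by (auto intro!: C_diff_linear[OF bounded_linear_scaleR_right])
qed

lemma smooth_C_diff: "smooth f ==> C_diff m f" by (simp add: smooth_def)

lemma smooth_partial: "smooth f ==> smooth (partial k f)"
 unfolding smooth_def by (metis C_diff_partial)

text \<open>Composition with a merely C^1 real function. It is meant for the piecewise quadratic
  \<open>step\<close>, whose derivative has kinks.\<close>

lemma C_diff_1_real_compose:
 assumes "C_diff 1 f" "!!t. (h has_real_derivative h' t) (at t)" "continuous_on UNIV h'"
 shows "C_diff 1 (%x. h (f x))" "partial k (%x. h (f x)) = (%x. h' (f x) * partial k f x)"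
proof -
 have p: "partial k (%x. h (f x)) = (%x. h' (f x) * partial k f x)" for k
  using assms(1,2) by (intro ext partial_compose_has_derivative) (auto simp: has_field_derivative_def)
 moreover have "(%x. h (f x)) differentiable at x" for x
 proof -
  have "h differentiable at (f x)" using assms(2) by (auto simp: has_field_derivative_def differentiable_def)
  thus ?thesis using differentiable_chain_at[OF C_diff_D[OF assms(1), of x], of h] by (simp add: o_def)
 qed
 moreover have "continuous_on UNIV (%x. h' (f x) * partial k f x)" for k
  using continuous_on_compose2[OF assms(3) C_diff_cont[OF assms(1)]] C_diff_cont_partial[OF assms(1)]
  by (intro continuous_on_mult) auto
 ultimately show "C_diff 1 (%x. h (f x))" by simp
 show "partial k (%x. h (f x)) = (%x. h' (f x) * partial k f x)" by (rule p)
qed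

subsection \<open>Vanishing outside a ball\<close>

text \<open>Holds without differentiability: \<open>frechet_derivative\<close> is a choice from the
  set of all derivatives at the point, and functions that agree near the point have the same such
  set.\<close>

lemma partial_local:
 assumes "open S" "x \<in> S" "!!z. z \<in> S ==> f z = g z"
 shows "partial k f x = partial k g x"
proof -
 have "(f has_derivative D) (at x) \<longleftrightarrow> (g has_derivative D) (at x)" for D
  using assms has_derivative_transform_within_open[of f D x UNIV S g]
   has_derivative_transform_within_open[of g D x UNIV S f] by auto
 thus ?thesis by (simp add: partial_def frechet_derivative_def)
qed

text \<open>Supports are mostly controlled by an explicit radius instead of compactness of
  \<open>supp\<close>: the radius is inherited by derivatives and can be kept fixed along a family
  of functions.\<close>

lemma partial_zero_outside: "(!!z. norm z > R ==> f z = 0) ==> norm x > R ==> partial k f x = 0"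
proof -
 assume a: "!!z. norm z > R ==> f z = 0" "norm x > R"
 have "open {z. norm z > R}" by (intro open_Collect_less continuous_intros)
 hence "partial k f x = partial k (%x. 0) x"
 proof (rule partial_local)
  show "x \<in> {z. norm z > R}" using a(2) by simp
  show "f z = 0" if "z \<in> {z. norm z > R}" for z using that by (intro a(1)) simp
 qed
 thus ?thesis by simp
qed

lemma not_in_supp: "x \<notin> supp f ==> f x = 0"
 using closure_subset[of "{x. f x \<noteq> 0}"] by (auto simp: supp_def)

lemma supp_partial: "supp (partial k f) \<subseteq> supp f"
proof -
 have "partial k f x = 0" if "x \<notin> supp f" for x
 proof -
  have "open (- supp f)" by (simp add: supp_def open_Compl)
  hence "partial k f x = partial k (%x. 0) x"
   using that by (rule_tac partial_local) (auto intro: not_in_supp)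
  thus ?thesis by simp
 qed
 thus ?thesis unfolding supp_def[of "partial k f"]
  by (intro closure_minimal) (auto simp: supp_def)
qed

lemma supp_subset_cballD: "supp f \<subseteq> cball 0 R ==> norm x > R ==> f x = 0"
 using not_in_supp[of x f] by (meson mem_cball_0 not_le subsetD)

lemma compact_supp_vanish: "compact (supp f) ==> \<exists>R>0. \<forall>x. norm x > R --> f x = 0"
proof -
 assume "compact (supp f)"
 then obtain R where "R > 0" "!!x. x \<in> supp f ==> norm x \<le> R" 
  using compact_imp_bounded[of "supp f"] by (auto simp: bounded_pos)
 moreover have "f x = 0" if "norm x > R" for x
  using that \<open>!!x. x \<in> supp f ==> norm x \<le> R\<close>[of x] not_in_supp[of x f] by linarith
 ultimately show ?thesis by blast
qed

lemma cvanish_bounded: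
 fixes f :: "'a::euclidean_space => 'b::real_normed_vector"
 assumes "continuous_on UNIV f" "!!x. norm x > R ==> f x = 0"
 shows "\<exists>C>0. \<forall>x. norm (f x) \<le> C"
proof -
 have "compact (f ` cball 0 R)" by (intro compact_continuous_image continuous_on_subset[OF assms(1)]) auto
 then obtain C where C: "C > 0" "\<forall>y\<in>f ` cball 0 R. norm y \<le> C"
  using compact_imp_bounded[of "f ` cball 0 R"] by (auto simp: bounded_pos)
 have "norm (f x) \<le> C" for x
 proof (cases "norm x > R")
  case True
  thus ?thesis using assms(2)[OF True] C by simp
 next
  case False
  thus ?thesis using C by simp
 qed
 thus ?thesis using C by blast
qed

lemma cvanish_integrable:
 fixes f :: "'a::euclidean_space => 'b::euclidean_space"
 assumes "continuous_on UNIV f" "!!x. norm x > R ==> f x = 0"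
 shows "integrable lborel f"
proof -
 have "set_integrable lborel (cball 0 R) f"
  unfolding set_integrable_def by (intro borel_integrable_compact continuous_on_subset[OF assms(1)]) auto
 moreover have "(%x. indicator (cball 0 R) x *\<^sub>R f x) = f"
  using assms(2) by (intro ext) (simp add: indicator_def not_le)
 ultimately show ?thesis by (simp add: set_integrable_def)
qed

lemma cont_measurable: "continuous_on UNIV f ==> f \<in> borel_measurable borel"
 by (rule borel_measurable_continuous_onI)

subsection \<open>Differentiation under the integral sign\<close>

lemma continuous_under_integral:
 fixes F :: "'a::metric_space => 'm => 'b::euclidean_space"
 assumes "r > 0" "!!x. x \<in> ball x0 r ==> F x \<in> borel_measurable M"
  "!!m. m \<in> space M ==> isCont (%x. F x m) x0"
  "!!x m. x \<in> ball x0 r ==> m \<in> space M ==> norm (F x m) \<le> G m" "integrable M G"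
 shows "isCont (%x. LINT m|M. F x m) x0"
 unfolding continuous_at_sequentially
proof (intro allI impI)
 fix u :: "nat => 'a" assume u: "u ----> x0"
 then obtain N where N: "!!n. n \<ge> N ==> u n \<in> ball x0 r"
  using assms(1) unfolding lim_sequentially by (auto simp: dist_commute)
 \<comment> \<open>The dominating function is available only in the ball, so the sequence is started
   at \<open>N\<close>; \<open>LIMSEQ_offset\<close> undoes the shift.\<close>
 have "(%n. LINT m|M. F (u (n + N)) m) ----> (LINT m|M. F x0 m)"
 proof (rule integral_dominated_convergence[where w=G])
  show "AE m in M. (%n. F (u (n + N)) m) ----> F x0 m"
  proof (rule AE_I2)
   fix m assume "m \<in> space M"
   from assms(3)[OF this] have "(%n. F (u n) m) ----> F x0 m"
    using u unfolding continuous_at_sequentially o_def by blast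
   thus "(%n. F (u (n + N)) m) ----> F x0 m" by (rule LIMSEQ_ignore_initial_segment)
  qed
  show "!!n. AE m in M. norm (F (u (n + N)) m) \<le> G m"
   using N assms(4) by (intro AE_I2) auto
 qed (use assms N in auto)
 thus "((%x. LINT m|M. F x m) \<circ> u) ----> (LINT m|M. F x0 m)"
  unfolding o_def by (rule LIMSEQ_offset)
qed

text \<open>Dominated convergence for the remainder quotient. The mean value inequality on the
  convex ball bounds the increment of \<open>F\<close> by \<open>G\<close> times the norm of the
  increment of \<open>x\<close>; the linear term has the same bound, hence the dominating function
  \<open>2 * G\<close>.\<close>

lemma has_derivative_under_integral:
 fixes F :: "'a::euclidean_space => 'm => 'b::euclidean_space"
 assumes r: "r > 0" and int: "!!x. x \<in> ball x0 r ==> integrable M (F x)"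
  and der: "!!x m. x \<in> ball x0 r ==> m \<in> space M ==> ((%x. F x m) has_derivative D x m) (at x)"
  and bnd: "!!x m. x \<in> ball x0 r ==> m \<in> space M ==> onorm (D x m) \<le> G m"
  and G: "integrable M G" and meas: "!!h. (%m. D x0 m h) \<in> borel_measurable M"
 shows "((%x. LINT m|M. F x m) has_derivative (%h. LINT m|M. D x0 m h)) (at x0)"
proof -
 have x0: "x0 \<in> ball x0 r" using r by simp
 have bl: "bounded_linear (D x m)" if "x \<in> ball x0 r" "m \<in> space M" for x m
  using der[OF that] by (rule has_derivative_bounded_linear)
 have Dle: "norm (D x0 m h) \<le> G m * norm h" if "m \<in> space M" for m h
  using onorm[OF bl[OF x0 that], of h] bnd[OF x0 that] mult_right_mono[OF bnd[OF x0 that] norm_ge_zero[of h]]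
  by (meson order_trans)
 have Dint: "integrable M (%m. D x0 m h)" for h
  by (rule Bochner_Integration.integrable_bound[of M "%m. G m * norm h"])
   (use G meas in \<open>auto intro!: AE_I2 order_trans[OF Dle abs_ge_self]\<close>)
 have lin: "linear (%h. LINT m|M. D x0 m h)"
 proof (rule linearI)
  fix a b
  have "(LINT m|M. D x0 m (a + b)) = (LINT m|M. D x0 m a + D x0 m b)"
   using bl[OF x0] by (intro LINT_cong) (auto simp: bounded_linear.linear linear_add)
  thus "(LINT m|M. D x0 m (a + b)) = (LINT m|M. D x0 m a) + (LINT m|M. D x0 m b)"
   using Dint by simp
 next
  fix c :: real and b
  have "(LINT m|M. D x0 m (c *\<^sub>R b)) = (LINT m|M. c *\<^sub>R D x0 m b)"
   using bl[OF x0] by (intro LINT_cong) (auto simp: bounded_linear.linear linear_scale)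
  thus "(LINT m|M. D x0 m (c *\<^sub>R b)) = c *\<^sub>R (LINT m|M. D x0 m b)" by simp
 qed
 show ?thesis unfolding has_derivative_at
 proof (intro conjI)
  show "bounded_linear (%h. LINT m|M. D x0 m h)" using lin linear_conv_bounded_linear by blast
  let ?Q = "%h m. norm (F (x0 + h) m - F x0 m - D x0 m h) / norm h"
  have key: "(%n. LINT m|M. ?Q (u n) m) ----> (LINT m|M. 0)"
   if u: "u ----> 0" "!!n. norm (u n) < r" "!!n. u n \<noteq> 0" for u
  proof (rule integral_dominated_convergence[where w="%m. 2 * G m"])
   have ub: "x0 + u n \<in> ball x0 r" for n using u(2)[of n] by (simp add: dist_norm)
   show "(%m. ?Q (u n) m) \<in> borel_measurable M" for n
    using int[OF ub] int[OF x0] meas by (auto intro!: borel_measurable_divide)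
   show "integrable M (%m. 2 * G m)" using G by simp
   show "AE m in M. (%n. ?Q (u n) m) ----> 0"
   proof (rule AE_I2)
    fix m assume "m \<in> space M"
    from der[OF x0 this] have "((%h. ?Q h m) ---> 0) (at 0)" by (simp add: has_derivative_at)
    thus "(%n. ?Q (u n) m) ----> 0"
     using u by (intro
      filterlim_compose[of "%h. ?Q h m" "nhds 0" "at 0" u sequentially])
      (auto simp: filterlim_at)
   qed
   show "AE m in M. norm (?Q (u n) m) \<le> 2 * G m" for n
   proof (rule AE_I2)
    fix m assume m: "m \<in> space M"
    have "norm (F (x0 + u n) m - F x0 m) \<le> G m * norm (x0 + u n - x0)"
     by (rule differentiable_bound[of "ball x0 r" "%x. F x m" "%x. D x m"])
      (rule convex_ball has_derivative_at_withinI[OF der[OF _ m]] bnd[OF _ m] ub x0; assumption?)+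
    hence "norm (F (x0 + u n) m - F x0 m - D x0 m (u n)) \<le> 2 * G m * norm (u n)"
     using Dle[OF m, of "u n"] norm_triangle_ineq4[of "F (x0 + u n) m - F x0 m" "D x0 m (u n)"] by simp
    thus "norm (?Q (u n) m) \<le> 2 * G m" using u(3)[of n] by (simp add: field_simps)
   qed
  qed auto
  show "(%h. norm ((LINT m|M. F (x0 + h) m) - (LINT m|M. F x0 m) - (LINT m|M. D x0 m h)) / norm h) \<midarrow>0\<rightarrow> 0"
   unfolding tendsto_at_iff_sequentially
  proof (intro allI impI)
   fix u assume u: "\<forall>i. u i \<in> UNIV - {0::'a}" "u ----> 0"
   then obtain N where N: "!!n. n \<ge> N ==> norm (u n) < r" using r
    using LIMSEQ_D[OF u(2) r] by auto
   define v where "v = (%n. u (n + N))"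
   have v: "v ----> 0" "!!n. norm (v n) < r" "!!n. v n \<noteq> 0"
    using LIMSEQ_ignore_initial_segment[OF u(2), of N] N u(1) by (auto simp: v_def)
   have vb: "x0 + v n \<in> ball x0 r" for n using v(2)[of n] by (simp add: dist_norm)
   have le: "norm ((LINT m|M. F (x0 + v n) m) - (LINT m|M. F x0 m) - (LINT m|M. D x0 m (v n))) / norm (v n)
    \<le> (LINT m|M. ?Q (v n) m)" for n
   proof -
    have i: "integrable M (%m. F (x0 + v n) m - F x0 m - D x0 m (v n))"
     using int[OF vb] int[OF x0] Dint by auto
    have "(LINT m|M. F (x0 + v n) m) - (LINT m|M. F x0 m) - (LINT m|M. D x0 m (v n))
     = (LINT m|M. F (x0 + v n) m - F x0 m - D x0 m (v n))"
     using int[OF vb] int[OF x0] Dint by (simp add: LINT_diff)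
    also have "norm ... \<le> (LINT m|M. norm (F (x0 + v n) m - F x0 m - D x0 m (v n)))"
     by (rule integral_norm_bound)
    finally show ?thesis using v(3)[of n] by (simp add: divide_right_mono)
   qed
   have "(%n. norm ((LINT m|M. F (x0 + v n) m) - (LINT m|M. F x0 m) - (LINT m|M. D x0 m (v n))) / norm (v n)) ----> 0"
    by (rule tendsto_sandwich[OF _ _ tendsto_const key[OF v, simplified]]) (use le in auto)
   thus "((%h. norm ((LINT m|M. F (x0 + h) m) - (LINT m|M. F x0 m) - (LINT m|M. D x0 m h)) / norm h) \<circ> u) ----> 0"
    unfolding o_def v_def by (rule LIMSEQ_offset)
  qed
 qed
qed

text \<open>The version in coordinates: a common bound \<open>G\<close> for the n partial
  derivatives bounds the operator norm of the derivative by n times \<open>G\<close>.\<close>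

lemma partial_under_integral:
 fixes F :: "real^'n::finite => 'm => 'b::euclidean_space"
 assumes r: "r > 0" and int: "!!x. x \<in> ball x0 r ==> integrable M (F x)"
  and der: "!!x m. x \<in> ball x0 r ==> m \<in> space M ==> (%x. F x m) differentiable at x"
  and bnd: "!!x m k. x \<in> ball x0 r ==> m \<in> space M ==> norm (partial k (%x. F x m) x) \<le> G m"
  and G: "integrable M G" and meas: "!!k. (%m. partial k (%x. F x m) x0) \<in> borel_measurable M"
 shows "(%x. LINT m|M. F x m) differentiable at x0"
  and "partial k (%x. LINT m|M. F x m) x0 = (LINT m|M. partial k (%x. F x m) x0)"
proof -
 let ?D = "%x m h. \<Sum>k\<in>UNIV. h $ k *\<^sub>R partial k (%x. F x m) x"
 have d: "((%x. LINT m|M. F x m) has_derivative (%h. LINT m|M. ?D x0 m h)) (at x0)"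
 proof (rule has_derivative_under_integral[OF r int, where D="?D" and G="%m. real CARD('n) * G m"])
  fix x m assume xm: "x \<in> ball x0 r" "m \<in> space M"
  show dd: "((%x. F x m) has_derivative ?D x m) (at x)" by (rule has_derivative_sum_partial[OF der[OF xm]])
  have "norm (?D x m h) \<le> real CARD('n) * G m * norm h" for h
  proof -
   have "norm (?D x m h) \<le> (\<Sum>k::'n\<in>UNIV. norm h * G m)"
   proof (intro sum_norm_le)
    fix k :: 'n
    show "norm (h $ k *\<^sub>R partial k (%x. F x m) x) \<le> norm h * G m"
     using bnd[OF xm, of k] component_le_norm_cart[of h k] by (auto intro!: mult_mono)
   qed
   thus ?thesis by (simp add: algebra_simps)
  qed
  moreover have "0 \<le> G m" using bnd[OF xm] norm_ge_zero order_trans by blast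
  ultimately show "onorm (?D x m) \<le> real CARD('n) * G m" by (intro onorm_bound) auto
 next
  show "integrable M (%m. real CARD('n) * G m)" using G by simp
  show "(%m. ?D x0 m h) \<in> borel_measurable M" for h using meas by auto
 qed
 thus "(%x. LINT m|M. F x m) differentiable at x0" by (auto simp: differentiable_def)
 have "?D x0 m (axis k 1) = partial k (%x. F x m) x0" for m
  by (simp add: axis_def if_distrib[of "%c. c *\<^sub>R _"] sum.delta cong: if_cong)
 thus "partial k (%x. LINT m|M. F x m) x0 = (LINT m|M. partial k (%x. F x m) x0)"
  using partial_eqI[OF d, of k] by simp
qed

subsection \<open>Affine substitutions\<close>

lemma lborel_integral_affine:
 fixes f :: "'a::euclidean_space => 'b::euclidean_space"
 assumes "c \<noteq> 0" and [measurable]: "f \<in> borel_measurable borel"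
 shows "(LINT x|lborel. f x) = \<bar>c\<bar> ^ DIM('a) *\<^sub>R (LINT x|lborel. f (t + c *\<^sub>R x))"
 by (subst lborel_affine[OF assms(1), of t])
  (simp add: integral_density integral_distr)

lemma lborel_integral_translate:
 fixes f :: "'a::euclidean_space => 'b::euclidean_space"
 assumes "f \<in> borel_measurable borel"
 shows "(LINT x|lborel. f (t + x)) = (LINT x|lborel. f x)"
 using lborel_integral_affine[of 1 f t] assms by simp

lemma lborel_integral_reflect_translate:
 fixes f :: "'a::euclidean_space => 'b::euclidean_space"
 assumes "f \<in> borel_measurable borel"
 shows "(LINT x|lborel. f (t - x)) = (LINT x|lborel. f x)"
 using lborel_integral_affine[of "-1" f t] assms by simp

lemma lborel_integral_scale:
 fixes f :: "'a::euclidean_space => 'b::euclidean_space"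
 assumes "de > 0" and "f \<in> borel_measurable borel"
 shows "(LINT x|lborel. f (x /\<^sub>R de)) = de ^ DIM('a) *\<^sub>R (LINT x|lborel. f x)"
 using lborel_integral_affine[of "1/de" f 0] assms
 by (simp add: divide_inverse power_inverse flip: power_mult_distrib)

subsection \<open>Convolution\<close>

text \<open>Integration is over the completed measure because the second argument is often a square
  integrable function that is only Lebesgue measurable. For Borel integrands
  \<open>integral_completion\<close> gives back the Borel integral.\<close>

definition conv :: "(real^'n::finite => real) => (real^'n => 'b::euclidean_space) => real^'n => 'b" where
 "conv k f x = (LINT z|lebesgue. k (x - z) *\<^sub>R f z)"

lemma continuous_measurable_lebesgue: "continuous_on UNIV f ==> f \<in> borel_measurable lebesgue"
 for f :: "'a::euclidean_space => 'b::euclidean_space"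
 using measurable_completion[of f lborel borel] cont_measurable[of f] by simp

lemma cvanish_integrable_leb:
 fixes f :: "'a::euclidean_space => 'b::euclidean_space"
 assumes "continuous_on UNIV f" "!!x. norm x > R ==> f x = 0"
 shows "integrable lebesgue f"
 using cvanish_integrable[OF assms] by (simp add: integrable_completion borel_measurable_integrable)

lemma conv_integrable:
 fixes f :: "real^'n::finite => 'b::euclidean_space"
 assumes "continuous_on UNIV k" "!!x. norm x > R ==> k x = 0" "integrable lebesgue f"
 shows "integrable lebesgue (%z. k (x - z) *\<^sub>R f z)"
proof -
 obtain C where C: "!!x. norm (k x) \<le> C" using cvanish_bounded[OF assms(1,2)] by blast
 have "continuous_on UNIV (%z. k (x - z))"
  using continuous_on_compose2[OF assms(1), of UNIV "%z. x - z"] by (simp add: continuous_intros)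
 hence m: "(%z. k (x - z)) \<in> borel_measurable lebesgue" by (rule continuous_measurable_lebesgue)
 show ?thesis
 proof (rule Bochner_Integration.integrable_bound[of lebesgue "%z. C * norm (f z)"])
  show "integrable lebesgue (%z. C * norm (f z))" using assms(3) by simp
  show "(%z. k (x - z) *\<^sub>R f z) \<in> borel_measurable lebesgue"
   using m borel_measurable_integrable[OF assms(3)] by (rule borel_measurable_scaleR)
  have "norm (k (x - z) *\<^sub>R f z) \<le> norm (C * norm (f z))" for z
   using C[of "x - z"] by (auto simp: mult_right_mono intro!: order_trans[OF _ abs_ge_self])
  thus "AE z in lebesgue. norm (k (x - z) *\<^sub>R f z) \<le> norm (C * norm (f z))" by simp
 qed
qed

lemma C_diff_shift: "C_diff m k ==> C_diff m (%x. k (x - z))"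
 using C_diff_affine[of m k "- z" 1] by (simp add: algebra_simps)

lemma partial_shift: "k differentiable at (x - z) ==> partial j (%x. k (x - z)) x = partial j k (x - z)"
 using partial_affine[of k "- z" 1 x j] by (simp add: algebra_simps)

lemma partial_conv:
 assumes k: "C_diff 1 k" "!!x. norm x > R ==> k x = 0" and f: "integrable lebesgue f"
 shows "conv k f differentiable at x" "partial j (conv k f) x = conv (partial j k) f x"
proof -
 note pz = partial_zero_outside[of R k, OF k(2)]
 have ex: "\<exists>C. \<forall>x. norm (partial j k x) \<le> C" for j
  using cvanish_bounded[OF C_diff_cont_partial[OF k(1)] pz] by blast
 \<comment> \<open>A bound is chosen for each direction, and the sum \<open>C\<close> of these
   nonnegative bounds serves for all directions at once.\<close>
 define c where "c j = (SOME C. \<forall>x. norm (partial j k x) \<le> C)" for j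
 have c: "norm (partial j k x) \<le> c j" for j x
  using someI_ex[OF ex[of j]] unfolding c_def by blast
 have c0: "0 \<le> c j" for j using c[of j 0] norm_ge_zero order_trans by blast
 define C where "C = (\<Sum>j\<in>UNIV. c j)"
 have C: "norm (partial j k x) \<le> C" for j x
  using c[of j x] member_le_sum[of j UNIV c] c0 unfolding C_def by force
 have pt: "partial j (%x. k (x - z) *\<^sub>R f z) x = partial j k (x - z) *\<^sub>R f z"
  "(%x. k (x - z) *\<^sub>R f z) differentiable at x" for j z x
 proof -
  have d: "(%x. k (x - z)) differentiable at x" by (rule C_diff_D[OF C_diff_shift[OF k(1)]]) simp
  show "partial j (%x. k (x - z) *\<^sub>R f z) x = partial j k (x - z) *\<^sub>R f z"
   using partial_linear[OF bounded_linear_scaleR_left[of "f z"] d, of j] partial_shift[of k x z j] C_diff_D[OF k(1)] by simp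
  show "(%x. k (x - z) *\<^sub>R f z) differentiable at x"
   using C_diff_D[OF C_diff_linear[OF bounded_linear_scaleR_left[of "f z"] C_diff_shift[OF k(1)]]] by simp
 qed
 note r = partial_under_integral[of 1 x lebesgue "%x z. k (x - z) *\<^sub>R f z" "%z. C * norm (f z)"]
 have a1: "integrable lebesgue (%z. k (x - z) *\<^sub>R f z)" for x
  by (rule conv_integrable[OF C_diff_cont[OF k(1)] k(2) f])
 have a2: "norm (partial k' (%x. k (x - m) *\<^sub>R f m) x) \<le> C * norm (f m)" for x m k'
  using C[of k' "x - m"] by (simp add: pt mult_right_mono)
 have a3: "(%m. partial k' (%x. k (x - m) *\<^sub>R f m) x) \<in> borel_measurable lebesgue" for k'
  using conv_integrable[OF C_diff_cont_partial[OF k(1)] pz f]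
  unfolding pt by (rule borel_measurable_integrable)
 have a4: "integrable lebesgue (%z. C * norm (f z))" using f by simp
 show "conv k f differentiable at x" "partial j (conv k f) x = conv (partial j k) f x"
  using r[OF _ a1 pt(2) a2 a4 a3] by (simp_all add: conv_def[abs_def] pt(1))
qed

lemma C_diff_conv:
 assumes f: "integrable lebesgue f"
 shows "C_diff m k ==> (!!x. norm x > R ==> k x = 0) ==> C_diff m (conv k f)"
proof (induction m arbitrary: k)
 case 0
 hence k: "continuous_on UNIV k" by simp
 obtain C where C: "!!x. norm (k x) \<le> C" using cvanish_bounded[OF k 0(2)] by blast
 have "isCont (conv k f) x" for x
  unfolding conv_def[abs_def]
 proof (rule continuous_under_integral[where r=1 and G="%z. C * norm (f z)"])
  show "(%z. k (x - z) *\<^sub>R f z) \<in> borel_measurable lebesgue" for x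
   by (rule borel_measurable_integrable[OF conv_integrable[OF k 0(2) f]])
  show "isCont (%x. k (x - z) *\<^sub>R f z) x" for z
   using k by (auto intro!: continuous_intros isCont_o2[of x "%x. x - z" k] simp: continuous_on_eq_continuous_at)
  show "norm (k (x - z) *\<^sub>R f z) \<le> C * norm (f z)" for x z using C[of "x - z"] by (simp add: mult_right_mono)
 qed (use f in auto)
 thus ?case by (simp add: continuous_at_imp_continuous_on)
next
 case (Suc m)
 have k: "C_diff 1 k" using Suc.prems(1) by (rule C_diff_mono) simp
 have "partial j (conv k f) = conv (partial j k) f" for j
  by (intro ext partial_conv(2)[OF k Suc.prems(2) f])
 moreover have "conv k f differentiable at x" for x by (rule partial_conv(1)[OF k Suc.prems(2) f])
 moreover have "C_diff m (conv (partial j k) f)" for j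
  using Suc.prems(1) partial_zero_outside[of R k, OF Suc.prems(2)] by (intro Suc.IH) auto
 ultimately show ?case by simp
qed

text \<open>The kernel enters only through its L^1 norm, which \<open>rescale\<close> preserves;
  this makes the estimates of mollified fields uniform in the scale.\<close>

lemma conv_norm_le:
 assumes "continuous_on UNIV k" "!!x. norm x > R ==> k x = 0" "integrable lebesgue f" "!!z. norm (f z) \<le> M"
 shows "norm (conv k f x) \<le> M * (LINT z|lborel. \<bar>k z\<bar>)"
proof -
 have ki: "integrable lborel (%z. \<bar>k z\<bar>)"
  by (rule cvanish_integrable[where R=R]) (use assms in \<open>auto intro: continuous_intros\<close>)
 have "continuous_on UNIV (%z. k (x - z))"
  using continuous_on_compose2[OF assms(1), of UNIV "%z. x - z"] by (simp add: continuous_intros)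
 hence kc: "continuous_on UNIV (%z. \<bar>k (x - z)\<bar>)" by (intro continuous_intros)
 have kx: "integrable lebesgue (%z. \<bar>k (x - z)\<bar>)"
 proof (rule cvanish_integrable_leb[OF kc, where R="norm x + R"])
  show "\<bar>k (x - z)\<bar> = 0" if "norm z > norm x + R" for z
   using assms(2)[of "x - z"] that norm_triangle_ineq2[of z x] by (simp add: norm_minus_commute)
 qed
 have "norm (conv k f x) \<le> (LINT z|lebesgue. norm (k (x - z) *\<^sub>R f z))"
  unfolding conv_def by (rule integral_norm_bound)
 also have "... \<le> (LINT z|lebesgue. M * \<bar>k (x - z)\<bar>)"
 proof (rule integral_mono)
  show "integrable lebesgue (%z. norm (k (x - z) *\<^sub>R f z))"
   by (rule integrable_norm[OF conv_integrable[OF assms(1-3)]])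
  show "integrable lebesgue (%z. M * \<bar>k (x - z)\<bar>)" using kx by simp
  show "norm (k (x - z) *\<^sub>R f z) \<le> M * \<bar>k (x - z)\<bar>" for z
   using mult_left_mono[OF assms(4)[of z], of "\<bar>k (x - z)\<bar>"] by (simp add: mult.commute)
 qed
 also have "... = M * (LINT z|lborel. \<bar>k (x - z)\<bar>)"
  using cont_measurable[OF kc] by (simp add: integral_completion)
 also have "(LINT z|lborel. \<bar>k (x - z)\<bar>) = (LINT z|lborel. \<bar>k z\<bar>)"
  by (rule lborel_integral_reflect_translate[of "%z. \<bar>k z\<bar>"])
   (use assms(1) in \<open>auto intro!: cont_measurable continuous_intros\<close>)
 finally show ?thesis .
qed

subsection \<open>Integrals of derivatives\<close>

text \<open>The integral of \<open>f (z + x)\<close> over \<open>z\<close> does not depend on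
  \<open>x\<close>, so its derivative at \<open>x = 0\<close>, computed under the integral sign,
  vanishes. All integrations by parts in the whole space rest on this translation argument.\<close>

lemma integral_partial_zero:
 fixes f :: "real^'n::finite => 'b::euclidean_space"
 assumes f: "C_diff 1 f" "!!x. norm x > R ==> f x = 0"
 shows "(LINT x|lborel. partial j f x) = 0"
proof -
 note pz = partial_zero_outside[of R f, OF f(2)]
 have pc: "continuous_on UNIV (partial j f)" for j by (rule C_diff_cont_partial[OF f(1)])
 have ex: "\<exists>C. \<forall>x. norm (partial j f x) \<le> C" for j
  using cvanish_bounded[OF pc pz] by blast
 define c where "c j = (SOME C. \<forall>x. norm (partial j f x) \<le> C)" for j
 have c: "norm (partial j f x) \<le> c j" for j x
  using someI_ex[OF ex[of j]] unfolding c_def by blast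
 have c0: "0 \<le> c j" for j using c[of j 0] norm_ge_zero order_trans by blast
 define C where "C = (\<Sum>j\<in>UNIV. c j)"
 have C: "norm (partial j f x) \<le> C" for j x
  using c[of j x] member_le_sum[of j UNIV c] c0 unfolding C_def by force
 let ?F = "%x z. f (z + x)"
 have pt: "partial j (%x. f (z + x)) x = partial j f (z + x)"
  "(%x. f (z + x)) differentiable at x" for j z x
  using partial_affine[of f z 1 x j] C_diff_D[OF f(1)] C_diff_D[OF C_diff_affine[OF f(1), of z 1]]
  by simp_all
 have a1: "integrable lborel (%z. f (z + x))" for x
 proof (rule cvanish_integrable[where R="R + norm x"])
  show "continuous_on UNIV (%z. f (z + x))"
   using C_diff_cont[OF C_diff_affine[OF f(1), of x 1]] by (simp add: add.commute)
  show "f (z + x) = 0" if "norm z > R + norm x" for z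
   using that norm_triangle_ineq2[of z "- x"] by (intro f(2)) simp
 qed
 \<comment> \<open>Translations by less than 1 keep all supports inside the ball of radius
   \<open>R + 1\<close>, which gives one integrable majorant.\<close>
 let ?G = "%z::real^'n. C * indicator (cball 0 (R + 1)) z"
 have a2: "norm (partial k (%x. f (m + x)) x) \<le> ?G m" if "x \<in> ball 0 1" for x m k
 proof (cases "norm m \<le> R + 1")
  case False
  hence "norm (m + x) > R" using that norm_triangle_ineq2[of m "- x"] by simp
  with False show ?thesis by (simp add: pt pz)
 qed (use C in \<open>simp add: pt\<close>)
 have a4: "integrable lborel ?G"
  using emeasure_lborel_cball_finite[of "0::real^'n" "R + 1"]
  by (intro integrable_mult_right integrable_real_indicator) (auto simp: less_top)
 have a3: "(%m. partial k (%x. f (m + x)) 0) \<in> borel_measurable lborel" for k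
  using cont_measurable[OF pc] by (simp add: pt)
 have "partial j (%x. LINT z|lborel. f (z + x)) 0 = (LINT z|lborel. partial j (%x. f (z + x)) 0)"
  by (rule partial_under_integral(2)[where r=1 and G="?G"]) (use a1 pt(2) a2 a3 a4 in auto)
 moreover have "(LINT z|lborel. f (z + x)) = (LINT z|lborel. f z)" for x
  using lborel_integral_translate[OF cont_measurable[OF C_diff_cont[OF f(1)]], of x] by (simp add: add.commute)
 ultimately show ?thesis by (simp add: pt)
qed

text \<open>Integration by parts in \<open>z\<close>. Putting the derivative on \<open>f\<close>
  avoids the factor that differentiating a rescaled kernel produces; so one derivative of a
  mollified C^1 field is bounded uniformly in the scale.\<close>

lemma conv_partial_right:
 fixes f :: "real^'n::finite => 'b::euclidean_space"
 assumes k: "C_diff 1 k" "!!x. norm x > R ==> k x = 0"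
  and f: "C_diff 1 f" "!!x. norm x > R' ==> f x = 0"
 shows "conv (partial j k) f x = conv k (partial j f) x"
proof -
 have kz: "C_diff 1 (%z. k (x - z))" for x using C_diff_affine[OF k(1), of x "-1"] by simp
 have pk: "partial j (%z. k (x - z)) z = - partial j k (x - z)" for z
  using partial_affine[of k x "-1" z j] C_diff_D[OF k(1)] by simp
 have "C_diff 1 (%z. k (x - z) *\<^sub>R f z)" by (rule C_diff_scaleR[OF kz f(1)])
 hence "(LINT z|lborel. partial j (%z. k (x - z) *\<^sub>R f z) z) = 0"
  by (rule integral_partial_zero[where R=R']) (use f(2) in simp)
 moreover have "partial j (%z. k (x - z) *\<^sub>R f z) z = k (x - z) *\<^sub>R partial j f z - partial j k (x - z) *\<^sub>R f z" for z
  by (simp add: partial_scaleR C_diff_D[OF kz] C_diff_D[OF f(1)] pk)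
 ultimately have "(LINT z|lborel. k (x - z) *\<^sub>R partial j f z - partial j k (x - z) *\<^sub>R f z) = 0" by simp
 moreover have c1: "continuous_on UNIV (%z. k (x - z) *\<^sub>R partial j f z)"
  using C_diff_cont[OF kz] C_diff_cont_partial[OF f(1)] by (intro continuous_intros)
 moreover have "continuous_on UNIV (%z. partial j (%z. k (x - z)) z)"
  by (rule C_diff_cont_partial[OF kz])
 from continuous_on_minus[OF this] have "continuous_on UNIV (%z. partial j k (x - z))" by (simp add: pk)
 hence c2: "continuous_on UNIV (%z. partial j k (x - z) *\<^sub>R f z)"
  using C_diff_cont[OF f(1)] by (intro continuous_intros)
 moreover have "integrable lborel (%z. k (x - z) *\<^sub>R partial j f z)"
  by (rule cvanish_integrable[OF c1, of R']) (simp add: partial_zero_outside[of R' f, OF f(2)])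
 moreover have "integrable lborel (%z. partial j k (x - z) *\<^sub>R f z)"
  by (rule cvanish_integrable[OF c2, of R']) (use f(2) in auto)
 ultimately show ?thesis
  using cont_measurable[OF c1] cont_measurable[OF c2]
  by (simp add: conv_def integral_completion)
qed

subsection \<open>Integrals along rays\<close>

text \<open>The set \<open>{..0}\<close> gives the half-line integrals of the phases and
  \<open>UNIV\<close> the line integrals of the amplitudes, so both are treated together. Values in
  any Euclidean space make it possible to integrate the field first and take the component along the
  direction afterwards.\<close>

definition ray :: "real set => real^'n::finite => (real^'n => 'b::euclidean_space) => real^'n => 'b" where
 "ray S th f x = (LINT s|lborel. indicator S s *\<^sub>R f (x + s *\<^sub>R th))"

lemma half_line_integral_ray: "half_line_integral th A = ray {..0} th (%z. th \<bullet> A z)"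
 by (auto simp: half_line_integral_def ray_def set_lebesgue_integral_def fun_eq_iff)

lemma line_integral_ray: "line_integral th A = ray UNIV th (%z. th \<bullet> A z)"
 by (auto simp: line_integral_def ray_def fun_eq_iff)

lemma integrable_const_Icc: "integrable lborel (%s::real. C * indicator {a..b} s :: real)"
 by (intro integrable_mult_right integrable_real_indicator) (auto simp: emeasure_lborel_Icc_eq)

lemma ray_vanish:
 assumes "norm th = 1" "!!x. norm x > R ==> f x = 0" "\<bar>s\<bar> > R + norm x"
 shows "f (x + s *\<^sub>R th) = 0"
 using assms(1,3) norm_triangle_ineq2[of "s *\<^sub>R th" "- x"] by (intro assms(2)) (simp add: add.commute)

lemma continuous_on_along_ray:
 fixes f :: "real^'n::finite => 'b::euclidean_space"
 assumes "continuous_on UNIV f"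
 shows "continuous_on UNIV (%s. f (x + s *\<^sub>R th))"
 using continuous_on_compose2[OF assms, of UNIV "%s. x + s *\<^sub>R th"] by (simp add: continuous_intros)

lemma ray_integrable:
 fixes f :: "real^'n::finite => 'b::euclidean_space"
 assumes "norm th = 1" "continuous_on UNIV f" "!!x. norm x > R ==> f x = 0" "S \<in> sets borel"
 shows "integrable lborel (%s. indicator S s *\<^sub>R f (x + s *\<^sub>R th))"
proof (rule integrable_mult_indicator)
 show "integrable lborel (%s. f (x + s *\<^sub>R th))"
  using ray_vanish[of th R f x, OF assms(1,3)]
  by (intro cvanish_integrable[where R="R + norm x"] continuous_on_along_ray assms(2)) auto
qed (use assms in auto)

text \<open>The points of a line that lie in the ball of radius \<open>R\<close> have parameters in
  an interval of length \<open>2 * R\<close> centred at \<open>- (x \<bullet> th)\<close>. Centring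
  it there instead of at 0 makes the bound uniform in \<open>x\<close>.\<close>

lemma ray_norm_le:
 assumes th: "norm th = 1" and f: "continuous_on UNIV f" "!!x. norm x > R ==> f x = 0"
  and S: "S \<in> sets borel" and M: "!!x. norm (f x) \<le> M" and R: "R \<ge> 0"
 shows "norm (ray S th f x) \<le> 2 * R * M"
proof -
 let ?I = "{- R - x \<bullet> th .. R - x \<bullet> th}"
 have M0: "0 \<le> M" using M norm_ge_zero order_trans by blast
 have le: "norm (indicator S s *\<^sub>R f (x + s *\<^sub>R th)) \<le> M * indicator ?I s" for s
 proof (cases "s \<in> ?I")
  case True
  thus ?thesis using M[of "x + s *\<^sub>R th"] M0 by (auto simp: indicator_def)
 next
  case False
  have "\<bar>(x + s *\<^sub>R th) \<bullet> th\<bar> \<le> norm (x + s *\<^sub>R th)"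
   using Cauchy_Schwarz_ineq2[of "x + s *\<^sub>R th" th] th by simp
  moreover have "(x + s *\<^sub>R th) \<bullet> th = x \<bullet> th + s"
   using th by (simp add: inner_add_left dot_square_norm)
  ultimately have "norm (x + s *\<^sub>R th) > R" using False by auto
  thus ?thesis using f(2) M0 by simp
 qed
 have "norm (ray S th f x) \<le> (LINT s|lborel. norm (indicator S s *\<^sub>R f (x + s *\<^sub>R th)))"
  unfolding ray_def by (rule integral_norm_bound)
 also have "... \<le> (LINT s|lborel. M * indicator ?I s)"
  by (rule integral_mono[OF integrable_norm[OF ray_integrable[of th f R S, OF th f S]] integrable_const_Icc le])
 also have "... = M * (2 * R)" using R by simp
 finally show ?thesis by (simp add: algebra_simps)
qed

lemma ray_add:
 assumes "norm th = 1" "S \<in> sets borel" "continuous_on UNIV f" "!!x. norm x > R ==> f x = 0"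
  "continuous_on UNIV g" "!!x. norm x > R ==> g x = 0"
 shows "ray S th (%x. f x + g x) x = ray S th f x + ray S th g x"
 using ray_integrable[of th f R S, OF assms(1,3,4,2)] ray_integrable[of th g R S, OF assms(1,5,6,2)]
 by (simp add: ray_def scaleR_add_right)

lemma ray_scaleR: "ray S th (%x. c *\<^sub>R f x) x = c *\<^sub>R ray S th f x"
proof -
 have "indicator S s *\<^sub>R c *\<^sub>R f (x + s *\<^sub>R th) = c *\<^sub>R indicator S s *\<^sub>R f (x + s *\<^sub>R th)" for s
  by (rule scaleR_left_commute)
 thus ?thesis by (simp add: ray_def del: scaleR_scaleR)
qed

lemma ray_sum:
 assumes "norm th = 1" "S \<in> sets borel" "!!i. continuous_on UNIV (f i)" "!!i x. norm x > R ==> f i x = 0"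
 shows "ray S th (%x. \<Sum>i\<in>I. f i x) x = (\<Sum>i\<in>I. ray S th (f i) x)"
 using ray_integrable[of th "f _" R S, OF assms(1,3,4,2)]
 by (simp add: ray_def scaleR_sum_right)

lemma partial_ray:
 assumes th: "norm th = 1" and f: "C_diff 1 f" "!!x. norm x > R ==> f x = 0" and S: "S \<in> sets borel"
 shows "ray S th f differentiable at x" "partial j (ray S th f) x = ray S th (partial j f) x"
proof -
 note pz = partial_zero_outside[of R f, OF f(2)]
 have pc: "continuous_on UNIV (partial j f)" for j by (rule C_diff_cont_partial[OF f(1)])
 have ex: "\<exists>C. \<forall>x. norm (partial j f x) \<le> C" for j
  using cvanish_bounded[OF pc pz] by blast
 define c where "c j = (SOME C. \<forall>x. norm (partial j f x) \<le> C)" for j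
 have c: "norm (partial j f x) \<le> c j" for j x
  using someI_ex[OF ex[of j]] unfolding c_def by blast
 have c0: "0 \<le> c j" for j using c[of j 0] norm_ge_zero order_trans by blast
 define C where "C = (\<Sum>j\<in>UNIV. c j)"
 have C: "norm (partial j f x) \<le> C" for j x
  using c[of j x] member_le_sum[of j UNIV c] c0 unfolding C_def by force
 have C0: "0 \<le> C" using C norm_ge_zero order_trans by blast
 have pt: "partial j (%x. indicator S s *\<^sub>R f (x + s *\<^sub>R th)) x = indicator S s *\<^sub>R partial j f (x + s *\<^sub>R th)"
  "(%x. indicator S s *\<^sub>R f (x + s *\<^sub>R th)) differentiable at x" for j s x
 proof -
  have sh: "C_diff 1 (%x. f (x + s *\<^sub>R th))" using C_diff_affine[OF f(1), of "s *\<^sub>R th" 1] by (simp add: add.commute)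
  hence d: "(%x. f (x + s *\<^sub>R th)) differentiable at x" by simp
  have "partial j (%x. f (x + s *\<^sub>R th)) x = partial j f (x + s *\<^sub>R th)"
   using partial_affine[of f "s *\<^sub>R th" 1 x j] C_diff_D[OF f(1)] by (simp add: add.commute)
  thus "partial j (%x. indicator S s *\<^sub>R f (x + s *\<^sub>R th)) x = indicator S s *\<^sub>R partial j f (x + s *\<^sub>R th)"
   using partial_linear[OF bounded_linear_scaleR_right d] by metis
  show "(%x. indicator S s *\<^sub>R f (x + s *\<^sub>R th)) differentiable at x"
   using C_diff_linear[OF bounded_linear_scaleR_right sh] by simp
 qed
 \<comment> \<open>Outside this interval of parameters no ray starting within distance 1 of
   \<open>x\<close> meets the support.\<close>
 let ?I = "{- (R + norm x + 1) .. R + norm x + 1}"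
 let ?G = "%s::real. C * indicator ?I s"
 have a2: "norm (partial k (%x. indicator S s *\<^sub>R f (x + s *\<^sub>R th)) z) \<le> ?G s" if "z \<in> ball x 1" for z s k
 proof (cases "s \<in> ?I")
  case True
  thus ?thesis using C[of k "z + s *\<^sub>R th"] C0 unfolding pt by (simp add: indicator_def)
 next
  case False
  have "norm z < norm x + 1" using that norm_triangle_ineq2[of z x] by (simp add: dist_norm norm_minus_commute)
  hence "\<bar>s\<bar> > R + norm z" using False by auto
  from ray_vanish[of th R "partial k f" z s, OF th pz this] show ?thesis unfolding pt using C0 by simp
 qed
 have a4: "integrable lborel ?G" by (rule integrable_const_Icc)
 have a3: "(%s. partial k (%x. indicator S s *\<^sub>R f (x + s *\<^sub>R th)) x) \<in> borel_measurable lborel" for k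
  using ray_integrable[of th "partial k f" R S, OF th pc pz S] unfolding pt by (rule borel_measurable_integrable)
 have a1: "integrable lborel (%s. indicator S s *\<^sub>R f (z + s *\<^sub>R th))" for z
  by (rule ray_integrable[of th f R S, OF th C_diff_cont[OF f(1)] f(2) S])
 note r = partial_under_integral[of 1 x lborel "%x s. indicator S s *\<^sub>R f (x + s *\<^sub>R th)" ?G, OF _ a1 pt(2) a2 a4 a3]
 show "ray S th f differentiable at x" "partial j (ray S th f) x = ray S th (partial j f) x"
  using r by (simp_all add: ray_def[abs_def] pt(1))
qed

lemma C_diff_ray:
 assumes th: "norm th = 1" and S: "S \<in> sets borel"
 shows "C_diff m f ==> (!!x. norm x > R ==> f x = 0) ==> C_diff m (ray S th f)"
proof (induction m arbitrary: f)
 case 0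
 hence f: "continuous_on UNIV f" by simp
 obtain C where C: "C > 0" "!!x. norm (f x) \<le> C" using cvanish_bounded[OF f 0(2)] by blast
 have "isCont (ray S th f) x" for x
  unfolding ray_def[abs_def]
 proof (rule continuous_under_integral[where r=1 and G="%s::real. C * indicator {- (R + norm x + 1) .. R + norm x + 1} s"])
  show "(%s. indicator S s *\<^sub>R f (z + s *\<^sub>R th)) \<in> borel_measurable lborel" for z
   by (rule borel_measurable_integrable[OF ray_integrable[of th f R S, OF th f 0(2) S]])
  show "isCont (%x. indicator S s *\<^sub>R f (x + s *\<^sub>R th)) x" for s
   using f by (auto intro!: continuous_intros isCont_o2[of x "%x. x + s *\<^sub>R th" f] simp: continuous_on_eq_continuous_at)
  show "integrable lborel (%s::real. C * indicator {- (R + norm x + 1) .. R + norm x + 1} s)"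
   by (rule integrable_const_Icc)
  fix z s assume "z \<in> ball x 1"
  hence z: "norm z < norm x + 1" using norm_triangle_ineq2[of z x] by (simp add: dist_norm norm_minus_commute)
  show "norm (indicator S s *\<^sub>R f (z + s *\<^sub>R th)) \<le> C * indicator {- (R + norm x + 1) .. R + norm x + 1} s"
  proof (cases "s \<in> {- (R + norm x + 1) .. R + norm x + 1}")
   case True
   thus ?thesis using C by (simp add: indicator_def)
  next
   case False
   hence "\<bar>s\<bar> > R + norm z" using z by auto
   from ray_vanish[of th R f z s, OF th 0(2) this] show ?thesis using C(1) by simp
  qed
 qed auto
 thus ?case by (simp add: continuous_at_imp_continuous_on)
next
 case (Suc m)
 have f: "C_diff 1 f" using Suc.prems(1) by (rule C_diff_mono) simp
 have "partial j (ray S th f) = ray S th (partial j f)" for j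
  by (intro ext partial_ray(2)[of th f R S, OF th f Suc.prems(2) S])
 moreover have "ray S th f differentiable at x" for x by (rule partial_ray(1)[of th f R S, OF th f Suc.prems(2) S])
 moreover have "C_diff m (ray S th (partial j f))" for j
  using Suc.prems(1) partial_zero_outside[of R f, OF Suc.prems(2)] by (intro Suc.IH) auto
 ultimately show ?case by simp
qed

lemma has_vector_derivative_along_ray:
 assumes "f differentiable at (x + s *\<^sub>R th)"
 shows "((%s. f (x + s *\<^sub>R th)) has_vector_derivative (\<Sum>j\<in>UNIV. th $ j *\<^sub>R partial j f (x + s *\<^sub>R th))) (at s within T)"
proof -
 have "((%s. x + s *\<^sub>R th) has_vector_derivative th) (at s within T)"
  by (auto intro!: derivative_eq_intros)
 from vector_derivative_diff_chain_within[OF this has_derivative_at_withinI[OF has_derivative_sum_partial[OF assms]]]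
 show ?thesis by (simp add: o_def)
qed

text \<open>Differentiation along \<open>th\<close> commutes with the integral and turns the
  integrand into a derivative in \<open>s\<close>. The fundamental theorem leaves the value at the
  end point \<open>x\<close> for the half-line and nothing for the whole line. These are the
  transport equations for the phases and for the amplitude.\<close>

lemma ray_derivative:
 assumes th: "norm th = 1" and f: "C_diff 1 f" "!!x. norm x > R ==> f x = 0"
 shows "(\<Sum>j\<in>UNIV. th $ j *\<^sub>R partial j (ray {..0} th f) x) = f x" (is ?A)
  and "(\<Sum>j\<in>UNIV. th $ j *\<^sub>R partial j (ray UNIV th f) x) = 0" (is ?B)
proof -
 let ?f' = "%z. \<Sum>j\<in>UNIV. th $ j *\<^sub>R partial j f z"
 have pc: "continuous_on UNIV (partial j f)" for j by (rule C_diff_cont_partial[OF f(1)])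
 note pz = partial_zero_outside[of R f, OF f(2)]
 have c': "continuous_on UNIV ?f'" using pc by (intro continuous_intros)
 have z': "!!x. norm x > R ==> ?f' x = 0" using pz by simp
 have eq: "(\<Sum>j\<in>UNIV. th $ j *\<^sub>R partial j (ray S th f) x) = ray S th ?f' x" if "S \<in> sets borel" for S
 proof -
  have "(\<Sum>j\<in>UNIV. th $ j *\<^sub>R partial j (ray S th f) x) = (\<Sum>j\<in>UNIV. ray S th (%z. th $ j *\<^sub>R partial j f z) x)"
   using partial_ray(2)[of th f R S, OF th f that] by (simp add: ray_scaleR)
  also have "... = ray S th ?f' x"
   by (rule ray_sum[symmetric, OF th that, where R=R]) (use pc pz in \<open>auto intro!: continuous_intros\<close>)
  finally show ?thesis .
 qed
 \<comment> \<open>At parameters beyond \<open>c\<close> the ray has left the support. The maximum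
   and the summand 1 make \<open>c\<close> positive and the comparison strict whatever the sign of
   \<open>R\<close>.\<close>
 define c where "c = max 0 R + norm x + 1"
 have c: "c > R + norm x" "c > 0" by (auto simp: c_def max_def add_nonneg_pos)
 have ftc: "(LINT s|lborel. indicator {a..b} s *\<^sub>R ?f' (x + s *\<^sub>R th)) = f (x + b *\<^sub>R th) - f (x + a *\<^sub>R th)" if "a \<le> b" for a b
  by (rule integral_FTC_Icc[OF that, where F="%s. f (x + s *\<^sub>R th)"])
   (use has_vector_derivative_along_ray[OF C_diff_D[OF f(1)]]
      continuous_on_subset[OF continuous_on_along_ray[OF c']] in auto)
 have out: "?f' (x + s *\<^sub>R th) = 0" if "\<bar>s\<bar> > c" for s
  by (rule ray_vanish[of th R ?f' x s, OF th z']) (use c that in auto)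
 have "ray {..0} th ?f' x = (LINT s|lborel. indicator {-c..0} s *\<^sub>R ?f' (x + s *\<^sub>R th))"
  unfolding ray_def using out c(2) by (intro LINT_cong) (auto simp: indicator_def)
 moreover have "f (x + (- c) *\<^sub>R th) = 0" by (rule ray_vanish[of th R f, OF th f(2)]) (use c in auto)
 ultimately show ?A using ftc[of "-c" 0] c(2) eq[of "{..0}"] by simp
 have "ray UNIV th ?f' x = (LINT s|lborel. indicator {-c..c} s *\<^sub>R ?f' (x + s *\<^sub>R th))"
  unfolding ray_def using out c(2) by (intro LINT_cong) (auto simp: indicator_def)
 moreover have "f (x + (- c) *\<^sub>R th) = 0" "f (x + c *\<^sub>R th) = 0" by (rule ray_vanish[of th R f, OF th f(2)]; use c in simp)+
 ultimately show ?B using ftc[of "-c" c] c(2) eq[of UNIV] by simp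
qed

text \<open>Dominated convergence: the parameters at which a ray from \<open>x\<close> can meet the
  support lie in one bounded interval, independent of the direction.\<close>

lemma ray_tendsto:
 fixes f :: "real^'n::finite => 'b::euclidean_space" and th :: "real => real^'n"
 assumes th: "!!t. t > T ==> norm (th t) = 1" "norm th0 = 1" "(th ---> th0) at_top"
  and f: "continuous_on UNIV f" "!!x. norm x > R ==> f x = 0" and S: "S \<in> sets borel"
 shows "((%t. ray S (th t) f x) ---> ray S th0 f x) at_top"
proof -
 obtain C where C: "C > 0" "!!x. norm (f x) \<le> C" using cvanish_bounded[OF f] by blast
 have meas: "(%s. indicator S s *\<^sub>R f (x + s *\<^sub>R th)) \<in> borel_measurable lborel" for th
  using S cont_measurable[OF continuous_on_along_ray[OF f(1)]] by measurable
 show ?thesis unfolding ray_def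
 proof (rule integral_dominated_convergence_at_top[where w="%s::real. C * indicator {- (R + norm x) .. R + norm x} s"])
  show "integrable lborel (%s::real. C * indicator {- (R + norm x) .. R + norm x} s)"
   by (rule integrable_const_Icc)
  show "AE s in lborel. ((%t. indicator S s *\<^sub>R f (x + s *\<^sub>R th t)) ---> indicator S s *\<^sub>R f (x + s *\<^sub>R th0)) at_top"
  proof (intro AE_I2 tendsto_scaleR tendsto_const)
   fix s
   have "isCont f (x + s *\<^sub>R th0)" using f(1) by (simp add: continuous_on_eq_continuous_at)
   thus "((%t. f (x + s *\<^sub>R th t)) ---> f (x + s *\<^sub>R th0)) at_top"
    by (rule isCont_tendsto_compose) (intro tendsto_intros th(3))
  qed
  show "EV t. AE s in lborel. norm (indicator S s *\<^sub>R f (x + s *\<^sub>R th t)) \<le> C * indicator {- (R + norm x) .. R + norm x} s"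
   using eventually_gt_at_top[of T]
  proof eventually_elim
   case (elim t)
   show ?case
   proof (rule AE_I2)
    fix s :: real
    show "norm (indicator S s *\<^sub>R f (x + s *\<^sub>R th t)) \<le> C * indicator {- (R + norm x) .. R + norm x} s"
    proof (cases "s \<in> {- (R + norm x) .. R + norm x}")
     case True
     thus ?thesis using C by (simp add: indicator_def)
    next
     case False
     hence "\<bar>s\<bar> > R + norm x" by auto
     from ray_vanish[of "th t" R f x s, OF th(1)[OF elim] f(2) this] show ?thesis using C(1) by simp
    qed
   qed
  qed
 qed (use meas in auto)
qed

section \<open>Square integrable functions\<close>

lemma in_L2_measurable: "in_L2 M f ==> f \<in> borel_measurable M"
 by (simp add: in_L2_def)

lemma in_L2_bound:
 assumes "in_L2 M f" "g \<in> borel_measurable M" "AE x in M. norm (g x) \<le> C * norm (f x)"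
 shows "in_L2 M g"
 unfolding in_L2_def
proof (intro conjI assms(2))
 have [measurable]: "g \<in> borel_measurable M" by fact
 show "integrable M (%x. (norm (g x))^2)"
 proof (rule Bochner_Integration.integrable_bound[of M "%x. C^2 * (norm (f x))^2"])
  show "integrable M (%x. C^2 * (norm (f x))^2)" using assms(1) by (simp add: in_L2_def)
  show "AE x in M. norm ((norm (g x))^2) \<le> norm (C^2 * (norm (f x))^2)"
   using assms(3)
  proof eventually_elim
   case (elim x)
   thus ?case using power_mono[OF elim norm_ge_zero, of 2] by (simp add: power_mult_distrib)
  qed
 qed measurable
qed

lemma in_L2_add:
 assumes "in_L2 M f" "in_L2 M g"
 shows "in_L2 M (%x. f x + g x)"
 unfolding in_L2_def
proof (intro conjI)
 have [measurable]: "f \<in> borel_measurable M" "g \<in> borel_measurable M" using assms by (auto simp: in_L2_def)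
 show "(%x. f x + g x) \<in> borel_measurable M" by measurable
 show "integrable M (%x. (norm (f x + g x))^2)"
 proof (rule Bochner_Integration.integrable_bound[of M "%x. 2 * (norm (f x))^2 + 2 * (norm (g x))^2"])
  show "integrable M (%x. 2 * (norm (f x))^2 + 2 * (norm (g x))^2)" using assms by (simp add: in_L2_def)
  have "(norm (f x + g x))^2 \<le> 2 * (norm (f x))^2 + 2 * (norm (g x))^2" for x
  proof -
   have "(norm (f x + g x))^2 \<le> (norm (f x) + norm (g x))^2" by (intro power_mono norm_triangle_ineq) simp
   also have "... \<le> 2 * (norm (f x))^2 + 2 * (norm (g x))^2"
    using zero_le_power2[of "norm (f x) - norm (g x)"] by (simp add: power2_sum power2_diff)
   finally show ?thesis .
  qed
  thus "AE x in M. norm ((norm (f x + g x))^2) \<le> norm (2 * (norm (f x))^2 + 2 * (norm (g x))^2)" by auto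
 qed measurable
qed

lemma in_L2_linear:
 assumes "bounded_linear L" "in_L2 M f"
 shows "in_L2 M (%x. L (f x))"
proof -
 obtain K where K: "!!x. norm (L x) \<le> norm x * K" using assms(1) bounded_linear.bounded by blast
 have "(%x. L (f x)) \<in> borel_measurable M"
  using borel_measurable_continuous_on[OF linear_continuous_on[OF assms(1), of UNIV] in_L2_measurable[OF assms(2)]] .
 thus ?thesis
  by (rule in_L2_bound[OF assms(2), where C=K]) (use K in \<open>simp add: mult.commute\<close>)
qed

lemma in_L2_scaleR: "in_L2 M f ==> in_L2 M (%x. c *\<^sub>R f x)"
 by (rule in_L2_linear[OF bounded_linear_scaleR_right])

lemma in_L2_uminus: "in_L2 M f ==> in_L2 M (%x. - f x)"
 by (rule in_L2_linear[OF bounded_linear_minus[OF bounded_linear_ident]])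

lemma in_L2_diff: "in_L2 M f ==> in_L2 M g ==> in_L2 M (%x. f x - g x)"
 using in_L2_add[OF _ in_L2_uminus] by fastforce

lemma in_L2_zero [simp]: "in_L2 M (%x. 0)" by (simp add: in_L2_def)

lemma in_L2_cong_AE:
 assumes "in_L2 M f" "g \<in> borel_measurable M" "AE x in M. f x = g x"
 shows "in_L2 M g"
 using assms(3) by (intro in_L2_bound[OF assms(1,2), where C=1]) auto

lemma in_L2_norm: "in_L2 M f ==> in_L2 M (%x. norm (f x))"
 unfolding in_L2_def
proof
 assume f: "f \<in> borel_measurable M \<and> integrable M (%x. (norm (f x))^2)"
 hence [measurable]: "f \<in> borel_measurable M" by simp
 show "(%x. norm (f x)) \<in> borel_measurable M" by measurable
 show "integrable M (%x. (norm (norm (f x)))^2)" using f by simp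
qed

lemma in_L2_integrable:
 fixes f :: "'a => 'b::euclidean_space" and g :: "'a => 'c::euclidean_space" and B :: "'b => 'c => 'd::euclidean_space"
 assumes B: "bounded_bilinear B" and f: "in_L2 M f" and g: "in_L2 M g"
 shows "integrable M (%x. B (f x) (g x))"
proof -
 obtain K where K: "K > 0" "!!a b. norm (B a b) \<le> norm a * norm b * K"
  using bounded_bilinear.pos_bounded[OF B] by blast
 have m: "(%x. B (f x) (g x)) \<in> borel_measurable M"
 proof -
  have c: "continuous_on UNIV (%p. B (fst p) (snd p))"
   by (intro bounded_bilinear.continuous_on[OF B] continuous_intros)
  show ?thesis
   using borel_measurable_continuous_on[OF c, of "%x. (f x, g x)" M] f g
   by (simp add: in_L2_def borel_measurable_Pair)
 qed
 show ?thesis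
 proof (rule Bochner_Integration.integrable_bound[of M "%x. K * ((norm (f x))^2 + (norm (g x))^2)"])
  show "integrable M (%x. K * ((norm (f x))^2 + (norm (g x))^2))" using f g by (simp add: in_L2_def)
  have "norm (B (f x) (g x)) \<le> K * ((norm (f x))^2 + (norm (g x))^2)" for x
  proof -
   have "norm (f x) * norm (g x) \<le> (norm (f x))^2 + (norm (g x))^2"
    using zero_le_power2[of "norm (f x) - norm (g x)"] mult_nonneg_nonneg[OF norm_ge_zero[of "f x"] norm_ge_zero[of "g x"]]
    unfolding power2_diff by linarith
   hence "norm (f x) * norm (g x) * K \<le> ((norm (f x))^2 + (norm (g x))^2) * K"
    using K(1) by (intro mult_right_mono) auto
   thus ?thesis using K(2)[of "f x" "g x"] by (simp add: mult.commute)
  qed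
  thus "AE x in M. norm (B (f x) (g x)) \<le> norm (K * ((norm (f x))^2 + (norm (g x))^2))" using K(1) by auto
 qed (rule m)
qed

lemma tendsto_0_squeeze:
 fixes a b :: "nat => real"
 assumes "!!m. 0 \<le> a m" "!!m. a m \<le> b m" "b ----> 0"
 shows "a ----> 0"
 using tendsto_sandwich[of "%_. 0" a sequentially b 0] assms by simp

section \<open>The L^2 norm, the Cauchy-Schwarz inequality and limits in L^2\<close>

definition L2norm :: "'a measure => ('a => 'b::euclidean_space) => real" where
 "L2norm M f = sqrt (LINT x|M. (norm (f x))^2)"

lemma L2norm_nonneg [simp]: "0 \<le> L2norm M f" by (simp add: L2norm_def)

lemma L2norm_power2: "(L2norm M f)^2 = (LINT x|M. (norm (f x))^2)" by (simp add: L2norm_def)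

lemma L2norm_eq_0_AE:
 assumes "in_L2 M f" "L2norm M f = 0"
 shows "AE x in M. f x = 0"
proof -
 have "(LINT x|M. (norm (f x))^2) = 0" using assms(2) L2norm_power2[of M f] by simp
 hence "AE x in M. (norm (f x))^2 = 0"
  using integral_nonneg_eq_0_iff_AE[of M "%x. (norm (f x))^2"] assms(1) by (simp add: in_L2_def)
 thus ?thesis by eventually_elim simp
qed

text \<open>For norms a, b > 0 of \<open>f\<close> and \<open>g\<close> the weighted Young
  inequality u v \<le> (b / a) u^2 / 2 + (a / b) v^2 / 2 is integrated; the weights are those for
  which the right side becomes a b. If one norm vanishes, that function is zero almost
  everywhere.\<close>

lemma L2norm_Cauchy_Schwarz_norm:
 assumes "in_L2 M f" "in_L2 M g"
 shows "(LINT x|M. norm (f x) * norm (g x)) \<le> L2norm M f * L2norm M g"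
proof -
 have i: "integrable M (%x. norm (f x) * norm (g x))"
  by (rule in_L2_integrable[OF bb_mult in_L2_norm[OF assms(1)] in_L2_norm[OF assms(2)]])
 consider "L2norm M f = 0" | "L2norm M g = 0" | "L2norm M f > 0" "L2norm M g > 0"
  using L2norm_nonneg[of M f] L2norm_nonneg[of M g] by linarith
 thus ?thesis
 proof cases
  case 1
  have "AE x in M. norm (f x) * norm (g x) = 0"
   using L2norm_eq_0_AE[OF assms(1) 1] by eventually_elim simp
  hence "(LINT x|M. norm (f x) * norm (g x)) = 0" by (rule integral_eq_zero_AE)
  with 1 show ?thesis by simp
 next
  case 2
  have "AE x in M. norm (f x) * norm (g x) = 0"
   using L2norm_eq_0_AE[OF assms(2) 2] by eventually_elim simp
  hence "(LINT x|M. norm (f x) * norm (g x)) = 0" by (rule integral_eq_zero_AE)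
  with 2 show ?thesis by simp
 next
  case 3
  let ?a = "L2norm M f" let ?b = "L2norm M g"
  have "(LINT x|M. norm (f x) * norm (g x)) \<le> (LINT x|M. (?b / ?a / 2) * (norm (f x))^2 + (?a / ?b / 2) * (norm (g x))^2)"
  proof (rule integral_mono[OF i])
   show "integrable M (%x. (?b / ?a / 2) * (norm (f x))^2 + (?a / ?b / 2) * (norm (g x))^2)"
    using assms by (simp add: in_L2_def)
   fix x
   have "0 \<le> (?b * norm (f x) - ?a * norm (g x))^2 / (2 * ?a * ?b)" using 3 by simp
   also have "... = (?b / ?a / 2) * (norm (f x))^2 + (?a / ?b / 2) * (norm (g x))^2 - norm (f x) * norm (g x)"
   proof -
    have "(b * u - a * v)^2 / (2 * a * b) = (b / a / 2) * u^2 + (a / b / 2) * v^2 - u * v"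
     if "a > 0" "b > 0" for a b u v :: real
     using that by (simp add: field_simps power2_eq_square)
    thus ?thesis using 3 by blast
   qed
   finally show "norm (f x) * norm (g x) \<le> (?b / ?a / 2) * (norm (f x))^2 + (?a / ?b / 2) * (norm (g x))^2" by simp
  qed
  also have "... = (?b / ?a / 2) * ?a^2 + (?a / ?b / 2) * ?b^2"
   using assms by (simp add: in_L2_def L2norm_power2)
  also have "... = ?a * ?b" using 3 by (simp add: power2_eq_square)
  finally show ?thesis .
 qed
qed

lemma L2norm_bilinear:
 fixes f :: "'a => 'b::euclidean_space" and g :: "'a => 'c::euclidean_space" and B :: "'b => 'c => 'd::euclidean_space"
 assumes B: "bounded_bilinear B" and f: "in_L2 M f" and g: "in_L2 M g"
  and K: "K \<ge> 0" "!!a b. norm (B a b) \<le> K * (norm a * norm b)"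
 shows "norm (LINT x|M. B (f x) (g x)) \<le> K * (L2norm M f * L2norm M g)"
proof -
 have i: "integrable M (%x. norm (f x) * norm (g x))"
  by (rule in_L2_integrable[OF bb_mult in_L2_norm[OF f] in_L2_norm[OF g]])
 have "norm (LINT x|M. B (f x) (g x)) \<le> (LINT x|M. norm (B (f x) (g x)))" by (rule integral_norm_bound)
 also have "... \<le> (LINT x|M. K * (norm (f x) * norm (g x)))"
  using i K by (intro integral_mono integrable_norm in_L2_integrable[OF B f g]) auto
 also have "... \<le> K * (L2norm M f * L2norm M g)"
  using mult_left_mono[OF L2norm_Cauchy_Schwarz_norm[OF f g] K(1)] by simp
 finally show ?thesis .
qed

lemma L2norm_triangle:
 assumes f: "in_L2 M f" and g: "in_L2 M g"
 shows "L2norm M (%x. f x + g x) \<le> L2norm M f + L2norm M g"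
proof -
 have i: "integrable M (%x. norm (f x) * norm (g x))"
  by (rule in_L2_integrable[OF bb_mult in_L2_norm[OF f] in_L2_norm[OF g]])
 have "(L2norm M (%x. f x + g x))^2 = (LINT x|M. (norm (f x + g x))^2)" by (rule L2norm_power2)
 also have "... \<le> (LINT x|M. (norm (f x))^2 + 2 * (norm (f x) * norm (g x)) + (norm (g x))^2)"
 proof (rule integral_mono)
  show "integrable M (%x. (norm (f x + g x))^2)" using in_L2_add[OF f g] by (simp add: in_L2_def)
  show "integrable M (%x. (norm (f x))^2 + 2 * (norm (f x) * norm (g x)) + (norm (g x))^2)"
   using f g i by (simp add: in_L2_def)
  show "(norm (f x + g x))^2 \<le> (norm (f x))^2 + 2 * (norm (f x) * norm (g x)) + (norm (g x))^2" for x
   using power_mono[OF norm_triangle_ineq norm_ge_zero, of "f x" "g x" 2] by (simp add: power2_sum)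
 qed
 also have "... = (L2norm M f)^2 + 2 * (LINT x|M. norm (f x) * norm (g x)) + (L2norm M g)^2"
  using f g i by (simp add: in_L2_def L2norm_power2)
 also have "... \<le> (L2norm M f + L2norm M g)^2"
  using L2norm_Cauchy_Schwarz_norm[OF f g] by (simp add: power2_sum)
 finally show ?thesis by (rule power2_le_imp_le) simp
qed

lemma L2norm_mono:
 assumes "in_L2 M f" "in_L2 M g" "AE x in M. norm (g x) \<le> norm (f x)"
 shows "L2norm M g \<le> L2norm M f"
 unfolding L2norm_def
proof (rule real_sqrt_le_mono[OF integral_mono_AE])
 show "AE x in M. (norm (g x))^2 \<le> (norm (f x))^2" using assms(3) by eventually_elim simp
qed (use assms in \<open>auto simp: in_L2_def\<close>)

lemma L2norm_scaleR: "L2norm M (%x. c *\<^sub>R f x) = \<bar>c\<bar> * L2norm M f"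
 by (simp add: L2norm_def power_mult_distrib real_sqrt_mult)

lemma L2norm_minus_commute: "L2norm M (%x. f x - g x) = L2norm M (%x. g x - f x)"
 by (simp add: L2norm_def norm_minus_commute)

lemma L2_tendsto_iff:
 "L2_tendsto M F f \<longleftrightarrow> (\<forall>m. in_L2 M (F m)) \<and> in_L2 M f \<and> (%m. L2norm M (%x. F m x - f x)) ----> 0"
proof -
 have "(%m. LINT x|M. (norm (F m x - f x))^2) ----> 0 \<longleftrightarrow> (%m. L2norm M (%x. F m x - f x)) ----> 0" (is "?A \<longleftrightarrow> ?B")
 proof
  assume ?A
  from tendsto_real_sqrt[OF this] show ?B by (simp add: L2norm_def)
 next
  assume ?B
  from tendsto_power[OF this, of 2] show ?A by (simp add: L2norm_power2)
 qed
 thus ?thesis by (simp add: L2_tendsto_def)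
qed

lemma L2_tendsto_const: "in_L2 M f ==> L2_tendsto M (%_. f) f"
 by (simp add: L2_tendsto_def)

lemma L2_tendsto_add:
 assumes "L2_tendsto M F f" "L2_tendsto M G g"
 shows "L2_tendsto M (%m x. F m x + G m x) (%x. f x + g x)"
proof -
 have i: "!!m. in_L2 M (F m)" "in_L2 M f" "!!m. in_L2 M (G m)" "in_L2 M g"
  using assms by (auto simp: L2_tendsto_iff)
 have "L2norm M (%x. F m x + G m x - (f x + g x)) \<le> L2norm M (%x. F m x - f x) + L2norm M (%x. G m x - g x)" for m
  using L2norm_triangle[OF in_L2_diff[OF i(1)[of m] i(2)] in_L2_diff[OF i(3)[of m] i(4)]] by (simp add: algebra_simps)
 moreover have "(%m. L2norm M (%x. F m x - f x) + L2norm M (%x. G m x - g x)) ----> 0"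
  using assms by (intro tendsto_add_zero) (auto simp: L2_tendsto_iff)
 ultimately have "(%m. L2norm M (%x. F m x + G m x - (f x + g x))) ----> 0"
  by (rule tendsto_0_squeeze[OF L2norm_nonneg])
 thus ?thesis using i in_L2_add[OF i(1,3)] in_L2_add[OF i(2,4)] by (simp add: L2_tendsto_iff)
qed

lemma L2_tendsto_bound:
 assumes "L2_tendsto M F f" "!!m. in_L2 M (G m)" "in_L2 M g" 
  "!!m. AE x in M. norm (G m x - g x) \<le> C * norm (F m x - f x)"
 shows "L2_tendsto M G g"
proof -
 have i: "!!m. in_L2 M (F m)" "in_L2 M f" using assms(1) by (auto simp: L2_tendsto_iff)
 have "L2norm M (%x. G m x - g x) \<le> \<bar>C\<bar> * L2norm M (%x. F m x - f x)" for m
  unfolding L2norm_scaleR[of M C "%x. F m x - f x", symmetric]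
 proof (rule L2norm_mono)
  show "in_L2 M (%x. C *\<^sub>R (F m x - f x))" "in_L2 M (%x. G m x - g x)"
   using i assms(2,3) by (auto intro!: in_L2_scaleR in_L2_diff)
  show "AE x in M. norm (G m x - g x) \<le> norm (C *\<^sub>R (F m x - f x))"
   using assms(4)[of m]
  proof eventually_elim
   case (elim x)
   also have "C * norm (F m x - f x) \<le> norm (C *\<^sub>R (F m x - f x))" by (simp add: mult_right_mono)
   finally show ?case .
  qed
 qed
 moreover have "(%m. \<bar>C\<bar> * L2norm M (%x. F m x - f x)) ----> 0"
  using assms(1) by (intro tendsto_mult_right_zero) (auto simp: L2_tendsto_iff)
 ultimately have "(%m. L2norm M (%x. G m x - g x)) ----> 0"
  by (rule tendsto_0_squeeze[OF L2norm_nonneg])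
 thus ?thesis using assms by (auto simp: L2_tendsto_iff)
qed

lemma L2_tendsto_linear:
 assumes "bounded_linear L" "L2_tendsto M F f"
 shows "L2_tendsto M (%m x. L (F m x)) (%x. L (f x))"
proof -
 obtain K where K: "!!x. norm (L x) \<le> norm x * K" using assms(1) bounded_linear.bounded by blast
 show ?thesis
 proof (rule L2_tendsto_bound[OF assms(2), where C=K])
  show "AE x in M. norm (L (F m x) - L (f x)) \<le> K * norm (F m x - f x)" for m
   using K by (simp add: linear_diff[OF bounded_linear.linear[OF assms(1)], symmetric] mult.commute)
  show "in_L2 M (%x. L (F m x))" for m
   by (rule in_L2_linear[OF assms(1)]) (use assms(2) in \<open>simp add: L2_tendsto_iff\<close>)
  show "in_L2 M (%x. L (f x))"
   by (rule in_L2_linear[OF assms(1)]) (use assms(2) in \<open>simp add: L2_tendsto_iff\<close>)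
 qed
qed

text \<open>The integrand is expanded about the limits into three terms, each containing at least
  one of the increments \<open>?dF\<close>, \<open>?dG\<close>. This is the device by which the
  Green formulas pass to L^2 limits.\<close>

lemma L2_tendsto_bilinear:
 fixes f :: "'a => 'b::euclidean_space" and g :: "'a => 'c::euclidean_space" and B :: "'b => 'c => 'd::euclidean_space"
 assumes B: "bounded_bilinear B" and F: "L2_tendsto M F f" and G: "L2_tendsto M G g"
 shows "(%m. LINT x|M. B (F m x) (G m x)) ----> (LINT x|M. B (f x) (g x))"
proof -
 have i: "!!m. in_L2 M (F m)" "in_L2 M f" "!!m. in_L2 M (G m)" "in_L2 M g"
  using F G by (auto simp: L2_tendsto_iff)
 obtain K where K: "K > 0" "!!a b. norm (B a b) \<le> norm a * norm b * K"
  using bounded_bilinear.pos_bounded[OF B] by blast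
 have K': "K \<ge> 0" "!!a b. norm (B a b) \<le> K * (norm a * norm b)" using K by (auto simp: mult.commute)
 let ?dF = "%m x. F m x - f x" and ?dG = "%m x. G m x - g x"
 have dF: "in_L2 M (?dF m)" "in_L2 M (?dG m)" for m using i by (auto intro: in_L2_diff)
 have eq: "(LINT x|M. B (F m x) (G m x)) - (LINT x|M. B (f x) (g x)) =
  (LINT x|M. B (?dF m x) (?dG m x)) + (LINT x|M. B (?dF m x) (g x)) + (LINT x|M. B (f x) (?dG m x))" for m
 proof -
  have "B (F m x) (G m x) = B (f x) (g x) + (B (?dF m x) (?dG m x) + B (?dF m x) (g x) + B (f x) (?dG m x))" for x
   by (simp add: bounded_bilinear.diff_left[OF B] bounded_bilinear.diff_right[OF B])
  hence "(LINT x|M. B (F m x) (G m x)) = (LINT x|M. B (f x) (g x) + (B (?dF m x) (?dG m x) + B (?dF m x) (g x) + B (f x) (?dG m x)))"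
   by simp
  also have "... = (LINT x|M. B (f x) (g x)) + ((LINT x|M. B (?dF m x) (?dG m x)) + (LINT x|M. B (?dF m x) (g x)) + (LINT x|M. B (f x) (?dG m x)))"
   using in_L2_integrable[OF B dF(1)[of m] dF(2)[of m]] in_L2_integrable[OF B dF(1)[of m] i(4)]
    in_L2_integrable[OF B i(2) dF(2)[of m]] in_L2_integrable[OF B i(2) i(4)]
   by (simp only: LINT_add Bochner_Integration.integrable_add)
  finally show ?thesis by simp
 qed
 let ?e = "%m. K * (L2norm M (?dF m) * L2norm M (?dG m)) + K * (L2norm M (?dF m) * L2norm M g) + K * (L2norm M f * L2norm M (?dG m))"
 have le: "norm ((LINT x|M. B (F m x) (G m x)) - (LINT x|M. B (f x) (g x))) \<le> ?e m" for m
  unfolding eq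
  by (intro order_trans[OF norm_triangle_ineq] add_mono L2norm_bilinear[OF B _ _ K'] dF i)
 have "?e ----> K * (0 * 0) + K * (0 * L2norm M g) + K * (L2norm M f * 0)"
  using F G by (intro tendsto_intros) (auto simp: L2_tendsto_iff)
 hence "?e ----> 0" by simp
 hence "(%m. norm ((LINT x|M. B (F m x) (G m x)) - (LINT x|M. B (f x) (g x)))) ----> 0"
  by (rule tendsto_0_squeeze[rotated 2]) (rule norm_ge_zero le)+
 thus ?thesis using Lim_null[of "%m. LINT x|M. B (F m x) (G m x)"] tendsto_norm_zero_cancel by simp
qed

section \<open>Completeness of \<open>L^2\<close>\<close>

lemma L2norm_nn_integral:
 assumes "in_L2 M f"
 shows "(\<integral>\<^sup>+x. ennreal ((norm (f x))^2) \<partial>M) = ennreal ((L2norm M f)^2)"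
 unfolding L2norm_power2 using assms by (intro nn_integral_eq_integral) (auto simp: in_L2_def)

lemma L2norm_le_nn_integral:
 assumes "f \<in> borel_measurable M" "(\<integral>\<^sup>+x. ennreal ((norm (f x))^2) \<partial>M) \<le> ennreal (c^2)" "c \<ge> 0"
 shows "in_L2 M f" "L2norm M f \<le> c"
proof -
 have [measurable]: "f \<in> borel_measurable M" by fact
 have "integrable M (%x. (norm (f x))^2)"
  by (rule integrableI_nonneg) (use assms(2) in \<open>auto intro: le_less_trans\<close>)
 thus *: "in_L2 M f" using assms(1) by (simp add: in_L2_def)
 have "ennreal ((L2norm M f)^2) \<le> ennreal (c^2)" using assms(2) unfolding L2norm_nn_integral[OF *] .
 hence "(L2norm M f)^2 \<le> c^2" by (simp add: ennreal_le_iff)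
 thus "L2norm M f \<le> c" using assms(3) by (rule power2_le_imp_le)
qed

text \<open>Riesz-Fischer along a subsequence whose consecutive distances are below
  \<open>(1/4)^k\<close>. With the weight \<open>4^k\<close> the integrals of the squared increments
  still have a finite sum; where the weighted sum is finite, the increments are bounded by a
  multiple of \<open>(1/2)^k\<close>, hence pointwise convergence. Fatou's lemma then bounds the
  distance of the whole sequence to the limit.\<close>

lemma L2_complete:
 assumes F: "!!n. in_L2 M (F n)"
  and Cauchy: "!!e. e > 0 ==> \<exists>N. \<forall>m\<ge>N. \<forall>n\<ge>N. L2norm M (%x. F m x - F n x) < e"
 shows "\<exists>f. L2_tendsto M F f"
proof -
 have [measurable]: "F n \<in> borel_measurable M" for n using F[of n] by (simp add: in_L2_def)
 have "\<forall>k::nat. \<exists>N. \<forall>m\<ge>N. \<forall>n\<ge>N. L2norm M (%x. F m x - F n x) < (1/4)^k"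
  by (intro allI Cauchy) simp
 from choice[OF this]
 obtain N where N: "L2norm M (%x. F m x - F n x) < (1/4)^k" if "m \<ge> N k" "n \<ge> N k" for k m n by auto
 \<comment> \<open>The numbers \<open>N k\<close> need not be monotone in \<open>k\<close>; their
   partial sums dominate all earlier ones.\<close>
 define r where "r k = (\<Sum>i\<le>k. N i)" for k
 have r: "r j \<ge> N k" if "j \<ge> k" for j k
  unfolding r_def using that by (intro member_le_sum) auto
 let ?D = "%k x. F (r (Suc k)) x - F (r k) x"
 have L2D: "in_L2 M (?D k)" for k using F by (intro in_L2_diff)
 have "(\<integral>\<^sup>+x. (\<Sum>k. ennreal (4^k * (norm (?D k x))^2)) \<partial>M) = (\<Sum>k. \<integral>\<^sup>+x. ennreal (4^k * (norm (?D k x))^2) \<partial>M)"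
  by (rule nn_integral_suminf) measurable
 also have "... \<le> (\<Sum>k. ennreal ((1/4)^k))"
 proof (rule suminf_le)
  fix k
  have "(\<integral>\<^sup>+x. ennreal (4^k * (norm (?D k x))^2) \<partial>M) = (\<integral>\<^sup>+x. ennreal (4^k) * ennreal ((norm (?D k x))^2) \<partial>M)"
   by (simp add: ennreal_mult)
  also have "... = ennreal (4^k) * ennreal ((L2norm M (?D k))^2)"
   unfolding L2norm_nn_integral[OF L2D, symmetric] by (rule nn_integral_cmult) measurable
  also have "... = ennreal (4^k * (L2norm M (?D k))^2)" by (simp add: ennreal_mult)
  also have "... \<le> ennreal ((1/4)^k)"
  proof (rule ennreal_leI)
   have "(L2norm M (?D k))^2 \<le> ((1/4)^k)^2"
    using N[of k "r (Suc k)" "r k"] r[of k "Suc k"] r[of k k] by (intro power_mono) auto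
   hence "4^k * (L2norm M (?D k))^2 \<le> 4^k * ((1/4)^k)^2" by simp
   also have "... = (4 * (1/4) * (1/4))^k" by (simp only: power2_eq_square power_mult_distrib mult.assoc)
   also have "... = (1/4)^k" by simp
   finally show "4^k * (L2norm M (?D k))^2 \<le> (1/4)^k" .
  qed
  finally show "(\<integral>\<^sup>+x. ennreal (4^k * (norm (?D k x))^2) \<partial>M) \<le> ennreal ((1/4)^k)" .
 qed auto
 also have "... = ennreal (\<Sum>k. (1/4)^k)" by (rule suminf_ennreal2) (auto simp: summable_geometric)
 also have "... < \<infinity>" by simp
 finally have fin: "(\<integral>\<^sup>+x. (\<Sum>k. ennreal (4^k * (norm (?D k x))^2)) \<partial>M) < \<infinity>" .
 have "AE x in M. (\<Sum>k. ennreal (4^k * (norm (?D k x))^2)) \<noteq> \<infinity>"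
 proof (rule nn_integral_PInf_AE)
  show "(%x. \<Sum>k. ennreal (4^k * (norm (?D k x))^2)) \<in> borel_measurable M" by measurable
  show "(\<integral>\<^sup>+x. (\<Sum>k. ennreal (4^k * (norm (?D k x))^2)) \<partial>M) \<noteq> \<infinity>" using fin by auto
 qed
 hence conv: "AE x in M. convergent (%k. F (r k) x)"
 proof eventually_elim
  case (elim x)
  define S where "S = (\<Sum>k. ennreal (4^k * (norm (?D k x))^2))"
  have "S \<noteq> \<infinity>" using elim unfolding S_def .
  then obtain H where SH: "S = ennreal H" "H \<ge> 0" by (cases S) auto
  have H: "(\<Sum>k. ennreal (4^k * (norm (?D k x))^2)) = ennreal H" "H \<ge> 0"
   using SH unfolding S_def by this
  have b: "norm (?D k x) \<le> sqrt H * (1/2)^k" for k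
  proof -
   define a where "a k = ennreal (4^k * (norm (?D k x))^2)" for k
   have "summable a" by simp
   from sum_le_suminf[OF this, of "{k}"] have "a k \<le> (\<Sum>k. a k)" by simp
   hence "ennreal (4^k * (norm (?D k x))^2) \<le> ennreal H" unfolding a_def H(1) .
   hence "4^k * (norm (?D k x))^2 \<le> H" using H(2) by (simp add: ennreal_le_iff)
   hence "(norm (?D k x))^2 \<le> H * (1/4)^k" by (simp add: power_one_over field_simps)
   also have "(1/4 :: real)^k = ((1/2)^k)^2" by (simp add: power2_eq_square flip: power_mult_distrib)
   also have "H * ... = (sqrt H * (1/2)^k)^2" using H(2) by (simp add: power_mult_distrib)
   finally show ?thesis by (rule power2_le_imp_le) (use H in simp)
  qed
  have "summable (%k. ?D k x)"
   by (rule summable_comparison_test'[where g="%k. sqrt H * (1/2)^k" and N=0])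
    (use b in \<open>auto intro!: summable_mult summable_geometric\<close>)
  hence "(%n. \<Sum>k<n. ?D k x) ----> (\<Sum>k. ?D k x)" by (rule summable_LIMSEQ)
  moreover have "(\<Sum>k<n. ?D k x) = F (r n) x - F (r 0) x" for n by (rule sum_lessThan_telescope)
  ultimately have "(%n. F (r n) x - F (r 0) x + F (r 0) x) ----> (\<Sum>k. ?D k x) + F (r 0) x"
   by (intro tendsto_add tendsto_const) simp
  thus ?case by (auto simp: convergent_def)
 qed
 define f where "f x = lim (%k. F (r k) x)" for x
 have f[measurable]: "f \<in> borel_measurable M" unfolding f_def[abs_def] by (rule borel_measurable_lim_metric) measurable
 have lim: "AE x in M. (%k. F (r k) x) ----> f x"
  using conv unfolding f_def by eventually_elim (simp add: convergent_LIMSEQ_iff)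
 have le: "in_L2 M (%x. F n x - f x) \<and> L2norm M (%x. F n x - f x) \<le> (1/4)^k" if n: "n \<ge> N k" for n k
 proof -
  have "(\<integral>\<^sup>+x. ennreal ((norm (F n x - f x))^2) \<partial>M) \<le> (\<integral>\<^sup>+x. liminf (%j. ennreal ((norm (F n x - F (r j) x))^2)) \<partial>M)"
  proof (rule nn_integral_mono_AE)
   show "AE x in M. ennreal ((norm (F n x - f x))^2) \<le> liminf (%j. ennreal ((norm (F n x - F (r j) x))^2))"
    using lim
   proof eventually_elim
    case (elim x)
    have "(%j. ennreal ((norm (F n x - F (r j) x))^2)) ----> ennreal ((norm (F n x - f x))^2)"
     by (intro tendsto_ennrealI tendsto_intros elim)
    thus ?case by (subst lim_imp_Liminf[OF sequentially_bot]) auto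
   qed
  qed
  also have "... \<le> liminf (%j. \<integral>\<^sup>+x. ennreal ((norm (F n x - F (r j) x))^2) \<partial>M)"
   by (rule nn_integral_liminf) measurable
  also have "... \<le> ennreal (((1/4)^k)^2)"
  proof (rule Liminf_le)
   show "\<forall>\<^sub>F j in sequentially. (\<integral>\<^sup>+x. ennreal ((norm (F n x - F (r j) x))^2) \<partial>M) \<le> ennreal (((1/4)^k)^2)"
    using eventually_ge_at_top[of k]
   proof eventually_elim
    case (elim j)
    have "L2norm M (%x. F n x - F (r j) x) < (1/4)^k" using N[OF n r[OF elim]] .
    thus ?case unfolding L2norm_nn_integral[OF in_L2_diff[OF F F]]
     by (intro ennreal_leI power_mono) auto
   qed
  qed simp
  finally show ?thesis using L2norm_le_nn_integral[of "%x. F n x - f x" M "(1/4)^k"] by simp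
 qed
 have "in_L2 M (%x. F (N 0) x - (F (N 0) x - f x))"
  by (rule in_L2_diff[OF F]) (use le in blast)
 hence f2: "in_L2 M f" by simp
 have "(%n. L2norm M (%x. F n x - f x)) ----> 0"
 proof (rule LIMSEQ_I)
  fix e :: real assume e: "e > 0"
  obtain k where k: "(1/4)^k < e" using real_arch_pow_inv[OF e, of "1/4"] by auto
  have "norm (L2norm M (%x. F n x - f x) - 0) < e" if "n \<ge> N k" for n
   using le[OF that] k by simp
  thus "\<exists>no. \<forall>n\<ge>no. norm (L2norm M (%x. F n x - f x) - 0) < e" by blast
 qed
 thus ?thesis using F f2 by (auto simp: L2_tendsto_iff)
qed

section \<open>Coercive problems on subspaces of \<open>L^2\<close>\<close>

lemma L2_inner_le: "in_L2 M f ==> in_L2 M g ==> \<bar>LINT x|M. f x \<bullet> g x\<bar> \<le> L2norm M f * L2norm M g"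
 using L2norm_bilinear[OF bounded_bilinear_inner, of M f g 1] by (simp add: Cauchy_Schwarz_ineq2)

lemma L2_inner_integrable: "in_L2 M f ==> in_L2 M g ==> integrable M (%x. f x \<bullet> g x)"
 by (rule in_L2_integrable[OF bounded_bilinear_inner])

lemma L2_inner_diff:
 assumes "in_L2 M f" "in_L2 M g" "in_L2 M h"
 shows "(LINT x|M. (f x - c *\<^sub>R g x) \<bullet> h x) = (LINT x|M. f x \<bullet> h x) - c * (LINT x|M. g x \<bullet> h x)"
 using L2_inner_integrable[OF assms(1,3)] L2_inner_integrable[OF assms(2,3)] by (simp add: inner_diff_left)

lemma L2norm_diff_power2:
 assumes "in_L2 M f" "in_L2 M g"
 shows "(L2norm M (%x. f x - c *\<^sub>R g x))^2 = (L2norm M f)^2 - 2 * c * (LINT x|M. f x \<bullet> g x) + c^2 * (L2norm M g)^2"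
proof -
 have "(norm (a - c *\<^sub>R b))^2 = (norm a)^2 - 2 * c * (a \<bullet> b) + c^2 * (norm b)^2" for a b :: 'b
  unfolding power2_norm_eq_inner by (simp add: inner_diff_left inner_diff_right inner_commute power2_eq_square algebra_simps)
 thus ?thesis
  unfolding L2norm_power2 using assms L2_inner_integrable[OF assms] by (simp add: in_L2_def)
qed

text \<open>The subspace need not be closed, so the distance from \<open>h\<close> may have no
  minimiser. A point within \<open>e^2\<close> of the infimum of the squared distance is enough:
  moving it along \<open>v\<close> by the optimal amount lowers the squared distance by
  \<open>I^2 / (L2norm M v)^2\<close>, which must therefore stay below \<open>e^2\<close>.\<close>

lemma L2_near_projection:
 assumes S: "(%x. 0) \<in> S" "!!p. p \<in> S ==> in_L2 M p" "!!p v c. p \<in> S ==> v \<in> S ==> (%x. p x - c *\<^sub>R v x) \<in> S"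
  and h: "in_L2 M h" and e: "e > 0"
 shows "\<exists>p\<in>S. \<forall>v\<in>S. \<bar>LINT x|M. (h x - p x) \<bullet> v x\<bar> \<le> e * L2norm M v"
proof -
 let ?n = "%p. (L2norm M (%x. h x - p x))^2"
 have bb: "bdd_below (?n ` S)" by (intro bdd_belowI[of _ 0]) auto
 have "Inf (?n ` S) < Inf (?n ` S) + e^2" using e by simp
 then obtain p where p: "p \<in> S" "?n p < Inf (?n ` S) + e^2"
  using S(1) by (subst (asm) cInf_less_iff) (auto intro: bb)
 have "\<bar>LINT x|M. (h x - p x) \<bullet> v x\<bar> \<le> e * L2norm M v" if v: "v \<in> S" for v
 proof (cases "L2norm M v = 0")
  case True
  thus ?thesis using L2_inner_le[OF in_L2_diff[OF h S(2)[OF p(1)]] S(2)[OF v]] by simp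
 next
  case False
  define I where "I = (LINT x|M. (h x - p x) \<bullet> v x)"
  define c where "c = I / (L2norm M v)^2"
  have "(%x. p x - (- c) *\<^sub>R v x) \<in> S" by (rule S(3)[OF p(1) v])
  hence "?n p < ?n (%x. p x - (- c) *\<^sub>R v x) + e^2" using p(2) cInf_lower[OF imageI bb] by fastforce
  also have "?n (%x. p x - (- c) *\<^sub>R v x) = (L2norm M (%x. (h x - p x) - c *\<^sub>R v x))^2" by (simp add: algebra_simps)
  also have "... = ?n p - 2 * c * I + c^2 * (L2norm M v)^2"
   unfolding I_def by (rule L2norm_diff_power2[OF in_L2_diff[OF h S(2)[OF p(1)]] S(2)[OF v]])
  also have "... = ?n p - I^2 / (L2norm M v)^2" using False by (simp add: c_def power2_eq_square)
  finally have "I^2 < (e * L2norm M v)^2" using False by (simp add: field_simps)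
  hence "\<bar>I\<bar> \<le> \<bar>e * L2norm M v\<bar>" by (simp only: abs_le_square_iff less_imp_le)
  thus ?thesis using e by (simp add: I_def)
 qed
 thus ?thesis using p(1) by blast
qed

text \<open>The Lax--Milgram iteration \<open>\<phi> - \<kappa> p\<close>, where \<open>p\<close> is an approximate projection of \<open>T (u0 + \<phi>)\<close> onto
 the subspace, stays inside the subspace, so that its closure is not needed.\<close>

lemma coercive_variational_solution:
 fixes T :: "('a => 'b::euclidean_space) => 'a => 'b"
 assumes S: "(%x. 0) \<in> S" "!!p. p \<in> S ==> in_L2 M p" "!!p v c. p \<in> S ==> v \<in> S ==> (%x. p x - c *\<^sub>R v x) \<in> S"
  and T: "!!f. in_L2 M f ==> in_L2 M (T f)" "!!f g c. T (%x. f x - c *\<^sub>R g x) = (%x. T f x - c *\<^sub>R T g x)"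
  and bnd: "!!f. in_L2 M f ==> L2norm M (T f) \<le> C * L2norm M f"
  and coer: "!!f. in_L2 M f ==> c * (L2norm M f)^2 \<le> (LINT x|M. T f x \<bullet> f x)" and c: "0 < c" "c < C"
  and u0: "in_L2 M u0"
 shows "\<exists>F w. (\<forall>k. F k \<in> S) \<and> L2_tendsto M F w \<and> (\<forall>v\<in>S. (LINT x|M. T (%x. u0 x + w x) x \<bullet> v x) = 0)"
proof -
 \<comment> \<open>The step length c / C^2 minimises 1 - 2 \<kappa> c + \<kappa>^2 C^2, and the
   minimum 1 - (c / C)^2 is \<open>q^2\<close>, the square of the contraction factor in
   \<open>contr\<close>. The midpoint \<open>s\<close> of \<open>q\<close> and 1 is the rate of the
   projection tolerances \<open>s^k\<close>: summable, yet slower than \<open>q^k\<close>.\<close>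
 define ka where "ka = c / C^2"
 define q where "q = sqrt (1 - (c / C)^2)"
 define s where "s = (1 + q) / 2"
 have C: "C > 0" and ka: "ka > 0" using c by (auto simp: ka_def)
 have "(c / C)^2 < 1" using c C by (simp add: power_divide power_strict_mono)
 moreover have "0 < (c / C)^2" using c C by simp
 ultimately have q: "0 \<le> q" "q < 1" "q^2 = 1 - (c / C)^2" by (simp_all add: q_def)
 hence s: "0 < s" "s < 1" "q < s" by (auto simp: s_def)
 define P where "P k h = (SOME p. p \<in> S \<and> (\<forall>v\<in>S. \<bar>LINT x|M. (h x - p x) \<bullet> v x\<bar> \<le> s^k * L2norm M v))" for k h
 have P: "P k h \<in> S \<and> (\<forall>v\<in>S. \<bar>LINT x|M. (h x - P k h x) \<bullet> v x\<bar> \<le> s^k * L2norm M v)" if "in_L2 M h" for k h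
 proof -
  have "\<exists>p\<in>S. \<forall>v\<in>S. \<bar>LINT x|M. (h x - p x) \<bullet> v x\<bar> \<le> s^k * L2norm M v"
   by (rule L2_near_projection[OF S that zero_less_power[OF s(1)]])
  thus ?thesis unfolding P_def Bex_def by (rule someI_ex)
 qed
 define F where "F = rec_nat (%x. 0) (%k f x. f x - ka *\<^sub>R P k (T (%x. u0 x + f x)) x)"
 define h where "h k = T (%x. u0 x + F k x)" for k
 define p where "p k = P k (h k)" for k
 have F0: "F 0 = (%x. 0)" and FS: "F (Suc k) = (%x. F k x - ka *\<^sub>R p k x)" for k by (simp_all add: F_def p_def h_def)
 have h2': "in_L2 M (h k)" if "F k \<in> S" for k unfolding h_def by (intro T in_L2_add u0 S(2) that)
 have FIn: "F k \<in> S" for k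
 proof (induction k)
  case (Suc k)
  thus ?case unfolding FS p_def by (intro S(3) conjunct1[OF P[OF h2']])
 qed (simp add: F0 S(1))
 note h2 = h2'[OF FIn]
 have p: "p k \<in> S" "v \<in> S ==> \<bar>LINT x|M. (h k x - p k x) \<bullet> v x\<bar> \<le> s^k * L2norm M v" for k v
  unfolding p_def using P[OF h2[of k], of k] by blast+
 note p2 = S(2)[OF p(1)] and F2 = S(2)[OF FIn]
 have hS: "h (Suc k) = (%x. h k x - ka *\<^sub>R T (p k) x)" for k
  unfolding h_def T(2)[symmetric] FS by (simp add: algebra_simps)
 hence hSx: "h k x - ka *\<^sub>R T (p k) x = h (Suc k) x" for k x by simp
 have contr: "L2norm M (%x. f x - ka *\<^sub>R T f x) \<le> q * L2norm M f" if f: "in_L2 M f" for f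
 proof -
  have "(L2norm M (%x. f x - ka *\<^sub>R T f x))^2 = (L2norm M f)^2 - 2 * ka * (LINT x|M. T f x \<bullet> f x) + ka^2 * (L2norm M (T f))^2"
   unfolding L2norm_diff_power2[OF f T(1)[OF f]] by (simp add: inner_commute)
  also have "... \<le> (L2norm M f)^2 - 2 * ka * (c * (L2norm M f)^2) + ka^2 * (C * L2norm M f)^2"
   using coer[OF f] ka bnd[OF f] by (intro add_mono diff_mono mult_left_mono power_mono) auto
  also have "... = (q * L2norm M f)^2"
   unfolding power_mult_distrib q(3) ka_def using C by (simp add: power2_eq_square field_simps)
  finally show ?thesis by (rule power2_le_imp_le) (use q in simp)
 qed
 \<comment> \<open>The new residual is tested against itself. Up to the two projection tolerances,
   of order \<open>s^k\<close> and \<open>s^Suc k\<close>, it is the contracted old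
   residual.\<close>
 have step: "L2norm M (p (Suc k)) \<le> q * L2norm M (p k) + 2 * s^k" for k
 proof (cases "L2norm M (p (Suc k)) = 0")
  case False
  let ?v = "p (Suc k)" let ?n = "L2norm M ?v"
  have "?n^2 = (LINT x|M. ?v x \<bullet> ?v x)" by (simp add: L2norm_power2 dot_square_norm)
  also have "... = (LINT x|M. (h k x - p k x) \<bullet> ?v x) + (LINT x|M. (p k x - ka *\<^sub>R T (p k) x) \<bullet> ?v x) - (LINT x|M. (h (Suc k) x - ?v x) \<bullet> ?v x)"
   using L2_inner_diff[OF h2[of k] p2[of k] p2[of "Suc k"], of 1] L2_inner_diff[OF p2[of k] T(1)[OF p2[of k]] p2[of "Suc k"], of ka]
    L2_inner_diff[OF h2[of "Suc k"] p2[of "Suc k"] p2[of "Suc k"], of 1] L2_inner_diff[OF h2[of k] T(1)[OF p2[of k]] p2[of "Suc k"], of ka]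
   unfolding hSx scaleR_one mult_1 by linarith
  also have "... \<le> s^k * ?n + (q * L2norm M (p k)) * ?n + s^Suc k * ?n"
   using p(2)[OF p(1), of k "Suc k"] p(2)[OF p(1), of "Suc k" "Suc k"]
    order_trans[OF L2_inner_le[OF in_L2_diff[OF p2[of k] in_L2_scaleR[OF T(1)[OF p2[of k]], of ka]] p2[of "Suc k"]] mult_right_mono[OF contr[OF p2[of k]] L2norm_nonneg]]
   by (simp add: abs_le_iff)
  finally have "?n * ?n \<le> (q * L2norm M (p k) + s^k + s^Suc k) * ?n" by (simp add: power2_eq_square algebra_simps)
  hence "?n \<le> q * L2norm M (p k) + s^k + s^Suc k" using False by (simp add: less_le)
  moreover have "s^Suc k \<le> s^k" using s by simp
  ultimately show ?thesis by linarith
 qed (use q s in simp)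
 \<comment> \<open>Chosen so that D q + 2 \<le> D s; then the bound \<open>D * s^k\<close>
   reproduces itself in the recursion \<open>step\<close>.\<close>
 define D where "D = L2norm M (p 0) + 2 / (s - q)"
 have "2 / (s - q) * (s - q) = 2" using s(3) nonzero_eq_divide_eq[of "s - q" "2 / (s - q)" 2] by simp
 moreover have "0 \<le> L2norm M (p 0) * (s - q)" using s(3) by simp
 ultimately have D: "D * (s - q) \<ge> 2" unfolding D_def distrib_right by linarith
 have pk: "L2norm M (p k) \<le> D * s^k" for k
 proof (induction k)
  case (Suc k)
  have "L2norm M (p (Suc k)) \<le> q * (D * s^k) + 2 * s^k" using step[of k] mult_left_mono[OF Suc q(1)] by linarith
  also have "... \<le> q * (D * s^k) + D * (s - q) * s^k" using D s by (intro add_left_mono mult_right_mono) auto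
  finally show ?case by (simp add: algebra_simps)
 qed (use s in \<open>simp add: D_def\<close>)
 \<comment> \<open>The constant of the geometric tail: with ka D = B (1 - s) the bounds of the
   increments telescope.\<close>
 define B where "B = ka * D / (1 - s)"
 have B: "ka * D = B * (1 - s)" "B \<ge> 0" using s ka by (auto simp: B_def D_def)
 have diff: "L2norm M (%x. F (n + j) x - F n x) \<le> B * s^n - B * s^(n + j)" for n j
 proof (induction j)
  case (Suc j)
  have "L2norm M (%x. F (n + Suc j) x - F n x) = L2norm M (%x. (F (n + j) x - F n x) + (- ka) *\<^sub>R p (n + j) x)"
   by (simp add: FS algebra_simps)
  also have "... \<le> L2norm M (%x. F (n + j) x - F n x) + ka * L2norm M (p (n + j))"
   using L2norm_triangle[OF in_L2_diff[OF F2[of "n + j"] F2[of n]] in_L2_scaleR[OF p2[of "n + j"], of "- ka"]] ka unfolding L2norm_scaleR by simp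
  also have "... \<le> (B * s^n - B * s^(n + j)) + ka * (D * s^(n + j))" using Suc pk[of "n + j"] ka by (intro add_mono mult_left_mono) auto
  also have "ka * (D * s^(n + j)) = B * (1 - s) * s^(n + j)" unfolding B(1)[symmetric] by simp
  finally show ?case by (simp add: algebra_simps)
 qed (simp add: L2norm_def)
 have "\<exists>N. \<forall>m\<ge>N. \<forall>n\<ge>N. L2norm M (%x. F m x - F n x) < e" if e: "e > 0" for e
 proof -
  have sz: "(%n. B * s^n) ----> 0" using LIMSEQ_power_zero[of s] s tendsto_mult_right_zero by force
  obtain N where N: "!!n. n \<ge> N ==> B * s^n < e" using order_tendstoD(2)[OF sz e] by (auto simp: eventually_sequentially)
  have 1: "L2norm M (%x. F m x - F n x) < e" if "n \<ge> N" "m \<ge> n" for m n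
  proof -
   have "0 \<le> B * s^m" using B(2) s by simp
   thus ?thesis using diff[of n "m - n"] N[OF that(1)] unfolding le_add_diff_inverse[OF that(2)] by linarith
  qed
  have "L2norm M (%x. F m x - F n x) < e" if "n \<ge> N" "m \<ge> N" for m n
   using 1[of n m] 1[of m n] that L2norm_minus_commute[of M "F m" "F n"] by (cases "m \<ge> n") auto
  thus ?thesis by blast
 qed
 from L2_complete[OF F2 this] obtain w where w: "L2_tendsto M F w" by blast
 hence w2: "in_L2 M w" and wl: "(%k. L2norm M (%x. w x - F k x)) ----> 0"
  by (auto simp: L2_tendsto_iff L2norm_minus_commute[of M w])
 have "(LINT x|M. T (%x. u0 x + w x) x \<bullet> v x) = 0" if v: "v \<in> S" for v
 proof -
  let ?I = "LINT x|M. T (%x. u0 x + w x) x \<bullet> v x" let ?n = "L2norm M v"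
  \<comment> \<open>Three contributions, all tending to zero: the tolerance of the projection, the
    residual \<open>p k\<close>, and the distance of \<open>F k\<close> from the limit.\<close>
  have b: "\<bar>?I\<bar> \<le> ((1 + D) * s^k + C * L2norm M (%x. w x - F k x)) * ?n" for k
  proof -
   have "T (%x. u0 x + w x) = (%x. h k x - (-1) *\<^sub>R T (%x. w x - F k x) x)"
    unfolding h_def T(2)[symmetric] by simp
   hence "?I = (LINT x|M. h k x \<bullet> v x) + (LINT x|M. T (%x. w x - F k x) x \<bullet> v x)"
    using L2_inner_diff[OF h2[of k] T(1)[OF in_L2_diff[OF w2 F2[of k]]] S(2)[OF v], of "-1"] by simp
   moreover have "(LINT x|M. h k x \<bullet> v x) = (LINT x|M. (h k x - p k x) \<bullet> v x) + (LINT x|M. p k x \<bullet> v x)"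
    using L2_inner_diff[OF h2[of k] p2[of k] S(2)[OF v], of 1] by simp
   moreover have "\<bar>LINT x|M. p k x \<bullet> v x\<bar> \<le> D * s^k * ?n"
    by (rule order_trans[OF L2_inner_le[OF p2 S(2)[OF v]] mult_right_mono[OF pk L2norm_nonneg]])
   moreover have "\<bar>LINT x|M. T (%x. w x - F k x) x \<bullet> v x\<bar> \<le> C * L2norm M (%x. w x - F k x) * ?n"
    by (rule order_trans[OF L2_inner_le[OF T(1)[OF in_L2_diff[OF w2 F2]] S(2)[OF v]] mult_right_mono[OF bnd[OF in_L2_diff[OF w2 F2]] L2norm_nonneg]])
   ultimately show ?thesis using p(2)[OF v, of k] by (simp add: algebra_simps)
  qed
  have "(%k. ((1 + D) * s^k + C * L2norm M (%x. w x - F k x)) * ?n) ----> ((1 + D) * 0 + C * 0) * ?n"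
   using s by (intro tendsto_intros wl LIMSEQ_power_zero) simp
  hence "\<bar>?I\<bar> \<le> 0" using LIMSEQ_le_const[of _ 0 "\<bar>?I\<bar>"] b by fastforce
  thus ?thesis by simp
 qed
 thus ?thesis using FIn w by blast
qed

section \<open>Approximate identities\<close>

lemma cvanish_in_L2:
 assumes "continuous_on UNIV (f :: 'a::euclidean_space => 'b::euclidean_space)" "!!x. norm x > R ==> f x = 0"
 shows "in_L2 lebesgue f"
 unfolding in_L2_def
 by (intro conjI continuous_measurable_lebesgue cvanish_integrable_leb[where R=R] continuous_on_power continuous_on_norm)
  (simp_all add: assms)

text \<open>Truncation in space and in size leaves a bounded function with bounded support, which is
  the limit almost everywhere of continuous functions. These are composed with the retraction
  \<open>tr\<close> onto the ball of radius \<open>M\<close> and multiplied by the plateau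
  \<open>cu\<close>; neither operation changes the truncated function, and together they supply the
  majorant for dominated convergence.\<close>

lemma L2_approx_continuous:
 fixes f :: "'a::euclidean_space => 'b::euclidean_space"
 assumes f: "in_L2 lebesgue f" and e: "e > 0"
 shows "\<exists>g R. continuous_on UNIV g \<and> (\<forall>x. norm x > R --> g x = 0) \<and> L2norm lebesgue (%x. f x - g x) < e"
proof -
 have [measurable]: "f \<in> borel_measurable lebesgue" using f by (simp add: in_L2_def)
 have id[measurable]: "(%x::'a. x) \<in> borel_measurable lebesgue" by (simp add: continuous_measurable_lebesgue)
 define F where "F n x = (if norm x \<le> real n \<and> norm (f x) \<le> real n then f x else 0)" for n :: nat and x
 have Fm: "F n \<in> borel_measurable lebesgue" for n unfolding F_def[abs_def] by measurable
 have F2: "in_L2 lebesgue (F n)" for n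
  by (rule in_L2_bound[OF f Fm, where C=1]) (auto simp: F_def)
 have "(%n. LINT x|lebesgue. (norm (F n x - f x))^2) ----> (LINT x::'a|lebesgue. (0::real))"
 proof (rule integral_dominated_convergence[where w="%x. (norm (f x))^2"])
  show "integrable lebesgue (%x. (norm (f x))^2)" using f by (simp add: in_L2_def)
  show "(%x. (norm (F n x - f x))^2) \<in> borel_measurable lebesgue" for n using Fm[of n] by measurable
  show "AE x in lebesgue. (%n. (norm (F n x - f x))^2) ----> 0"
  proof (rule AE_I2)
   fix x
   obtain N :: nat where N: "real N \<ge> max (norm x) (norm (f x))" using real_arch_simple by blast
   have "\<forall>\<^sub>F n in sequentially. (norm (F n x - f x))^2 = 0"
    using eventually_ge_at_top[of N] by eventually_elim (use N in \<open>auto simp: F_def\<close>)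
   thus "(%n. (norm (F n x - f x))^2) ----> 0" by (rule tendsto_eventually)
  qed
  show "AE x in lebesgue. norm ((norm (F n x - f x))^2) \<le> (norm (f x))^2" for n
   by (rule AE_I2) (simp add: F_def)
 qed simp
 hence "L2_tendsto lebesgue F f" using F2 f by (simp add: L2_tendsto_def)
 hence "(%n. L2norm lebesgue (%x. F n x - f x)) ----> 0" by (simp add: L2_tendsto_iff)
 from LIMSEQ_D[OF this, of "e/2"] e obtain N where N: "L2norm lebesgue (%x. F N x - f x) < e/2" by auto
 have "F N measurable_on UNIV" by (rule lebesgue_measurable_imp_measurable_on[OF Fm]) simp
 then obtain Z g where Z: "negligible Z" "!!n. continuous_on UNIV (g n)" "!!x. x \<notin> Z ==> (%n. g n x) ----> F N x"
  unfolding measurable_on_def by auto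
 \<comment> \<open>The extra 1 leaves room for \<open>cu\<close> to descend from 1 at radius
   \<open>N\<close> to 0 at radius \<open>M\<close>.\<close>
 define M where "M = real N + 1"
 have M: "M > 0" by (simp add: M_def)
 define tr where "tr v = (M / max M (norm v)) *\<^sub>R v" for v :: 'b
 define cu where "cu x = max 0 (min 1 (M - norm x))" for x :: 'a
 have ctr: "isCont tr v" for v unfolding tr_def[abs_def] using M by (intro continuous_intros) auto
 have ccu: "continuous_on UNIV cu" unfolding cu_def[abs_def] by (intro continuous_intros)
 have trb: "norm (tr v) \<le> M" for v
  using M by (cases "norm v \<le> M") (auto simp: tr_def max_def field_simps)
 have cub: "0 \<le> cu x" "cu x \<le> 1" for x by (auto simp: cu_def)
 define h where "h n x = cu x *\<^sub>R tr (g n x)" for n x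
 have hc: "continuous_on UNIV (h n)" for n
  unfolding h_def[abs_def]
  using continuous_on_compose2[of UNIV tr UNIV "g n"] ctr Z(2) ccu
  by (intro continuous_intros) (auto simp: continuous_at_imp_continuous_on)
 have hz: "h n x = 0" if "norm x > M" for n x using that by (simp add: h_def cu_def)
 have hb: "norm (h n x) \<le> M * indicator (cball 0 M) x" for n x
 proof (cases "norm x \<le> M")
  case True
  thus ?thesis using mult_mono[OF cub(2)[of x] trb[of "g n x"]] cub(1)[of x] by (simp add: h_def)
 qed (simp add: hz)
 have FN: "cu x *\<^sub>R tr (F N x) = F N x" for x
 proof (cases "norm x \<le> real N \<and> norm (f x) \<le> real N")
  case True
  thus ?thesis by (simp add: F_def cu_def tr_def M_def max_def)
 next
  case False
  thus ?thesis by (auto simp: F_def tr_def)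
 qed
 have FNb: "norm (F N x) \<le> M * indicator (cball 0 M) x" for x
  by (auto simp: F_def M_def indicator_def)
 have h2: "in_L2 lebesgue (h n)" for n
by (rule cvanish_in_L2[OF hc hz])
 have "(%n. LINT x|lebesgue. (norm (h n x - F N x))^2) ----> (LINT x::'a|lebesgue. (0::real))"
 proof (rule integral_dominated_convergence[where w="%x. (2 * M)^2 * indicator (cball 0 M) x"])
  have "emeasure lebesgue (cball (0::'a) M) < \<infinity>" using emeasure_lborel_cball_finite[of "0::'a" M] by simp
  thus "integrable lebesgue (%x::'a. (2 * M)^2 * indicator (cball 0 M) x :: real)"
   by (intro integrable_mult_right integrable_real_indicator) auto
  show "(%x. (norm (h n x - F N x))^2) \<in> borel_measurable lebesgue" for n
   using in_L2_diff[OF h2 F2, of n N] by (simp add: in_L2_def borel_measurable_integrable)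
  have "AE x in lebesgue. x \<notin> Z" using Z(1) by (metis AE_not_in negligible_iff_null_sets)
  thus "AE x in lebesgue. (%n. (norm (h n x - F N x))^2) ----> 0"
  proof eventually_elim
   case (elim x)
   have "(%n. cu x *\<^sub>R tr (g n x)) ----> cu x *\<^sub>R tr (F N x)"
    by (intro tendsto_scaleR tendsto_const isCont_tendsto_compose[OF ctr] Z(3) elim)
   hence "(%n. h n x) ----> F N x" by (simp add: FN h_def)
   hence "(%n. (norm (h n x - F N x))^2) ----> (norm (F N x - F N x))^2" by (intro tendsto_intros)
   thus ?case by simp
  qed
  show "AE x in lebesgue. norm ((norm (h n x - F N x))^2) \<le> (2 * M)^2 * indicator (cball 0 M) x" for n
  proof (rule AE_I2)
   fix x
   have "norm (h n x - F N x) \<le> 2 * M * indicator (cball 0 M) x"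
    using norm_triangle_ineq4[of "h n x" "F N x"] hb[of n x] FNb[of x] by linarith
   hence "(norm (h n x - F N x))^2 \<le> (2 * M * indicator (cball 0 M) x)^2" by (intro power_mono) auto
   thus "norm ((norm (h n x - F N x))^2) \<le> (2 * M)^2 * indicator (cball 0 M) x"
    by (auto simp: indicator_def split: if_splits)
  qed
 qed simp
 hence "L2_tendsto lebesgue h (F N)" using h2 F2 by (simp add: L2_tendsto_def)
 hence "(%n. L2norm lebesgue (%x. h n x - F N x)) ----> 0" by (simp add: L2_tendsto_iff)
 from LIMSEQ_D[OF this, of "e/2"] e obtain n where n: "L2norm lebesgue (%x. h n x - F N x) < e/2" by auto
 have "L2norm lebesgue (%x. f x - h n x) = L2norm lebesgue (%x. (h n x - F N x) + (F N x - f x))"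
  by (subst L2norm_minus_commute) simp
 also have "... \<le> L2norm lebesgue (%x. h n x - F N x) + L2norm lebesgue (%x. F N x - f x)"
  by (intro L2norm_triangle in_L2_diff h2 F2 f)
 also have "... < e" using N n by simp
 finally show ?thesis using hc[of n] hz[of _ n] by blast
qed

text \<open>Young's inequality: Cauchy-Schwarz with the kernel split into two square roots, then
  Tonelli, which integrates the kernel out in either variable. Tonelli is applied to Borel
  functions, hence the Borel representative \<open>G\<close> of the norm of
  \<open>f\<close>.\<close>

lemma conv_L2norm_le:
 fixes f :: "real^'n::finite => 'b::euclidean_space"
 assumes k: "continuous_on UNIV k" "!!x. norm x > R ==> k x = 0"
  and f: "integrable lebesgue f" "in_L2 lebesgue f"
 shows "in_L2 lebesgue (conv k f)" "L2norm lebesgue (conv k f) \<le> (LINT z|lborel. \<bar>k z\<bar>) * L2norm lebesgue f"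
proof -
 define K where "K = (LINT z|lborel. \<bar>k z\<bar>)"
 have K0: "K \<ge> 0" by (simp add: K_def)
 have km[measurable]: "k \<in> borel_measurable borel" by (rule cont_measurable[OF k(1)])
 have "integrable lborel (%z. \<bar>k z\<bar>)"
  by (rule cvanish_integrable[where R=R]) (use k in \<open>auto intro: continuous_intros\<close>)
 hence K: "(\<integral>\<^sup>+z. ennreal \<bar>k z\<bar> \<partial>lborel) = ennreal K" unfolding K_def by (rule nn_integral_eq_integral) simp
 have cc: "continuous_on UNIV (conv k f)" using C_diff_conv[of f 0 k R, OF f(1) _ k(2)] k by simp
 hence [measurable]: "conv k f \<in> borel_measurable borel" by (rule cont_measurable)
 have "(%z. ennreal (norm (f z))) \<in> borel_measurable (completion lborel)" using in_L2_measurable[OF f(2)] by measurable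
 then obtain G where G[measurable]: "G \<in> borel_measurable lborel" and Gf: "AE z in lborel. ennreal (norm (f z)) = G z"
  using completion_ex_borel_measurable by blast
 let ?k = "%x z. ennreal \<bar>k (x - z)\<bar>"
 have kK: "(\<integral>\<^sup>+z. ?k x z \<partial>lborel) = ennreal K" "(\<integral>\<^sup>+x. ?k x z \<partial>lborel) = ennreal K" for x z
 proof -
  have "distr lborel borel (%z. x - z) = lborel" using lborel_affine[of "- 1" x] by (simp add: density_1)
  thus "(\<integral>\<^sup>+z. ?k x z \<partial>lborel) = ennreal K"
   using nn_integral_distr[of "%z. x - z" lborel borel "%z. ennreal \<bar>k z\<bar>"] by (simp add: K)
  have "(\<integral>\<^sup>+x. ?k x z \<partial>lborel) = (\<integral>\<^sup>+x. ennreal \<bar>k x\<bar> \<partial>distr lborel borel ((+) (- z)))"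
   by (subst nn_integral_distr) (auto simp: algebra_simps)
  thus "(\<integral>\<^sup>+x. ?k x z \<partial>lborel) = ennreal K" by (simp only: lborel_distr_plus K)
 qed
 have pt: "ennreal ((norm (conv k f x))^2) \<le> ennreal K * (\<integral>\<^sup>+z. ?k x z * (G z)^2 \<partial>lborel)" for x
 proof -
  let ?s = "%z. ennreal (sqrt \<bar>k (x - z)\<bar>)"
  have ss: "?s z * ?s z = ?k x z" for z by (simp add: ennreal_mult[symmetric])
  have "ennreal (norm (conv k f x)) \<le> (\<integral>\<^sup>+z. norm (k (x - z) *\<^sub>R f z) \<partial>lebesgue)"
   unfolding conv_def by (rule integral_norm_bound_ennreal[OF conv_integrable[of k R, OF k f(1)]])
  also have "... = (\<integral>\<^sup>+z. ?s z * (?s z * G z) \<partial>lborel)"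
   unfolding nn_integral_completion using Gf
   by (intro nn_integral_cong_AE) (auto simp: ss mult.assoc[symmetric] ennreal_mult elim!: eventually_mono)
  finally have "(ennreal (norm (conv k f x)))^2 \<le> (\<integral>\<^sup>+z. ?s z * (?s z * G z) \<partial>lborel)^2" by (intro power_mono) auto
  also have "... \<le> (\<integral>\<^sup>+z. (?s z)^2 \<partial>lborel) * (\<integral>\<^sup>+z. (?s z * G z)^2 \<partial>lborel)" by (rule Cauchy_Schwarz_nn_integral) measurable
  also have "... = ennreal K * (\<integral>\<^sup>+z. ?k x z * (G z)^2 \<partial>lborel)"
   unfolding power_mult_distrib by (simp only: power2_eq_square[of "ennreal _"] ss kK)
  finally show ?thesis by (simp add: ennreal_power)
 qed
 have "(\<integral>\<^sup>+x. ennreal ((norm (conv k f x))^2) \<partial>lebesgue) \<le> (\<integral>\<^sup>+x. ennreal K * (\<integral>\<^sup>+z. ?k x z * (G z)^2 \<partial>lborel) \<partial>lborel)"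
  unfolding nn_integral_completion by (intro nn_integral_mono pt)
 also have "... = ennreal K * (\<integral>\<^sup>+z. (\<integral>\<^sup>+x. ?k x z * (G z)^2 \<partial>lborel) \<partial>lborel)"
  by (subst nn_integral_cmult, measurable, subst lborel_pair.Fubini', measurable)
 also have "... = ennreal K * (ennreal K * (\<integral>\<^sup>+z. (G z)^2 \<partial>lborel))"
  by (simp add: nn_integral_multc nn_integral_cmult kK)
 also have "(\<integral>\<^sup>+z. (G z)^2 \<partial>lborel) = (\<integral>\<^sup>+z. ennreal ((norm (f z))^2) \<partial>lebesgue)"
  unfolding nn_integral_completion using Gf by (intro nn_integral_cong_AE) (auto simp: ennreal_power[symmetric] elim!: eventually_mono)
 also have "... = ennreal ((L2norm lebesgue f)^2)" by (rule L2norm_nn_integral[OF f(2)])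
 also have "ennreal K * (ennreal K * ...) = ennreal ((K * L2norm lebesgue f)^2)"
  using K0 by (simp add: ennreal_mult[symmetric] power2_eq_square algebra_simps)
 finally show "in_L2 lebesgue (conv k f)" "L2norm lebesgue (conv k f) \<le> (LINT z|lborel. \<bar>k z\<bar>) * L2norm lebesgue f"
  using L2norm_le_nn_integral[OF continuous_measurable_lebesgue[OF cc], of "K * L2norm lebesgue f"] K0 by (simp_all add: K_def)
qed

definition rescale :: "(real^'n::finite => real) => real => real^'n => real" where
 "rescale k de y = k (y /\<^sub>R de) / de ^ CARD('n)"

lemma rescale_vanish:
 assumes "de > 0" "!!x. norm x > R ==> k x = 0" "norm y > de * R"
 shows "rescale k de y = 0"
proof -
 have "norm (y /\<^sub>R de) > R" using assms(1,3) by (simp add: field_simps)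
 thus ?thesis by (simp add: rescale_def assms(2))
qed

lemma C_diff_rescale: "C_diff m k ==> C_diff m (rescale k de)"
 using C_diff_linear[OF bounded_linear_divide C_diff_affine[of m k 0 "inverse de"]]
 by (simp add: rescale_def[abs_def])

lemma partial_rescale:
 assumes "C_diff 1 k"
 shows "partial j (rescale k de) = (%y. rescale (partial j k) de y / de)"
proof
 fix y
 have "C_diff 1 (%y. k (0 + inverse de *\<^sub>R y))" by (rule C_diff_affine[OF assms])
 hence "(%y. k (y /\<^sub>R de)) differentiable at y" by simp
 from partial_linear[OF bounded_linear_divide[of "de ^ CARD('a)"] this, of j]
 have "partial j (rescale k de) y = partial j (%y. k (y /\<^sub>R de)) y / de ^ CARD('a)"
  by (simp add: rescale_def[abs_def])
 also have "partial j (%y. k (y /\<^sub>R de)) y = partial j k (y /\<^sub>R de) / de"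
  using partial_affine[of k 0 "inverse de" y j] C_diff_D[OF assms] by (simp add: divide_inverse mult.commute)
 finally show "partial j (rescale k de) y = rescale (partial j k) de y / de"
  unfolding rescale_def[of "partial j k"] by (simp add: mult.commute)
qed

lemma integral_rescale:
 assumes "de > 0" "continuous_on UNIV k"
 shows "(LINT y|lborel. rescale k de y) = (LINT y|lborel. k y)"
  "(LINT y|lborel. \<bar>rescale k de y\<bar>) = (LINT y|lborel. \<bar>k y\<bar>)"
 using lborel_integral_scale[OF assms(1), of k] lborel_integral_scale[OF assms(1), of "%y. \<bar>k y\<bar>"]
  cont_measurable[OF assms(2)] assms(1)
 by (simp_all add: rescale_def abs_divide)

text \<open>The kernel has mass one, so \<open>f x\<close> is the average of the constant
  \<open>f x\<close>; what remains is the oscillation of \<open>f\<close> over the support of the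
  rescaled kernel.\<close>

lemma conv_rescale_error:
 fixes f :: "real^'n::finite => 'b::euclidean_space"
 assumes de: "de > 0" and k: "continuous_on UNIV k" "!!x. norm x > R ==> k x = 0" "(LINT y|lborel. k y) = 1"
  and f: "integrable lebesgue f" and e: "!!z. norm (x - z) \<le> de * R ==> norm (f z - f x) \<le> e"
 shows "norm (conv (rescale k de) f x - f x) \<le> e * (LINT y|lborel. \<bar>k y\<bar>)"
proof -
 let ?k = "rescale k de"
 have c: "continuous_on UNIV ?k" using C_diff_rescale[of 0 k de] k(1) by simp
 have v: "!!y. norm y > de * R ==> ?k y = 0" by (rule rescale_vanish[OF de k(2)])
 have kc: "continuous_on UNIV (%z. ?k (x - z))"
  using continuous_on_compose2[OF c, of UNIV "%z. x - z"] by (simp add: continuous_intros)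
 have kz: "?k (x - z) = 0" if "norm z > norm x + de * R" for z
  using that norm_triangle_ineq2[of z x] by (intro v) (simp add: norm_minus_commute)
 have ki: "integrable lebesgue (%z. ?k (x - z))"
  by (rule cvanish_integrable_leb[OF kc kz])
 have one: "(LINT z|lebesgue. ?k (x - z)) = 1"
  using lborel_integral_reflect_translate[of ?k x] cont_measurable[OF c] cont_measurable[OF kc]
  by (simp add: integral_completion integral_rescale(1)[OF de k(1)] k(3))
 have abs1: "(LINT z|lebesgue. \<bar>?k (x - z)\<bar>) = (LINT y|lborel. \<bar>k y\<bar>)"
 proof -
  have "(LINT z|lebesgue. \<bar>?k (x - z)\<bar>) = (LINT z|lborel. \<bar>?k (x - z)\<bar>)"
   using cont_measurable[OF kc] by (intro integral_completion) measurable
  also have "... = (LINT z|lborel. \<bar>?k z\<bar>)"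
   using cont_measurable[OF c] by (intro lborel_integral_reflect_translate[of "%z. \<bar>?k z\<bar>"]) measurable
  finally show ?thesis by (simp add: integral_rescale(2)[OF de k(1)])
 qed
 have fi: "integrable lebesgue (%z. ?k (x - z) *\<^sub>R f z)" by (rule conv_integrable[of ?k "de * R", OF c v f])
 have ci: "integrable lebesgue (%z. ?k (x - z) *\<^sub>R f x)" by (rule integrable_scaleR_left) (rule ki)
 have "(LINT z|lebesgue. ?k (x - z) *\<^sub>R f x) = f x"
  using ki by (simp add: one)
 hence "conv ?k f x - f x = (LINT z|lebesgue. ?k (x - z) *\<^sub>R f z - ?k (x - z) *\<^sub>R f x)"
  unfolding conv_def using fi ci by (simp add: LINT_diff)
 also have "norm ... \<le> (LINT z|lebesgue. norm (?k (x - z) *\<^sub>R f z - ?k (x - z) *\<^sub>R f x))" by (rule integral_norm_bound)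
 also have "... \<le> (LINT z|lebesgue. e * \<bar>?k (x - z)\<bar>)"
 proof (rule integral_mono)
  show "integrable lebesgue (%z. norm (?k (x - z) *\<^sub>R f z - ?k (x - z) *\<^sub>R f x))" using fi ci by (intro integrable_norm Bochner_Integration.integrable_diff)
  show "integrable lebesgue (%z. e * \<bar>?k (x - z)\<bar>)" using ki by simp
  fix z
  show "norm (?k (x - z) *\<^sub>R f z - ?k (x - z) *\<^sub>R f x) \<le> e * \<bar>?k (x - z)\<bar>"
  proof (cases "norm (x - z) \<le> de * R")
   case True
   from mult_left_mono[OF e[OF this], of "\<bar>?k (x - z)\<bar>"] show ?thesis
    by (simp add: scaleR_diff_right[symmetric] mult.commute)
  qed (simp add: v)
 qed
 finally show ?thesis by (simp add: abs1)
qed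

lemma continuous_vanish_uniform:
 fixes f :: "'a::euclidean_space => 'b::real_normed_vector"
 assumes "continuous_on UNIV f" "!!x. norm x > R ==> f x = 0" "e > 0"
 shows "\<exists>d>0. \<forall>x z. norm (x - z) \<le> d --> norm (f z - f x) \<le> e"
proof -
 have "uniformly_continuous_on (cball 0 (R + 1)) f"
  by (rule compact_uniformly_continuous[OF continuous_on_subset[OF assms(1)]]) auto
 then obtain d where d: "d > 0" "!!x z. x \<in> cball 0 (R+1) ==> z \<in> cball 0 (R+1) ==> dist z x < d ==> dist (f z) (f x) < e"
  unfolding uniformly_continuous_on_def using assms(3) by meson
 \<comment> \<open>At distance at most 1, both points lie outside the support as soon as one of them
   has norm above \<open>R + 1\<close>.\<close>
 have "norm (f z - f x) \<le> e" if xz: "norm (x - z) \<le> min (d/2) 1" for x z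
 proof (cases "norm x \<le> R + 1 \<and> norm z \<le> R + 1")
  case True
  thus ?thesis using d(2)[of x z] d(1) xz by (simp add: dist_norm norm_minus_commute)
 next
  case False
  hence "norm x > R" "norm z > R" using xz norm_triangle_ineq2[of x z] norm_triangle_ineq2[of z x]
   by (auto simp: norm_minus_commute)
  thus ?thesis using assms(2,3) by simp
 qed
 thus ?thesis using d(1) by (intro exI[of _ "min (d/2) 1"]) auto
qed

lemma conv_diff:
 fixes f g :: "real^'n::finite => 'b::euclidean_space"
 assumes "continuous_on UNIV k" "!!x. norm x > R ==> k x = 0" "integrable lebesgue f" "integrable lebesgue g"
 shows "conv k (%x. f x - g x) x = conv k f x - conv k g x"
 unfolding conv_def scaleR_diff_right
 by (intro LINT_diff conv_integrable[of k R f, OF assms(1,2,3)] conv_integrable[of k R g, OF assms(1,2,4)])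

lemma conv_vanish:
 assumes "!!x. norm x > r ==> k x = 0" "!!x. norm x > R ==> f x = 0" "norm x > R + r"
 shows "conv k f x = 0"
proof -
 have "k (x - z) *\<^sub>R f z = 0" for z
 proof (cases "norm z > R")
  case False
  hence "norm (x - z) > r" using assms(3) norm_triangle_ineq2[of x z] by linarith
  thus ?thesis using assms(1) by simp
 qed (use assms(2) in simp)
 thus ?thesis unfolding conv_def by (simp only: Bochner_Integration.integral_zero)
qed

text \<open>For a continuous function vanishing outside a ball the mollifications converge pointwise
  under a common majorant. By \<open>conv_L2norm_le\<close> they are bounded on L^2 uniformly in the
  scale, so density carries the convergence over to all of L^2.\<close>

lemma conv_rescale_L2_tendsto:
 fixes f :: "real^'n::finite => 'b::euclidean_space"
 assumes k: "continuous_on UNIV k" "!!x. norm x > R ==> k x = 0" "(LINT y|lborel. k y) = 1"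
  and f: "integrable lebesgue f" "in_L2 lebesgue f" and R: "R > 0"
  and de: "!!m. de m > 0" "de ----> 0"
 shows "L2_tendsto lebesgue (%m. conv (rescale k (de m)) f) f"
proof -
 define K where "K = (LINT y|lborel. \<bar>k y\<bar>)"
 have K0: "K \<ge> 0" by (simp add: K_def)
 let ?k = "%m. rescale k (de m)"
 have kc: "continuous_on UNIV (?k m)" for m using C_diff_rescale[of 0 k "de m"] k(1) by simp
 have v: "?k m y = 0" if "norm y > de m * R" for m y by (rule rescale_vanish[OF de(1) k(2) that])
 have Km: "(LINT y|lborel. \<bar>?k m y\<bar>) = K" for m unfolding K_def by (rule integral_rescale(2)[OF de(1) k(1)])
 have bound: "in_L2 lebesgue (conv (?k m) h)" "L2norm lebesgue (conv (?k m) h) \<le> K * L2norm lebesgue h"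
  if "integrable lebesgue h" "in_L2 lebesgue h" for m and h :: "real^'n => 'b"
  using conv_L2norm_le[of "?k m" "de m * R" h, OF kc v that] by (auto simp: Km)
 obtain D where D: "!!m. de m \<le> D" using convergent_imp_bounded[OF de(2)] by (auto simp: bounded_iff abs_le_iff)
 have gm: "L2_tendsto lebesgue (%m. conv (?k m) g) g"
  if g: "continuous_on UNIV g" "!!x. norm x > Rg ==> g x = 0" "integrable lebesgue g" "in_L2 lebesgue g" for g :: "real^'n => 'b" and Rg
 proof -
  obtain C where C: "!!x. norm (g x) \<le> C" using cvanish_bounded[OF g(1,2)] by blast
  have z: "norm (conv (?k m) g x - g x) \<le> (C * K + C) * indicator (cball 0 (Rg + D * R)) x" for m x
  proof (cases "norm x \<le> Rg + D * R")
   case True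
   have "norm (conv (?k m) g x) \<le> C * K" using conv_norm_le[of "?k m" "de m * R" g C x, OF kc v g(3) C] by (simp add: Km)
   thus ?thesis using True C[of x] norm_triangle_ineq4[of "conv (?k m) g x" "g x"] by simp
  next
   case False
   moreover have "de m * R \<le> D * R" "0 \<le> de m * R" using D[of m] R de(1)[of m] by auto
   ultimately show ?thesis using conv_vanish[of "de m * R" "?k m" Rg g x, OF v g(2)] g(2)[of x] by simp
  qed
  have "(%m. LINT x|lebesgue. (norm (conv (?k m) g x - g x))^2) ----> (LINT x::real^'n|lebesgue. (0::real))"
  proof (rule integral_dominated_convergence[where w="%x. (C * K + C)^2 * indicator (cball 0 (Rg + D * R)) x"])
   show "integrable lebesgue (%x::real^'n. (C * K + C)^2 * indicator (cball 0 (Rg + D * R)) x :: real)"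
    using emeasure_lborel_cball_finite[of "0::real^'n" "Rg + D * R"] by (intro integrable_mult_right integrable_real_indicator) auto
   show "(%x. (norm (conv (?k m) g x - g x))^2) \<in> borel_measurable lebesgue" for m
    using in_L2_diff[OF bound(1)[OF g(3,4)] g(4)] by (simp add: in_L2_def borel_measurable_integrable)
   show "AE x in lebesgue. norm ((norm (conv (?k m) g x - g x))^2) \<le> (C * K + C)^2 * indicator (cball 0 (Rg + D * R)) x" for m
   proof (rule AE_I2)
    fix x show "norm ((norm (conv (?k m) g x - g x))^2) \<le> (C * K + C)^2 * indicator (cball 0 (Rg + D * R)) x"
     using power_mono[OF z[of m x], of 2] by (auto simp: indicator_def split: if_splits)
   qed
   have "(%m. conv (?k m) g x - g x) ----> 0" for x
   proof (rule LIMSEQ_I)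
    fix e :: real assume e: "e > 0"
    obtain d where d: "d > 0" "!!x z. norm (x - z) \<le> d ==> norm (g z - g x) \<le> e / (K + 1)"
     using continuous_vanish_uniform[of g Rg "e / (K + 1)", OF g(1,2)] e K0 by auto
    obtain N where N: "!!m. m \<ge> N ==> de m < d / R"
     using LIMSEQ_D[OF de(2), of "d / R"] d(1) R de(1) by (auto simp: abs_of_pos)
    have "norm (conv (?k m) g x - g x - 0) < e" if "m \<ge> N" for m
    proof -
     have "norm (conv (?k m) g x - g x) \<le> e / (K + 1) * K" unfolding K_def[symmetric]
      using conv_rescale_error[of "de m" k R g x "e / (K + 1)", OF de(1) k g(3)] N[OF that] R d(2)[of x] by (auto simp: K_def pos_less_divide_eq)
     also have "... < e" using e K0 by (simp add: field_simps)
     finally show ?thesis by simp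
    qed
    thus "\<exists>no. \<forall>m\<ge>no. norm (conv (?k m) g x - g x - 0) < e" by blast
   qed
   from tendsto_power[OF tendsto_norm[OF this], of _ 2]
   show "AE x in lebesgue. (%m. (norm (conv (?k m) g x - g x))^2) ----> 0" by simp
  qed simp
  thus ?thesis using bound(1)[OF g(3,4)] g(4) by (simp add: L2_tendsto_def)
 qed
 have "(%m. L2norm lebesgue (%x. conv (?k m) f x - f x)) ----> 0"
 proof (rule LIMSEQ_I)
  fix e :: real assume e: "e > 0"
  \<comment> \<open>The approximation error enters twice, mollified with factor \<open>K\<close> and
    as it stands with factor 1, hence \<open>K + 1\<close>.\<close>
  define e1 where "e1 = e / (2 * (K + 1))"
  have e1: "e1 > 0" "(K + 1) * e1 = e / 2" using e K0 by (auto simp: e1_def field_simps)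
  obtain g Rg where g: "continuous_on UNIV g" "\<forall>x. norm x > Rg --> g x = 0" "L2norm lebesgue (%x. f x - g x) < e1"
   using L2_approx_continuous[OF f(2) e1(1)] by auto
  have gi: "integrable lebesgue g" by (rule cvanish_integrable_leb[OF g(1)]) (use g(2) in blast)
  have g2: "in_L2 lebesgue g" by (rule cvanish_in_L2[OF g(1)]) (use g(2) in blast)
  have fg: "integrable lebesgue (%x. f x - g x)" "in_L2 lebesgue (%x. f x - g x)" using f gi g2 by (auto intro: in_L2_diff)
  have "(%m. L2norm lebesgue (%x. conv (?k m) g x - g x)) ----> 0" using gm[OF g(1) _ gi g2, of Rg] g(2) by (simp add: L2_tendsto_iff)
  from LIMSEQ_D[OF this, of "e / 2"] e obtain N where N: "!!m. m \<ge> N ==> L2norm lebesgue (%x. conv (?k m) g x - g x) < e / 2" by auto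
  have "L2norm lebesgue (%x. conv (?k m) f x - f x) < e" if m: "m \<ge> N" for m
  proof -
   note b = in_L2_diff[OF bound(1)[OF gi g2, of m] g2] and c = in_L2_scaleR[OF fg(2), of "-1"]
   have eq: "(%x. conv (?k m) f x - f x) = (%x. conv (?k m) (%x. f x - g x) x + ((conv (?k m) g x - g x) + (-1) *\<^sub>R (f x - g x)))"
    using conv_diff[of "?k m" "de m * R" f g, OF kc v f(1) gi] by (simp add: fun_eq_iff)
   have "L2norm lebesgue (%x. conv (?k m) f x - f x) \<le> L2norm lebesgue (conv (?k m) (%x. f x - g x)) + (L2norm lebesgue (%x. conv (?k m) g x - g x) + L2norm lebesgue (%x. (-1) *\<^sub>R (f x - g x)))"
    unfolding eq using L2norm_triangle[OF bound(1)[OF fg, of m] in_L2_add[OF b c]] L2norm_triangle[OF b c] by linarith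
   also have "... < (K + 1) * L2norm lebesgue (%x. f x - g x) + e / 2"
    using N[OF m] bound(2)[OF fg, of m] unfolding L2norm_scaleR distrib_right abs_minus_cancel abs_one mult_1 by linarith
   also have "... \<le> (K + 1) * e1 + e / 2" using g(3) K0 by (intro add_right_mono mult_left_mono) auto
   finally show ?thesis using e1(2) by simp
  qed
  thus "\<exists>no. \<forall>m\<ge>no. norm (L2norm lebesgue (%x. conv (?k m) f x - f x) - 0) < e" by auto
 qed
 thus ?thesis using bound(1)[OF f] f by (simp add: L2_tendsto_iff)
qed

text \<open>The indicator of the ball of radius 3r/2 is mollified at scale r/2. At points of
  \<open>ball p r\<close> the kernel meets only the value 1, so the error estimate with oscillation
  0 gives equality; outside radius 2r it meets only the value 0.\<close>

lemma smooth_bump: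
 fixes rh :: "real^'n::finite => real"
 assumes rh: "smooth rh" "supp rh \<subseteq> cball 0 1" "(LINT x|lborel. rh x) = 1" and r: "r > 0"
 shows "\<exists>th :: real^'n => real. smooth th \<and> (\<forall>x\<in>ball p r. th x = 1) \<and> supp th \<subseteq> cball p (2 * r)"
proof -
 let ?f = "indicator (cball p (3 * r / 2)) :: real^'n => real"
 let ?k = "rescale rh (r / 2)"
 define th where "th = conv ?k ?f"
 have rhv: "rh x = 0" if "norm x > 1" for x using supp_subset_cballD[OF rh(2) that] .
 have kv: "?k y = 0" if "norm y > r / 2" for y
  using rescale_vanish[of "r/2" 1 rh y] r rhv that by simp
 have lm: "cball p (3 * r / 2) \<in> lmeasurable" by simp
 hence fi: "integrable lebesgue ?f"
  by (intro integrable_real_indicator) (auto simp: fmeasurable_def)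
 have "C_diff m th" for m unfolding th_def
  by (rule C_diff_conv[of ?f m ?k "r/2", OF fi C_diff_rescale[OF smooth_C_diff[OF rh(1)]] kv])
 hence "smooth th" by (simp add: smooth_def)
 moreover have "th x = 1" if x: "x \<in> ball p r" for x
 proof -
  have "norm (conv ?k ?f x - ?f x) \<le> 0 * (LINT y|lborel. \<bar>rh y\<bar>)"
  proof (rule conv_rescale_error[of "r/2" rh 1 ?f x 0])
   fix z assume "norm (x - z) \<le> r / 2 * 1"
   hence "dist p x < r" "dist x z \<le> r / 2" using x by (auto simp: dist_norm)
   hence "dist p z \<le> 3 * r / 2" "dist p x \<le> 3 * r / 2" using dist_triangle[of p z x] r by auto
   thus "norm (?f z - ?f x) \<le> 0" by (simp add: indicator_def)
  qed (use r rhv rh(3) fi C_diff_cont[OF smooth_C_diff[OF rh(1), of 0]] in auto)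
  thus ?thesis using x r by (simp add: th_def indicator_def)
 qed
 moreover have "supp th \<subseteq> cball p (2 * r)" unfolding supp_def
 proof (rule closure_minimal)
  have "th x = 0" if "x \<notin> cball p (2 * r)" for x
  proof -
   have "?k (x - z) *\<^sub>R ?f z = 0" for z
   proof (cases "z \<in> cball p (3 * r / 2)")
    case True
    hence "norm (x - z) > r / 2" using that dist_triangle[of p x z] by (auto simp: dist_norm norm_minus_commute)
    from kv[OF this] show ?thesis by simp
   qed simp
   thus ?thesis by (simp only: th_def conv_def Bochner_Integration.integral_zero)
  qed
  thus "{x. th x \<noteq> 0} \<subseteq> cball p (2 * r)" by blast
 qed simp
 ultimately show ?thesis by blast
qed

section \<open>The divergence theorem\<close>

subsection \<open>A \<open>C\<^sup>1\<close> step function\<close>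

lemma has_real_derivative_pos_part_square: "((%t::real. (max 0 t)^2) has_real_derivative 2 * max 0 t) (at t)"
proof -
 consider "t > 0" | "t < 0" | "t = 0" by linarith
 thus ?thesis
 proof cases
  case 1
  have "((%t. t^2) has_real_derivative 2 * t) (at t)" by (auto intro!: derivative_eq_intros)
  hence "((%t. (max 0 t)^2) has_real_derivative 2 * t) (at t)"
   by (rule DERIV_cong_ev[THEN iffD1, rotated 3]) (use eventually_nhds_in_open[of "{0<..}" t] 1 in \<open>auto elim!: eventually_mono\<close>)
  with 1 show ?thesis by simp
 next
  case 2
  have "((%t. 0) has_real_derivative 0) (at t)" by simp
  hence "((%t. (max 0 t)^2) has_real_derivative 0) (at t)"
   by (rule DERIV_cong_ev[THEN iffD1, rotated 3]) (use eventually_nhds_in_open[of "{..<0}" t] 2 in \<open>auto elim!: eventually_mono\<close>)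
  with 2 show ?thesis by simp
 next
  case 3
  have "((%h. (max 0 h)^2 / h) ---> 0) (at (0::real))"
  proof (rule Lim_null_comparison[of _ "%h. \<bar>h\<bar>"])
   show "\<forall>\<^sub>F h::real in at 0. norm ((max 0 h)^2 / h) \<le> \<bar>h\<bar>"
    by (rule always_eventually) (auto simp: max_def power2_eq_square)
   show "((%h::real. \<bar>h\<bar>) ---> 0) (at 0)" by (rule tendsto_rabs_zero) simp
  qed
  thus ?thesis using 3 by (simp add: has_field_derivative_iff)
 qed
qed

text \<open>A tent over the unit interval with peak 2, hence of mass 1. Its primitive
  \<open>step\<close> is a C^1 transition from 0 to 1; rescaled, it approximates the indicator of
  the region above a graph.\<close>

definition hat :: "real => real" where
 "hat t = 4 * max 0 t - 8 * max 0 (t - 1/2) + 4 * max 0 (t - 1)"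

definition step :: "real => real" where
 "step t = 2 * (max 0 t)^2 - 4 * (max 0 (t - 1/2))^2 + 2 * (max 0 (t - 1))^2"

lemma has_real_derivative_step: "(step has_real_derivative hat t) (at t)"
proof -
 have d: "((%t::real. (max 0 (t - c))^2) has_real_derivative 2 * max 0 (t - c)) (at t)" for c
  using has_real_derivative_pos_part_square[of "t - c"] DERIV_shift[of "%t. (max 0 t)^2" _ t "- c"] by simp
 show ?thesis unfolding step_def[abs_def] hat_def
  using DERIV_add[OF DERIV_diff[OF DERIV_cmult[OF d[of 0], of 2] DERIV_cmult[OF d[of "1/2"], of 4]] DERIV_cmult[OF d[of 1], of 2]]
  by simp
qed

lemma continuous_on_hat: "continuous_on UNIV hat"
 unfolding hat_def[abs_def] by (intro continuous_intros)

lemma hat_bounds: "0 \<le> hat t" "hat t \<le> 2" "t \<le> 0 ==> hat t = 0" "t \<ge> 1 ==> hat t = 0"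
 by (auto simp: hat_def max_def)

lemma step_vals: "t \<le> 0 ==> step t = 0" "t \<ge> 1 ==> step t = 1"
 by (auto simp: step_def max_def power2_eq_square algebra_simps)

lemma step_bound: "\<bar>step t\<bar> \<le> 1"
proof -
 consider "t \<le> 0" | "t \<ge> 1" | "0 < t" "t \<le> 1/2" | "1/2 < t" "t < 1" by linarith
 thus ?thesis
 proof cases
  case 3
  hence "t * t \<le> (1/2) * (1/2)" by (intro mult_mono) auto
  moreover have "max 0 (t - 1/2) = 0" "max 0 (t - 1) = 0" "max 0 t = t" using 3 by auto
  ultimately show ?thesis using 3 by (simp add: step_def power2_eq_square abs_le_iff)
 next
  case 4
  have eq: "step t = 1 - 2 * (1 - t)^2" using 4 by (simp add: step_def max_def power2_eq_square algebra_simps)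
  have "(1 - t) * (1 - t) \<le> (1/2) * (1/2)" using 4 by (intro mult_mono) auto
  moreover have "0 \<le> (1 - t)^2" by simp
  ultimately show ?thesis unfolding eq by (simp add: power2_eq_square abs_le_iff)
 qed (simp_all add: step_vals)
qed

lemma integral_hat: "(LINT t|lborel. hat t) = 1"
proof -
 have "(LINT t|lborel. indicator {0..1} t *\<^sub>R hat t) = step 1 - step 0"
  by (rule integral_FTC_Icc) (use has_real_derivative_step continuous_on_hat in
    \<open>auto simp: has_real_derivative_iff_has_vector_derivative[symmetric] intro: DERIV_subset continuous_on_subset\<close>)
 moreover have "(%t. indicator {0..1} t *\<^sub>R hat t) = hat"
 proof
  fix t show "indicator {0..1} t *\<^sub>R hat t = hat t"
   by (cases "t < 0"; cases "t > 1") (auto simp: hat_bounds)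
 qed
 ultimately show ?thesis by (simp add: step_vals)
qed

subsection \<open>Integration along a fixed direction\<close>

text \<open>A line in direction \<open>e\<close> meets the slab in a segment of length one. For
  functions constant along \<open>e\<close>, integration over the slab is therefore integration over
  the hyperplane orthogonal to \<open>e\<close>, as in the definition of
  \<open>surface_measure\<close>.\<close>

lemma slab_length:
 fixes e :: "'a::euclidean_space"
 assumes "norm e = 1"
 shows "(\<integral>\<^sup>+t. indicator {x. 0 < x \<bullet> e \<and> x \<bullet> e < 1} (x - t *\<^sub>R e) \<partial>lborel) = 1"
proof -
 have "indicator {x. 0 < x \<bullet> e \<and> x \<bullet> e < 1} (x - t *\<^sub>R e) = (indicator {x \<bullet> e - 1 <..< x \<bullet> e} t :: ennreal)" for t
  using assms by (auto simp: indicator_def inner_diff_left dot_square_norm)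
 thus ?thesis by simp
qed

lemma slab_borel [measurable]: "{x. 0 < x \<bullet> e \<and> x \<bullet> e < 1} \<in> sets borel" for e :: "'a::euclidean_space"
 by (intro borel_open open_Collect_conj open_Collect_less continuous_intros)

lemma nn_integral_slab:
 fixes e :: "'a::euclidean_space"
 assumes e: "norm e = 1" and [measurable]: "f \<in> borel_measurable borel"
 shows "(\<integral>\<^sup>+x. (\<integral>\<^sup>+t. indicator {x. 0 < x \<bullet> e \<and> x \<bullet> e < 1} x * f (x + t *\<^sub>R e) \<partial>lborel) \<partial>lborel) = (\<integral>\<^sup>+x. f x \<partial>lborel)"
proof -
 let ?S = "{x. 0 < x \<bullet> e \<and> x \<bullet> e < 1}"
 have "(\<integral>\<^sup>+x. (\<integral>\<^sup>+t. indicator ?S x * f (x + t *\<^sub>R e) \<partial>lborel) \<partial>lborel) = (\<integral>\<^sup>+t. (\<integral>\<^sup>+x. indicator ?S x * f (x + t *\<^sub>R e) \<partial>lborel) \<partial>lborel)"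
  by (rule lborel_pair.Fubini'[symmetric]) measurable
 also have "... = (\<integral>\<^sup>+t. (\<integral>\<^sup>+x. indicator ?S (x - t *\<^sub>R e) * f x \<partial>lborel) \<partial>lborel)"
 proof (rule nn_integral_cong)
  fix t :: real
  have "(\<integral>\<^sup>+x. indicator ?S x * f (x + t *\<^sub>R e) \<partial>lborel) = (\<integral>\<^sup>+x. indicator ?S (x - t *\<^sub>R e) * f x \<partial>distr lborel borel ((+) (t *\<^sub>R e)))"
   by (subst nn_integral_distr) (auto simp: add.commute)
  thus "(\<integral>\<^sup>+x. indicator ?S x * f (x + t *\<^sub>R e) \<partial>lborel) = (\<integral>\<^sup>+x. indicator ?S (x - t *\<^sub>R e) * f x \<partial>lborel)"
   by (simp add: lborel_distr_plus)
 qed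
 also have "... = (\<integral>\<^sup>+x. (\<integral>\<^sup>+t. indicator ?S (x - t *\<^sub>R e) * f x \<partial>lborel) \<partial>lborel)"
  by (rule lborel_pair.Fubini') measurable
 also have "... = (\<integral>\<^sup>+x. f x \<partial>lborel)"
  by (rule nn_integral_cong) (simp add: nn_integral_multc slab_length[OF e])
 finally show ?thesis .
qed

text \<open>Fubini for the splitting into hyperplane and direction \<open>e\<close>, without
  coordinates on the hyperplane: for each \<open>t\<close> the variable \<open>x\<close> is
  translated by \<open>t *\<^sub>R e\<close>, and then \<open>t\<close> runs over the unit segment
  for which \<open>x - t *\<^sub>R e\<close> lies in the slab.\<close>

lemma integral_slab:
 fixes e :: "'a::euclidean_space" and f :: "'a => 'b::euclidean_space"
 assumes e: "norm e = 1" and f: "f \<in> borel_measurable borel" "integrable lborel f"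
 shows "(LINT x|lborel. indicator {x. 0 < x \<bullet> e \<and> x \<bullet> e < 1} x *\<^sub>R (LINT t|lborel. f (x + t *\<^sub>R e))) = (LINT x|lborel. f x)"
proof -
 let ?S = "{x. 0 < x \<bullet> e \<and> x \<bullet> e < 1}"
 note [measurable] = f(1)
  have int2: "integrable (lborel \<Otimes>\<^sub>M lborel) (%(x, t). indicator ?S (x - t *\<^sub>R e) *\<^sub>R f x)"
  proof (rule integrableI_bounded)
   show "(%(x, t). indicator ?S (x - t *\<^sub>R e) *\<^sub>R f x) \<in> borel_measurable (lborel \<Otimes>\<^sub>M lborel)" by measurable
   have "(\<integral>\<^sup>+p. ennreal (norm ((%(x, t). indicator ?S (x - t *\<^sub>R e) *\<^sub>R f x) p)) \<partial>(lborel \<Otimes>\<^sub>M lborel))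
    = (\<integral>\<^sup>+x. (\<integral>\<^sup>+t. ennreal (norm (indicator ?S (x - t *\<^sub>R e) *\<^sub>R f x)) \<partial>lborel) \<partial>lborel)"
    by (subst lborel.nn_integral_fst[symmetric]) (auto simp: split_beta)
   also have "... = (\<integral>\<^sup>+x. (\<integral>\<^sup>+t. indicator ?S (x - t *\<^sub>R e) * ennreal (norm (f x)) \<partial>lborel) \<partial>lborel)"
    by (intro nn_integral_cong) (auto simp: indicator_def)
   also have "... = (\<integral>\<^sup>+x. ennreal (norm (f x)) \<partial>lborel)"
    by (rule nn_integral_cong) (simp add: nn_integral_multc slab_length[OF e])
   also have "... < \<infinity>" using f(2) by (simp add: integrable_iff_bounded)
   finally show "(\<integral>\<^sup>+p. ennreal (norm ((%(x, t). indicator ?S (x - t *\<^sub>R e) *\<^sub>R f x) p)) \<partial>(lborel \<Otimes>\<^sub>M lborel)) < \<infinity>" .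
  qed
 have "integrable (lborel \<Otimes>\<^sub>M lborel) (%(x, t). indicator ?S x *\<^sub>R f (x + t *\<^sub>R e))"
 proof (rule integrableI_bounded)
  show "(%(x, t). indicator ?S x *\<^sub>R f (x + t *\<^sub>R e)) \<in> borel_measurable (lborel \<Otimes>\<^sub>M lborel)" by measurable
  have "(\<integral>\<^sup>+p. ennreal (norm ((%(x, t). indicator ?S x *\<^sub>R f (x + t *\<^sub>R e)) p)) \<partial>(lborel \<Otimes>\<^sub>M lborel))
   = (\<integral>\<^sup>+x. (\<integral>\<^sup>+t. ennreal (norm (indicator ?S x *\<^sub>R f (x + t *\<^sub>R e))) \<partial>lborel) \<partial>lborel)"
   by (subst lborel.nn_integral_fst[symmetric]) (auto simp: split_beta)
  also have "... = (\<integral>\<^sup>+x. (\<integral>\<^sup>+t. indicator ?S x * ennreal (norm (f (x + t *\<^sub>R e))) \<partial>lborel) \<partial>lborel)"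
   by (intro nn_integral_cong) (auto simp: indicator_def)
  also have "... = (\<integral>\<^sup>+x. ennreal (norm (f x)) \<partial>lborel)"
   by (rule nn_integral_slab[OF e]) measurable
  also have "... < \<infinity>" using f(2) by (simp add: integrable_iff_bounded)
  finally show "(\<integral>\<^sup>+p. ennreal (norm ((%(x, t). indicator ?S x *\<^sub>R f (x + t *\<^sub>R e)) p)) \<partial>(lborel \<Otimes>\<^sub>M lborel)) < \<infinity>" .
 qed
 from lborel_pair.Fubini_integral[OF this]
 have "(LINT x|lborel. (LINT t|lborel. indicator ?S x *\<^sub>R f (x + t *\<^sub>R e))) = (LINT t|lborel. (LINT x|lborel. indicator ?S x *\<^sub>R f (x + t *\<^sub>R e)))"
  by simp
 also have "... = (LINT t|lborel. (LINT x|lborel. indicator ?S (x - t *\<^sub>R e) *\<^sub>R f x))"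
 proof (rule LINT_cong[OF refl])
  fix t :: real
  show "(LINT x|lborel. indicator ?S x *\<^sub>R f (x + t *\<^sub>R e)) = (LINT x|lborel. indicator ?S (x - t *\<^sub>R e) *\<^sub>R f x)"
   using lborel_integral_translate[of "%x. indicator ?S (x - t *\<^sub>R e) *\<^sub>R f x" "t *\<^sub>R e"] by (simp add: add.commute)
 qed
 also have "... = (LINT x|lborel. (LINT t|lborel. indicator ?S (x - t *\<^sub>R e) *\<^sub>R f x))"
  using lborel_pair.Fubini_integral[OF int2] by simp
 also have "... = (LINT x|lborel. f x)"
 proof (rule LINT_cong[OF refl])
  fix x
  have "indicator ?S (x - t *\<^sub>R e) = indicat_real {x \<bullet> e - 1 <..< x \<bullet> e} t" for t
   using e by (auto simp: indicator_def inner_diff_left dot_square_norm)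
  thus "(LINT t|lborel. indicator ?S (x - t *\<^sub>R e) *\<^sub>R f x) = f x" by simp
 qed
 finally show ?thesis by simp
qed


subsection \<open>The region above a graph\<close>

lemma norm_orthogonal_part_le:
 fixes e :: "'a::euclidean_space"
 assumes "norm e = 1"
 shows "norm (y - (y \<bullet> e) *\<^sub>R e) \<le> norm y"
proof -
 have "(norm (y - (y \<bullet> e) *\<^sub>R e))^2 = (norm y)^2 - (y \<bullet> e)^2"
 proof -
  have "inner e e = 1" using assms by (simp add: dot_square_norm)
  thus ?thesis unfolding power2_norm_eq_inner
   by (simp add: inner_diff_left inner_diff_right inner_commute[of e y] power2_eq_square)
 qed
 hence "(norm (y - (y \<bullet> e) *\<^sub>R e))^2 \<le> (norm y)^2" by simp
 thus ?thesis by (rule power2_le_imp_le) simp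
qed

text \<open>On each line in direction \<open>e\<close> the weight is a tent of mass one that sits
  between heights 0 and 1/N above the graph. By \<open>integral_slab\<close> the volume integral
  consists of averages of \<open>g\<close> over such short segments, and these converge to the value
  of \<open>g\<close> on the graph.\<close>

lemma graph_layer_limit:
 fixes e :: "'a::euclidean_space" and g :: "'a => 'b::euclidean_space"
 assumes e: "norm e = 1" and ga: "continuous_on UNIV ga" "!!x t. ga (x + t *\<^sub>R e) = ga x"
  and g: "continuous_on UNIV g" "!!x. norm x > R ==> g x = 0"
 shows "(%n. LINT x|lborel. (hat (real (Suc n) * (x \<bullet> e - ga x)) * real (Suc n)) *\<^sub>R g x) ---->
  (LINT x|lborel. indicator {x. 0 < x \<bullet> e \<and> x \<bullet> e < 1} x *\<^sub>R g (x + (ga x - x \<bullet> e) *\<^sub>R e))"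
proof -
 let ?S = "{x. 0 < x \<bullet> e \<and> x \<bullet> e < 1}"
 let ?P = "%x. x + (ga x - x \<bullet> e) *\<^sub>R e"
 have [measurable]: "ga \<in> borel_measurable borel" "g \<in> borel_measurable borel" "hat \<in> borel_measurable borel"
  using ga(1) g(1) continuous_on_hat by (auto intro: cont_measurable)
 obtain C where C: "C > 0" "!!x. norm (g x) \<le> C" using cvanish_bounded[OF g] by blast
 define J where "J n x = (LINT s|lborel. hat s *\<^sub>R g (?P x + (s / real (Suc n)) *\<^sub>R e))" for n x
 have hi: "integrable lborel hat"
  by (rule cvanish_integrable[OF continuous_on_hat, of 1]) (auto simp: hat_bounds abs_if split: if_splits)
 have ji: "integrable lborel (%s. hat s *\<^sub>R g (?P x + (s / c) *\<^sub>R e))" for c x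
 proof (rule Bochner_Integration.integrable_bound[of lborel "%s. C * hat s"])
  show "AE s in lborel. norm (hat s *\<^sub>R g (?P x + (s / c) *\<^sub>R e)) \<le> norm (C * hat s)"
  proof (rule AE_I2)
   fix s
   show "norm (hat s *\<^sub>R g (?P x + (s / c) *\<^sub>R e)) \<le> norm (C * hat s)"
    using mult_left_mono[OF C(2) hat_bounds(1)[of s]] hat_bounds(1)[of s] C(1) by (simp add: abs_mult mult.commute)
  qed
 qed (use hi in auto)
 have eq: "(LINT x|lborel. (hat (real (Suc n) * (x \<bullet> e - ga x)) * real (Suc n)) *\<^sub>R g x) = (LINT x|lborel. indicator ?S x *\<^sub>R J n x)" for n
 proof -
  define N where "N = real (Suc n)"
  have N: "N > 0" by (simp add: N_def)
  let ?F = "%x. (hat (N * (x \<bullet> e - ga x)) * N) *\<^sub>R g x"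
  have Fc: "continuous_on UNIV ?F"
   by (intro continuous_intros continuous_on_compose2[OF continuous_on_hat] ga(1) g(1)) auto
  have Fi: "integrable lborel ?F" by (rule cvanish_integrable[OF Fc, of R]) (simp add: g(2))
  have in1: "(LINT t|lborel. ?F (x + t *\<^sub>R e)) = J n x" for x
  proof -
   let ?G = "%t. (hat (N * (x \<bullet> e + t - ga x)) * N) *\<^sub>R g (x + t *\<^sub>R e)"
   have "(x + t *\<^sub>R e) \<bullet> e = x \<bullet> e + t" for t using e by (simp add: inner_add_left dot_square_norm)
   hence "(LINT t|lborel. ?F (x + t *\<^sub>R e)) = (LINT t|lborel. ?G t)" by (simp add: ga(2))
   also have "... = (1/N) *\<^sub>R (LINT s|lborel. ?G ((ga x - x \<bullet> e) + (1/N) *\<^sub>R s))"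
    using lborel_integral_affine[of "1/N" ?G "ga x - x \<bullet> e"] N by simp
   also have "(LINT s|lborel. ?G ((ga x - x \<bullet> e) + (1/N) *\<^sub>R s)) = (LINT s|lborel. N *\<^sub>R (hat s *\<^sub>R g (?P x + (s / N) *\<^sub>R e)))"
    using N by (intro LINT_cong refl) (simp add: algebra_simps)
   also have "... = N *\<^sub>R (LINT s|lborel. hat s *\<^sub>R g (?P x + (s / N) *\<^sub>R e))"
    by (rule integral_scaleR_right)
   also have "(1/N) *\<^sub>R ... = J n x" unfolding J_def N_def[symmetric] using N by simp
   finally show ?thesis .
  qed
  show ?thesis using integral_slab[OF e cont_measurable[OF Fc] Fi] unfolding in1 N_def[symmetric] by simp
 qed
 have "(%n. LINT x|lborel. indicator ?S x *\<^sub>R J n x) ----> (LINT x|lborel. indicator ?S x *\<^sub>R g (?P x))"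
 proof (rule integral_dominated_convergence[where w="%x. C * indicator (cball 0 (R + 1)) x"])
  show "(%x. indicator ?S x *\<^sub>R g (?P x)) \<in> borel_measurable lborel" by measurable
  show "(%x. indicator ?S x *\<^sub>R J n x) \<in> borel_measurable lborel" for n
   unfolding J_def by measurable
  show "integrable lborel (%x::'a. C * indicator (cball 0 (R + 1)) x)"
   using emeasure_lborel_cball_finite[of "0::'a" "R + 1"]
   by (intro integrable_mult_right integrable_real_indicator) (auto simp: less_top)
  show "AE x in lborel. (%n. indicator ?S x *\<^sub>R J n x) ----> indicator ?S x *\<^sub>R g (?P x)"
  proof (intro AE_I2 tendsto_scaleR tendsto_const)
   fix x
   have "(%n. J n x) ----> (LINT s|lborel. hat s *\<^sub>R g (?P x))"
    unfolding J_def
   proof (rule integral_dominated_convergence[where w="%s. C * hat s"])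
    show "AE s in lborel. (%n. hat s *\<^sub>R g (?P x + (s / real (Suc n)) *\<^sub>R e)) ----> hat s *\<^sub>R g (?P x)"
    proof (intro AE_I2 tendsto_scaleR tendsto_const)
     fix s :: real
     have "(%n. ?P x + (s / real (Suc n)) *\<^sub>R e) ----> ?P x + 0 *\<^sub>R e"
      by (intro tendsto_intros LIMSEQ_Suc[OF lim_const_over_n])
     hence "(%n. ?P x + (s / real (Suc n)) *\<^sub>R e) ----> ?P x" by simp
     moreover have "isCont g (?P x)" using g(1) by (simp add: continuous_on_eq_continuous_at)
     ultimately show "(%n. g (?P x + (s / real (Suc n)) *\<^sub>R e)) ----> g (?P x)"
      by (rule isCont_tendsto_compose[rotated])
    qed
    show "AE s in lborel. norm (hat s *\<^sub>R g (?P x + (s / real (Suc n)) *\<^sub>R e)) \<le> C * hat s" for n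
    proof (rule AE_I2)
     fix s
     show "norm (hat s *\<^sub>R g (?P x + (s / real (Suc n)) *\<^sub>R e)) \<le> C * hat s"
      using mult_left_mono[OF C(2) hat_bounds(1)[of s]] hat_bounds(1)[of s] C(1) by (simp add: abs_mult mult.commute)
    qed
   qed (use hi in auto)
   also have "(LINT s|lborel. hat s *\<^sub>R g (?P x)) = g (?P x)" using hi by (simp add: integral_hat)
   finally show "(%n. J n x) ----> g (?P x)" .
  qed
  show "AE x in lborel. norm (indicator ?S x *\<^sub>R J n x) \<le> C * indicator (cball 0 (R + 1)) x" for n
  proof (rule AE_I2)
   fix x
   have Jb: "norm (J n x) \<le> C"
   proof -
    have "norm (J n x) \<le> (LINT s|lborel. norm (hat s *\<^sub>R g (?P x + (s / real (Suc n)) *\<^sub>R e)))"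
     unfolding J_def by (rule integral_norm_bound)
    also have "... \<le> (LINT s|lborel. hat s * C)"
     by (rule integral_mono[OF integrable_norm[OF ji]]) (use hi C hat_bounds(1) in \<open>auto intro!: mult_left_mono\<close>)
    finally show ?thesis using hi by (simp add: integral_hat)
   qed
   \<comment> \<open>In the slab the component along \<open>e\<close> is below 1, so a point of norm
     above \<open>R + 1\<close> has an orthogonal part longer than \<open>R\<close>; the whole line
     through it then misses the support of \<open>g\<close>.\<close>
   show "norm (indicator ?S x *\<^sub>R J n x) \<le> C * indicator (cball 0 (R + 1)) x"
   proof (cases "x \<in> ?S \<and> norm x > R + 1")
    case True
    have "g (?P x + u *\<^sub>R e) = 0" for u
    proof -
     let ?y = "?P x + u *\<^sub>R e"
     have yx: "?y - (?y \<bullet> e) *\<^sub>R e = x - (x \<bullet> e) *\<^sub>R e"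
      using e by (simp add: inner_add_left dot_square_norm algebra_simps)
     have "norm (x - (x \<bullet> e) *\<^sub>R e) \<le> norm ?y" using norm_orthogonal_part_le[OF e, of ?y] unfolding yx .
     moreover have "norm x \<le> norm (x - (x \<bullet> e) *\<^sub>R e) + norm ((x \<bullet> e) *\<^sub>R e)"
      using norm_triangle_ineq[of "x - (x \<bullet> e) *\<^sub>R e" "(x \<bullet> e) *\<^sub>R e"] by simp
     moreover have "norm ((x \<bullet> e) *\<^sub>R e) < 1" using True e by simp
     ultimately have "norm ?y > R" using True by linarith
     thus ?thesis by (rule g(2))
    qed
    hence "J n x = 0" by (simp add: J_def)
    thus ?thesis using C(1) by simp
   next
    case False
    thus ?thesis using Jb C(1) by (auto simp: indicator_def)
   qed
  qed
 qed
 thus ?thesis unfolding eq .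
qed

text \<open>The cut-off \<open>step\<close>, applied to N times the height above the graph,
  multiplies \<open>ph\<close>, and the integral of the derivative of the product vanishes. As N
  grows the cut-off tends to the indicator of the region above the graph and its derivative to a
  layer on the graph. The vector \<open>grad ga - e\<close> is the unnormalised outward
  normal.\<close>

lemma graph_divergence:
 fixes e :: "real^'n::finite" and ph :: "real^'n => 'b::euclidean_space"
 assumes e: "norm e = 1" and ga: "C_diff 1 ga" "!!x t. ga (x + t *\<^sub>R e) = ga x"
  and ph: "C_diff 1 ph" "!!x. norm x > R ==> ph x = 0"
 shows "(LINT x|lborel. indicator {x. x \<bullet> e > ga x} x *\<^sub>R partial j ph x) =
  (LINT x|lborel. indicator {x. 0 < x \<bullet> e \<and> x \<bullet> e < 1} x *\<^sub>R
   (%p. (partial j ga p - e $ j) *\<^sub>R ph p) (x + (ga x - x \<bullet> e) *\<^sub>R e))"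
proof -
 let ?g = "%p. (partial j ga p - e $ j) *\<^sub>R ph p"
 have gac: "continuous_on UNIV ga" by (rule C_diff_cont[OF ga(1)])
 have pc: "continuous_on UNIV (partial j ph)" by (rule C_diff_cont_partial[OF ph(1)])
 have pz: "partial j ph x = 0" if "norm x > R" for x by (rule partial_zero_outside[of R ph, OF ph(2) that])
 have gc: "continuous_on UNIV ?g"
  using C_diff_cont_partial[OF ga(1)] C_diff_cont[OF ph(1)] by (intro continuous_intros)
 let ?h = "%n x. step (real (Suc n) * (x \<bullet> e - ga x))"
 have eq: "(LINT x|lborel. ?h n x *\<^sub>R partial j ph x) = (LINT x|lborel. (hat (real (Suc n) * (x \<bullet> e - ga x)) * real (Suc n)) *\<^sub>R ?g x)" for n
 proof -
  let ?N = "real (Suc n)"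
  have lin: "bounded_linear (%x. x \<bullet> e)" by (rule bounded_linear_inner_left)
  have u: "C_diff 1 (%x. ?N *\<^sub>R (x \<bullet> e - ga x))"
   by (intro C_diff_linear[OF bounded_linear_scaleR_right] C_diff_diff C_diff_bounded_linear[OF lin] ga(1))
  have pu: "partial j (%x. ?N *\<^sub>R (x \<bullet> e - ga x)) x = ?N * (e $ j - partial j ga x)" for x
  proof (rule partial_eqI[THEN trans])
   show "((%x. ?N *\<^sub>R (x \<bullet> e - ga x)) has_derivative (%h. ?N *\<^sub>R (h \<bullet> e - frechet_derivative ga (at x) h))) (at x)"
    using C_diff_D[OF ga(1), of x] unfolding frechet_derivative_works
    by (auto intro!: derivative_eq_intros)
   show "?N *\<^sub>R (axis j 1 \<bullet> e - frechet_derivative ga (at x) (axis j 1)) = ?N * (e $ j - partial j ga x)"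
    by (simp add: partial_def inner_axis')
  qed
  note st = C_diff_1_real_compose[OF u has_real_derivative_step continuous_on_hat]
  have h: "C_diff 1 (?h n)" "partial j (?h n) = (%x. hat (?N * (x \<bullet> e - ga x)) * (?N * (e $ j - partial j ga x)))"
   subgoal using st(1) unfolding real_scaleR_def .
   subgoal using st(2)[of j] unfolding pu unfolding real_scaleR_def .
   done
  have hphi: "C_diff 1 (%x. ?h n x *\<^sub>R ph x)" by (rule C_diff_scaleR[OF h(1) ph(1)])
  have z: "(LINT x|lborel. partial j (%x. ?h n x *\<^sub>R ph x) x) = 0"
   by (rule integral_partial_zero[OF hphi, of R]) (simp add: ph(2))
  have p: "partial j (%x. ?h n x *\<^sub>R ph x) x = ?h n x *\<^sub>R partial j ph x - (hat (?N * (x \<bullet> e - ga x)) * ?N) *\<^sub>R ?g x" for x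
  proof -
   have "partial j (%x. ?h n x *\<^sub>R ph x) x = ?h n x *\<^sub>R partial j ph x + partial j (?h n) x *\<^sub>R ph x"
    by (rule partial_scaleR[OF C_diff_D[OF h(1)] C_diff_D[OF ph(1)]]) auto
   also have "partial j (?h n) x *\<^sub>R ph x = - ((hat (?N * (x \<bullet> e - ga x)) * ?N) *\<^sub>R ?g x)"
    unfolding h(2) by (simp add: algebra_simps)
   finally show ?thesis by simp
  qed
  have c1: "continuous_on UNIV (%x. ?h n x *\<^sub>R partial j ph x)"
   using C_diff_cont[OF h(1)] pc by (intro continuous_intros)
  have i1: "integrable lborel (%x. ?h n x *\<^sub>R partial j ph x)"
   by (rule cvanish_integrable[OF c1, of R]) (simp add: pz)
  have c2: "continuous_on UNIV (%x. (hat (?N * (x \<bullet> e - ga x)) * ?N) *\<^sub>R ?g x)"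
   by (intro continuous_intros continuous_on_compose2[OF continuous_on_hat] gac gc
     C_diff_cont_partial[OF ga(1)] C_diff_cont[OF ph(1)]) auto
  have i2: "integrable lborel (%x. (hat (?N * (x \<bullet> e - ga x)) * ?N) *\<^sub>R ?g x)"
   by (rule cvanish_integrable[OF c2, of R]) (simp add: ph(2))
  show ?thesis using z i1 i2 unfolding p by (simp add: LINT_diff)
 qed
 have "(%n. LINT x|lborel. ?h n x *\<^sub>R partial j ph x) ----> (LINT x|lborel. indicator {x. x \<bullet> e > ga x} x *\<^sub>R partial j ph x)"
 proof (rule integral_dominated_convergence[where w="%x. norm (partial j ph x)"])
  have op: "open {x. x \<bullet> e > ga x}" using gac by (intro open_Collect_less continuous_intros)
  have [measurable]: "partial j ph \<in> borel_measurable borel" "ga \<in> borel_measurable borel" "step \<in> borel_measurable borel"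
   using pc gac continuous_at_imp_continuous_on[of UNIV step] DERIV_isCont[OF has_real_derivative_step]
   by (auto intro!: cont_measurable)
  show "(%x. indicator {x. x \<bullet> e > ga x} x *\<^sub>R partial j ph x) \<in> borel_measurable lborel"
   using borel_open[OF op] by measurable
  show "(%x. ?h n x *\<^sub>R partial j ph x) \<in> borel_measurable lborel" for n by measurable
  show "integrable lborel (%x. norm (partial j ph x))"
   by (intro integrable_norm cvanish_integrable[OF pc pz])
  show "AE x in lborel. (%n. ?h n x *\<^sub>R partial j ph x) ----> indicator {x. x \<bullet> e > ga x} x *\<^sub>R partial j ph x"
  proof (intro AE_I2 tendsto_scaleR tendsto_const)
   fix x
   show "(%n. ?h n x) ----> indicator {x. x \<bullet> e > ga x} x"
   proof (cases "x \<bullet> e > ga x")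
    case True
    obtain M where M: "1 / (x \<bullet> e - ga x) \<le> real M" using real_arch_simple by blast
    have "\<forall>\<^sub>F n in sequentially. ?h n x = 1"
     using eventually_ge_at_top[of M]
    proof eventually_elim
     case (elim n)
     have "1 / (x \<bullet> e - ga x) \<le> real (Suc n)" using M elim by simp
     hence "real (Suc n) * (x \<bullet> e - ga x) \<ge> 1" using True by (simp add: pos_divide_le_eq)
     thus ?case by (rule step_vals(2))
    qed
    with True show ?thesis by (simp add: tendsto_eventually)
   next
    case False
    hence "?h n x = 0" for n by (intro step_vals(1)) (simp add: mult_nonneg_nonpos)
    with False show ?thesis by simp
   qed
  qed
  show "AE x in lborel. norm (?h n x *\<^sub>R partial j ph x) \<le> norm (partial j ph x)" for n
   using step_bound by (auto intro!: mult_left_le_one_le)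
 qed
 moreover have "(%n. LINT x|lborel. ?h n x *\<^sub>R partial j ph x) ---->
  (LINT x|lborel. indicator {x. 0 < x \<bullet> e \<and> x \<bullet> e < 1} x *\<^sub>R ?g (x + (ga x - x \<bullet> e) *\<^sub>R e))"
  unfolding eq by (rule graph_layer_limit[OF e gac ga(2) gc, of R]) (simp add: ph(2))
 ultimately show ?thesis by (rule LIMSEQ_unique)
qed

subsection \<open>Charts of the boundary\<close>

lemma C11_chart_graph:
 assumes "C11_chart Om U e ga"
 shows "open U" "norm e = 1" "!!x t. ga (x + t *\<^sub>R e) = ga x" "!!x. x \<in> U ==> x \<in> Om \<longleftrightarrow> x \<bullet> e > ga x"
  "C_diff 1 ga" "continuous_on UNIV (grad ga)"
proof -
 obtain L where L: "L-lipschitz_on UNIV (grad ga)" using assms by (auto simp: C11_chart_def)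
 show gc: "continuous_on UNIV (grad ga)"
  using lipschitz_on_uniformly_continuous[OF L] uniformly_continuous_imp_continuous by blast
 have "continuous_on UNIV (%x. grad ga x $ k)" for k using gc by (intro continuous_intros)
 hence "continuous_on UNIV (partial k ga)" for k by (simp add: grad_def)
 thus "C_diff 1 ga" using assms by (simp add: C11_chart_def)
 show "open U" "norm e = 1" "!!x t. ga (x + t *\<^sub>R e) = ga x" using assms by (auto simp: C11_chart_def)
 show "x \<in> Om \<longleftrightarrow> x \<bullet> e > ga x" if "x \<in> U" for x
 proof -
  have "x \<in> Om \<inter> U \<longleftrightarrow> x \<in> {x\<in>U. x \<bullet> e > ga x}" using assms by (simp add: C11_chart_def)
  with that show ?thesis by simp
 qed
qed

text \<open>A point of \<open>U\<close> below the graph has a neighbourhood free of the domain. A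
  point on the graph is not in the domain, but moving it slightly along \<open>e\<close> leads into
  the domain.\<close>

lemma chart_frontier:
 assumes ch: "C11_chart Om U e ga" and Om: "open Om" and p: "p \<in> U"
 shows "p \<in> frontier Om \<longleftrightarrow> p \<bullet> e = ga p"
proof -
 note c = C11_chart_graph[OF ch]
 have gac: "continuous_on UNIV ga" using C_diff_cont[OF c(5)] .
 have fr: "frontier Om = closure Om - Om" using Om by (simp add: frontier_def interior_open)
 show ?thesis
 proof
  assume pf: "p \<in> frontier Om"
  hence "p \<notin> Om" using fr by blast
  hence "p \<bullet> e \<le> ga p" using c(4)[OF p] by simp
  moreover have "\<not> p \<bullet> e < ga p"
  proof
   assume that: "p \<bullet> e < ga p"
   let ?W = "U \<inter> {x. x \<bullet> e < ga x}"
   have "open ?W" using c(1) gac by (intro open_Int open_Collect_less continuous_intros)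
   moreover have "?W \<inter> Om = {}" using c(4) by fastforce
   moreover have "p \<in> ?W" using p that by simp
   ultimately have "p \<notin> closure Om" using open_Int_closure_eq_empty[of ?W Om] by blast
   thus False using pf fr by blast
  qed
  ultimately show "p \<bullet> e = ga p" by linarith
 next
  assume eq: "p \<bullet> e = ga p"
  hence "p \<notin> Om" using c(4)[OF p] by simp
  moreover have "p \<in> closure Om"
   unfolding closure_approachable
  proof (intro allI impI)
   fix d :: real assume d: "d > 0"
   obtain r where r: "r > 0" "ball p r \<subseteq> U" using c(1) p openE by blast
   define t where "t = min d r / 2"
   have t: "t > 0" "t < d" "t < r" using d r by (auto simp: t_def)
   have "dist (p + t *\<^sub>R e) p = t" using c(2) t by (simp add: dist_norm)
   moreover have "p + t *\<^sub>R e \<in> U" using r t c(2) by (auto simp: dist_norm subset_iff)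
   moreover have "(p + t *\<^sub>R e) \<bullet> e > ga (p + t *\<^sub>R e)"
    using eq t c(2) c(3) by (simp add: inner_add_left dot_square_norm)
   ultimately show "\<exists>y\<in>Om. dist y p < d" using c(4) t by (intro bexI[of _ "p + t *\<^sub>R e"]) auto
  qed
  ultimately show "p \<in> frontier Om" using fr by blast
 qed
qed

lemma outward_normal_chart:
 assumes "outward_unit_normal Om nu" "C11_chart Om U e ga" "p \<in> U" "p \<in> frontier Om"
 shows "nu p = (grad ga p - e) /\<^sub>R sqrt (1 + (norm (grad ga p))^2)"
 using assms unfolding outward_unit_normal_def by blast

lemma continuous_on_normal:
 assumes "C11_domain Om" "outward_unit_normal Om nu"
 shows "continuous_on (frontier Om) nu"
 unfolding continuous_on_eq_continuous_within
proof
 fix p assume p: "p \<in> frontier Om"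
 obtain U e ga where ch: "p \<in> U" "C11_chart Om U e ga" using assms(1) p unfolding C11_domain_def by blast
 note c = C11_chart_graph[OF ch(2)]
 let ?n = "%p. (grad ga p - e) /\<^sub>R sqrt (1 + (norm (grad ga p))^2)"
 have nz: "sqrt (1 + (norm (grad ga p))^2) \<noteq> 0" for p
 proof -
  have "1 + (norm (grad ga p))^2 > 0" by (rule add_pos_nonneg) simp_all
  thus ?thesis by simp
 qed
 have "continuous_on UNIV ?n" using c(6) nz by (intro continuous_intros) auto
 hence cn: "continuous (at p within frontier Om) ?n"
  using continuous_on_eq_continuous_at[OF open_UNIV] continuous_at_imp_continuous_at_within by blast
 obtain d where d: "d > 0" "ball p d \<subseteq> U" by (rule openE[OF c(1) ch(1)])
 show "continuous (at p within frontier Om) nu"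
 proof (rule continuous_transform_within[OF cn d(1) p])
  fix q assume q: "q \<in> frontier Om" "dist q p < d"
  hence "q \<in> U" using d(2) by (auto simp: dist_commute subset_iff)
  from outward_normal_chart[OF assms(2) ch(2) this q(1)] show "?n q = nu q" by simp
 qed
qed

lemma grad_invariant:
 assumes "!!x t. ga (x + t *\<^sub>R e) = ga x" "!!x. ga differentiable at x"
 shows "partial k ga (x + t *\<^sub>R e) = partial k ga x"
 using partial_affine[of ga "t *\<^sub>R e" 1 x k] assms by (simp add: add.commute)

subsection \<open>Surface integrals\<close>

lemma surface_space: "surface_measure Om sg ==> space sg = frontier Om"
 unfolding surface_measure_def using sets_eq_imp_space_eq[of sg "restrict_space borel (frontier Om)"]
 by (simp add: space_restrict_space)

lemma surface_sets:
 assumes "surface_measure Om sg"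
 shows "E \<in> sets sg \<longleftrightarrow> E \<in> sets borel \<and> E \<subseteq> frontier Om"
proof -
 have "frontier Om \<in> sets borel" by (simp add: frontier_closed borel_closed)
 moreover have "sets sg = sets (restrict_space borel (frontier Om))" using assms by (simp add: surface_measure_def)
 ultimately show ?thesis by (auto simp: sets_restrict_space_iff)
qed

lemma surface_measure_chart:
 assumes "surface_measure Om sg" "C11_chart Om U e ga" "E \<in> sets sg" "E \<subseteq> U"
 shows "emeasure sg E = (\<integral>\<^sup>+x. indicator {x. 0 < x \<bullet> e \<and> x \<bullet> e < 1} x
  * indicator E (x + (ga x - x \<bullet> e) *\<^sub>R e) * ennreal (sqrt (1 + (norm (grad ga x))^2)) \<partial>lborel)"
 using assms(1)[unfolded surface_measure_def, THEN conjunct2, rule_format, OF assms(2-4)] .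

lemma surface_measurable_continuous:
 fixes f :: "real^'n::finite => 'b::euclidean_space"
 assumes "surface_measure Om sg" "continuous_on (frontier Om) f"
 shows "f \<in> borel_measurable sg"
proof -
 have "f \<in> borel_measurable (restrict_space borel (frontier Om))"
  by (rule borel_measurable_continuous_on_restrict[OF assms(2)])
 thus ?thesis
  using assms(1) by (simp add: surface_measure_def measurable_cong_sets[of sg "restrict_space borel (frontier Om)"])
qed

text \<open>Near a boundary point the surface density is bounded on the part of the slab lying over
  a small ball; this part is bounded since the slab has width one. Compactness of the boundary
  reduces everything to finitely many balls.\<close>

lemma surface_measure_finite:
 assumes dom: "C11_domain Om" "bounded Om" and sg: "surface_measure Om sg"
 shows "finite_measure sg"
proof -
 have cf: "compact (frontier Om)" using dom(2) by (simp add: compact_frontier_bounded)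
 have loc: "\<exists>r>0. emeasure sg (frontier Om \<inter> ball p r) < \<infinity>" if p: "p \<in> frontier Om" for p
 proof -
  obtain U e ga where ch: "p \<in> U" "C11_chart Om U e ga" using dom(1) p unfolding C11_domain_def by blast
  note c = C11_chart_graph[OF ch(2)]
  obtain r where r: "r > 0" "ball p r \<subseteq> U" using c(1) ch(1) openE by blast
  let ?E = "frontier Om \<inter> ball p r"
  have E: "?E \<in> sets sg" unfolding surface_sets[OF sg] by (simp add: borel_closed frontier_closed)
  have sq: "continuous_on UNIV (%x. sqrt (1 + (norm (grad ga x))^2))" using c(6) by (intro continuous_intros)
  define R where "R = norm p + r + 1"
  obtain C where C: "!!x. x \<in> cball 0 R ==> sqrt (1 + (norm (grad ga x))^2) \<le> C"
  proof -
   have "compact ((%x. sqrt (1 + (norm (grad ga x))^2)) ` cball 0 R)"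
    by (intro compact_continuous_image continuous_on_subset[OF sq]) auto
   from compact_imp_bounded[OF this]
   obtain C where C: "\<forall>y\<in>(%x. sqrt (1 + (norm (grad ga x))^2)) ` cball 0 R. norm y \<le> C"
    unfolding bounded_iff by (rule exE)
   show ?thesis
   proof (rule that[of C])
    fix x :: "real^'a" assume "x \<in> cball 0 R"
    hence "norm (sqrt (1 + (norm (grad ga x))^2)) \<le> C" using C by simp
    thus "sqrt (1 + (norm (grad ga x))^2) \<le> C" by simp
   qed
  qed
  have "emeasure sg ?E = (\<integral>\<^sup>+x. indicator {x. 0 < x \<bullet> e \<and> x \<bullet> e < 1} x
    * indicator ?E (x + (ga x - x \<bullet> e) *\<^sub>R e) * ennreal (sqrt (1 + (norm (grad ga x))^2)) \<partial>lborel)"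
   by (rule surface_measure_chart[OF sg ch(2) E]) (use r(2) in blast)
  also have "... \<le> (\<integral>\<^sup>+x. ennreal C * indicator (cball (0::real^'a) R) x \<partial>lborel)"
  proof (rule nn_integral_mono)
   fix x
   show "indicator {x. 0 < x \<bullet> e \<and> x \<bullet> e < 1} x * indicator ?E (x + (ga x - x \<bullet> e) *\<^sub>R e) * ennreal (sqrt (1 + (norm (grad ga x))^2))
    \<le> ennreal C * indicator (cball (0::real^'a) R) x"
   proof (cases "0 < x \<bullet> e \<and> x \<bullet> e < 1 \<and> x + (ga x - x \<bullet> e) *\<^sub>R e \<in> ?E")
    case True
    let ?y = "x + (ga x - x \<bullet> e) *\<^sub>R e"
    have "norm ?y < norm p + r" using True norm_triangle_ineq2[of ?y p] by (auto simp: dist_norm norm_minus_commute)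
    moreover have yx: "?y - (?y \<bullet> e) *\<^sub>R e = x - (x \<bullet> e) *\<^sub>R e"
     using c(2) by (simp add: inner_add_left dot_square_norm algebra_simps)
    have "norm (x - (x \<bullet> e) *\<^sub>R e) \<le> norm ?y" using norm_orthogonal_part_le[OF c(2), of ?y] unfolding yx .
    moreover have "norm x \<le> norm (x - (x \<bullet> e) *\<^sub>R e) + norm ((x \<bullet> e) *\<^sub>R e)"
     using norm_triangle_ineq[of "x - (x \<bullet> e) *\<^sub>R e" "(x \<bullet> e) *\<^sub>R e"] by simp
    moreover have "norm ((x \<bullet> e) *\<^sub>R e) < 1" using True c(2) by simp
    ultimately have "norm x \<le> R" unfolding R_def by linarith
    thus ?thesis using True C[of x] by (simp add: ennreal_leI)
   next
    case False
    thus ?thesis by (auto simp: indicator_def)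
   qed
  qed
  also have "... = ennreal C * emeasure lborel (cball (0::real^'a) R)" by (simp add: nn_integral_cmult_indicator)
  also have "... < \<infinity>" using emeasure_lborel_cball_finite[of "0::real^'a" R] by (simp add: ennreal_mult_less_top)
  finally show ?thesis using r(1) by blast
 qed
 then obtain r where r: "!!p. p \<in> frontier Om ==> r p > 0" "!!p. p \<in> frontier Om ==> emeasure sg (frontier Om \<inter> ball p (r p)) < \<infinity>"
  by metis
 obtain C where C: "C \<subseteq> frontier Om" "finite C" "frontier Om \<subseteq> (\<Union>p\<in>C. ball p (r p))"
  by (rule compactE_image[OF cf, of "frontier Om" "%p. ball p (r p)"]) (use r(1) in force)+
 have "emeasure sg (space sg) \<le> (\<Sum>p\<in>C. emeasure sg (frontier Om \<inter> ball p (r p)))"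
 proof -
  have "space sg = (\<Union>p\<in>C. frontier Om \<inter> ball p (r p))" using C(3) surface_space[OF sg] by auto
  thus ?thesis
   using emeasure_subadditive_finite[OF C(2), of "%p. frontier Om \<inter> ball p (r p)" sg]
   by (auto simp: surface_sets[OF sg] image_subset_iff borel_closed frontier_closed)
 qed
 also have "... < \<infinity>" using r(2) C(1,2) by (simp add: subset_iff)
 finally show ?thesis by (intro finite_measureI) simp
qed

lemma surface_integrable:
 fixes f :: "real^'n::finite => 'b::euclidean_space"
 assumes dom: "C11_domain Om" "bounded Om" and sg: "surface_measure Om sg" and f: "continuous_on (frontier Om) f"
 shows "integrable sg f"
proof -
 interpret finite_measure sg by (rule surface_measure_finite[OF dom sg])
 have "compact (f ` frontier Om)" using dom(2) f by (intro compact_continuous_image compact_frontier_bounded)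
 from compact_imp_bounded[OF this] obtain C where "\<forall>y\<in>f ` frontier Om. norm y \<le> C"
  unfolding bounded_iff by (rule exE)
 hence "AE x in sg. norm (f x) \<le> C" by (intro AE_I2) (simp add: surface_space[OF sg])
 thus ?thesis by (rule integrable_const_bound) (rule surface_measurable_continuous[OF sg f])
qed

text \<open>The specification of the surface measure speaks of sets only. It says that the
  restriction to \<open>K\<close> is the image of a weighted Lebesgue measure under the projection
  \<open>?P\<close> onto the graph; written as an equality of measures with density
  \<open>indicator K\<close>, this carries over to integrals.\<close>

lemma surface_integral_chart:
 fixes f :: "real^'n::finite => 'b::euclidean_space"
 assumes sg: "surface_measure Om sg" and Om: "open Om" and ch: "C11_chart Om U e ga"
  and K: "K \<in> sets borel" "K \<subseteq> U" and f: "f \<in> borel_measurable borel" "!!x. x \<notin> K ==> f x = 0"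
 shows "(LINT x|sg. f x) = (LINT x|lborel. indicator {x. 0 < x \<bullet> e \<and> x \<bullet> e < 1} x *\<^sub>R
   (sqrt (1 + (norm (grad ga x))^2) *\<^sub>R f (x + (ga x - x \<bullet> e) *\<^sub>R e)))"
proof -
 note c = C11_chart_graph[OF ch]
 let ?S = "{x. 0 < x \<bullet> e \<and> x \<bullet> e < 1}"
 let ?P = "%x. x + (ga x - x \<bullet> e) *\<^sub>R e"
 let ?w = "%x. sqrt (1 + (norm (grad ga x))^2)"
 have Km[measurable]: "K \<in> sets borel" by fact
 have fm[measurable]: "f \<in> borel_measurable borel" by fact
 have [measurable]: "ga \<in> borel_measurable borel" "grad ga \<in> borel_measurable borel"
  using C_diff_cont[OF c(5)] c(6) by (auto intro: cont_measurable)
 have idm: "(%x. x) \<in> measurable sg borel"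
  by (rule surface_measurable_continuous[OF sg]) (rule continuous_on_id)
 define sg1 where "sg1 = distr sg borel (%x. x)"
 define N where "N = distr (density lborel (%x. indicator ?S x * ennreal (?w x))) borel ?P"
 have Pm[measurable]: "?P \<in> borel \<rightarrow>\<^sub>M borel" by measurable
 have PU: "?P x \<in> frontier Om" if "?P x \<in> U" for x
  unfolding chart_frontier[OF ch Om that] using c(2,3) by (simp add: inner_add_left dot_square_norm)
 have "density sg1 (indicator K) = density N (indicator K)"
 proof (rule measure_eqI)
  show "sets (density sg1 (indicator K)) = sets (density N (indicator K))" by (simp add: sg1_def N_def)
  fix A assume "A \<in> sets (density sg1 (indicator K))"
  hence A[measurable]: "A \<in> sets borel" by (simp add: sg1_def)
  have KA: "K \<inter> A \<inter> frontier Om \<in> sets sg" unfolding surface_sets[OF sg] by (auto simp: borel_closed frontier_closed)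
  have "emeasure (density sg1 (indicator K)) A = emeasure sg1 (K \<inter> A)"
   by (rule emeasure_restricted) (simp_all add: sg1_def)
  also have "... = emeasure sg (K \<inter> A \<inter> frontier Om)"
   unfolding sg1_def by (subst emeasure_distr[OF idm]) (auto simp: surface_space[OF sg])
  also have "... = (\<integral>\<^sup>+x. indicator ?S x * indicator (K \<inter> A \<inter> frontier Om) (?P x) * ennreal (?w x) \<partial>lborel)"
   by (rule surface_measure_chart[OF sg ch KA]) (use K(2) in blast)
  also have "... = (\<integral>\<^sup>+x. (indicator ?S x * ennreal (?w x)) * indicator (K \<inter> A) (?P x) \<partial>lborel)"
   using PU K(2) by (intro nn_integral_cong) (auto simp: indicator_def)
  also have "... = (\<integral>\<^sup>+x. indicator (K \<inter> A) (?P x) \<partial>density lborel (%x. indicator ?S x * ennreal (?w x)))"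
   by (rule nn_integral_density[symmetric]) measurable
  also have "... = emeasure N (K \<inter> A)"
   unfolding N_def by (subst nn_integral_distr[symmetric, of ?P _ borel]) auto
  also have "... = emeasure (density N (indicator K)) A"
   by (rule emeasure_restricted[symmetric]) (simp_all add: N_def)
  finally show "emeasure (density sg1 (indicator K)) A = emeasure (density N (indicator K)) A" .
 qed
 hence eq: "(LINT x|density sg1 (indicator K). f x) = (LINT x|density N (indicator K). f x)" by simp
 have fK: "indicator K x *\<^sub>R f x = f x" for x using f(2)[of x] by (auto simp: indicator_def)
 have d: "(LINT x|density M (indicator K). f x) = (LINT x|M. f x)" if "sets M = sets borel" for M
 proof -
  have m1: "f \<in> borel_measurable M" "K \<in> sets M" using that fm by (auto simp: measurable_cong_sets[OF that])
  have "density M (indicator K) = density M (%x. ennreal (indicator K x))" by (simp add: ennreal_indicator)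
  hence "(LINT x|density M (indicator K). f x) = (LINT x|M. indicator K x *\<^sub>R f x)"
   using m1 by (simp add: integral_density)
  thus ?thesis by (simp add: fK)
 qed
 have "(LINT x|sg. f x) = (LINT x|sg1. f x)" unfolding sg1_def by (rule integral_distr[symmetric, OF idm fm])
 also have "... = (LINT x|N. f x)" using eq d[of sg1] d[of N] by (simp add: sg1_def N_def)
 also have "... = (LINT x|density lborel (%x. indicator ?S x * ennreal (?w x)). f (?P x))"
  unfolding N_def by (rule integral_distr) measurable
 also have "density lborel (%x. indicator ?S x * ennreal (?w x)) = density lborel (%x. ennreal (indicator ?S x * ?w x))"
  by (intro density_cong) (auto simp: indicator_def)
 also have "(LINT x|density lborel (%x. ennreal (indicator ?S x * ?w x)). f (?P x)) = (LINT x|lborel. (indicator ?S x * ?w x) *\<^sub>R f (?P x))"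
  by (rule integral_density) (auto intro!: AE_I2)
 finally show ?thesis by simp
qed


subsection \<open>Localization\<close>

text \<open>A partition of unity made from finitely many bumps: each \<open>be i\<close> is its bump
  times the product of one minus the earlier bumps. The sums telescope to one minus the full
  product, and the product vanishes on \<open>C\<close> because at each point some bump equals
  1.\<close>

lemma smooth_localization:
 fixes rh :: "real^'n::finite => real" and C :: "(real^'n) set"
 assumes rh: "smooth rh" "supp rh \<subseteq> cball 0 1" "(LINT x|lborel. rh x) = 1"
  and C: "compact C" and r: "!!p. p \<in> C ==> r p > 0"
 shows "\<exists>(N::nat) q be. (\<forall>i<N. q i \<in> C \<and> smooth (be i) \<and> supp (be i) \<subseteq> cball (q i) (2 * r (q i))) \<and>
  (\<forall>x\<in>C. (\<Sum>i<N. be i x :: real) = 1)"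
proof -
 obtain D where D: "D \<subseteq> C" "finite D" "C \<subseteq> (\<Union>p\<in>D. ball p (r p))"
  by (rule compactE_image[OF C, of C "%p. ball p (r p)"]) (use r in force)+
 obtain N q where q: "D = q ` {i. i < (N::nat)}" using finite_imp_nat_seg_image_inj_on[OF D(2)] by blast
 have qC: "q i \<in> C" if "i < N" for i using q D(1) that by blast
 have "\<exists>th :: real^'n => real. smooth th \<and> (\<forall>x\<in>ball p (r p). th x = 1) \<and> supp th \<subseteq> cball p (2 * r p)" if "p \<in> C" for p
  by (rule smooth_bump[OF rh r[OF that]])
 then obtain th :: "real^'n => real^'n => real" where th: "!!p. p \<in> C ==> smooth (th p)"
  "!!p x. p \<in> C ==> x \<in> ball p (r p) ==> th p x = 1" "!!p. p \<in> C ==> supp (th p) \<subseteq> cball p (2 * r p)"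
  by metis
 define be where "be i x = th (q i) x * (\<Prod>j<i. 1 - th (q j) x)" for i x
 have sm: "smooth (be i)" if i: "i < N" for i
 proof -
  have "C_diff m (be i)" for m unfolding be_def[abs_def]
   by (intro C_diff_mult C_diff_prod C_diff_diff C_diff_const smooth_C_diff th(1) qC) (use i in auto)
  thus ?thesis by (simp add: smooth_def)
 qed
 have su: "supp (be i) \<subseteq> cball (q i) (2 * r (q i))" if i: "i < N" for i
 proof -
  have "{x. be i x \<noteq> 0} \<subseteq> {x. th (q i) x \<noteq> 0}" by (auto simp: be_def)
  hence "supp (be i) \<subseteq> supp (th (q i))" unfolding supp_def by (rule closure_mono)
  thus ?thesis using th(3)[OF qC[OF i]] by blast
 qed
 have tel: "(\<Sum>i<M. be i x) = 1 - (\<Prod>j<M. 1 - th (q j) x)" for M x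
  by (induction M) (auto simp: be_def algebra_simps)
 have "(\<Sum>i<N. be i x) = 1" if x: "x \<in> C" for x
 proof -
  obtain i where i: "i < N" "x \<in> ball (q i) (r (q i))" using D(3) x q by blast
  have "(\<Prod>j<N. 1 - th (q j) x) = 0"
   using i th(2)[OF qC[OF i(1)] i(2)] by (intro prod_zero bexI[of _ i]) auto
  thus ?thesis by (simp add: tel)
 qed
 thus ?thesis using qC sm su by (intro exI[of _ N] exI[of _ q] exI[of _ be]) simp
qed

subsection \<open>Divergence theorem\<close>

lemma LINT_lebesgue_on:
 fixes f :: "'a::euclidean_space => 'b::euclidean_space"
 assumes "S \<in> sets borel" "f \<in> borel_measurable borel"
 shows "(LINT x|lebesgue_on S. f x) = (LINT x|lborel. indicator S x *\<^sub>R f x)"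
proof -
 have "(LINT x|lebesgue_on S. f x) = (LINT x|lebesgue. indicator S x *\<^sub>R f x)"
  by (rule integral_restrict_space) (use assms(1) in auto)
 also have "... = (LINT x|lborel. indicator S x *\<^sub>R f x)"
  by (rule integral_completion) (use assms in measurable)
 finally show ?thesis .
qed

lemma divergence_theorem_interior:
 fixes f :: "real^'n::finite => 'b::euclidean_space"
 assumes Om: "open Om" "bounded Om" and sg: "surface_measure Om sg"
  and f: "C_diff 1 f" "supp f \<subseteq> Om"
 shows "(LINT x|lebesgue_on Om. partial j f x) = 0" "(LINT x|sg. nu x $ j *\<^sub>R f x) = 0"
proof -
 obtain R where R: "!!x. x \<in> Om ==> norm x \<le> R" using Om(2) unfolding bounded_iff by blast
 have fz: "f x = 0" if "norm x > R" for x using R f(2) that not_in_supp[of x f] by force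
 have "partial j f x = 0" if "x \<notin> Om" for x
  using that f(2) supp_partial[of j f] by (intro not_in_supp) blast
 hence "indicator Om x *\<^sub>R partial j f x = partial j f x" for x by (auto simp: indicator_def)
 hence "(LINT x|lebesgue_on Om. partial j f x) = (LINT x|lborel. partial j f x)"
  using cont_measurable[OF C_diff_cont_partial[OF f(1)]] borel_open[OF Om(1)]
  by (simp add: LINT_lebesgue_on)
 thus "(LINT x|lebesgue_on Om. partial j f x) = 0" using integral_partial_zero[of f R j, OF f(1) fz] by simp
 have "f x = 0" if "x \<in> space sg" for x
 proof -
  have "x \<notin> Om" using that Om(1) by (simp add: surface_space[OF sg] frontier_def interior_open)
  thus ?thesis using f(2) by (intro not_in_supp) blast
 qed
 hence "(LINT x|sg. nu x $ j *\<^sub>R f x) = (LINT x|sg. 0)" by (intro LINT_cong) auto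
 thus "(LINT x|sg. nu x $ j *\<^sub>R f x) = 0" by simp
qed

text \<open>The surface density cancels the normalisation of \<open>nu\<close> and leaves the vector
  \<open>grad ga - e\<close> of \<open>graph_divergence\<close>. Since \<open>ga\<close> is constant
  along \<open>e\<close>, so is its gradient, which may therefore be taken at the graph
  point.\<close>

lemma divergence_theorem_chart:
 fixes f :: "real^'n::finite => 'b::euclidean_space"
 assumes Om: "open Om" and sg: "surface_measure Om sg" and nu: "outward_unit_normal Om nu" and ch: "C11_chart Om U e ga"
  and f: "C_diff 1 f" "compact (supp f)" "supp f \<subseteq> U"
 shows "(LINT x|lebesgue_on Om. partial j f x) = (LINT x|sg. nu x $ j *\<^sub>R f x)"
proof -
 note c = C11_chart_graph[OF ch]
 let ?S = "{x. 0 < x \<bullet> e \<and> x \<bullet> e < 1}"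
 let ?P = "%x. x + (ga x - x \<bullet> e) *\<^sub>R e"
 let ?w = "%x. sqrt (1 + (norm (grad ga x))^2)"
 obtain R where R: "!!x. norm x > R ==> f x = 0" using compact_supp_vanish[OF f(2)] by blast
 have w0: "?w x > 0" for x by (simp add: add_pos_nonneg)
 have wc: "continuous_on UNIV ?w" using c(6) by (intro continuous_intros)
 have pz: "partial j f x = 0" if "x \<notin> U" for x
  using that f(3) supp_partial[of j f] by (intro not_in_supp) blast
 have "indicator Om x *\<^sub>R partial j f x = indicator {x. x \<bullet> e > ga x} x *\<^sub>R partial j f x" for x
  using c(4)[of x] pz[of x] by (cases "x \<in> U") (auto simp: indicator_def)
 hence "(LINT x|lborel. indicator Om x *\<^sub>R partial j f x) = (LINT x|lborel. indicator {x. x \<bullet> e > ga x} x *\<^sub>R partial j f x)"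
  by presburger
 hence "(LINT x|lebesgue_on Om. partial j f x) = (LINT x|lborel. indicator {x. x \<bullet> e > ga x} x *\<^sub>R partial j f x)"
  using LINT_lebesgue_on[OF borel_open[OF Om] cont_measurable[OF C_diff_cont_partial[OF f(1)]]] by simp
 also have "... = (LINT x|lborel. indicator ?S x *\<^sub>R (%p. (partial j ga p - e $ j) *\<^sub>R f p) (?P x))"
  by (rule graph_divergence[OF c(2) c(5) c(3) f(1) R])
 also have "... = (LINT x|lborel. indicator ?S x *\<^sub>R (?w x *\<^sub>R ((grad ga (?P x) - e) $ j / ?w (?P x)) *\<^sub>R f (?P x)))"
 proof (rule LINT_cong[OF refl])
  fix x
  have "grad ga (?P x) = grad ga x"
   unfolding grad_def using grad_invariant[of ga e _ x, OF c(3) C_diff_D[OF c(5)]] by simp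
  hence "?w (?P x) = ?w x" "?w x \<noteq> 0" using w0[of x] by auto
  hence "?w x * ((grad ga (?P x) - e) $ j / ?w (?P x)) = partial j ga (?P x) - e $ j"
   by (simp add: grad_def)
  thus "indicator ?S x *\<^sub>R (%p. (partial j ga p - e $ j) *\<^sub>R f p) (?P x)
   = indicator ?S x *\<^sub>R (?w x *\<^sub>R ((grad ga (?P x) - e) $ j / ?w (?P x)) *\<^sub>R f (?P x))"
   by (simp only: scaleR_scaleR)
 qed
 also have "... = (LINT x|sg. ((grad ga x - e) $ j / ?w x) *\<^sub>R f x)"
 proof (rule surface_integral_chart[OF sg Om ch _ f(3), symmetric])
  show "supp f \<in> sets borel" using f(2) by (simp add: borel_closed compact_imp_closed)
  have "?w x \<noteq> 0" for x using w0[of x] by simp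
  hence "continuous_on UNIV (%x. ((grad ga x - e) $ j / ?w x) *\<^sub>R f x)"
   using c(6) C_diff_cont[OF f(1)] by (intro continuous_intros) auto
  thus "(%x. ((grad ga x - e) $ j / ?w x) *\<^sub>R f x) \<in> borel_measurable borel" by (rule cont_measurable)
  show "((grad ga x - e) $ j / ?w x) *\<^sub>R f x = 0" if "x \<notin> supp f" for x using not_in_supp[OF that] by simp
 qed
 also have "... = (LINT x|sg. nu x $ j *\<^sub>R f x)"
 proof (rule LINT_cong[OF refl])
  fix x assume x: "x \<in> space sg"
  show "((grad ga x - e) $ j / ?w x) *\<^sub>R f x = nu x $ j *\<^sub>R f x"
  proof (cases "x \<in> U")
   case True
   have "nu x = (grad ga x - e) /\<^sub>R ?w x"
    by (rule outward_normal_chart[OF nu ch True]) (use x in \<open>simp add: surface_space[OF sg]\<close>)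
   thus ?thesis by (simp add: divide_inverse mult.commute)
  next
   case False
   hence "f x = 0" using f(3) by (intro not_in_supp) blast
   thus ?thesis by simp
  qed
 qed
 finally show ?thesis .
qed

text \<open>The members of a partition of unity on the closure are supported either in the domain or
  in a single chart. Their products with \<open>f\<close> add up to \<open>f\<close> on an open set,
  hence so do the derivatives.\<close>

lemma divergence_theorem_partial:
 fixes f :: "real^'n::finite => 'b::euclidean_space" and rh :: "real^'n => real"
 assumes rh: "smooth rh" "supp rh \<subseteq> cball 0 1" "(LINT x|lborel. rh x) = 1"
  and dom: "C11_domain Om" "bounded Om" and sg: "surface_measure Om sg" and nu: "outward_unit_normal Om nu"
  and f: "C_diff 1 f"
 shows "(LINT x|lebesgue_on Om. partial j f x) = (LINT x|sg. nu x $ j *\<^sub>R f x)"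
proof -
 have Om: "open Om" using dom(1) by (simp add: C11_domain_def)
 have "\<exists>r>0. cball p (2 * r) \<subseteq> Om \<or> (\<exists>U e ga. C11_chart Om U e ga \<and> cball p (2 * r) \<subseteq> U)" if p: "p \<in> closure Om" for p
 proof (cases "p \<in> Om")
  case True
  obtain d where d: "d > 0" "cball p d \<subseteq> Om" using Om True unfolding open_contains_cball by blast
  thus ?thesis by (intro exI[of _ "d/2"]) auto
 next
  case False
  hence "p \<in> frontier Om" using p Om by (simp add: frontier_def interior_open)
  then obtain U e ga where U: "p \<in> U" "C11_chart Om U e ga" using dom(1) unfolding C11_domain_def by blast
  have "open U" by (rule C11_chart_graph(1)[OF U(2)])
  then obtain d where d: "d > 0" "cball p d \<subseteq> U" using U(1) unfolding open_contains_cball by blast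
  have "cball p (2 * (d/2)) \<subseteq> U" using d by simp
  thus ?thesis using U(2) d(1) half_gt_zero[OF d(1)] by blast
 qed
 then obtain r where r: "!!p. p \<in> closure Om ==> r p > 0"
  "!!p. p \<in> closure Om ==> cball p (2 * r p) \<subseteq> Om \<or> (\<exists>U e ga. C11_chart Om U e ga \<and> cball p (2 * r p) \<subseteq> U)"
  by metis
 have cc: "compact (closure Om)" using dom(2) by (simp add: compact_closure)
 obtain N :: nat and q be where be: "\<forall>i<N. q i \<in> closure Om \<and> smooth (be i) \<and> supp (be i) \<subseteq> cball (q i) (2 * r (q i))"
  "\<forall>x\<in>closure Om. (\<Sum>i<N. be i x :: real) = 1"
 proof -
  have "\<exists>(N::nat) q be. (\<forall>i<N. q i \<in> closure Om \<and> smooth (be i) \<and> supp (be i) \<subseteq> cball (q i) (2 * r (q i))) \<and>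
   (\<forall>x\<in>closure Om. (\<Sum>i<N. be i x :: real) = 1)"
   using r(1) by (rule smooth_localization[OF rh cc])
  thus ?thesis using that by blast
 qed
 let ?f = "%i x. be i x *\<^sub>R f x"
 have fi: "C_diff 1 (?f i)" if "i < N" for i using be(1) that by (intro C_diff_scaleR f smooth_C_diff) auto
 have sf: "supp (?f i) \<subseteq> cball (q i) (2 * r (q i))" if "i < N" for i
 proof -
  have "supp (?f i) \<subseteq> supp (be i)" unfolding supp_def by (intro closure_mono) auto
  thus ?thesis using be(1) that by blast
 qed
 have loc: "(LINT x|lebesgue_on Om. partial j (?f i) x) = (LINT x|sg. nu x $ j *\<^sub>R ?f i x)" if i: "i < N" for i
 proof -
  have qi: "q i \<in> closure Om" using be(1) i by blast
  from r(2)[OF qi] show ?thesis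
  proof
   assume "cball (q i) (2 * r (q i)) \<subseteq> Om"
   hence "supp (?f i) \<subseteq> Om" using sf[OF i] by blast
   from divergence_theorem_interior[OF Om dom(2) sg fi[OF i] this] show ?thesis by simp
  next
   assume "\<exists>U e ga. C11_chart Om U e ga \<and> cball (q i) (2 * r (q i)) \<subseteq> U"
   then obtain U e ga where U: "C11_chart Om U e ga" "cball (q i) (2 * r (q i)) \<subseteq> U" by blast
   have "compact (supp (?f i))"
    using compact_Int_closed[OF compact_cball, of "supp (?f i)" "q i" "2 * r (q i)"] sf[OF i]
    by (simp add: supp_def inf.absorb2)
   thus ?thesis by (rule divergence_theorem_chart[OF Om sg nu U(1) fi[OF i]]) (use sf[OF i] U(2) in blast)
  qed
 qed
 have pc: "continuous_on UNIV (partial j (?f i))" if "i < N" for i by (rule C_diff_cont_partial[OF fi[OF that]])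
 have "partial j f x = (\<Sum>i<N. partial j (?f i) x)" if x: "x \<in> Om" for x
 proof -
  have "partial j f x = partial j (%x. \<Sum>i<N. ?f i x) x"
  proof (rule partial_local[OF Om x])
   fix z assume "z \<in> Om"
   hence "z \<in> closure Om" using closure_subset by blast
   thus "f z = (\<Sum>i<N. ?f i z)" using be(2) by (simp add: scaleR_left.sum[symmetric])
  qed
  also have "... = (\<Sum>i<N. partial j (?f i) x)"
   by (rule partial_eqI[THEN trans, OF has_derivative_sum[OF has_derivative_sum_partial[OF C_diff_D[OF fi]]]])
    (auto simp: axis_def if_distrib[of "%c. c *\<^sub>R _"] sum.delta cong: if_cong)
  finally show ?thesis .
 qed
 hence "(LINT x|lebesgue_on Om. partial j f x) = (LINT x|lebesgue_on Om. (\<Sum>i<N. partial j (?f i) x))"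
  by (intro LINT_cong) auto
 also have "... = (\<Sum>i<N. LINT x|lebesgue_on Om. partial j (?f i) x)"
 proof (rule Bochner_Integration.integral_sum)
  fix i assume "i \<in> {..<N}"
  hence i: "i < N" by simp
  have "integrable lborel (partial j (?f i))"
  proof (rule cvanish_integrable[OF pc[OF i], where R="norm (q i) + 2 * r (q i)"])
   fix x :: "real^'n" assume x: "norm x > norm (q i) + 2 * r (q i)"
   have "x \<notin> cball (q i) (2 * r (q i))"
    using x norm_triangle_ineq2[of x "q i"] by (simp add: dist_norm norm_minus_commute)
   thus "partial j (?f i) x = 0" using sf[OF i] supp_partial[of j "?f i"] by (intro not_in_supp) blast
  qed
  hence "integrable lebesgue (partial j (?f i))" by (simp add: integrable_completion borel_measurable_integrable)
  hence "integrable lebesgue (%x. indicator Om x *\<^sub>R partial j (?f i) x)"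
   by (rule integrable_mult_indicator[rotated]) (simp add: borel_open[OF Om])
  thus "integrable (lebesgue_on Om) (partial j (?f i))"
   by (subst integrable_restrict_space) (simp_all add: borel_open[OF Om])
 qed
 also have "... = (\<Sum>i<N. LINT x|sg. nu x $ j *\<^sub>R ?f i x)" using loc by simp
 also have "... = (LINT x|sg. (\<Sum>i<N. nu x $ j *\<^sub>R ?f i x))"
 proof (rule Bochner_Integration.integral_sum[symmetric])
  fix i assume "i \<in> {..<N}"
  hence "continuous_on UNIV (?f i)" using C_diff_cont[OF fi] by simp
  from continuous_on_subset[OF this subset_UNIV] have "continuous_on (frontier Om) (?f i)" .
  with continuous_on_component[OF continuous_on_normal[OF dom(1) nu]]
  have "continuous_on (frontier Om) (%x. nu x $ j *\<^sub>R ?f i x)" by (rule continuous_on_scaleR)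
  thus "integrable sg (%x. nu x $ j *\<^sub>R ?f i x)" by (rule surface_integrable[OF dom sg])
 qed
 also have "... = (LINT x|sg. nu x $ j *\<^sub>R f x)"
 proof (rule LINT_cong[OF refl])
  fix x assume "x \<in> space sg"
  hence "x \<in> closure Om" by (simp add: surface_space[OF sg] frontier_def)
  hence "(\<Sum>i<N. be i x) = 1" using be(2) by blast
  thus "(\<Sum>i<N. nu x $ j *\<^sub>R ?f i x) = nu x $ j *\<^sub>R f x"
   by (simp add: scaleR_sum_right[symmetric] scaleR_left.sum[symmetric] del: scaleR_scaleR)
 qed
 finally show ?thesis .
qed

theorem divergence_theorem:
 fixes F :: "real^'n::finite => complex^'n" and rh :: "real^'n => real"
 assumes rh: "smooth rh" "supp rh \<subseteq> cball 0 1" "(LINT x|lborel. rh x) = 1"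
  and dom: "C11_domain Om" "bounded Om" and sg: "surface_measure Om sg" and nu: "outward_unit_normal Om nu"
  and F: "C_diff 1 F"
 shows "(LINT x|lebesgue_on Om. cdiv F x) = (LINT x|sg. cdot (F x) (cvec (nu x)))"
proof -
 have Om: "open Om" using dom(1) by (simp add: C11_domain_def)
 have Fk: "C_diff 1 (%x. F x $ k)" for k by (rule C_diff_nth[OF F])
 have i1: "integrable (lebesgue_on Om) g" if g: "continuous_on UNIV g" for g :: "real^'n => complex"
 proof -
  have "integrable lborel (%x. indicator (closure Om) x *\<^sub>R g x)"
   using dom(2) by (intro borel_integrable_compact continuous_on_subset[OF g]) (auto simp: compact_closure)
  hence "integrable lebesgue (%x. indicator (closure Om) x *\<^sub>R g x)" by (simp add: integrable_completion borel_measurable_integrable)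
  hence "integrable lebesgue (%x. indicator Om x *\<^sub>R (indicator (closure Om) x *\<^sub>R g x))"
   by (rule integrable_mult_indicator[rotated]) (simp add: borel_open[OF Om])
  moreover have "(%x. indicator Om x *\<^sub>R (indicator (closure Om) x *\<^sub>R g x)) = (%x. indicator Om x *\<^sub>R g x)"
   using closure_subset[of Om] by (auto simp: indicator_def fun_eq_iff)
  ultimately show ?thesis by (subst integrable_restrict_space) (simp_all add: borel_open[OF Om])
 qed
 have "(LINT x|lebesgue_on Om. cdiv F x) = (LINT x|lebesgue_on Om. (\<Sum>k\<in>UNIV. partial k (%x. F x $ k) x))"
  by (simp add: cdiv_def partial_nth C_diff_D[OF F])
 also have "... = (\<Sum>k\<in>UNIV. LINT x|lebesgue_on Om. partial k (%x. F x $ k) x)"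
  by (rule Bochner_Integration.integral_sum) (rule i1[OF C_diff_cont_partial[OF Fk]])
 also have "... = (\<Sum>k\<in>UNIV. LINT x|sg. nu x $ k *\<^sub>R F x $ k)"
  by (intro sum.cong refl divergence_theorem_partial[OF rh dom sg nu Fk])
 also have "... = (LINT x|sg. (\<Sum>k\<in>UNIV. nu x $ k *\<^sub>R F x $ k))"
  using continuous_on_subset[OF C_diff_cont[OF Fk] subset_UNIV]
  by (intro Bochner_Integration.integral_sum[symmetric] surface_integrable[OF dom sg] continuous_on_scaleR
    continuous_on_component[OF continuous_on_normal[OF dom(1) nu]])
 also have "... = (LINT x|sg. cdot (F x) (cvec (nu x)))"
  by (simp add: cdot_def cvec_def scaleR_conv_of_real mult.commute)
 finally show ?thesis .
qed

section \<open>Complex vector fields\<close>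

lemma cdot_add_left: "cdot (a + b) c = cdot a c + cdot b c"
 and cdot_add_right: "cdot a (b + c) = cdot a b + cdot a c"
 and cdot_diff_left: "cdot (a - b) c = cdot a c - cdot b c"
 and cdot_diff_right: "cdot a (b - c) = cdot a b - cdot a c"
 and cdot_smult_left: "cdot (s *s a) b = s * cdot a b"
 and cdot_smult_right: "cdot a (s *s b) = s * cdot a b"
 and cdot_commute: "cdot a b = cdot b a"
 and cdot_zero_left [simp]: "cdot 0 b = 0"
 and cdot_zero_right [simp]: "cdot a 0 = 0"
 by (simp_all add: cdot_def sum.distrib sum_subtractf sum_distrib_left algebra_simps)

lemma norm_cdot_le: "norm (cdot a b) \<le> norm a * norm b" for a b :: "complex^'n::finite"
proof -
 have "norm (cdot a b) \<le> (\<Sum>k\<in>UNIV. \<bar>norm (a $ k)\<bar> * \<bar>norm (b $ k)\<bar>)"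
  unfolding cdot_def by (rule order_trans[OF norm_sum]) (simp add: norm_mult)
 also have "... \<le> L2_set (%k. norm (a $ k)) UNIV * L2_set (%k. norm (b $ k)) UNIV"
  by (rule L2_set_mult_ineq)
 finally show ?thesis by (simp add: norm_vec_def)
qed

lemma norm_smult_vec: "norm (c *s v) = norm c * norm v" for v :: "complex^'n::finite"
 by (simp add: norm_vec_def norm_mult L2_set_right_distrib)

lemma bb_cdot: "bounded_bilinear (cdot :: complex^'n::finite => _)"
proof
 show "cdot (r *\<^sub>R a) b = r *\<^sub>R cdot a b" "cdot a (r *\<^sub>R b) = r *\<^sub>R cdot a b" for r and a b :: "complex^'n"
  by (simp_all add: cdot_def scaleR_sum_right)
 show "\<exists>K. \<forall>a b :: complex^'n. norm (cdot a b) \<le> norm a * norm b * K"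
  by (intro exI[of _ 1] allI) (simp add: norm_cdot_le)
qed (rule cdot_add_left cdot_add_right)+

lemma bb_smult: "bounded_bilinear ((*s) :: complex => complex^'n::finite => _)"
proof
 show "\<exists>K. \<forall>a. \<forall>b :: complex^'n. norm (a *s b) \<le> norm a * norm b * K"
  by (intro exI[of _ 1]) (simp add: norm_smult_vec)
qed (auto simp: vec_eq_iff algebra_simps)

lemma bl_cvec: "bounded_linear (cvec :: real^'n::finite => complex^'n)"
proof (rule bounded_linear_intro[where K=1])
 show "norm (cvec x) \<le> norm x * 1" for x :: "real^'n" by (simp add: cvec_def norm_vec_def)
qed (auto simp: cvec_def vec_eq_iff scaleR_conv_of_real[where 'a=complex])

lemma norm_cvec [simp]: "norm (cvec x) = norm x" by (simp add: cvec_def norm_vec_def)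

text \<open>\<open>cdot\<close> is bilinear, as transposed operators require; norms and energies are
  recovered by pairing with the conjugated vector.\<close>

definition cnjv :: "complex^'n::finite => complex^'n" where "cnjv v = (\<chi> k. cnj (v $ k))"

lemma bl_cnjv: "bounded_linear (cnjv :: complex^'n::finite => complex^'n)"
proof (rule bounded_linear_intro[where K=1])
 show "norm (cnjv x) \<le> norm x * 1" for x :: "complex^'n" by (simp add: cnjv_def norm_vec_def)
qed (auto simp: cnjv_def vec_eq_iff)

lemma norm_cnjv [simp]: "norm (cnjv x) = norm x" by (simp add: cnjv_def norm_vec_def)

lemma cnjv_add: "cnjv (a + b) = cnjv a + cnjv b"
 and cnjv_diff: "cnjv (a - b) = cnjv a - cnjv b"
 and cnjv_smult: "cnjv (s *s a) = cnj s *s cnjv a"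
 and cnjv_cvec [simp]: "cnjv (cvec x) = cvec x"
 and cnjv_cnjv [simp]: "cnjv (cnjv a) = a"
 by (simp_all add: cnjv_def cvec_def vec_eq_iff)

lemma cdot_cnjv_self: "cdot a (cnjv a) = of_real ((norm a)^2)"
proof -
 have "(norm a)^2 = (\<Sum>k\<in>UNIV. (norm (a $ k))^2)" by (simp add: norm_vec_def L2_set_def sum_nonneg)
 thus ?thesis by (simp add: cdot_def cnjv_def complex_norm_square[symmetric])
qed

lemma inner_eq_Re_cdot: "inner a b = Re (cdot a (cnjv b))" for a b :: "complex^'n::finite"
 by (simp add: inner_vec_def cdot_def cnjv_def inner_complex_def)

lemma cgrad_nth [simp]: "cgrad f x $ k = partial k f x" by (simp add: cgrad_def)

lemma C_diff_cgrad: "C_diff (Suc m) f ==> C_diff m (cgrad f)"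
 by (rule C_diff_vec) simp

lemma smooth_cgrad: "smooth f ==> smooth (cgrad f)"
 unfolding smooth_def using C_diff_cgrad by blast

lemmas C_diff_smult = C_diff_bilinear[OF bb_smult]
lemmas C_diff_cvec = C_diff_linear[OF bl_cvec]

lemma cdiv_eq: "C_diff 1 F ==> cdiv F x = (\<Sum>k\<in>UNIV. partial k (%x. F x $ k) x)"
 unfolding cdiv_def by (simp add: partial_nth C_diff_D)

lemma continuous_on_cdiv: "C_diff 1 F ==> continuous_on UNIV (cdiv F)"
 unfolding cdiv_def[abs_def]
 by (intro continuous_on_sum continuous_on_component C_diff_cont_partial)

lemma cdiv_add: "C_diff 1 F ==> C_diff 1 G ==> cdiv (%x. F x + G x) x = cdiv F x + cdiv G x"
 unfolding cdiv_def by (simp add: partial_add C_diff_D sum.distrib)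

lemma cdiv_smult:
 assumes "C_diff 1 f" "C_diff 1 F"
 shows "cdiv (%x. f x *s F x) x = f x * cdiv F x + cdot (F x) (cgrad f x)"
 unfolding cdiv_def
 by (simp add: partial_bilinear[OF bb_smult C_diff_D[OF assms(1)] C_diff_D[OF assms(2)]]
   sum.distrib cdot_def sum_distrib_left mult.commute)

lemma cgrad_mult:
 assumes "C_diff 1 f" "C_diff 1 g"
 shows "cgrad (%x. f x * g x) x = f x *s cgrad g x + g x *s cgrad f x"
 by (simp add: vec_eq_iff partial_mult C_diff_D[OF assms(1)] C_diff_D[OF assms(2)] mult.commute)

lemma cgrad_add:
 "C_diff 1 f ==> C_diff 1 g ==> cgrad (%x. f x + g x) x = cgrad f x + cgrad g x"
 by (simp add: vec_eq_iff partial_add C_diff_D)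

lemma cgrad_linear:
 "bounded_linear L ==> C_diff 1 f ==> cgrad (%x. L (f x)) x $ k = L (cgrad f x $ k)"
 by (simp add: partial_linear C_diff_D)

lemma cgrad_diff:
 "C_diff 1 f ==> C_diff 1 g ==> cgrad (%x. f x - g x) x = cgrad f x - cgrad g x"
 using cgrad_add[of f "%x. - g x" x] cgrad_linear[OF bounded_linear_minus[OF bounded_linear_ident], of g x]
  C_diff_minus[of 1 g]
 by (simp add: vec_eq_iff)

lemma cgrad_cnj: "C_diff 1 f ==> cgrad (%x. cnj (f x)) x = cnjv (cgrad f x)"
 using cgrad_linear[OF bounded_linear_cnj, of f x] by (simp add: vec_eq_iff cnjv_def)

lemma C_diff_cnj: "C_diff m f ==> C_diff m (%x. cnj (f x))"
 by (rule C_diff_linear[OF bounded_linear_cnj])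

lemma smooth_add: "smooth f ==> smooth g ==> smooth (%x. f x + g x)"
 unfolding smooth_def using C_diff_add by blast

lemma smooth_diff: "smooth f ==> smooth g ==> smooth (%x. f x - g x)"
 unfolding smooth_def using C_diff_diff by blast

section \<open>Multipliers and limits in \<open>L^2\<close>\<close>

lemma in_L2_mult_bounded:
 fixes f :: "'a => 'b::euclidean_space" and g :: "'a => 'c::euclidean_space" and B :: "'b => 'c => 'd::euclidean_space"
 assumes B: "bounded_bilinear B" and f: "in_L2 M f" and g: "g \<in> borel_measurable M" "AE x in M. norm (g x) \<le> C"
 shows "in_L2 M (%x. B (f x) (g x))"
proof -
 obtain K where K: "K > 0" "!!a b. norm (B a b) \<le> norm a * norm b * K"
  using bounded_bilinear.pos_bounded[OF B] by blast
 have m: "(%x. B (f x) (g x)) \<in> borel_measurable M"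
 proof -
  have c: "continuous_on UNIV (%p. B (fst p) (snd p))"
   by (intro bounded_bilinear.continuous_on[OF B] continuous_intros)
  show ?thesis
   using borel_measurable_continuous_on[OF c, of "%x. (f x, g x)" M] f g(1)
   by (simp add: in_L2_def borel_measurable_Pair)
 qed
 show ?thesis
 proof (rule in_L2_bound[OF f m, where C="C * K"])
  show "AE x in M. norm (B (f x) (g x)) \<le> C * K * norm (f x)"
   using g(2)
  proof eventually_elim
   case (elim x)
   have "norm (f x) * norm (g x) * K \<le> norm (f x) * C * K"
    using elim K(1) by (intro mult_right_mono mult_left_mono) auto
   thus ?case using K(2)[of "f x" "g x"] by (simp add: algebra_simps)
  qed
 qed
qed

lemma L2_tendsto_diff:
 assumes "L2_tendsto M F f" "L2_tendsto M G g"
 shows "L2_tendsto M (%m x. F m x - G m x) (%x. f x - g x)"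
 using L2_tendsto_add[OF assms(1) L2_tendsto_linear[OF bounded_linear_minus[OF bounded_linear_ident] assms(2)]] by simp

lemma L2_tendsto_cong_AE:
 assumes "L2_tendsto M F f" "!!m. G m \<in> borel_measurable M" "g \<in> borel_measurable M"
  "!!m. AE x in M. F m x = G m x" "AE x in M. f x = g x"
 shows "L2_tendsto M G g"
proof (rule L2_tendsto_bound[OF assms(1), where C=1])
 show "in_L2 M (G m)" for m
  by (rule in_L2_cong_AE[OF _ assms(2,4)]) (use assms(1) in \<open>simp add: L2_tendsto_iff\<close>)
 show "in_L2 M g"
  by (rule in_L2_cong_AE[OF _ assms(3,5)]) (use assms(1) in \<open>simp add: L2_tendsto_iff\<close>)
 show "AE x in M. norm (G m x - g x) \<le> 1 * norm (F m x - f x)" for m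
  using assms(4)[of m] assms(5) by eventually_elim simp
qed

lemma in_L2_restrict:
 assumes "in_L2 lebesgue f" "S \<in> sets lebesgue"
 shows "in_L2 (lebesgue_on S) f"
 unfolding in_L2_def
proof
 show "f \<in> borel_measurable (lebesgue_on S)"
  using assms by (simp add: in_L2_def measurable_restrict_space1)
 show "integrable (lebesgue_on S) (%x. (norm (f x))^2)"
  using integrable_mult_indicator[of S lebesgue "%x. (norm (f x))^2"] assms
  by (simp add: in_L2_def integrable_restrict_space)
qed

lemma L2norm_restrict_le:
 assumes "in_L2 lebesgue f" "S \<in> sets lebesgue"
 shows "L2norm (lebesgue_on S) f \<le> L2norm lebesgue f"
proof -
 have "(LINT x|lebesgue_on S. (norm (f x))^2) = (LINT x|lebesgue. indicator S x *\<^sub>R (norm (f x))^2)"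
  using assms(2) by (simp add: integral_restrict_space)
 also have "... \<le> (LINT x|lebesgue. (norm (f x))^2)"
 proof (rule integral_mono)
  show "integrable lebesgue (%x. indicator S x *\<^sub>R (norm (f x))^2)"
   using integrable_mult_indicator[of S lebesgue "%x. (norm (f x))^2"] assms by (simp add: in_L2_def)
 qed (use assms in \<open>auto simp: in_L2_def indicator_def\<close>)
 finally show ?thesis by (simp add: L2norm_def)
qed

lemma L2_tendsto_restrict:
 assumes "L2_tendsto lebesgue F f" "S \<in> sets lebesgue"
 shows "L2_tendsto (lebesgue_on S) F f"
proof -
 have i: "!!m. in_L2 lebesgue (F m)" "in_L2 lebesgue f" "(%m. L2norm lebesgue (%x. F m x - f x)) ----> 0"
  using assms(1) by (auto simp: L2_tendsto_iff)
 have "(%m. L2norm (lebesgue_on S) (%x. F m x - f x)) ----> 0"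
  by (rule tendsto_0_squeeze[OF L2norm_nonneg _ i(3)]) (rule L2norm_restrict_le[OF in_L2_diff[OF i(1,2)] assms(2)])
 thus ?thesis using in_L2_restrict[OF i(1) assms(2)] in_L2_restrict[OF i(2) assms(2)] by (simp add: L2_tendsto_iff)
qed

lemma in_L2_extend:
 assumes "in_L2 (lebesgue_on S) f" "S \<in> sets lebesgue"
 shows "in_L2 lebesgue (%x. indicator S x *\<^sub>R f x)" "L2norm lebesgue (%x. indicator S x *\<^sub>R f x) = L2norm (lebesgue_on S) f"
proof -
 have sq: "(norm (indicator S x *\<^sub>R f x))^2 = indicator S x *\<^sub>R (norm (f x))^2" for x by (simp add: indicator_def)
 show "in_L2 lebesgue (%x. indicator S x *\<^sub>R f x)"
  unfolding in_L2_def sq using assms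
  by (auto simp: in_L2_def borel_measurable_restrict_space_iff integrable_restrict_space)
 show "L2norm lebesgue (%x. indicator S x *\<^sub>R f x) = L2norm (lebesgue_on S) f"
  unfolding L2norm_def sq using assms(2) by (simp add: integral_restrict_space)
qed

lemma L2_imp_integrable:
 fixes f :: "'a => 'b::euclidean_space"
 assumes "in_L2 M f" "finite_measure M"
 shows "integrable M f"
proof -
 interpret finite_measure M by fact
 have one: "in_L2 M (%x. 1::real)" by (simp add: in_L2_def)
 from in_L2_integrable[OF bounded_bilinear_scaleR one assms(1)] show ?thesis by simp
qed

section \<open>Green's formula and traces\<close>

text \<open>The mollifier is part of the setting because the cut-off functions, the partitions of
  unity and the regularisation of fields are all built from it.\<close>

locale boundary_setting =
 fixes Om :: "(real^'n::finite) set" and sg :: "(real^'n) measure" and nu :: "real^'n => real^'n" and rh :: "real^'n => real"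
 assumes dom: "C11_domain Om" "bounded Om" and surface: "surface_measure Om sg" and normal: "outward_unit_normal Om nu"
  and rho: "smooth rh" "supp rh \<subseteq> cball 0 1" "(LINT x|lborel. rh x) = 1"
begin

abbreviation "M \<equiv> lebesgue_on Om"

lemma open_dom: "open Om" using dom(1) by (simp add: C11_domain_def)

lemma sets_dom: "Om \<in> sets lebesgue" using borel_open[OF open_dom] by simp

lemma finite_dom: "finite_measure M"
proof -
 have "Om \<in> lmeasurable" by (rule lmeasurable_open[OF dom(2) open_dom])
 thus ?thesis by (rule finite_measure_lebesgue_on)
qed

lemma bounded_on_closure:
 fixes g :: "real^'n => 'b::real_normed_vector"
 assumes "continuous_on UNIV g"
 shows "\<exists>C>0. \<forall>x\<in>closure Om. norm (g x) \<le> C"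
proof -
 have "compact (g ` closure Om)"
  using dom(2) by (intro compact_continuous_image continuous_on_subset[OF assms]) (auto simp: compact_closure)
 from compact_imp_bounded[OF this] show ?thesis unfolding bounded_pos by auto
qed

lemma measurable_dom:
 fixes g :: "real^'n => 'b::euclidean_space"
 shows "continuous_on UNIV g ==> g \<in> borel_measurable M"
 by (rule measurable_restrict_space1[OF continuous_measurable_lebesgue])

lemma bounded_AE_dom:
 assumes "\<forall>x\<in>closure Om. norm (g x) \<le> C"
 shows "AE x in M. norm (g x) \<le> C"
 using assms closure_subset[of Om] by (intro AE_I2) auto

lemma bounded_AE_surface:
 assumes "\<forall>x\<in>closure Om. norm (g x) \<le> C"
 shows "AE x in sg. norm (g x) \<le> C"
 using assms by (intro AE_I2) (auto simp: surface_space[OF surface] frontier_def)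

lemma in_L2_of_bounded:
 fixes g :: "'a => 'b::euclidean_space"
 assumes "finite_measure N" "g \<in> borel_measurable N" "AE x in N. norm (g x) \<le> C"
 shows "in_L2 N g"
proof -
 interpret finite_measure N by fact
 have one: "in_L2 N (%x. 1::real)" by (simp add: in_L2_def)
 from in_L2_mult_bounded[OF bounded_bilinear_scaleR one assms(2,3)] show ?thesis by simp
qed

lemma continuous_in_L2:
 fixes g :: "real^'n => 'b::euclidean_space"
 assumes "continuous_on UNIV g"
 shows "in_L2 M g"
 using bounded_on_closure[OF assms] in_L2_of_bounded[OF finite_dom measurable_dom[OF assms] bounded_AE_dom] by blast

lemma continuous_in_L2_surface:
 fixes g :: "real^'n => 'b::euclidean_space"
 assumes "continuous_on UNIV g"
 shows "in_L2 sg g"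
proof -
 obtain C where C: "\<forall>x\<in>closure Om. norm (g x) \<le> C" using bounded_on_closure[OF assms] by blast
 show ?thesis
  by (rule in_L2_of_bounded[OF surface_measure_finite[OF dom surface] surface_measurable_continuous[OF surface] bounded_AE_surface[OF C]])
   (rule continuous_on_subset[OF assms subset_UNIV])
qed

lemma in_L2_mult_continuous:
 fixes f :: "real^'n => 'b::euclidean_space" and g :: "real^'n => 'c::euclidean_space" and B :: "'b => 'c => 'd::euclidean_space"
 assumes B: "bounded_bilinear B" and f: "in_L2 M f" and g: "continuous_on UNIV g"
 shows "in_L2 M (%x. B (f x) (g x))"
 using bounded_on_closure[OF g] in_L2_mult_bounded[OF B f measurable_dom[OF g] bounded_AE_dom] by blast

lemma green:
 assumes K: "C_diff 1 K" and ph: "C_diff 1 ph"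
 shows "(LINT x|M. cdiv K x * ph x) + (LINT x|M. cdot (K x) (cgrad ph x)) = (LINT x|sg. ph x * cdot (K x) (cvec (nu x)))"
proof -
 have "C_diff 1 (%x. ph x *s K x)" by (rule C_diff_smult[OF ph K])
 from divergence_theorem[OF rho dom surface normal this]
 have "(LINT x|sg. ph x * cdot (K x) (cvec (nu x))) = (LINT x|M. cdiv K x * ph x + cdot (K x) (cgrad ph x))"
  by (simp add: cdiv_smult[OF ph K] cdot_smult_left mult.commute)
 also have "... = (LINT x|M. cdiv K x * ph x) + (LINT x|M. cdot (K x) (cgrad ph x))"
 proof (rule LINT_add)
  have c: "continuous_on UNIV (cdiv K)" "continuous_on UNIV ph" "continuous_on UNIV K" "continuous_on UNIV (cgrad ph)"
   using continuous_on_cdiv[OF K] C_diff_cont[OF ph] C_diff_cont[OF K] C_diff_cgrad[of 0 ph] ph by auto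
  show "integrable M (%x. cdiv K x * ph x)"
   by (rule in_L2_integrable[OF bb_mult continuous_in_L2[OF c(1)] continuous_in_L2[OF c(2)]])
  show "integrable M (%x. cdot (K x) (cgrad ph x))"
   by (rule in_L2_integrable[OF bb_cdot continuous_in_L2[OF c(3)] continuous_in_L2[OF c(4)]])
 qed
 finally show ?thesis by simp
qed

lemma in_L2_flux_surface:
 assumes "continuous_on UNIV K"
 shows "in_L2 sg (%x. cdot (K x) (cvec (nu x)))"
proof -
 have c: "continuous_on (frontier Om) (%x. cdot (K x) (cvec (nu x)))"
  by (intro bounded_bilinear.continuous_on[OF bb_cdot] continuous_on_subset[OF assms subset_UNIV]
    bounded_linear.continuous_on[OF bl_cvec] continuous_on_normal[OF dom(1) normal])
 have "compact ((%x. cdot (K x) (cvec (nu x))) ` frontier Om)"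
  using dom(2) c by (intro compact_continuous_image compact_frontier_bounded)
 from compact_imp_bounded[OF this] obtain C where "\<forall>x\<in>frontier Om. norm (cdot (K x) (cvec (nu x))) \<le> C"
  unfolding bounded_iff by auto
 hence "AE x in sg. norm (cdot (K x) (cvec (nu x))) \<le> C" by (intro AE_I2) (simp add: surface_space[OF surface])
 thus ?thesis
  by (rule in_L2_of_bounded[OF surface_measure_finite[OF dom surface] surface_measurable_continuous[OF surface c]])
qed

text \<open>The formula \<open>green\<close> survives the three L^2 limits in
  \<open>has_trace\<close> because \<open>K\<close> is fixed and C^1: its flux through the boundary
  is one square integrable function.\<close>

lemma green_trace:
 assumes tr: "has_trace Om sg u G f" and K: "C_diff 1 K"
 shows "(LINT x|M. cdiv K x * u x) + (LINT x|M. cdot (K x) (G x)) = (LINT x|sg. f x * cdot (K x) (cvec (nu x)))"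
proof -
 obtain ph where ph: "!!m. smooth (ph m)" "L2_tendsto M ph u" "L2_tendsto M (%m. cgrad (ph m)) G" "L2_tendsto sg ph f"
  using tr unfolding has_trace_def by blast
 have c: "continuous_on UNIV (cdiv K)" "continuous_on UNIV K"
  using continuous_on_cdiv[OF K] C_diff_cont[OF K] by auto
 have "(%m. (LINT x|M. cdiv K x * ph m x) + (LINT x|M. cdot (K x) (cgrad (ph m) x))) ---->
  (LINT x|M. cdiv K x * u x) + (LINT x|M. cdot (K x) (G x))"
  by (intro tendsto_add L2_tendsto_bilinear[OF bb_mult L2_tendsto_const[OF continuous_in_L2[OF c(1)]] ph(2)]
    L2_tendsto_bilinear[OF bb_cdot L2_tendsto_const[OF continuous_in_L2[OF c(2)]] ph(3)])
 moreover have "(%m. LINT x|sg. ph m x * cdot (K x) (cvec (nu x))) ----> (LINT x|sg. f x * cdot (K x) (cvec (nu x)))"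
  by (rule L2_tendsto_bilinear[OF bb_mult ph(4) L2_tendsto_const[OF in_L2_flux_surface[OF c(2)]]])
 moreover have "(LINT x|M. cdiv K x * ph m x) + (LINT x|M. cdot (K x) (cgrad (ph m) x)) = (LINT x|sg. ph m x * cdot (K x) (cvec (nu x)))" for m
  by (rule green[OF K smooth_C_diff[OF ph(1)]])
 ultimately show ?thesis by (simp add: LIMSEQ_unique)
qed

lemma has_trace_smooth:
 assumes "smooth f"
 shows "has_trace Om sg f (cgrad f) f"
 unfolding has_trace_def
proof (intro exI[of _ "%m. f"] conjI allI assms)
 show "L2_tendsto M (%m. f) f" "L2_tendsto M (%m. cgrad f) (cgrad f)" "L2_tendsto sg (%m. f) f"
  using C_diff_cont[OF smooth_C_diff[OF assms, of 0]] C_diff_cont[OF smooth_C_diff[OF smooth_cgrad[OF assms], of 0]]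
  by (simp_all only: L2_tendsto_const continuous_in_L2 continuous_in_L2_surface)
qed

lemma has_trace_diff:
 assumes "has_trace Om sg u G f" "has_trace Om sg u' G' f'"
 shows "has_trace Om sg (%x. u x - u' x) (%x. G x - G' x) (%x. f x - f' x)"
proof -
 obtain ph where ph: "!!m. smooth (ph m)" "L2_tendsto M ph u" "L2_tendsto M (%m. cgrad (ph m)) G" "L2_tendsto sg ph f"
  using assms(1) unfolding has_trace_def by blast
 obtain ps where ps: "!!m. smooth (ps m)" "L2_tendsto M ps u'" "L2_tendsto M (%m. cgrad (ps m)) G'" "L2_tendsto sg ps f'"
  using assms(2) unfolding has_trace_def by blast
 have g: "cgrad (%x. ph m x - ps m x) = (%x. cgrad (ph m) x - cgrad (ps m) x)" for m
  by (intro ext cgrad_diff smooth_C_diff ph ps)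
 show ?thesis
  unfolding has_trace_def
  using smooth_diff[OF ph(1) ps(1)] L2_tendsto_diff[OF ph(2) ps(2)] L2_tendsto_diff[OF ph(3) ps(3)] L2_tendsto_diff[OF ph(4) ps(4)]
  by (intro exI[of _ "%m x. ph m x - ps m x"]) (simp add: g)
qed

lemma has_trace_cnj:
 assumes "has_trace Om sg u G f"
 shows "has_trace Om sg (%x. cnj (u x)) (%x. cnjv (G x)) (%x. cnj (f x))"
proof -
 obtain ph where ph: "!!m. smooth (ph m)" "L2_tendsto M ph u" "L2_tendsto M (%m. cgrad (ph m)) G" "L2_tendsto sg ph f"
  using assms unfolding has_trace_def by blast
 have s: "smooth (%x. cnj (ph m x))" for m
  using C_diff_cnj[OF smooth_C_diff[OF ph(1)]] by (simp add: smooth_def)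
 have g: "cgrad (%x. cnj (ph m x)) = (%x. cnjv (cgrad (ph m) x))" for m
  by (intro ext cgrad_cnj smooth_C_diff ph)
 show ?thesis
  unfolding has_trace_def
  using s L2_tendsto_linear[OF bounded_linear_cnj ph(2)] L2_tendsto_linear[OF bl_cnjv ph(3)] L2_tendsto_linear[OF bounded_linear_cnj ph(4)]
  by (intro exI[of _ "%m x. cnj (ph m x)"]) (simp add: g)
qed

lemma has_trace_in_L2: "has_trace Om sg u G f ==> in_L2 M u \<and> in_L2 M G"
 unfolding has_trace_def by (auto simp: L2_tendsto_iff)

text \<open>The approximation demanded by \<open>normal_trace_pairing\<close>, with the divergence
  as a parameter: smooth fields converging in the graph norm of the divergence.\<close>

definition flux_approx :: "(real^'n => complex^'n) => (real^'n => complex) => (nat => real^'n => complex^'n) => bool" where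
 "flux_approx F d Ph \<longleftrightarrow> (\<forall>m. smooth (Ph m)) \<and> L2_tendsto M Ph F \<and> L2_tendsto M (%m. cdiv (Ph m)) d"

text \<open>For a C^1 function \<open>g\<close>, Green's formula makes the boundary pairing
  continuous in the graph norm. So the limit exists and depends on \<open>F\<close> and
  \<open>d\<close> alone, not on the approximating fields.\<close>

lemma flux_approx_pairing:
 assumes Ph: "flux_approx F d Ph" and g: "C_diff 1 g"
 shows "(%m. LINT x|sg. cdot (Ph m x) (cvec (nu x)) * g x) ----> (LINT x|M. d x * g x) + (LINT x|M. cdot (F x) (cgrad g x))"
proof -
 have c: "continuous_on UNIV g" "continuous_on UNIV (cgrad g)"
  using C_diff_cont[OF g] C_diff_cgrad[of 0 g] g by auto
 have "(%m. (LINT x|M. cdiv (Ph m) x * g x) + (LINT x|M. cdot (Ph m x) (cgrad g x))) ----> (LINT x|M. d x * g x) + (LINT x|M. cdot (F x) (cgrad g x))"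
  using Ph unfolding flux_approx_def
  by (intro tendsto_add L2_tendsto_bilinear[OF bb_mult _ L2_tendsto_const[OF continuous_in_L2[OF c(1)]]]
    L2_tendsto_bilinear[OF bb_cdot _ L2_tendsto_const[OF continuous_in_L2[OF c(2)]]]) auto
 moreover have "(LINT x|M. cdiv (Ph m) x * g x) + (LINT x|M. cdot (Ph m x) (cgrad g x)) = (LINT x|sg. cdot (Ph m x) (cvec (nu x)) * g x)" for m
  using green[OF smooth_C_diff g, of "Ph m"] Ph unfolding flux_approx_def by (simp add: mult.commute)
 ultimately show ?thesis by simp
qed

text \<open>The trace vanishes only in the limit, whereas the approximating fields are unbounded on the
 boundary; so the limit of the trace approximation is taken first, for each fixed field.\<close>

lemma flux_approx_zero_trace:
 assumes Ph: "flux_approx F d Ph" and w: "has_trace Om sg w Gw (%_. 0)"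
 shows "(LINT x|M. d x * w x) + (LINT x|M. cdot (F x) (Gw x)) = 0"
proof -
 have "(LINT x|M. cdiv (Ph m) x * w x) + (LINT x|M. cdot (Ph m x) (Gw x)) = 0" for m
  using green_trace[OF w smooth_C_diff, of "Ph m"] Ph unfolding flux_approx_def by simp
 moreover have "(%m. (LINT x|M. cdiv (Ph m) x * w x) + (LINT x|M. cdot (Ph m x) (Gw x))) ----> (LINT x|M. d x * w x) + (LINT x|M. cdot (F x) (Gw x))"
  using Ph has_trace_in_L2[OF w] unfolding flux_approx_def
  by (intro tendsto_add L2_tendsto_bilinear[OF bb_mult _ L2_tendsto_const]
    L2_tendsto_bilinear[OF bb_cdot _ L2_tendsto_const]) auto
 ultimately show ?thesis by (simp add: LIMSEQ_const_iff)
qed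

section \<open>Weak divergence\<close>

text \<open>Reflected translates of the rescaled mollifier are test functions as long as the scale
  is below the distance to the complement, so the mollifications of \<open>h\<close> vanish there.
  Their L^2 limit is \<open>h\<close>; hence \<open>h\<close> is zero almost everywhere on the set
  of points farther than \<open>1 / real (Suc n)\<close> from the complement, and these sets exhaust
  the domain.\<close>

lemma fundamental_lemma:
 assumes h: "in_L2 M h" and z: "!!ph::real^'n => complex. test_function Om ph ==> (LINT x|M. h x * ph x) = 0"
 shows "AE x in M. h x = 0"
proof -
 define f where "f x = indicator Om x *\<^sub>R h x" for x
 have f2: "in_L2 lebesgue f" unfolding f_def[abs_def] by (rule in_L2_extend(1)[OF h sets_dom])
 have fi: "integrable lebesgue f"
  using L2_imp_integrable[OF h finite_dom] sets_dom unfolding f_def[abs_def]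
  by (simp add: integrable_restrict_space)
 have rc: "continuous_on UNIV rh" using smooth_C_diff[OF rho(1), of 0] by simp
 have rv: "rh x = 0" if "norm x > 1" for x using supp_subset_cballD[OF rho(2) that] .
 have conv0: "conv (rescale rh ep) f x = 0" if ep: "ep > 0" and x: "cball x ep \<subseteq> Om" for x ep
 proof -
  let ?k = "rescale rh ep"
  let ?ph = "%z. complex_of_real (?k (x - z))"
  have kC: "C_diff m ?k" for m by (rule C_diff_rescale[OF smooth_C_diff[OF rho(1)]])
  have "C_diff m ?ph" for m using C_diff_of_real[OF C_diff_affine[OF kC, of m x "-1"]] by simp
  hence sm: "smooth ?ph" by (simp add: smooth_def)
  have "?ph z = 0" if "z \<notin> cball x ep" for z
   using rescale_vanish[of ep 1 rh "x - z"] rv ep that by (simp add: dist_norm)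
  hence su: "supp ?ph \<subseteq> cball x ep" unfolding supp_def by (intro closure_minimal) blast+
  have "compact (supp ?ph)"
   using compact_Int_closed[OF compact_cball, of "supp ?ph" x ep] su by (simp add: supp_def inf.absorb2)
  hence "test_function Om ?ph" using sm su x by (auto simp: test_function_def)
  from z[OF this] have "(LINT z|lebesgue. indicator Om z *\<^sub>R (h z * ?ph z)) = 0"
   using sets_dom by (simp add: integral_restrict_space)
  thus ?thesis by (simp add: conv_def f_def scaleR_conv_of_real mult_ac)
 qed
 \<comment> \<open>The distance to the empty set is 0 by convention; positivity of
   \<open>infdist\<close> at points of the domain thus presupposes a nonempty complement.\<close>
 have ne: "- Om \<noteq> {}"
 proof
  assume "- Om = {}"
  hence "Om = UNIV" by auto
  thus False using dom(2) not_bounded_UNIV by metis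
 qed
 have z: "AE x in lebesgue. infdist x (- Om) > 1 / real (Suc n) --> f x = 0" for n
 proof -
  define E where "E = {x. infdist x (- Om) > 1 / real (Suc n)}"
  have "open E" unfolding E_def by (intro open_Collect_less continuous_intros)
  hence E: "E \<in> sets lebesgue" using borel_open by simp
  define de where "de m = 1 / real (Suc n) / real (Suc m)" for m
  have de: "de m > 0" "de m \<le> 1 / real (Suc n)" for m by (auto simp: de_def divide_simps)
  have de0: "de ----> 0" unfolding de_def[abs_def] by (rule LIMSEQ_Suc[OF lim_const_over_n])
  have L: "L2_tendsto lebesgue (%m. conv (rescale rh (de m)) f) f"
   by (rule conv_rescale_L2_tendsto[OF rc rv rho(3) fi f2 zero_less_one de(1) de0])
  have Ef: "in_L2 lebesgue (%x. indicator E x *\<^sub>R f x)"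
   by (rule in_L2_extend(1)[OF in_L2_restrict[OF f2 E] E])
  have "L2norm lebesgue (%x. indicator E x *\<^sub>R f x) \<le> L2norm lebesgue (%x. conv (rescale rh (de m)) f x - f x)" for m
  proof (rule L2norm_mono[OF _ Ef])
   show "in_L2 lebesgue (%x. conv (rescale rh (de m)) f x - f x)"
    using L by (intro in_L2_diff) (auto simp: L2_tendsto_iff)
   show "AE x in lebesgue. norm (indicator E x *\<^sub>R f x) \<le> norm (conv (rescale rh (de m)) f x - f x)"
   proof (rule AE_I2)
    fix x
    show "norm (indicator E x *\<^sub>R f x) \<le> norm (conv (rescale rh (de m)) f x - f x)"
    proof (cases "x \<in> E")
     case True
     have "cball x (de m) \<subseteq> Om"
     proof
      fix z assume "z \<in> cball x (de m)"
      hence "dist x z < infdist x (- Om)" using True de(2)[of m] by (simp add: E_def)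
      thus "z \<in> Om" using infdist_le[of z "- Om" x] by auto
     qed
     from conv0[OF de(1) this] show ?thesis by (simp add: indicator_def)
    qed simp
   qed
  qed
  moreover have "(%m. L2norm lebesgue (%x. conv (rescale rh (de m)) f x - f x)) ----> 0" using L by (simp add: L2_tendsto_iff)
  ultimately have "L2norm lebesgue (%x. indicator E x *\<^sub>R f x) \<le> 0" by (intro LIMSEQ_le_const) auto
  hence "L2norm lebesgue (%x. indicator E x *\<^sub>R f x) = 0" using L2norm_nonneg order_antisym by blast
  from L2norm_eq_0_AE[OF Ef this] show ?thesis
   by eventually_elim (auto simp: E_def indicator_def split: if_splits)
 qed
 hence "AE x in lebesgue. \<forall>n. infdist x (- Om) > 1 / real (Suc n) --> f x = 0"
  unfolding AE_all_countable by (rule allI)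
 hence "AE x in lebesgue. x \<in> Om --> h x = 0"
 proof eventually_elim
  case (elim x)
  show ?case
  proof
   assume x: "x \<in> Om"
   have "infdist x (- Om) \<noteq> 0"
    using in_closed_iff_infdist_zero[of "- Om" x] open_dom ne x by auto
   hence "infdist x (- Om) > 0" using infdist_nonneg[of x "- Om"] by linarith
   then obtain n where "1 / real (Suc n) < infdist x (- Om)" using nat_approx_posE by blast
   hence "f x = 0" using elim by blast
   thus "h x = 0" using x by (simp add: f_def)
  qed
 qed
 thus ?thesis using sets_dom by (simp add: AE_restrict_space_iff)
qed

lemma weak_divergence_unique:
 assumes "weak_divergence Om F d" "weak_divergence Om F d'"
 shows "AE x in M. d x = d' x"
proof -
 have i: "in_L2 M d" "in_L2 M d'" using assms by (auto simp: weak_divergence_def)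
 have "AE x in M. d x - d' x = 0"
 proof (rule fundamental_lemma[OF in_L2_diff[OF i]])
  fix ph :: "real^'n => complex" assume t: "test_function Om ph"
  have "continuous_on UNIV ph" using t smooth_C_diff[of ph 0] by (simp add: test_function_def)
  hence p: "in_L2 M ph" by (rule continuous_in_L2)
  have "(LINT x|M. (d x - d' x) * ph x) = (LINT x|M. d x * ph x) - (LINT x|M. d' x * ph x)"
   using in_L2_integrable[OF bb_mult i(1) p] in_L2_integrable[OF bb_mult i(2) p]
   by (simp add: left_diff_distrib)
  also have "... = 0"
   using assms t by (simp add: weak_divergence_def)
  finally show "(LINT x|M. (d x - d' x) * ph x) = 0" .
 qed
 thus ?thesis by eventually_elim simp
qed

end

section \<open>The magnetic boundary value problem\<close>

lemma cdot_minus_left: "cdot (- a) b = - cdot a b"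
 and cdot_minus_right: "cdot a (- b) = - cdot a b"
 by (simp_all add: cdot_def sum_negf)

definition mag_grad :: "(real^'n::finite => real^'n) => (real^'n => complex) => real^'n => complex^'n" where
 "mag_grad A f x = cgrad f x + (\<i> * f x) *s cvec (A x)"

text \<open>The square of - \<i> \<nabla> + A. Since \<open>mag_grad\<close> is \<i> times that
  operator, applying it twice, the second time as a divergence, produces the minus sign.\<close>

definition mag_laplace :: "(real^'n::finite => real^'n) => (real^'n => complex) => real^'n => complex" where
 "mag_laplace A f x = - (cdiv (mag_grad A f) x + \<i> * cdot (mag_grad A f x) (cvec (A x)))"

lemma C_diff_mag_grad:
 assumes "C_diff 2 f" "C_diff 1 A"
 shows "C_diff 1 (mag_grad A f)"
proof -
 have "C_diff 1 (cgrad f)" by (rule C_diff_cgrad) (use assms(1) in \<open>simp add: numeral_2_eq_2\<close>)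
 moreover have "C_diff 1 (%x. (\<i> * f x) *s cvec (A x))"
  using C_diff_mono[OF assms(1), of 1] by (intro C_diff_smult C_diff_mult C_diff_const C_diff_cvec assms(2)) auto
 ultimately show ?thesis unfolding mag_grad_def[abs_def] by (rule C_diff_add)
qed

lemma continuous_on_mag_laplace:
 assumes "C_diff 2 f" "C_diff 1 A"
 shows "continuous_on UNIV (mag_laplace A f)"
 unfolding mag_laplace_def[abs_def]
 using continuous_on_cdiv[OF C_diff_mag_grad[OF assms]] C_diff_cont[OF C_diff_mag_grad[OF assms]] C_diff_cont[OF assms(2)]
 by (intro continuous_intros bounded_bilinear.continuous_on[OF bb_cdot] bounded_linear.continuous_on[OF bl_cvec]) auto

text \<open>Coefficients on the whole space with explicit bounds: a C^1 vector potential and a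
  bounded electric potential without exceptional set. \<open>DN_map_cong\<close> connects this with
  data that are given on the domain only.\<close>

locale magnetic_problem = boundary_setting +
 fixes A :: "real^'a => real^'a" and V :: "real^'a => real" and lam :: complex and CA CV :: real
 assumes A: "C_diff 1 A" "!!x. norm (A x) \<le> CA"
  and V: "V \<in> borel_measurable lebesgue" "!!x. \<bar>V x\<bar> \<le> CV"
  and lam: "Im lam \<noteq> 0"
begin

definition flux :: "(real^'a => complex) => (real^'a => complex^'a) => real^'a => complex^'a" where
 "flux u G x = G x + (\<i> * u x) *s cvec (A x)"

text \<open>With F the flux, the equation reads - div F - \<i> F \<bullet> A + (V - lam) u = 0; this
  is its solution for div F.\<close>

definition src :: "(real^'a => complex) => (real^'a => complex^'a) => real^'a => complex" where
 "src u G x = (of_real (V x) - lam) * u x - \<i> * cdot (flux u G x) (cvec (A x))"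

lemma cA: "continuous_on UNIV (%x. cvec (A x))"
 by (intro bounded_linear.continuous_on[OF bl_cvec] C_diff_cont[OF A(1)])

lemma VM: "(%x. of_real (V x) - lam) \<in> borel_measurable M" "AE x in M. norm (of_real (V x) - lam) \<le> CV + norm lam"
proof -
 have [measurable]: "V \<in> borel_measurable lebesgue" by (rule V(1))
 have "(%x. of_real (V x) - lam) \<in> borel_measurable lebesgue" by measurable
 thus "(%x. of_real (V x) - lam) \<in> borel_measurable M" by (rule measurable_restrict_space1)
 have "norm (of_real (V x) - lam) \<le> CV + norm lam" for x
  using norm_triangle_ineq4[of "of_real (V x)" lam] V(2)[of x] by simp
 thus "AE x in M. norm (of_real (V x) - lam) \<le> CV + norm lam" by simp
qed

lemma in_L2_V: "in_L2 M u ==> in_L2 M (%x. (of_real (V x) - lam) * u x)"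
 using in_L2_mult_bounded[OF bb_mult _ VM, of u] by (simp add: mult.commute)

lemma in_L2_flux: "in_L2 M u ==> in_L2 M G ==> in_L2 M (flux u G)"
 unfolding flux_def[abs_def]
 using in_L2_mult_continuous[OF bb_smult in_L2_linear[OF bl_mult_right[of \<i>]] cA]
 by (intro in_L2_add) auto

lemma in_L2_src: "in_L2 M u ==> in_L2 M G ==> in_L2 M (src u G)"
 unfolding src_def[abs_def]
 by (intro in_L2_diff in_L2_V in_L2_linear[OF bl_mult_right[of \<i>]]
   in_L2_mult_continuous[OF bb_cdot in_L2_flux cA])

lemma bvp_integrand:
 "cdot (- \<i> *s G x + u x *s cvec (A x)) (\<i> *s cgrad ph x + ph x *s cvec (A x)) + (of_real (V x) - lam) * u x * ph x
  = cdot (flux u G x) (cgrad ph x) + src u G x * ph x"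
 by (simp add: flux_def src_def cdot_add_left cdot_add_right cdot_diff_left cdot_diff_right cdot_minus_left cdot_minus_right cdot_smult_left cdot_smult_right algebra_simps)

lemma test_function_continuous:
 assumes "test_function Om (ph :: real^'a => complex)"
 shows "continuous_on UNIV ph" "continuous_on UNIV (cgrad ph)"
 using assms smooth_C_diff[of ph 0] smooth_C_diff[OF smooth_cgrad, of ph 0] by (auto simp: test_function_def)

text \<open>By \<open>bvp_integrand\<close> the weak equation says that \<open>flux u G\<close> has
  weak divergence \<open>src u G\<close>. In this form the solution meets the requirements of
  \<open>normal_trace_pairing\<close>.\<close>

lemma bvp_solution_iff:
 "bvp_solution Om sg A V lam f u G \<longleftrightarrow> H1_fun Om u G \<and> weak_divergence Om (flux u G) (src u G) \<and> has_trace Om sg u G f"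
proof -
 have "weak_divergence Om (flux u G) (src u G) \<longleftrightarrow> (\<forall>ph::real^'a => complex. test_function Om ph -->
    (LINT x|M. cdot (- \<i> *s G x + u x *s cvec (A x)) (\<i> *s cgrad ph x + ph x *s cvec (A x))
      + (of_real (V x) - lam) * u x * ph x) = 0)" if "H1_fun Om u G"
 proof -
  have i: "in_L2 M (flux u G)" "in_L2 M (src u G)"
   using that by (auto simp: H1_fun_def intro!: in_L2_flux in_L2_src)
  have "(LINT x|M. cdot (- \<i> *s G x + u x *s cvec (A x)) (\<i> *s cgrad ph x + ph x *s cvec (A x)) + (of_real (V x) - lam) * u x * ph x)
   = (LINT x|M. cdot (flux u G x) (cgrad ph x)) + (LINT x|M. src u G x * ph x)" if "test_function Om ph" for ph
   unfolding bvp_integrand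
   by (intro LINT_add in_L2_integrable[OF bb_cdot i(1)]
     in_L2_integrable[OF bb_mult i(2)] continuous_in_L2 test_function_continuous[OF that])
  thus ?thesis using i by (simp add: weak_divergence_def eq_neg_iff_add_eq_0)
 qed
 thus ?thesis by (auto simp: bvp_solution_def)
qed

text \<open>Green's formula with the conjugate of \<open>w\<close>. The potential term in
  \<open>src\<close> completes the conjugated gradient of \<open>w\<close> to its conjugated flux,
  because conjugation turns \<i> w A into - \<i> times the conjugate of w times A.\<close>

lemma flux_energy:
 assumes F: "flux_approx (flux u G) (src u G) Ph" and u: "in_L2 M u" "in_L2 M G"
  and w: "has_trace Om sg w Gw (%_. 0)"
 shows "(LINT x|M. cdot (flux u G x) (cnjv (flux w Gw x))) + (LINT x|M. (of_real (V x) - lam) * u x * cnj (w x)) = 0"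
proof -
 have w2: "in_L2 M w" "in_L2 M Gw" using has_trace_in_L2[OF w] by auto
 have cw: "in_L2 M (%x. cnj (w x))" "in_L2 M (%x. cnjv (Gw x))" "in_L2 M (%x. cnjv (flux w Gw x))"
  using w2 in_L2_flux[OF w2] by (auto intro!: in_L2_linear[OF bounded_linear_cnj] in_L2_linear[OF bl_cnjv])
 have "has_trace Om sg (%x. cnj (w x)) (%x. cnjv (Gw x)) (%_. 0)" using has_trace_cnj[OF w] by simp
 from flux_approx_zero_trace[OF F this]
 have "(LINT x|M. src u G x * cnj (w x)) + (LINT x|M. cdot (flux u G x) (cnjv (Gw x))) = 0" .
 moreover have "(LINT x|M. src u G x * cnj (w x)) + (LINT x|M. cdot (flux u G x) (cnjv (Gw x)))
  = (LINT x|M. cdot (flux u G x) (cnjv (flux w Gw x))) + (LINT x|M. (of_real (V x) - lam) * u x * cnj (w x))"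
 proof -
  have "(LINT x|M. src u G x * cnj (w x)) + (LINT x|M. cdot (flux u G x) (cnjv (Gw x))) = (LINT x|M. src u G x * cnj (w x) + cdot (flux u G x) (cnjv (Gw x)))"
   by (rule LINT_add[symmetric])
    (intro in_L2_integrable[OF bb_mult] in_L2_integrable[OF bb_cdot] in_L2_src in_L2_flux u cw)+
  also have "... = (LINT x|M. cdot (flux u G x) (cnjv (flux w Gw x)) + (of_real (V x) - lam) * u x * cnj (w x))"
   by (intro LINT_cong refl)
    (simp add: src_def flux_def[of w] cnjv_add cnjv_smult cdot_add_right cdot_diff_right cdot_smult_right algebra_simps)
  also have "... = (LINT x|M. cdot (flux u G x) (cnjv (flux w Gw x))) + (LINT x|M. (of_real (V x) - lam) * u x * cnj (w x))"
   by (rule LINT_add)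
    (intro in_L2_integrable[OF bb_mult] in_L2_integrable[OF bb_cdot] in_L2_V in_L2_flux u cw)+
  finally show ?thesis .
 qed
 ultimately show ?thesis by simp
qed

text \<open>The flux term and the term with \<open>V x - Re lam\<close> are real, so the imaginary
  part of the left side is \<open>- Im lam\<close> times the squared norm of \<open>w\<close>.
  Cauchy-Schwarz bounds the right side.\<close>

lemma energy_estimate:
 assumes w: "in_L2 M w" "in_L2 M Gw" and Q: "in_L2 M Q"
  and e: "(LINT x|M. cdot (flux w Gw x) (cnjv (flux w Gw x))) + (LINT x|M. (of_real (V x) - lam) * w x * cnj (w x)) = - (LINT x|M. Q x * cnj (w x))"
 shows "\<bar>Im lam\<bar> * L2norm M w \<le> L2norm M Q"
proof -
 have cw: "in_L2 M (%x. cnj (w x))" by (rule in_L2_linear[OF bounded_linear_cnj w(1)])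
 have nw: "L2norm M (%x. cnj (w x)) = L2norm M w" by (simp add: L2norm_def)
 have im1: "Im (LINT x|M. cdot (flux w Gw x) (cnjv (flux w Gw x))) = 0"
  unfolding cdot_cnjv_self integral_complex_of_real by simp
 have eqn: "(of_real (V x) - lam) * w x * cnj (w x) = of_real ((V x - Re lam) * (norm (w x))^2) + (- \<i> * of_real (Im lam)) * of_real ((norm (w x))^2)" for x
 proof -
  define N where "N = (norm (w x))^2"
  have N: "w x * cnj (w x) = of_real N" by (simp add: N_def complex_norm_square[symmetric])
  have l: "lam = of_real (Re lam) + \<i> * of_real (Im lam)" by (simp add: complex_eq_iff)
  have "(of_real (V x) - lam) * w x * cnj (w x) = (of_real (V x) - lam) * of_real N"
   unfolding N[symmetric] by (rule mult.assoc)
  also have "... = of_real ((V x - Re lam) * N) + (- \<i> * of_real (Im lam)) * of_real N"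
   by (subst l) (simp add: algebra_simps)
  finally show ?thesis unfolding N_def .
 qed
 have n2: "integrable M (%x. (norm (w x))^2)" using w(1) by (simp add: in_L2_def)
 have i0: "integrable M (%x. (of_real (V x) - lam) * w x * cnj (w x))"
  by (rule in_L2_integrable[OF bb_mult in_L2_V[OF w(1)] cw])
 have i2: "integrable M (%x. (- \<i> * of_real (Im lam)) * complex_of_real ((norm (w x))^2))"
  by (intro integrable_mult_right integrable_of_real n2)
 have i1: "integrable M (%x. complex_of_real ((V x - Re lam) * (norm (w x))^2))"
  using Bochner_Integration.integrable_diff[OF i0 i2] unfolding eqn by simp
 have "(LINT x|M. (of_real (V x) - lam) * w x * cnj (w x)) = (LINT x|M. complex_of_real ((V x - Re lam) * (norm (w x))^2)) + (LINT x|M. (- \<i> * of_real (Im lam)) * complex_of_real ((norm (w x))^2))"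
  unfolding eqn by (rule LINT_add[OF i1 i2])
 also have "... = of_real (LINT x|M. (V x - Re lam) * (norm (w x))^2) + (- \<i> * of_real (Im lam)) * of_real ((L2norm M w)^2)"
  by (simp only: integral_complex_of_real integral_mult_right_zero L2norm_power2)
 finally have im2: "Im (LINT x|M. (of_real (V x) - lam) * w x * cnj (w x)) = - Im lam * (L2norm M w)^2" by simp
 have "Im (- (LINT x|M. Q x * cnj (w x))) = - Im lam * (L2norm M w)^2"
  using im1 im2 unfolding e[symmetric] by simp
 hence "\<bar>Im lam\<bar> * (L2norm M w)^2 = \<bar>Im (LINT x|M. Q x * cnj (w x))\<bar>" by (simp add: abs_mult)
 also have "... \<le> norm (LINT x|M. Q x * cnj (w x))" by (rule abs_Im_le_cmod)
 also have "... \<le> 1 * (L2norm M Q * L2norm M (%x. cnj (w x)))"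
  by (rule L2norm_bilinear[OF bb_mult Q cw]) (auto simp: norm_mult)
 finally have le: "\<bar>Im lam\<bar> * (L2norm M w)^2 \<le> L2norm M Q * L2norm M w" by (simp add: nw)
 show ?thesis
 proof (cases "L2norm M w = 0")
  case False
  hence "L2norm M w > 0" using L2norm_nonneg[of M w] by linarith
  with le show ?thesis by (simp add: power2_eq_square)
 qed simp
qed

text \<open>The difference has trace zero and can be inserted into the energy identities of both
  solutions. The flux approximations are assumed because those identities rest on Green's formula
  for the fluxes.\<close>

lemma bvp_unique:
 assumes "bvp_solution Om sg A V lam f u G" "flux_approx (flux u G) (src u G) Ph"
  and "bvp_solution Om sg A V lam f u' G'" "flux_approx (flux u' G') (src u' G') Ph'"
 shows "AE x in M. u x = u' x"
proof -
 have i: "in_L2 M u" "in_L2 M G" "in_L2 M u'" "in_L2 M G'"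
  using assms(1,3) by (auto simp: bvp_solution_def H1_fun_def)
 let ?w = "%x. u x - u' x" and ?G = "%x. G x - G' x"
 have w2: "in_L2 M ?w" "in_L2 M ?G" using i by (auto intro: in_L2_diff)
 have tr: "has_trace Om sg ?w ?G (%_. 0)"
  using has_trace_diff[of u G f u' G' f] assms(1,3) by (simp add: bvp_solution_def)
 have fl: "flux ?w ?G x = flux u G x - flux u' G' x" for x
  by (simp add: flux_def vec_eq_iff algebra_simps)
 note e1 = flux_energy[OF assms(2) i(1,2) tr] and e2 = flux_energy[OF assms(4) i(3,4) tr]
 have cw: "in_L2 M (%x. cnj (?w x))" by (rule in_L2_linear[OF bounded_linear_cnj w2(1)])
 have cf: "in_L2 M (%x. cnjv (flux ?w ?G x))" by (rule in_L2_linear[OF bl_cnjv in_L2_flux[OF w2]])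
 have "(LINT x|M. cdot (flux ?w ?G x) (cnjv (flux ?w ?G x))) = (LINT x|M. cdot (flux u G x) (cnjv (flux ?w ?G x)) - cdot (flux u' G' x) (cnjv (flux ?w ?G x)))"
  by (simp add: fl cdot_diff_left)
 also have "... = (LINT x|M. cdot (flux u G x) (cnjv (flux ?w ?G x))) - (LINT x|M. cdot (flux u' G' x) (cnjv (flux ?w ?G x)))"
  by (intro LINT_diff in_L2_integrable[OF bb_cdot _ cf] in_L2_flux i)
 finally have a: "(LINT x|M. cdot (flux ?w ?G x) (cnjv (flux ?w ?G x))) = ..." .
 have "(LINT x|M. (of_real (V x) - lam) * ?w x * cnj (?w x)) = (LINT x|M. (of_real (V x) - lam) * u x * cnj (?w x) - (of_real (V x) - lam) * u' x * cnj (?w x))"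
  by (simp add: algebra_simps)
 also have "... = (LINT x|M. (of_real (V x) - lam) * u x * cnj (?w x)) - (LINT x|M. (of_real (V x) - lam) * u' x * cnj (?w x))"
  by (intro LINT_diff in_L2_integrable[OF bb_mult _ cw] in_L2_V i)
 finally have b: "(LINT x|M. (of_real (V x) - lam) * ?w x * cnj (?w x)) = ..." .
 have "(LINT x|M. cdot (flux ?w ?G x) (cnjv (flux ?w ?G x))) + (LINT x|M. (of_real (V x) - lam) * ?w x * cnj (?w x)) = 0"
  unfolding a b add_diff_add[symmetric] e1 e2 by simp
 hence "\<bar>Im lam\<bar> * L2norm M ?w \<le> L2norm M (%x. 0 :: complex)"
  by (intro energy_estimate[OF w2 in_L2_zero]) simp
 hence "\<bar>Im lam\<bar> * L2norm M ?w \<le> 0" by (simp add: L2norm_def)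
 hence "L2norm M ?w = 0" using lam L2norm_nonneg[of M ?w] by (simp add: mult_le_0_iff)
 from L2norm_eq_0_AE[OF w2(1) this] show ?thesis by eventually_elim simp
qed

text \<open>The difference \<open>u - f\<close> has trace zero, and the smooth function
  \<open>f\<close> satisfies an energy identity with source \<open>mag_laplace A f\<close>.
  Subtracting it from the one for \<open>u\<close> leaves a problem whose right side is minus the
  operator applied to \<open>f\<close>.\<close>

lemma bvp_resolvent_estimate:
 assumes sol: "bvp_solution Om sg A V lam f u G" "flux_approx (flux u G) (src u G) Ph" and f: "smooth f"
 shows "\<bar>Im lam\<bar> * L2norm M (%x. u x - f x) \<le> L2norm M (%x. mag_laplace A f x + (of_real (V x) - lam) * f x)"
proof -
 have i: "in_L2 M u" "in_L2 M G" using sol(1) by (auto simp: bvp_solution_def H1_fun_def)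
 have f2: "C_diff 2 f" by (rule smooth_C_diff[OF f])
 have fL: "in_L2 M f" "in_L2 M (cgrad f)"
  using continuous_in_L2[of f] continuous_in_L2[of "cgrad f"] smooth_C_diff[OF f, of 0] smooth_C_diff[OF smooth_cgrad[OF f], of 0] by auto
 let ?w = "%x. u x - f x" and ?G = "%x. G x - cgrad f x"
 let ?Q = "%x. mag_laplace A f x + (of_real (V x) - lam) * f x"
 have w2: "in_L2 M ?w" "in_L2 M ?G" using i fL by (auto intro: in_L2_diff)
 have tr: "has_trace Om sg ?w ?G (%_. 0)"
  using has_trace_diff[of u G f f "cgrad f" f] has_trace_smooth[OF f] sol(1) by (simp add: bvp_solution_def)
 have Df: "C_diff 1 (mag_grad A f)" by (rule C_diff_mag_grad[OF f2 A(1)])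
 have ffl: "flux f (cgrad f) = mag_grad A f" by (simp add: flux_def mag_grad_def fun_eq_iff)
 have hL: "in_L2 M (mag_laplace A f)" by (rule continuous_in_L2[OF continuous_on_mag_laplace[OF f2 A(1)]])
 have QL: "in_L2 M ?Q" by (intro in_L2_add hL in_L2_V fL)
 have fl: "flux ?w ?G x = flux u G x - mag_grad A f x" for x
  unfolding ffl[symmetric] by (simp add: flux_def vec_eq_iff algebra_simps)
 have cw: "in_L2 M (%x. cnj (?w x))" by (rule in_L2_linear[OF bounded_linear_cnj w2(1)])
 have cG: "in_L2 M (%x. cnjv (?G x))" by (rule in_L2_linear[OF bl_cnjv w2(2)])
 have cf: "in_L2 M (%x. cnjv (flux ?w ?G x))" by (rule in_L2_linear[OF bl_cnjv in_L2_flux[OF w2]])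
 have DL: "in_L2 M (mag_grad A f)" "in_L2 M (cdiv (mag_grad A f))"
  using continuous_in_L2[OF C_diff_cont[OF Df]] continuous_in_L2[OF continuous_on_cdiv[OF Df]] by auto
 note e1 = flux_energy[OF sol(2) i tr]
 have "has_trace Om sg (%x. cnj (?w x)) (%x. cnjv (?G x)) (%_. 0)" using has_trace_cnj[OF tr] by simp
 from green_trace[OF this Df]
 have "0 = (LINT x|M. cdiv (mag_grad A f) x * cnj (?w x)) + (LINT x|M. cdot (mag_grad A f x) (cnjv (?G x)))" by simp
 also have "... = (LINT x|M. cdiv (mag_grad A f) x * cnj (?w x) + cdot (mag_grad A f x) (cnjv (?G x)))"
  by (rule LINT_add[symmetric])
   (intro in_L2_integrable[OF bb_mult] in_L2_integrable[OF bb_cdot] DL cw cG)+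
 also have "... = (LINT x|M. cdot (mag_grad A f x) (cnjv (flux ?w ?G x)) - mag_laplace A f x * cnj (?w x))"
  by (intro LINT_cong refl)
   (simp add: mag_laplace_def flux_def[of ?w] cnjv_add cnjv_diff cnjv_smult cdot_add_right cdot_diff_right cdot_smult_right algebra_simps)
 also have "... = (LINT x|M. cdot (mag_grad A f x) (cnjv (flux ?w ?G x))) - (LINT x|M. mag_laplace A f x * cnj (?w x))"
  by (rule LINT_diff)
   (intro in_L2_integrable[OF bb_mult] in_L2_integrable[OF bb_cdot] DL cw cf hL)+
 finally have e2: "(LINT x|M. cdot (mag_grad A f x) (cnjv (flux ?w ?G x))) = (LINT x|M. mag_laplace A f x * cnj (?w x))" by simp
 have "(LINT x|M. cdot (flux ?w ?G x) (cnjv (flux ?w ?G x))) = (LINT x|M. cdot (flux u G x) (cnjv (flux ?w ?G x)) - cdot (mag_grad A f x) (cnjv (flux ?w ?G x)))"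
  by (simp add: fl cdot_diff_left)
 also have "... = (LINT x|M. cdot (flux u G x) (cnjv (flux ?w ?G x))) - (LINT x|M. cdot (mag_grad A f x) (cnjv (flux ?w ?G x)))"
  by (intro LINT_diff in_L2_integrable[OF bb_cdot _ cf] in_L2_flux i DL)
 finally have a: "(LINT x|M. cdot (flux ?w ?G x) (cnjv (flux ?w ?G x))) = ..." .
 have "(LINT x|M. (of_real (V x) - lam) * ?w x * cnj (?w x)) = (LINT x|M. (of_real (V x) - lam) * u x * cnj (?w x) - (of_real (V x) - lam) * f x * cnj (?w x))"
  by (simp add: algebra_simps)
 also have "... = (LINT x|M. (of_real (V x) - lam) * u x * cnj (?w x)) - (LINT x|M. (of_real (V x) - lam) * f x * cnj (?w x))"
  by (intro LINT_diff in_L2_integrable[OF bb_mult _ cw] in_L2_V i fL)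
 finally have b: "(LINT x|M. (of_real (V x) - lam) * ?w x * cnj (?w x)) = ..." .
 have "(LINT x|M. ?Q x * cnj (?w x)) = (LINT x|M. mag_laplace A f x * cnj (?w x) + (of_real (V x) - lam) * f x * cnj (?w x))"
  by (simp add: distrib_right)
 also have "... = (LINT x|M. mag_laplace A f x * cnj (?w x)) + (LINT x|M. (of_real (V x) - lam) * f x * cnj (?w x))"
  by (intro LINT_add in_L2_integrable[OF bb_mult _ cw] in_L2_V fL hL)
 finally have q: "(LINT x|M. ?Q x * cnj (?w x)) = ..." .
 show ?thesis
 proof (rule energy_estimate[OF w2 QL])
  show "(LINT x|M. cdot (flux ?w ?G x) (cnjv (flux ?w ?G x))) + (LINT x|M. (of_real (V x) - lam) * ?w x * cnj (?w x)) = - (LINT x|M. ?Q x * cnj (?w x))"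
   unfolding a b q e2 add_diff_add[symmetric] e1 by simp
 qed
qed

text \<open>The divergence in the pairing is \<open>src u G\<close> by uniqueness of weak
  divergences, so the pairing is a volume integral. Green's formula with the field
  \<open>mag_grad (%x. - A x) g\<close> moves the derivatives from \<open>u\<close> to
  \<open>g\<close>. The pairing being bilinear, the operator on \<open>g\<close> is the transposed
  one: - \<i> \<nabla> + A becomes \<i> \<nabla> + A, which has the same square as - \<i> \<nabla> -
  A.\<close>

lemma bvp_pairing_value:
 assumes sol: "bvp_solution Om sg A V lam f u G" and g: "C_diff 2 g"
  and p: "normal_trace_pairing Om sg nu (%x. G x + (\<i> * u x) *s cvec (A x)) g s"
 shows "\<exists>Ph. flux_approx (flux u G) (src u G) Ph"
  and "s = (LINT x|sg. f x * cdot (mag_grad (%x. - A x) g x) (cvec (nu x)))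
   + (LINT x|M. u x * (mag_laplace (%x. - A x) g x + (of_real (V x) - lam) * g x))"
proof -
 have i: "in_L2 M u" "in_L2 M G" and tr: "has_trace Om sg u G f" and wd: "weak_divergence Om (flux u G) (src u G)"
  using sol unfolding bvp_solution_iff by (auto simp: H1_fun_def)
 have fe: "(%x. G x + (\<i> * u x) *s cvec (A x)) = flux u G" by (simp add: flux_def fun_eq_iff)
 obtain d Ph where Ph: "weak_divergence Om (flux u G) d" "!!m. smooth (Ph m)" "L2_tendsto M Ph (flux u G)" "L2_tendsto M (%m. cdiv (Ph m)) d"
  "(%m. LINT x|sg. cdot (Ph m x) (cvec (nu x)) * g x) ----> s"
  using p unfolding normal_trace_pairing_def fe by blast
 have sL: "in_L2 M (src u G)" by (rule in_L2_src[OF i])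
 have "L2_tendsto M (%m. cdiv (Ph m)) (src u G)"
 proof (rule L2_tendsto_cong_AE[OF Ph(4)])
  show "cdiv (Ph m) \<in> borel_measurable M" for m using Ph(4) by (simp add: L2_tendsto_iff in_L2_def)
  show "src u G \<in> borel_measurable M" using sL by (rule in_L2_measurable)
  show "AE x in M. d x = src u G x" by (rule weak_divergence_unique[OF Ph(1) wd])
 qed simp
 hence ap: "flux_approx (flux u G) (src u G) Ph" using Ph by (simp add: flux_approx_def)
 thus "\<exists>Ph. flux_approx (flux u G) (src u G) Ph" by blast
 have g1: "C_diff 1 g" using C_diff_mono[OF g, of 1] by simp
 have A': "C_diff 1 (%x. - A x)" by (rule C_diff_minus[OF A(1)])
 let ?K = "mag_grad (%x. - A x) g"
 have K: "C_diff 1 ?K" by (rule C_diff_mag_grad[OF g A'])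
 have L: "in_L2 M g" "in_L2 M (cgrad g)" "in_L2 M ?K" "in_L2 M (cdiv ?K)" "in_L2 M (mag_laplace (%x. - A x) g)"
  using C_diff_cont[OF g] C_diff_cgrad[of 0 g] g1 C_diff_cont[OF K] continuous_on_cdiv[OF K] continuous_on_mag_laplace[OF g A']
  by (auto intro!: continuous_in_L2)
 have "s = (LINT x|M. src u G x * g x) + (LINT x|M. cdot (flux u G x) (cgrad g x))"
  using flux_approx_pairing[OF ap g1] Ph(5) by (rule LIMSEQ_unique[rotated])
 also have "... = (LINT x|M. src u G x * g x + cdot (flux u G x) (cgrad g x))"
  by (rule LINT_add[symmetric])
   (intro in_L2_integrable[OF bb_mult] in_L2_integrable[OF bb_cdot] in_L2_flux sL i L)+
 also have "... = (LINT x|M. (cdiv ?K x * u x + cdot (?K x) (G x)) + u x * (mag_laplace (%x. - A x) g x + (of_real (V x) - lam) * g x))"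
  by (intro LINT_cong refl)
   (simp add: src_def flux_def mag_laplace_def mag_grad_def[of _ g] cdot_add_left cdot_add_right cdot_diff_left cdot_diff_right cdot_minus_left cdot_minus_right cdot_smult_left cdot_smult_right
     cdot_commute algebra_simps linear_neg[OF bounded_linear.linear[OF bl_cvec]])
 also have "... = (LINT x|M. cdiv ?K x * u x + cdot (?K x) (G x)) + (LINT x|M. u x * (mag_laplace (%x. - A x) g x + (of_real (V x) - lam) * g x))"
  by (intro LINT_add Bochner_Integration.integrable_add in_L2_integrable[OF bb_mult]
    in_L2_integrable[OF bb_cdot] in_L2_add in_L2_V i L)
 also have "(LINT x|M. cdiv ?K x * u x + cdot (?K x) (G x)) = (LINT x|M. cdiv ?K x * u x) + (LINT x|M. cdot (?K x) (G x))"
  by (intro LINT_add in_L2_integrable[OF bb_mult]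
    in_L2_integrable[OF bb_cdot] i L)
 also have "... = (LINT x|sg. f x * cdot (?K x) (cvec (nu x)))" by (rule green_trace[OF tr K])
 finally show "s = (LINT x|sg. f x * cdot (?K x) (cvec (nu x))) + (LINT x|M. u x * (mag_laplace (%x. - A x) g x + (of_real (V x) - lam) * g x))" .
qed

end

section \<open>Approximation of fields with square integrable divergence\<close>

context boundary_setting
begin

text \<open>Near a boundary point the mollifier is shifted against the direction pointing into the domain,
 so that for \<open>x\<close> in the domain only values at points of the domain enter the convolution at \<open>x\<close>.\<close>

lemma inward_shift:
 assumes p: "p \<in> closure Om"
 shows "\<exists>r>0. \<exists>c. \<exists>ep0>0. \<forall>ep x z. 0 < ep \<and> ep < ep0 \<and> x \<in> Om \<and> z \<in> cball p (2 * r) \<and> norm ((x - z) /\<^sub>R ep - c) \<le> 1 --> z \<in> Om"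
proof (cases "p \<in> Om")
 case True
 obtain d where d: "d > 0" "cball p d \<subseteq> Om" using open_dom True unfolding open_contains_cball by blast
 have "z \<in> Om" if "z \<in> cball p (2 * (d/2))" for z using that d by auto
 thus ?thesis using half_gt_zero[OF d(1)] by (intro exI[of _ "d/2"] conjI exI[of _ 0] exI[of _ 1]) auto
next
 case False
 hence pf: "p \<in> frontier Om" using p open_dom by (simp add: frontier_def interior_open)
 then obtain U e ga where U: "p \<in> U" "C11_chart Om U e ga" using dom(1) unfolding C11_domain_def by blast
 note c = C11_chart_graph[OF U(2)]
 obtain d where d: "d > 0" "cball p d \<subseteq> U" using c(1) U(1) unfolding open_contains_cball by blast
 \<comment> \<open>A third of the radius: \<open>z\<close> is within 2r of \<open>p\<close>, and
   both \<open>x\<close> and the shifted point \<open>?x'\<close> turn out to be within r of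
   \<open>z\<close>.\<close>
 define r where "r = d / 3"
 have r: "r > 0" "cball p (3 * r) \<subseteq> U" using d by (auto simp: r_def)
 have "compact (grad ga ` cball p (3 * r))" by (intro compact_continuous_image continuous_on_subset[OF c(6)]) auto
 from compact_imp_bounded[OF this] obtain L where L: "L > 0" "\<forall>x\<in>cball p (3 * r). norm (grad ga x) \<le> L"
  unfolding bounded_pos by auto
 have lip: "norm (ga z - ga x) \<le> L * norm (z - x)" if "x \<in> cball p (3 * r)" "z \<in> cball p (3 * r)" for x z
 proof (rule differentiable_bound[OF convex_cball _ _ that(2) that(1)])
  fix y assume y: "y \<in> cball p (3 * r)"
  show "(ga has_derivative (%h. \<Sum>k\<in>UNIV. h $ k *\<^sub>R partial k ga y)) (at y within cball p (3 * r))"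
   by (rule has_derivative_at_withinI[OF has_derivative_sum_partial[OF C_diff_D[OF c(5)]]]) simp
  have "(\<Sum>k\<in>UNIV. h $ k *\<^sub>R partial k ga y) = h \<bullet> grad ga y" for h by (simp add: inner_vec_def grad_def)
  hence "norm (\<Sum>k\<in>UNIV. h $ k *\<^sub>R partial k ga y) \<le> L * norm h" for h
   using Cauchy_Schwarz_ineq2[of h "grad ga y"] mult_left_mono[OF L(2)[rule_format, OF y] norm_ge_zero[of h]] by (simp add: mult.commute)
  thus "onorm (%h. \<Sum>k\<in>UNIV. h $ k *\<^sub>R partial k ga y) \<le> L" using L(1) by (intro onorm_bound) auto
 qed
 \<comment> \<open>Shifting by \<open>ep * m\<close> along \<open>e\<close> gains that much height;
   passing to \<open>z\<close> loses at most \<open>ep\<close> in height and \<open>L * ep\<close>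
   through the graph function. With \<open>L + 2\<close> a margin of \<open>ep\<close> remains. The
   bound \<open>ep0\<close> keeps \<open>ep * (m + 1)\<close> below \<open>r\<close>.\<close>
 define m where "m = L + 2"
 define ep0 where "ep0 = r / (m + 1)"
 have m: "m > 0" using L(1) by (simp add: m_def)
 have e0: "ep0 > 0" using r(1) m by (simp add: ep0_def)
 have "z \<in> Om" if h: "0 < ep" "ep < ep0" "x \<in> Om" "z \<in> cball p (2 * r)" "norm ((x - z) /\<^sub>R ep - - (m *\<^sub>R e)) \<le> 1" for ep x z
 proof -
  let ?x' = "x + (ep * m) *\<^sub>R e"
  have em: "ep * (m + 1) \<le> r" using h(2) m by (simp add: ep0_def pos_less_divide_eq less_imp_le)
  have "ep *\<^sub>R ((x - z) /\<^sub>R ep - - (m *\<^sub>R e)) = ?x' - z" using h(1) by (simp add: algebra_simps)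
  hence "norm (?x' - z) = ep * norm ((x - z) /\<^sub>R ep - - (m *\<^sub>R e))" using h(1) by (metis abs_of_pos norm_scaleR)
  hence xz: "norm (?x' - z) \<le> ep" using mult_left_mono[OF h(5), of ep] h(1) by simp
  have em1: "ep \<le> r" "ep * m \<ge> 0"
  proof -
   have "0 \<le> ep * m" using h(1) m by simp
   thus "ep \<le> r" "ep * m \<ge> 0" using em by (auto simp: algebra_simps)
  qed
  have "norm (x - z) \<le> norm (?x' - z) + norm ((ep * m) *\<^sub>R e)"
   using norm_triangle_ineq4[of "?x' - z" "(ep * m) *\<^sub>R e"] by (simp add: algebra_simps)
  hence "norm (x - z) \<le> r" using xz em em1 c(2) by (simp add: algebra_simps)
  moreover have "norm (?x' - z) \<le> r" using xz em1 by simp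
  moreover have "dist z x = norm (x - z)" "dist z ?x' = norm (?x' - z)" by (simp_all add: dist_norm norm_minus_commute)
  moreover have "dist p z \<le> 2 * r" using h(4) by simp
  ultimately have b: "x \<in> cball p (3 * r)" "?x' \<in> cball p (3 * r)" "z \<in> cball p (3 * r)"
   using dist_triangle[of p x z] dist_triangle[of p ?x' z] r(1)
   unfolding mem_cball by linarith+
  have "x \<bullet> e > ga x" using c(4)[of x] b(1) r(2) h(3) by blast
  moreover have "ga z \<le> ga x + L * ep"
  proof -
   have "ga z - ga ?x' \<le> L * norm (z - ?x')" using lip[OF b(2,3)] by (simp add: abs_le_iff)
   also have "... \<le> L * ep" using xz L(1) by (intro mult_left_mono) (auto simp: norm_minus_commute)
   finally show ?thesis using c(3)[of x "ep * m"] by simp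
  qed
  moreover have "z \<bullet> e \<ge> x \<bullet> e + ep * m - ep"
  proof -
   have "(?x' - z) \<bullet> e \<le> ep" using Cauchy_Schwarz_ineq2[of "?x' - z" e] xz c(2) by simp
   thus ?thesis using c(2) by (simp add: inner_diff_left inner_add_left dot_square_norm)
  qed
  moreover have "ep * m - ep - L * ep = ep" by (simp add: m_def algebra_simps)
  ultimately have "z \<bullet> e > ga z" using h(1) by linarith
  thus "z \<in> Om" using c(4)[of z] b(3) r(2) by blast
 qed
 thus ?thesis using r(1) e0 by (intro exI[of _ r] conjI exI[of _ "- (m *\<^sub>R e)"] exI[of _ ep0]) auto
qed

lemma conv_indicator:
 fixes h :: "real^'n => 'b::euclidean_space"
 shows "conv k (%z. indicator Om z *\<^sub>R h z) x = (LINT z|M. k (x - z) *\<^sub>R h z)"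
proof -
 have "(LINT z|M. k (x - z) *\<^sub>R h z) = (LINT z|lebesgue. indicator Om z *\<^sub>R k (x - z) *\<^sub>R h z)"
  using sets_dom by (simp add: integral_restrict_space)
 also have "... = conv k (%z. indicator Om z *\<^sub>R h z) x"
  unfolding conv_def by (intro LINT_cong refl) (rule scaleR_left_commute)
 finally show ?thesis by simp
qed

lemma indicator_integrable:
 fixes h :: "real^'n => 'b::euclidean_space"
 assumes "in_L2 M h"
 shows "integrable lebesgue (%z. indicator Om z *\<^sub>R h z)"
 using L2_imp_integrable[OF assms finite_dom] sets_dom by (simp add: integrable_restrict_space)

text \<open>The product of the kernel at \<open>x - z\<close> and the cut-off at \<open>z\<close> is
  a test function in \<open>z\<close> when its support lies in the domain; the weak divergence
  tested with it takes the derivative off the kernel. At such \<open>x\<close> the extension by zero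
  creates no boundary term, and divergence commutes with mollification up to the gradient of the
  cut-off.\<close>

lemma cdiv_conv:
 assumes wd: "weak_divergence Om F d" and k: "smooth k" "!!x. norm x > R ==> k x = 0" and be: "smooth be" "compact (supp be)"
  and x: "supp (%z. k (x - z) * be z) \<subseteq> Om"
 shows "cdiv (conv k (%z. indicator Om z *\<^sub>R be z *\<^sub>R F z)) x
  = conv k (%z. indicator Om z *\<^sub>R (be z *\<^sub>R d z + cdot (F z) (cvec (grad be z)))) x"
proof -
 have F: "in_L2 M F" "in_L2 M d" using wd by (auto simp: weak_divergence_def)
 have bec: "continuous_on UNIV be" using smooth_C_diff[OF be(1), of 0] by simp
 have pbc: "continuous_on UNIV (partial j be)" for j using smooth_C_diff[OF be(1), of 1] by simp
 have k1: "C_diff 1 k" by (rule smooth_C_diff[OF k(1)])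
 have bF: "in_L2 M (%z. be z *\<^sub>R F z)"
  using in_L2_mult_continuous[OF bounded_bilinear.flip[OF bounded_bilinear_scaleR] F(1) bec] by simp
 let ?Fb = "%z. indicator Om z *\<^sub>R be z *\<^sub>R F z"
 have Fbi: "integrable lebesgue ?Fb" by (rule indicator_integrable[OF bF])
 have kzC: "C_diff m (%z. k (x - z))" for m using C_diff_affine[OF smooth_C_diff[OF k(1)], of m x "-1"] by simp
 have pkc: "continuous_on UNIV (%z. partial j k (x - z))" for j
  using C_diff_affine[OF smooth_C_diff[OF smooth_partial[OF k(1)]], of 0 j x "-1"] by simp
 have pk: "partial j (%z. k (x - z)) z = - partial j k (x - z)" for z j
  using partial_affine[of k x "-1" z j] C_diff_D[OF k1] by simp
 let ?ph = "%z. complex_of_real (k (x - z) * be z)"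
 have phC: "C_diff m ?ph" for m by (intro C_diff_of_real C_diff_mult kzC smooth_C_diff[OF be(1)])
 have pph: "partial j ?ph z = of_real (k (x - z) * partial j be z - partial j k (x - z) * be z)" for j z
 proof -
  have "partial j ?ph z = of_real (partial j (%z. k (x - z) * be z) z)"
   by (rule partial_of_real) (rule C_diff_D[OF C_diff_mult[OF kzC[of 1] smooth_C_diff[OF be(1)]]], simp)
  also have "partial j (%z. k (x - z) * be z) z = k (x - z) * partial j be z + partial j (%z. k (x - z)) z * be z"
   by (rule partial_mult) (rule C_diff_D[OF kzC[of 1]] C_diff_D[OF smooth_C_diff[OF be(1), of 1]]; simp)+
  finally show ?thesis by (simp add: pk)
 qed
 have cgp: "cgrad ?ph z = of_real (k (x - z)) *s cvec (grad be z) - of_real (be z) *s cvec (\<chi> j. partial j k (x - z))" for z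
  unfolding vec_eq_iff cgrad_nth pph by (simp add: cvec_def grad_def mult.commute)
 have kF: "(\<Sum>j\<in>UNIV. partial j k (x - z) *\<^sub>R (be z *\<^sub>R F z $ j)) = of_real (be z) * cdot (F z) (cvec (\<chi> j. partial j k (x - z)))" for z
  by (simp add: cdot_def cvec_def sum_distrib_left scaleR_conv_of_real mult_ac)
 have "supp ?ph = supp (%z. k (x - z) * be z)" by (simp add: supp_def)
 moreover have "supp (%z. k (x - z) * be z) \<subseteq> supp be" unfolding supp_def by (intro closure_mono) auto
 ultimately have "compact (supp ?ph)" "supp ?ph \<subseteq> Om"
  using compact_Int_closed[OF be(2), of "supp ?ph"] x by (auto simp: supp_def inf.absorb2)
 hence "test_function Om ?ph" using phC by (simp add: test_function_def smooth_def)
 hence weak: "(LINT z|M. cdot (F z) (cgrad ?ph z)) = - (LINT z|M. d z * ?ph z)" using wd by (simp add: weak_divergence_def)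
 have Fj: "in_L2 M (%z. F z $ j)" for j by (rule in_L2_linear[OF bounded_linear_vec_nth F(1)])
 have ij: "integrable M (%z. partial j k (x - z) *\<^sub>R (be z *\<^sub>R F z $ j))" for j
 proof -
  have "in_L2 M (%z. be z *\<^sub>R F z $ j)"
   using in_L2_mult_continuous[OF bounded_bilinear.flip[OF bounded_bilinear_scaleR] Fj bec] by simp
  from in_L2_integrable[OF bounded_bilinear_scaleR continuous_in_L2[OF pkc] this] show ?thesis .
 qed
 have "cdiv (conv k ?Fb) x = (\<Sum>j\<in>UNIV. (LINT z|M. partial j k (x - z) *\<^sub>R (be z *\<^sub>R F z $ j)))"
  unfolding cdiv_def
 proof (rule sum.cong[OF refl])
  fix j
  have pz: "partial j k y = 0" if "norm y > R" for y by (rule partial_zero_outside[of R k, OF k(2) that])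
  have ci: "integrable lebesgue (%z. partial j k (x - z) *\<^sub>R ?Fb z)"
   by (rule conv_integrable[of "partial j k" R ?Fb, OF C_diff_cont_partial[OF k1] pz Fbi])
  have "partial j (conv k ?Fb) x $ j = conv (partial j k) ?Fb x $ j"
   using partial_conv(2)[of k R ?Fb j x, OF k1 k(2) Fbi] by simp
  also have "... = (LINT z|lebesgue. (partial j k (x - z) *\<^sub>R ?Fb z) $ j)"
   unfolding conv_def by (rule integral_bounded_linear[OF bounded_linear_vec_nth ci, symmetric])
  also have "... = conv (partial j k) (%z. indicator Om z *\<^sub>R be z *\<^sub>R F z $ j) x" by (simp add: conv_def)
  also have "... = (LINT z|M. partial j k (x - z) *\<^sub>R (be z *\<^sub>R F z $ j))" by (rule conv_indicator)
  finally show "partial j (conv k ?Fb) x $ j = (LINT z|M. partial j k (x - z) *\<^sub>R (be z *\<^sub>R F z $ j))" .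
 qed
 also have "... = (LINT z|M. (\<Sum>j\<in>UNIV. partial j k (x - z) *\<^sub>R (be z *\<^sub>R F z $ j)))"
  by (rule Bochner_Integration.integral_sum[symmetric]) (rule ij)
 also have "... = (LINT z|M. (k (x - z) *\<^sub>R cdot (F z) (cvec (grad be z))) - cdot (F z) (cgrad ?ph z))"
 proof (rule LINT_cong[OF refl])
  fix z
  show "(\<Sum>j\<in>UNIV. partial j k (x - z) *\<^sub>R (be z *\<^sub>R F z $ j)) = k (x - z) *\<^sub>R cdot (F z) (cvec (grad be z)) - cdot (F z) (cgrad ?ph z)"
   unfolding kF unfolding cgp cdot_diff_right cdot_smult_right scaleR_conv_of_real by simp
 qed
 also have "... = (LINT z|M. k (x - z) *\<^sub>R cdot (F z) (cvec (grad be z))) - (LINT z|M. cdot (F z) (cgrad ?ph z))"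
 proof (rule LINT_diff)
  have gc: "continuous_on UNIV (%z. cvec (grad be z))"
   unfolding grad_def by (intro bounded_linear.continuous_on[OF bl_cvec] continuous_on_vec_lambda pbc)
  have kc: "continuous_on UNIV (%z. k (x - z))" using kzC[of 0] by simp
  show "integrable M (%z. k (x - z) *\<^sub>R cdot (F z) (cvec (grad be z)))"
   by (rule in_L2_integrable[OF bounded_bilinear_scaleR continuous_in_L2[OF kc] in_L2_mult_continuous[OF bb_cdot F(1) gc]])
  show "integrable M (%z. cdot (F z) (cgrad ?ph z))"
   by (rule in_L2_integrable[OF bb_cdot F(1) continuous_in_L2[OF C_diff_cont[OF C_diff_cgrad[OF phC]]]])
 qed
 also have "... = (LINT z|M. k (x - z) *\<^sub>R cdot (F z) (cvec (grad be z))) + (LINT z|M. d z * ?ph z)" unfolding weak by simp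
 also have "... = (LINT z|M. k (x - z) *\<^sub>R cdot (F z) (cvec (grad be z)) + d z * ?ph z)"
 proof (rule LINT_add[symmetric])
  have gc: "continuous_on UNIV (%z. cvec (grad be z))"
   unfolding grad_def by (intro bounded_linear.continuous_on[OF bl_cvec] continuous_on_vec_lambda pbc)
  have kc: "continuous_on UNIV (%z. k (x - z))" using kzC[of 0] by simp
  show "integrable M (%z. k (x - z) *\<^sub>R cdot (F z) (cvec (grad be z)))"
   by (rule in_L2_integrable[OF bounded_bilinear_scaleR continuous_in_L2[OF kc] in_L2_mult_continuous[OF bb_cdot F(1) gc]])
  show "integrable M (%z. d z * ?ph z)"
   by (rule in_L2_integrable[OF bb_mult F(2) continuous_in_L2[OF C_diff_cont[OF phC]]])
 qed
 also have "... = (LINT z|M. k (x - z) *\<^sub>R (be z *\<^sub>R d z + cdot (F z) (cvec (grad be z))))"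
  by (intro LINT_cong refl) (simp add: scaleR_conv_of_real algebra_simps)
 also have "... = conv k (%z. indicator Om z *\<^sub>R (be z *\<^sub>R d z + cdot (F z) (cvec (grad be z)))) x"
  by (rule conv_indicator[symmetric])
 finally show ?thesis .
qed

text \<open>The mollifier is translated by \<open>c\<close> before it is rescaled, which realises
  the inward shift: for \<open>x\<close> in the domain the kernel meets the support of
  \<open>be\<close> only at points of the domain, so \<open>cdiv_conv\<close> applies at every such
  \<open>x\<close>. The translated kernel still has mass one and is an approximate identity.\<close>

lemma flux_approx_local:
 assumes wd: "weak_divergence Om F d" and be: "smooth be" "supp be \<subseteq> cball p (2 * r)"
  and sh: "ep0 > 0" "!!ep x z. 0 < ep ==> ep < ep0 ==> x \<in> Om ==> z \<in> cball p (2 * r) ==> norm ((x - z) /\<^sub>R ep - c) \<le> 1 ==> z \<in> Om"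
 shows "\<exists>Ph. flux_approx (%z. be z *\<^sub>R F z) (%z. be z *\<^sub>R d z + cdot (F z) (cvec (grad be z))) Ph"
proof -
 have F: "in_L2 M F" "in_L2 M d" using wd by (auto simp: weak_divergence_def)
 have bec: "continuous_on UNIV be" using smooth_C_diff[OF be(1), of 0] by simp
 have pbc: "continuous_on UNIV (partial j be)" for j using smooth_C_diff[OF be(1), of 1] by simp
 have bes: "compact (supp be)"
  using compact_Int_closed[OF compact_cball, of "supp be" p "2 * r"] be(2) by (simp add: supp_def inf.absorb2)
 have gc: "continuous_on UNIV (%z. cvec (grad be z))"
  unfolding grad_def by (intro bounded_linear.continuous_on[OF bl_cvec] continuous_on_vec_lambda pbc)
 have bF: "in_L2 M (%z. be z *\<^sub>R F z)" "in_L2 M (%z. be z *\<^sub>R d z + cdot (F z) (cvec (grad be z)))"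
  using in_L2_mult_continuous[OF bounded_bilinear.flip[OF bounded_bilinear_scaleR] F(1) bec]
   in_L2_mult_continuous[OF bounded_bilinear.flip[OF bounded_bilinear_scaleR] F(2) bec]
   in_L2_mult_continuous[OF bb_cdot F(1) gc]
  by (auto intro: in_L2_add)
 let ?Fb = "%z. indicator Om z *\<^sub>R be z *\<^sub>R F z"
 let ?db = "%z. indicator Om z *\<^sub>R (be z *\<^sub>R d z + cdot (F z) (cvec (grad be z)))"
 define k where "k y = rh (y - c)" for y
 have ks: "smooth k" unfolding k_def[abs_def] using C_diff_shift[OF smooth_C_diff[OF rho(1)]] by (simp add: smooth_def)
 have kc: "continuous_on UNIV k" using smooth_C_diff[OF ks, of 0] by simp
 have k0: "k y = 0" if "norm (y - c) > 1" for y unfolding k_def using supp_subset_cballD[OF rho(2) that] .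
 have kv: "k y = 0" if "norm y > 1 + norm c" for y
  using k0[of y] that norm_triangle_ineq2[of y c] by simp
 have k1: "(LINT y|lborel. k y) = 1"
  using lborel_integral_translate[of rh "- c"] cont_measurable[of rh] smooth_C_diff[OF rho(1), of 0] rho(3)
  by (simp add: k_def)
 have cp: "0 < 1 + norm c" by (simp add: add_pos_nonneg)
 \<comment> \<open>The double successor keeps every scale strictly below \<open>ep0\<close>.\<close>
 define de where "de m = ep0 / real (Suc (Suc m))" for m
 have de: "de m > 0" "de m < ep0" for m using sh(1) by (auto simp: de_def divide_simps)
 have de0: "de ----> 0"
  unfolding de_def[abs_def] by (rule LIMSEQ_Suc[OF LIMSEQ_Suc[OF lim_const_over_n]])
 define Ph where "Ph m = conv (rescale k (de m)) ?Fb" for m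
 have rs: "smooth (rescale k (de m))" for m using C_diff_rescale[OF smooth_C_diff[OF ks]] by (simp add: smooth_def)
 have rv: "rescale k (de m) y = 0" if "norm y > de m * (1 + norm c)" for m y by (rule rescale_vanish[OF de(1) kv that])
 have sm: "smooth (Ph m)" for m
  unfolding smooth_def Ph_def
  by (intro allI C_diff_conv[of ?Fb _ _ "de m * (1 + norm c)", OF indicator_integrable[OF bF(1)] smooth_C_diff[OF rs] rv])
 have lim1: "L2_tendsto M Ph ?Fb" unfolding Ph_def[abs_def]
  by (rule L2_tendsto_restrict[OF conv_rescale_L2_tendsto[OF kc kv k1 indicator_integrable[OF bF(1)] in_L2_extend(1)[OF bF(1) sets_dom] cp de(1) de0] sets_dom])
 have lim2: "L2_tendsto M (%m. conv (rescale k (de m)) ?db) ?db"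
  by (rule L2_tendsto_restrict[OF conv_rescale_L2_tendsto[OF kc kv k1 indicator_integrable[OF bF(2)] in_L2_extend(1)[OF bF(2) sets_dom] cp de(1) de0] sets_dom])
 have dv: "cdiv (Ph m) x = conv (rescale k (de m)) ?db x" if x: "x \<in> Om" for m x
  unfolding Ph_def
 proof (rule cdiv_conv[OF wd rs rv be(1) bes])
  let ?C = "supp be \<inter> {z. norm ((x - z) /\<^sub>R de m - c) \<le> 1}"
  have "closed ?C" unfolding supp_def by (intro closed_Int closed_closure closed_Collect_le continuous_intros)
  moreover have "{z. rescale k (de m) (x - z) * be z \<noteq> 0} \<subseteq> ?C"
   using not_in_supp[of _ be] k0 by (force simp: rescale_def)
  ultimately have "supp (%z. rescale k (de m) (x - z) * be z) \<subseteq> ?C" unfolding supp_def[of "%z. rescale k (de m) (x - z) * be z"] by (intro closure_minimal)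
  also have "?C \<subseteq> Om" using sh(2)[OF de x] be(2) by blast
  finally show "supp (%z. rescale k (de m) (x - z) * be z) \<subseteq> Om" .
 qed
 have "flux_approx (%z. be z *\<^sub>R F z) (%z. be z *\<^sub>R d z + cdot (F z) (cvec (grad be z))) Ph"
  unfolding flux_approx_def
 proof (intro conjI allI sm)
  show "L2_tendsto M Ph (%z. be z *\<^sub>R F z)"
   by (rule L2_tendsto_cong_AE[OF lim1 measurable_dom in_L2_measurable[OF bF(1)]])
    (use C_diff_cont[OF smooth_C_diff[OF sm, of 0]] in \<open>auto intro!: AE_I2\<close>)
  show "L2_tendsto M (%m. cdiv (Ph m)) (%z. be z *\<^sub>R d z + cdot (F z) (cvec (grad be z)))"
   by (rule L2_tendsto_cong_AE[OF lim2 measurable_dom in_L2_measurable[OF bF(2)]])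
    (use continuous_on_cdiv[OF smooth_C_diff[OF sm]] dv in \<open>auto intro!: AE_I2\<close>)
 qed
 thus ?thesis by blast
qed

lemma flux_approx_add:
 assumes "flux_approx F d Ph" "flux_approx F' d' Ph'"
 shows "flux_approx (%x. F x + F' x) (%x. d x + d' x) (%m x. Ph m x + Ph' m x)"
proof -
 have "cdiv (%x. Ph m x + Ph' m x) = (%x. cdiv (Ph m) x + cdiv (Ph' m) x)" for m
  by (intro ext cdiv_add smooth_C_diff) (use assms in \<open>auto simp: flux_approx_def\<close>)
 thus ?thesis using assms unfolding flux_approx_def by (simp add: smooth_add L2_tendsto_add)
qed

lemma flux_approx_zero: "flux_approx (%x. 0) (%x. 0) (%m x. 0)"
proof -
 have "cdiv (%x :: real^'n. 0) = (%x. 0)" by (simp add: cdiv_def fun_eq_iff)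
 thus ?thesis by (simp add: flux_approx_def smooth_def L2_tendsto_const)
qed

lemma flux_approx_sum:
 fixes N :: nat
 assumes "!!i. i < N ==> \<exists>Ph. flux_approx (F i) (d i) Ph"
 shows "\<exists>Ph. flux_approx (%x. \<Sum>i<N. F i x) (%x. \<Sum>i<N. d i x) Ph"
 using assms
proof (induction N)
 case 0
 thus ?case using flux_approx_zero by auto
next
 case (Suc N)
 obtain Ph where "flux_approx (%x. \<Sum>i<N. F i x) (%x. \<Sum>i<N. d i x) Ph" using Suc by force
 moreover obtain Ph' where "flux_approx (F N) (d N) Ph'" using Suc.prems by blast
 ultimately show ?case using flux_approx_add by fastforce
qed

text \<open>The local approximations are added over a partition of unity. Each local divergence
  contains an extra term with the gradient of a member; these gradients sum to zero on the domain,
  where the members sum to one.\<close>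

lemma flux_approx_exists:
 assumes wd: "weak_divergence Om F d"
 shows "\<exists>Ph. flux_approx F d Ph"
proof -
 have F: "in_L2 M F" "in_L2 M d" using wd by (auto simp: weak_divergence_def)
 define P where "P p r c ep0 \<longleftrightarrow> r > 0 \<and> ep0 > 0 \<and> (\<forall>ep x z. 0 < ep \<and> ep < ep0 \<and> x \<in> Om \<and> z \<in> cball p (2 * r) \<and> norm ((x - z) /\<^sub>R ep - c) \<le> 1 --> z \<in> Om)" for p r c ep0
 have "\<forall>p\<in>closure Om. \<exists>r. \<exists>c ep0. P p r c ep0"
  using inward_shift unfolding P_def by blast
 from bchoice[OF this] obtain r where r: "\<forall>p\<in>closure Om. \<exists>c ep0. P p (r p) c ep0" by blast
 have r0: "r p > 0" if "p \<in> closure Om" for p using r that unfolding P_def by blast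
 have cc: "compact (closure Om)" using dom(2) by (simp add: compact_closure)
 have "\<exists>(N::nat) q be. (\<forall>i<N. q i \<in> closure Om \<and> smooth (be i) \<and> supp (be i) \<subseteq> cball (q i) (2 * r (q i))) \<and>
   (\<forall>x\<in>closure Om. (\<Sum>i<N. be i x :: real) = 1)"
  using r0 by (rule smooth_localization[OF rho cc])
 then obtain N :: nat and q be where be: "\<forall>i<N. q i \<in> closure Om \<and> smooth (be i) \<and> supp (be i) \<subseteq> cball (q i) (2 * r (q i))"
  "\<forall>x\<in>closure Om. (\<Sum>i<N. be i x :: real) = 1" by blast
 have ex: "\<exists>Ph. flux_approx (%z. be i z *\<^sub>R F z) (%z. be i z *\<^sub>R d z + cdot (F z) (cvec (grad (be i) z))) Ph" if i: "i < N" for i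
 proof -
  have qi: "q i \<in> closure Om" "smooth (be i)" "supp (be i) \<subseteq> cball (q i) (2 * r (q i))" using be(1) i by auto
  obtain c ep0 where P: "P (q i) (r (q i)) c ep0" using r qi(1) by blast
  show ?thesis
   by (rule flux_approx_local[OF wd qi(2,3), of ep0 c]) (use P in \<open>auto simp: P_def\<close>)
 qed
 obtain Ph where Ph: "flux_approx (%z. \<Sum>i<N. be i z *\<^sub>R F z) (%z. \<Sum>i<N. be i z *\<^sub>R d z + cdot (F z) (cvec (grad (be i) z))) Ph"
 proof -
  have "\<exists>Ph. flux_approx (%z. \<Sum>i<N. be i z *\<^sub>R F z) (%z. \<Sum>i<N. be i z *\<^sub>R d z + cdot (F z) (cvec (grad (be i) z))) Ph"
   using ex by (rule flux_approx_sum)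
  thus ?thesis using that by blast
 qed
 have one: "(\<Sum>i<N. be i z) = 1" if "z \<in> Om" for z using be(2) that closure_subset by blast
 have g0: "(\<Sum>i<N. cvec (grad (be i) z)) = 0" if z: "z \<in> Om" for z
 proof -
  have "(\<Sum>i<N. partial k (be i) z) = 0" for k
  proof -
   have b: "be i differentiable at z" if "i < N" for i using be(1) that smooth_C_diff[of "be i" 1] by simp
   have "partial k (%z. \<Sum>i<N. be i z) z = (\<Sum>i<N. partial k (be i) z)"
    by (rule partial_eqI[THEN trans, OF has_derivative_sum[OF has_derivative_sum_partial[OF b]]])
     (auto simp: axis_def if_distrib[of "%c. c * _"] sum.delta cong: if_cong)
   moreover have "partial k (%z. \<Sum>i<N. be i z) z = partial k (%z. 1) z"
    by (rule partial_local[OF open_dom z one])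
   ultimately show ?thesis by simp
  qed
  moreover have "(\<Sum>i<N. cvec (grad (be i) z)) $ k = of_real (\<Sum>i<N. partial k (be i) z)" for k
   by (simp add: cvec_def grad_def)
  ultimately show ?thesis by (simp add: vec_eq_iff)
 qed
 have "flux_approx F d Ph" unfolding flux_approx_def
 proof (intro conjI)
  show "\<forall>m. smooth (Ph m)" using Ph by (simp add: flux_approx_def)
  show "L2_tendsto M Ph F"
  proof (rule L2_tendsto_cong_AE[OF _ _ in_L2_measurable[OF F(1)]])
   show "L2_tendsto M Ph (%z. \<Sum>i<N. be i z *\<^sub>R F z)" using Ph by (simp add: flux_approx_def)
   thus "Ph m \<in> borel_measurable M" for m by (simp add: L2_tendsto_iff in_L2_def)
   show "AE z in M. (\<Sum>i<N. be i z *\<^sub>R F z) = F z"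
    by (rule AE_I2) (simp add: scaleR_left.sum[symmetric] one)
  qed simp
  show "L2_tendsto M (%m. cdiv (Ph m)) d"
  proof (rule L2_tendsto_cong_AE[OF _ _ in_L2_measurable[OF F(2)]])
   show "L2_tendsto M (%m. cdiv (Ph m)) (%z. \<Sum>i<N. be i z *\<^sub>R d z + cdot (F z) (cvec (grad (be i) z)))" using Ph by (simp add: flux_approx_def)
   thus "cdiv (Ph m) \<in> borel_measurable M" for m by (simp add: L2_tendsto_iff in_L2_def)
   show "AE z in M. (\<Sum>i<N. be i z *\<^sub>R d z + cdot (F z) (cvec (grad (be i) z))) = d z"
   proof (rule AE_I2)
    fix z assume "z \<in> space M"
    hence z: "z \<in> Om" by simp
    have "(\<Sum>i<N. cdot (F z) (cvec (grad (be i) z))) = cdot (F z) (\<Sum>i<N. cvec (grad (be i) z))"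
     by (rule bounded_bilinear.sum_right[OF bb_cdot, symmetric])
    thus "(\<Sum>i<N. be i z *\<^sub>R d z + cdot (F z) (cvec (grad (be i) z))) = d z"
     by (simp add: sum.distrib scaleR_left.sum[symmetric] one[OF z] g0[OF z])
   qed
  qed simp
 qed
 thus ?thesis by blast
qed

end

section \<open>Existence for the boundary value problem\<close>

context boundary_setting
begin

lemma test_function_C_diff: "test_function Om ph ==> C_diff m ph"
 by (rule smooth_C_diff) (simp add: test_function_def)

lemma test_function_smooth: "test_function Om ph ==> smooth ph"
 by (simp add: test_function_def)

lemma test_function_surface: "test_function Om ph ==> x \<in> space sg ==> ph x = 0"
 using not_in_supp[of x ph] open_dom
 by (auto simp: test_function_def surface_space[OF surface] frontier_def interior_open)

text \<open>Green's formula for a test function times the constant vector \<open>axis k 1\<close>: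
  the boundary integral disappears because test functions vanish on the boundary.\<close>

lemma has_trace_H1:
 assumes "has_trace Om sg u G f"
 shows "H1_fun Om u G"
 unfolding H1_fun_def
proof (intro conjI allI impI)
 show "in_L2 M u" "in_L2 M G" using has_trace_in_L2[OF assms] by auto
 fix ph :: "real^'n => complex" and k assume t: "test_function Om ph"
 let ?e = "axis k 1 :: complex^'n"
 have ph: "C_diff 1 ph" by (rule test_function_C_diff[OF t])
 have K: "C_diff 1 (%x. ph x *s ?e)" by (intro C_diff_smult ph C_diff_const)
 have ce: "cdot ?e v = v $ k" for v by (simp add: cdot_def axis_def if_distrib[of "%c. c * _"] sum.delta cong: if_cong)
 have "cdiv (%x. ph x *s ?e) x = partial k ph x" for x
  using cdiv_smult[OF ph C_diff_const, of ?e x] by (simp add: ce cdiv_def)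
 with green_trace[OF assms K]
 have "(LINT x|M. partial k ph x * u x) + (LINT x|M. ph x * G x $ k) = (LINT x|sg. f x * cdot (ph x *s ?e) (cvec (nu x)))"
  by (simp add: cdot_smult_left ce)
 also have "... = (LINT x|sg. 0)"
  using test_function_surface[OF t] by (intro LINT_cong) (simp_all add: cdot_smult_left)
 finally have "(LINT x|M. u x * partial k ph x) + (LINT x|M. G x $ k * ph x) = 0" by (simp add: mult.commute)
 thus "(LINT x|M. u x * partial k ph x) = - (LINT x|M. G x $ k * ph x)" by (simp add: eq_neg_iff_add_eq_0)
qed

lemma test_function_linear:
 assumes L: "bounded_linear L" and t: "test_function Om (ph :: real^'n => complex)"
 shows "test_function Om (%x. L (ph x) :: complex)"
proof -
 have "supp (%x. L (ph x)) \<subseteq> supp ph"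
  unfolding supp_def using linear_0[OF bounded_linear.linear[OF L]] by (intro closure_mono) auto
 moreover hence "compact (supp (%x. L (ph x)))"
  using t compact_Int_closed[of "supp ph" "supp (%x. L (ph x))"] by (simp add: test_function_def supp_def inf.absorb2)
 ultimately show ?thesis using t C_diff_linear[OF L] by (auto simp: test_function_def smooth_def)
qed

lemma test_function_add:
 assumes "test_function Om (ph :: real^'n => complex)" "test_function Om ps"
 shows "test_function Om (%x. ph x + ps x)"
proof -
 have "supp (%x. ph x + ps x) \<subseteq> supp ph \<union> supp ps"
  unfolding supp_def closure_Un[symmetric] by (intro closure_mono) auto
 moreover hence "compact (supp (%x. ph x + ps x))"
  using assms compact_Int_closed[OF compact_Un, of "supp ph" "supp ps" "supp (%x. ph x + ps x)"]
  by (simp add: test_function_def supp_def inf.absorb2)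
 ultimately show ?thesis using assms smooth_add by (auto simp: test_function_def)
qed

text \<open>The space of the variational problem, in the form required by
  \<open>coercive_variational_solution\<close>: test functions paired with their gradients, a real
  subspace of an L^2 space with values in a product. Carrying the gradient along makes L^2
  convergence of pairs the same as convergence in H^1.\<close>

lemma test_pairs_subspace:
 defines "S \<equiv> {%x. (ph x, cgrad ph x) | ph. test_function Om ph}"
 shows "(%x. 0) \<in> S" "p \<in> S ==> in_L2 M p" "p \<in> S ==> v \<in> S ==> (%x. p x - c *\<^sub>R v x) \<in> S"
proof -
 have "test_function Om (%x. 0 :: complex)" by (simp add: test_function_def smooth_def supp_def)
 moreover have "(%x. 0) = (%x. (0 :: complex, cgrad (%x. 0 :: complex) x))" by (simp add: fun_eq_iff vec_eq_iff zero_prod_def)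
 ultimately show "(%x. 0) \<in> S" unfolding S_def by (intro CollectI exI[of _ "%x. 0"] conjI)
 show "in_L2 M p" if pS: "p \<in> S"
 proof -
  obtain ph where p: "p = (%x. (ph x, cgrad ph x))" "test_function Om ph" using pS[unfolded S_def mem_Collect_eq] by (elim exE conjE)
  show ?thesis unfolding p(1)
   by (intro continuous_in_L2 continuous_on_Pair smooth_C_diff[of _ 0, simplified] smooth_cgrad test_function_smooth[OF p(2)])
 qed
 show "(%x. p x - c *\<^sub>R v x) \<in> S" if pv: "p \<in> S" "v \<in> S"
 proof -
  obtain ph where p: "p = (%x. (ph x, cgrad ph x))" "test_function Om ph" using pv(1)[unfolded S_def mem_Collect_eq] by (elim exE conjE)
  obtain ps where v: "v = (%x. (ps x, cgrad ps x))" "test_function Om ps" using pv(2)[unfolded S_def mem_Collect_eq] by (elim exE conjE)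
  note t = test_function_linear[OF bounded_linear_scaleR_right v(2), of "- c"]
  have "cgrad (%x. (- c) *\<^sub>R ps x) x = (- c) *\<^sub>R cgrad ps x" for x
   using cgrad_linear[OF bounded_linear_scaleR_right test_function_C_diff[OF v(2)], of "- c" x] by (simp only: vec_eq_iff vector_scaleR_component) simp
  hence "(%x. p x - c *\<^sub>R v x) = (%x. (ph x + (- c) *\<^sub>R ps x, cgrad (%x. ph x + (- c) *\<^sub>R ps x) x))"
   using cgrad_add[OF test_function_C_diff[OF p(2)] test_function_C_diff[OF t]] by (simp add: p v fun_eq_iff)
  thus ?thesis unfolding S_def using test_function_add[OF p(2) t] by (intro CollectI exI conjI)
 qed
qed

end

context magnetic_problem
begin

text \<open>The factor \<open>rot\<close> rotates the sesquilinear form so that its real part is coercive.\<close>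

definition rot :: complex where
 "rot = 1 + \<i> * of_real ((CV + \<bar>Re lam\<bar> + 1 + CA^2) / Im lam)"

text \<open>The rotated form as a pointwise map on pairs of value and gradient: by
  \<open>inner_tp\<close> its real inner product with a test pair is the real part of
  \<open>rot\<close> times the sesquilinear integrand. Boundedness and coercivity in L^2 then follow
  from pointwise estimates.\<close>

definition tp :: "real^'a => complex \<times> (complex^'a) => complex \<times> (complex^'a)" where
 "tp x W = (let F = snd W + (\<i> * fst W) *s cvec (A x) in
  (rot * ((of_real (V x) - lam) * fst W - \<i> * cdot F (cvec (A x))), rot *s F))"

lemma CA0: "0 \<le> CA" using A(2)[of 0] norm_ge_zero order_trans by blast
lemma CV0: "0 \<le> CV" using V(2)[of 0] abs_ge_zero order_trans by blast

lemma inner_tp: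
 "inner (tp x (w, G)) (ph, H) = Re (rot * (((of_real (V x) - lam) * w - \<i> * cdot (G + (\<i> * w) *s cvec (A x)) (cvec (A x))) * cnj ph
  + cdot (G + (\<i> * w) *s cvec (A x)) (cnjv H)))"
proof -
 have "inner (rot * z, rot *s F) (ph, H) = Re (rot * (z * cnj ph + cdot F (cnjv H)))" for z F
  by (simp only: inner_prod_def inner_eq_Re_cdot cdot_smult_left inner_complex_def fst_conv snd_conv)
   (simp add: algebra_simps)
 thus ?thesis by (simp only: tp_def Let_def fst_conv snd_conv)
qed

text \<open>Multiplication by \<open>rot\<close> adds CV + |Re lam| + 1 + CA^2 to
  \<open>V x - Re lam\<close>, so the coefficient of |w|^2 is at least 1 + CA^2. The summand CA^2
  pays for recovering the gradient from the flux, |G|^2 \<le> 2 |F|^2 + 2 CA^2 |w|^2; the factor 2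
  there is the origin of 1/2.\<close>

lemma tp_coercive: "1/2 * (norm W)^2 \<le> inner (tp x W) W"
proof -
 obtain w G where W: "W = (w, G)" by (cases W)
 define F where "F = G + (\<i> * w) *s cvec (A x)"
 have "((of_real (V x) - lam) * w - \<i> * cdot F (cvec (A x))) * cnj w + cdot F (cnjv G)
  = (of_real (V x) - lam) * (w * cnj w) + cdot F (cnjv F)"
 proof -
  have "cnjv F = cnjv G + (- \<i> * cnj w) *s cvec (A x)" unfolding F_def cnjv_add cnjv_smult by simp
  hence "cdot F (cnjv F) = cdot F (cnjv G) - \<i> * cnj w * cdot F (cvec (A x))"
   unfolding \<open>cnjv F = _\<close> cdot_add_right cdot_smult_right by simp
  thus ?thesis by (simp add: algebra_simps)
 qed
 also have "... = (of_real (V x) - lam) * of_real ((norm w)^2) + of_real ((norm F)^2)"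
  by (simp add: cdot_cnjv_self complex_norm_square[symmetric])
 finally have "inner (tp x W) W = Re (rot * ((of_real (V x) - lam) * of_real ((norm w)^2) + of_real ((norm F)^2)))"
  unfolding W inner_tp F_def by simp
 also have "... = (V x - Re lam + (CV + \<bar>Re lam\<bar> + 1 + CA^2)) * (norm w)^2 + (norm F)^2"
  using lam by (simp add: rot_def field_simps)
 also have "... \<ge> (1 + CA^2) * (norm w)^2 + (norm F)^2"
 proof -
  have "1 + CA^2 \<le> V x - Re lam + (CV + \<bar>Re lam\<bar> + 1 + CA^2)" using V(2)[of x] abs_ge_self[of "Re lam"] by linarith
  thus ?thesis by (simp add: mult_right_mono)
 qed
 finally have 1: "(1 + CA^2) * (norm w)^2 + (norm F)^2 \<le> inner (tp x W) W" .
 have "norm G \<le> norm F + CA * norm w"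
 proof -
  have "norm ((\<i> * w) *s cvec (A x)) \<le> CA * norm w"
   using mult_right_mono[OF A(2)[of x] norm_ge_zero[of w]] by (simp add: norm_smult_vec norm_mult mult.commute)
  thus ?thesis using norm_triangle_ineq4[of F "(\<i> * w) *s cvec (A x)"] by (simp add: F_def)
 qed
 hence "(norm G)^2 \<le> (norm F + CA * norm w)^2" by (intro power_mono) auto
 also have "... \<le> 2 * (norm F)^2 + 2 * (CA^2 * (norm w)^2)"
  using zero_le_power2[of "norm F - CA * norm w"] by (simp add: power2_sum power2_diff power_mult_distrib)
 finally have "(norm G)^2 \<le> 2 * (norm F)^2 + 2 * (CA^2 * (norm w)^2)" .
 moreover have "(norm W)^2 = (norm w)^2 + (norm G)^2" by (simp add: W norm_Pair)
 moreover have "0 \<le> (norm w)^2" by simp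
 moreover have "(1 + CA^2) * (norm w)^2 = (norm w)^2 + CA^2 * (norm w)^2" by (simp add: distrib_right)
 ultimately show ?thesis using 1 by linarith
qed

lemma tp_bound: "norm (tp x W) \<le> norm rot * ((CV + norm lam) + (1 + CA) * CA + (1 + CA)) * norm W"
proof -
 obtain w G where W: "W = (w, G)" by (cases W)
 define F where "F = G + (\<i> * w) *s cvec (A x)"
 have wW: "norm w \<le> norm W" "norm G \<le> norm W" using norm_fst_le[of w G] norm_snd_le[of G w] by (auto simp: W)
 have a: "norm (A x) \<le> CA" by (rule A(2))
 have "norm F \<le> norm G + norm w * norm (A x)"
  unfolding F_def by (rule order_trans[OF norm_triangle_ineq]) (simp add: norm_smult_vec norm_mult)
 also have "... \<le> norm W + norm W * CA" using wW a by (intro add_mono mult_mono) auto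
 finally have F: "norm F \<le> (1 + CA) * norm W" by (simp add: algebra_simps)
 have "norm ((of_real (V x) - lam) * w - \<i> * cdot F (cvec (A x))) \<le> norm (of_real (V x) - lam) * norm w + norm (cdot F (cvec (A x)))"
  by (rule order_trans[OF norm_triangle_ineq4]) (simp add: norm_mult)
 also have "... \<le> (CV + norm lam) * norm W + (1 + CA) * norm W * CA"
 proof (intro add_mono mult_mono)
  show "norm (of_real (V x) - lam) \<le> CV + norm lam"
   using norm_triangle_ineq4[of "of_real (V x)" lam] V(2)[of x] by simp
  show "norm (cdot F (cvec (A x))) \<le> (1 + CA) * norm W * CA"
   using norm_cdot_le[of F "cvec (A x)"] mult_mono[OF F a] CA0 by simp
 qed (use wW CV0 in auto)
 finally have 1: "norm ((of_real (V x) - lam) * w - \<i> * cdot F (cvec (A x))) \<le> ((CV + norm lam) + (1 + CA) * CA) * norm W"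
  by (simp add: algebra_simps)
 have "tp x W = (rot * ((of_real (V x) - lam) * w - \<i> * cdot F (cvec (A x))), rot *s F)"
  by (simp add: tp_def W F_def Let_def)
 hence "norm (tp x W) \<le> norm rot * norm ((of_real (V x) - lam) * w - \<i> * cdot F (cvec (A x))) + norm rot * norm F"
  using norm_Pair_le[of "rot * ((of_real (V x) - lam) * w - \<i> * cdot F (cvec (A x)))" "rot *s F"]
  by (simp add: norm_mult norm_smult_vec)
 also have "... \<le> norm rot * (((CV + norm lam) + (1 + CA) * CA) * norm W) + norm rot * ((1 + CA) * norm W)"
  by (intro add_mono mult_left_mono 1 F) auto
 finally show ?thesis by (simp add: algebra_simps)
qed

lemma tp_diff: "tp x (W - c *\<^sub>R W') = tp x W - c *\<^sub>R tp x W'"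
proof -
 have F: "snd (W - c *\<^sub>R W') + (\<i> * fst (W - c *\<^sub>R W')) *s cvec (A x)
  = (snd W + (\<i> * fst W) *s cvec (A x)) - c *\<^sub>R (snd W' + (\<i> * fst W') *s cvec (A x))"
  by (simp add: vec_eq_iff algebra_simps)
 show ?thesis unfolding tp_def Let_def F cdot_diff_left bounded_bilinear.scaleR_left[OF bb_cdot]
   bounded_bilinear.diff_right[OF bb_smult] bounded_bilinear.scaleR_right[OF bb_smult]
  by (simp only: prod_eq_iff fst_diff snd_diff fst_scaleR snd_scaleR fst_conv snd_conv refl simp_thms)
   (simp add: scaleR_right_diff_distrib algebra_simps)
qed

lemma in_L2_tp:
 assumes "in_L2 M f"
 shows "in_L2 M (%x. tp x (f x))"
proof (rule in_L2_bound[OF assms])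
 define Tc where "Tc p = (let F = snd (snd (snd p)) + (\<i> * fst (snd (snd p))) *s fst p in
  (rot * ((of_real (fst (snd p)) - lam) * fst (snd (snd p)) - \<i> * cdot F (fst p)), rot *s F))"
  for p :: "(complex^'a) \<times> real \<times> complex \<times> (complex^'a)"
 have c: "continuous_on UNIV Tc"
  unfolding Tc_def[abs_def] Let_def
  by (intro continuous_intros bounded_bilinear.continuous_on[OF bb_cdot] bounded_bilinear.continuous_on[OF bb_smult])
 have m: "(%x. (cvec (A x), V x, f x)) \<in> borel_measurable M"
  by (intro borel_measurable_Pair measurable_dom[OF cA] measurable_restrict_space1[OF V(1)] in_L2_measurable[OF assms])
 have "(%x. tp x (f x)) = (%x. Tc (cvec (A x), V x, f x))"
  by (simp add: Tc_def tp_def Let_def fun_eq_iff)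
 thus "(%x. tp x (f x)) \<in> borel_measurable M" using borel_measurable_continuous_on[OF c m] by simp
 show "AE x in M. norm (tp x (f x)) \<le> (norm rot * ((CV + norm lam) + (1 + CA) * CA + (1 + CA))) * norm (f x)"
  using tp_bound by simp
qed

lemma rot_nonzero: "rot \<noteq> 0"
proof
 assume "rot = 0"
 hence "Re rot = 0" by simp
 thus False by (simp add: rot_def)
qed

text \<open>Lax-Milgram for the correction \<open>u - f\<close>, which is a limit of test functions
  in H^1 and so has trace zero. The variational result concerns real parts only; testing with
  \<open>ps\<close> and with \<i> times \<open>ps\<close> and dividing by \<open>rot\<close> gives
  the complex equation.\<close>

lemma bvp_exists:
 assumes f: "smooth f"
 shows "\<exists>u G. bvp_solution Om sg A V lam f u G"
proof -
 let ?S = "{%x. (ph x, cgrad ph x) | ph. test_function Om ph}"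
 \<comment> \<open>The added 1 makes the bound strictly larger than the coercivity constant
   1/2.\<close>
 let ?C = "norm rot * ((CV + norm lam) + (1 + CA) * CA + (1 + CA)) + 1"
 define u0 where "u0 x = (f x, cgrad f x)" for x
 have fc: "continuous_on UNIV f" "continuous_on UNIV (cgrad f)"
  using smooth_C_diff[OF f, of 0] smooth_C_diff[OF smooth_cgrad[OF f], of 0] by auto
 have u02: "in_L2 M u0" unfolding u0_def[abs_def] by (rule continuous_in_L2) (intro continuous_on_Pair fc)
 have "\<exists>F w. (\<forall>k. F k \<in> ?S) \<and> L2_tendsto M F w \<and> (\<forall>v\<in>?S. (LINT x|M. tp x (u0 x + w x) \<bullet> v x) = 0)"
 proof (rule coercive_variational_solution[OF test_pairs_subspace in_L2_tp _ _ _ _ _ u02, where c="1/2" and C="?C"])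
  show "L2norm M (%x. tp x (g x)) \<le> ?C * L2norm M g" if g: "in_L2 M g" for g
  proof -
   have C0: "?C \<ge> 0" using CA0 CV0 by (intro mult_nonneg_nonneg add_nonneg_nonneg) auto
   have "L2norm M (%x. tp x (g x)) \<le> L2norm M (%x. ?C *\<^sub>R g x)"
   proof (rule L2norm_mono[OF in_L2_scaleR[OF g] in_L2_tp[OF g]], rule AE_I2)
    fix x show "norm (tp x (g x)) \<le> norm (?C *\<^sub>R g x)"
     using tp_bound[of x "g x"] C0 norm_ge_zero[of "g x"] by (simp only: norm_scaleR real_norm_def abs_of_nonneg distrib_right[of _ 1])
   qed
   thus ?thesis unfolding L2norm_scaleR using C0 by simp
  qed
  show "1/2 * (L2norm M g)^2 \<le> (LINT x|M. tp x (g x) \<bullet> g x)" if g: "in_L2 M g" for g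
   unfolding L2norm_power2 integral_mult_right_zero[symmetric]
   by (rule integral_mono[OF _ L2_inner_integrable[OF in_L2_tp[OF g] g] tp_coercive]) (use g in \<open>simp add: in_L2_def\<close>)
  have "0 \<le> norm rot * ((CV + norm lam) + (1 + CA) * CA + (1 + CA))"
   using CA0 CV0 by (intro mult_nonneg_nonneg add_nonneg_nonneg) auto
  thus "1/2 < ?C" by linarith
 qed (simp_all add: tp_diff)
 then obtain F W where F: "\<forall>k. F k \<in> ?S" and lim: "L2_tendsto M F W" and W: "\<forall>v\<in>?S. (LINT x|M. tp x (u0 x + W x) \<bullet> v x) = 0"
  by (elim exE conjE)
 have "\<forall>m. \<exists>ph. F m = (%x. (ph x, cgrad ph x)) \<and> test_function Om ph" using F unfolding mem_Collect_eq .
 from choice[OF this] obtain ph where ph: "!!m. F m = (%x. (ph m x, cgrad (ph m) x))" "!!m. test_function Om (ph m)" by blast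
 have phs: "smooth (ph m)" for m by (rule test_function_smooth[OF ph(2)])
 define w where "w x = fst (W x)" for x
 define Gw where "Gw x = snd (W x)" for x
 have lw: "L2_tendsto M ph w" using L2_tendsto_linear[OF bounded_linear_fst lim] by (simp add: w_def[abs_def] ph(1))
 have lG: "L2_tendsto M (%m. cgrad (ph m)) Gw" using L2_tendsto_linear[OF bounded_linear_snd lim] by (simp add: Gw_def[abs_def] ph(1))
 define u where "u x = f x + w x" for x
 define G where "G x = cgrad f x + Gw x" for x
 have tr: "has_trace Om sg u G f"
  unfolding has_trace_def
 proof (intro exI[of _ "%m x. f x + ph m x"] conjI allI)
  show "smooth (%x. f x + ph m x)" for m by (rule smooth_add[OF f phs])
  show "L2_tendsto M (%m x. f x + ph m x) u"
   unfolding u_def[abs_def] by (rule L2_tendsto_add[OF L2_tendsto_const[OF continuous_in_L2[OF fc(1)]] lw])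
  have "cgrad (%x. f x + ph m x) = (%x. cgrad f x + cgrad (ph m) x)" for m
   by (intro ext cgrad_add smooth_C_diff f phs)
  thus "L2_tendsto M (%m. cgrad (%x. f x + ph m x)) G"
   unfolding G_def[abs_def] using L2_tendsto_add[OF L2_tendsto_const[OF continuous_in_L2[OF fc(2)]] lG] by simp
  have c: "continuous_on (frontier Om) (%x. f x + ph m x)" "continuous_on (frontier Om) f" for m
   using continuous_on_subset[OF C_diff_cont[OF smooth_C_diff[OF smooth_add[OF f phs], of 0]] subset_UNIV]
    continuous_on_subset[OF fc(1) subset_UNIV] by auto
  \<comment> \<open>Test functions vanish on the boundary, so every approximant coincides with
    \<open>f\<close> there.\<close>
  show "L2_tendsto sg (%m x. f x + ph m x) f"
  proof (rule L2_tendsto_cong_AE[OF L2_tendsto_const[OF continuous_in_L2_surface[OF fc(1)]]])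
   show "(%x. f x + ph m x) \<in> borel_measurable sg" "f \<in> borel_measurable sg" for m
    by (rule surface_measurable_continuous[OF surface c(1)] surface_measurable_continuous[OF surface c(2)])+
   show "AE x in sg. f x = f x + ph m x" for m
    using test_function_surface[OF ph(2)] by (intro AE_I2) simp
  qed simp
 qed
 have H1: "H1_fun Om u G" by (rule has_trace_H1[OF tr])
 have i: "in_L2 M u" "in_L2 M G" using has_trace_in_L2[OF tr] by auto
 have sL: "in_L2 M (src u G)" "in_L2 M (flux u G)" by (rule in_L2_src[OF i] in_L2_flux[OF i])+
 define J where "J ps = (LINT x|M. src u G x * ps x + cdot (flux u G x) (cgrad ps x))" for ps :: "real^'a => complex"
 have Ji: "integrable M (%x. src u G x * ps x + cdot (flux u G x) (cgrad ps x))" if "test_function Om ps" for ps :: "real^'a => complex"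
  by (intro Bochner_Integration.integrable_add in_L2_integrable[OF bb_mult sL(1)]
    in_L2_integrable[OF bb_cdot sL(2)] continuous_in_L2 test_function_continuous[OF that])
 have Re0: "Re (rot * J ps) = 0" if t: "test_function Om ps" for ps :: "real^'a => complex"
 proof -
  have te: "test_function Om (%x. cnj (ps x))" by (rule test_function_linear[OF bounded_linear_cnj t])
  have ge: "cgrad (%x. cnj (ps x)) x = cnjv (cgrad ps x)" for x by (rule cgrad_cnj[OF test_function_C_diff[OF t]])
  have "tp x (u0 x + W x) \<bullet> (cnj (ps x), cgrad (%x. cnj (ps x)) x) = Re (rot * (src u G x * ps x + cdot (flux u G x) (cgrad ps x)))" for x
  proof -
   have "u0 x + W x = (u x, G x)" by (simp add: u0_def u_def G_def w_def Gw_def prod_eq_iff)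
   thus ?thesis unfolding ge by (simp only: inner_tp) (simp add: src_def flux_def)
  qed
  moreover have "(%x. (cnj (ps x), cgrad (%x. cnj (ps x)) x)) \<in> ?S" by (intro CollectI exI[of _ "%x. cnj (ps x)"] conjI te refl)
  ultimately have "0 = (LINT x|M. Re (rot * (src u G x * ps x + cdot (flux u G x) (cgrad ps x))))"
   using bspec[OF W, of "%x. (cnj (ps x), cgrad (%x. cnj (ps x)) x)"] by (simp only:)
  also have "... = Re (rot * J ps)"
   unfolding J_def using Ji[OF t] by (simp only: integral_Re integrable_mult_right integral_mult_right_zero)
  finally show ?thesis by simp
 qed
 have J0: "J ps = 0" if t: "test_function Om ps" for ps :: "real^'a => complex"
 proof -
  have ti: "test_function Om (%x. \<i> * ps x)" by (rule test_function_linear[OF bl_mult_right t])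
  have C: "C_diff 1 ps" by (rule test_function_C_diff[OF t])
  have "cgrad (%x. \<i> * ps x) x = \<i> *s cgrad ps x" for x
   using cgrad_linear[OF bl_mult_right C, of \<i> x] by (simp add: vec_eq_iff)
  hence "J (%x. \<i> * ps x) = (LINT x|M. \<i> * (src u G x * ps x + cdot (flux u G x) (cgrad ps x)))"
   by (simp add: J_def cdot_smult_right algebra_simps)
  also have "... = \<i> * J ps" unfolding J_def by (rule integral_mult_right_zero)
  finally have "Re (rot * (\<i> * J ps)) = 0" using Re0[OF ti] by simp
  hence "Im (rot * J ps) = 0" by (simp add: algebra_simps)
  with Re0[OF t] have "rot * J ps = 0" by (simp add: complex_eq_iff)
  thus ?thesis using rot_nonzero by simp
 qed
 have "weak_divergence Om (flux u G) (src u G)"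
  unfolding weak_divergence_def
 proof (intro conjI sL allI impI)
  fix ps :: "real^'a => complex" assume t: "test_function Om ps"
  have "J ps = (LINT x|M. src u G x * ps x) + (LINT x|M. cdot (flux u G x) (cgrad ps x))"
   unfolding J_def
   by (intro LINT_add in_L2_integrable[OF bb_mult sL(1)]
     in_L2_integrable[OF bb_cdot sL(2)] continuous_in_L2 test_function_continuous[OF t])
  thus "(LINT x|M. cdot (flux u G x) (cgrad ps x)) = - (LINT x|M. src u G x * ps x)"
   using J0[OF t] by (simp add: eq_neg_iff_add_eq_0 add.commute)
 qed
 thus ?thesis using H1 tr unfolding bvp_solution_iff by blast
qed

section \<open>The Dirichlet-to-Neumann map\<close>

text \<open>Here the definite description is resolved. A solution and an approximation of its flux
  exist; every admissible value has the form given by \<open>bvp_pairing_value\<close>; and that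
  form depends on the solution only through its class almost everywhere, which is unique.\<close>

lemma DN_map_formula:
 assumes f: "smooth f" and g: "C_diff 2 g"
 shows "\<exists>u. in_L2 M u \<and>
  \<bar>Im lam\<bar> * L2norm M (%x. u x - f x) \<le> L2norm M (%x. mag_laplace A f x + (of_real (V x) - lam) * f x) \<and>
  DN_map Om sg nu A V lam f g = (LINT x|sg. f x * cdot (mag_grad (%x. - A x) g x) (cvec (nu x)))
   + (LINT x|M. u x * (mag_laplace (%x. - A x) g x + (of_real (V x) - lam) * g x))"
proof -
 obtain u G where sol: "bvp_solution Om sg A V lam f u G" using bvp_exists[OF f] by blast
 hence wd: "weak_divergence Om (flux u G) (src u G)" and u2: "in_L2 M u"
  unfolding bvp_solution_iff by (auto simp: H1_fun_def)
 obtain Ph where Ph: "flux_approx (flux u G) (src u G) Ph" using flux_approx_exists[OF wd] by blast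
 have g1: "C_diff 1 g" using C_diff_mono[OF g, of 1] by simp
 have fe: "(%x. G x + (\<i> * u x) *s cvec (A x)) = flux u G" by (simp add: flux_def fun_eq_iff)
 let ?s = "%u. (LINT x|sg. f x * cdot (mag_grad (%x. - A x) g x) (cvec (nu x)))
   + (LINT x|M. u x * (mag_laplace (%x. - A x) g x + (of_real (V x) - lam) * g x))"
 have "\<exists>s. normal_trace_pairing Om sg nu (%x. G x + (\<i> * u x) *s cvec (A x)) g s"
  unfolding fe normal_trace_pairing_def
  using wd Ph flux_approx_pairing[OF Ph g1] unfolding flux_approx_def by blast
 then obtain s where s: "normal_trace_pairing Om sg nu (%x. G x + (\<i> * u x) *s cvec (A x)) g s" by blast
 have sv: "s = ?s u" by (rule bvp_pairing_value(2)[OF sol g s])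
 have "DN_map Om sg nu A V lam f g = ?s u"
  unfolding DN_map_def
 proof (rule the_equality)
  show "\<exists>u' G'. bvp_solution Om sg A V lam f u' G' \<and> normal_trace_pairing Om sg nu (%x. G' x + (\<i> * u' x) *s cvec (A x)) g (?s u)"
   using sol s sv by blast
 next
  fix s' assume "\<exists>u' G'. bvp_solution Om sg A V lam f u' G' \<and> normal_trace_pairing Om sg nu (%x. G' x + (\<i> * u' x) *s cvec (A x)) g s'"
  then obtain u' G' where s': "bvp_solution Om sg A V lam f u' G'"
   "normal_trace_pairing Om sg nu (%x. G' x + (\<i> * u' x) *s cvec (A x)) g s'" by blast
  obtain Ph' where Ph': "flux_approx (flux u' G') (src u' G') Ph'" using bvp_pairing_value(1)[OF s'(1) g s'(2)] by blast
  have eq: "AE x in M. u' x = u x" by (rule bvp_unique[OF s'(1) Ph' sol Ph])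
  have u2': "in_L2 M u'" using s'(1) by (simp add: bvp_solution_def H1_fun_def)
  have A': "C_diff 1 (%x. - A x)" by (rule C_diff_minus[OF A(1)])
  have gL: "in_L2 M (%x. mag_laplace (%x. - A x) g x + (of_real (V x) - lam) * g x)"
   by (intro in_L2_add in_L2_V continuous_in_L2 continuous_on_mag_laplace[OF g A'] C_diff_cont[OF g])
  have "(LINT x|M. u' x * (mag_laplace (%x. - A x) g x + (of_real (V x) - lam) * g x))
   = (LINT x|M. u x * (mag_laplace (%x. - A x) g x + (of_real (V x) - lam) * g x))"
  proof (rule integral_cong_AE)
   show "AE x in M. u' x * (mag_laplace (%x. - A x) g x + (of_real (V x) - lam) * g x) = u x * (mag_laplace (%x. - A x) g x + (of_real (V x) - lam) * g x)"
    using eq by eventually_elim simp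
  qed (rule borel_measurable_integrable in_L2_integrable[OF bb_mult _ gL] u2 u2')+
  thus "s' = ?s u" using bvp_pairing_value(2)[OF s'(1) g s'(2)] by simp
 qed
 thus ?thesis using u2 bvp_resolvent_estimate[OF sol Ph f] by blast
qed

end

section \<open>Replacing the coefficients outside the domain and on null sets\<close>

lemma in_L2_cong: "(!!x. x \<in> space M ==> f x = g x) ==> in_L2 M f \<longleftrightarrow> in_L2 M g"
 unfolding in_L2_def using measurable_cong[of M f g borel] Bochner_Integration.integrable_cong[OF refl, of M "%x. (norm (f x))^2" "%x. (norm (g x))^2"]
 by simp

lemma L2_tendsto_cong: "(!!x. x \<in> space M ==> f x = g x) ==> L2_tendsto M F f \<longleftrightarrow> L2_tendsto M F g"
 unfolding L2_tendsto_def using in_L2_cong[of M f g]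
 by (simp cong: LINT_cong)

lemma normal_trace_pairing_cong:
 assumes "!!x. x \<in> Om ==> F x = F' x"
 shows "normal_trace_pairing Om sg nu F g s \<longleftrightarrow> normal_trace_pairing Om sg nu F' g s"
proof -
 have s: "space (lebesgue_on Om) = Om" by simp
 have i: "(LINT x|lebesgue_on Om. cdot (F x) (h x)) = (LINT x|lebesgue_on Om. cdot (F' x) (h x))" for h
  using assms by (intro LINT_cong[OF refl]) simp
 have "in_L2 (lebesgue_on Om) F = in_L2 (lebesgue_on Om) F'" using assms by (intro in_L2_cong) simp
 moreover have "L2_tendsto (lebesgue_on Om) Ph F = L2_tendsto (lebesgue_on Om) Ph F'" for Ph
  using assms by (intro L2_tendsto_cong) simp
 ultimately show ?thesis unfolding normal_trace_pairing_def weak_divergence_def i by simp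
qed

text \<open>The weak equation and the flux see the vector potential only at points of the domain and
  the electric potential only almost everywhere. This allows the given data to be exchanged for the
  globally bounded ones of \<open>magnetic_problem\<close>.\<close>

lemma (in magnetic_problem) DN_map_cong:
 assumes A': "!!x. x \<in> Om ==> A' x = A x" and V': "V' \<in> borel_measurable M" "AE x in M. V' x = V x"
 shows "DN_map Om sg nu A' V' lam f g = DN_map Om sg nu A V lam f g"
proof -
 have "(LINT x|M. cdot (- \<i> *s G x + u x *s cvec (A' x)) (\<i> *s cgrad ph x + ph x *s cvec (A' x)) + (of_real (V' x) - lam) * u x * ph x)
  = (LINT x|M. cdot (- \<i> *s G x + u x *s cvec (A x)) (\<i> *s cgrad ph x + ph x *s cvec (A x)) + (of_real (V x) - lam) * u x * ph x)"
  if H: "H1_fun Om u G" and t: "test_function Om ph" for u G and ph :: "real^'a => complex"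
 proof -
  have L: "in_L2 M u" "in_L2 M G" using H by (auto simp: H1_fun_def)
  have c[measurable]: "ph \<in> borel_measurable M" "u \<in> borel_measurable M" "V' \<in> borel_measurable M" "V \<in> borel_measurable M"
   using measurable_dom[OF test_function_continuous(1)[OF t]] in_L2_measurable[OF L(1)] V'(1) measurable_restrict_space1[OF V(1)] by auto
  let ?K = "%x. cdot (- \<i> *s G x + u x *s cvec (A x)) (\<i> *s cgrad ph x + ph x *s cvec (A x))"
  have "?K = (%x. cdot (flux u G x) (cgrad ph x) - (\<i> * cdot (flux u G x) (cvec (A x))) * ph x)"
   by (simp add: fun_eq_iff flux_def cdot_add_left cdot_add_right cdot_diff_left cdot_diff_right cdot_minus_left cdot_minus_right cdot_smult_left cdot_smult_right algebra_simps)
  hence [measurable]: "?K \<in> borel_measurable M"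
   using in_L2_measurable[OF in_L2_mult_continuous[OF bb_cdot in_L2_flux[OF L] test_function_continuous(2)[OF t]]]
    in_L2_measurable[OF in_L2_mult_continuous[OF bb_cdot in_L2_flux[OF L] cA]] by simp
  have "(LINT x|M. cdot (- \<i> *s G x + u x *s cvec (A' x)) (\<i> *s cgrad ph x + ph x *s cvec (A' x)) + (of_real (V' x) - lam) * u x * ph x)
   = (LINT x|M. ?K x + (of_real (V' x) - lam) * u x * ph x)"
   using A' by (intro LINT_cong[OF refl]) simp
  also have "... = (LINT x|M. ?K x + (of_real (V x) - lam) * u x * ph x)"
   by (rule integral_cong_AE, measurable, use V'(2) in eventually_elim) simp
  finally show ?thesis .
 qed
 hence "bvp_solution Om sg A' V' lam f u G = bvp_solution Om sg A V lam f u G" for u G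
  unfolding bvp_solution_def by auto
 moreover have "normal_trace_pairing Om sg nu (%x. G x + (\<i> * u x) *s cvec (A' x)) g s
  = normal_trace_pairing Om sg nu (%x. G x + (\<i> * u x) *s cvec (A x)) g s" for u G s
  using A' by (intro normal_trace_pairing_cong) simp
 ultimately show ?thesis unfolding DN_map_def by simp
qed

section \<open>Comparison of two Dirichlet-to-Neumann maps\<close>

context boundary_setting
begin

lemma in_Linfty_representative:
 assumes "in_Linfty Om V"
 shows "\<exists>V' C. V' \<in> borel_measurable lebesgue \<and> (\<forall>x. \<bar>V' x\<bar> \<le> C) \<and> V \<in> borel_measurable M \<and> (AE x in M. V x = V' x)"
proof -
 obtain C where V[measurable]: "V \<in> borel_measurable M" and C: "AE x in M. \<bar>V x\<bar> \<le> C"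
  using assms by (auto simp: in_Linfty_def)
 define W where "W x = (if \<bar>V x\<bar> \<le> C then V x else 0)" for x
 have "W \<in> borel_measurable M" unfolding W_def[abs_def] by measurable
 hence "(%x. indicator Om x *\<^sub>R W x) \<in> borel_measurable lebesgue"
  using sets_dom borel_measurable_restrict_space_iff[of Om lebesgue W] by (simp add: mult.commute)
 moreover have "\<bar>indicator Om x *\<^sub>R W x\<bar> \<le> \<bar>C\<bar>" for x
  using abs_ge_self[of C] by (cases "x \<in> Om") (auto simp: W_def simp del: abs_ge_self intro: order_trans)
 moreover have "AE x in M. V x = indicator Om x *\<^sub>R W x"
  using C AE_space by eventually_elim (simp add: W_def)
 ultimately show ?thesis using V by blast
qed

text \<open>In the formula for either map the solution is replaced by the common boundary function
  \<open>f\<close>. The boundary integrals cancel, because they contain the potentials only on the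
  frontier. By Cauchy-Schwarz and the resolvent estimate each replacement costs the norm of the
  operator on \<open>f\<close> times that of the transposed operator on \<open>g\<close>, divided by
  |Im lam|.\<close>

lemma DN_map_difference:
 assumes A: "C_diff 1 A1" "C_diff 1 A2" "!!x. norm (A1 x) \<le> CA" "!!x. norm (A2 x) \<le> CA"
  and fr: "!!x. x \<in> frontier Om ==> A1 x = A2 x"
  and V: "V1 \<in> borel_measurable lebesgue" "V2 \<in> borel_measurable lebesgue" "!!x. \<bar>V1 x\<bar> \<le> CV" "!!x. \<bar>V2 x\<bar> \<le> CV"
  and lam: "Im lam \<noteq> 0" and f: "smooth f" and g: "C_diff 2 g"
 shows "norm (DN_map Om sg nu A1 V1 lam f g - DN_map Om sg nu A2 V2 lam f g
   - (LINT x|M. f x * ((mag_laplace (%x. - A1 x) g x + (of_real (V1 x) - lam) * g x)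
           - (mag_laplace (%x. - A2 x) g x + (of_real (V2 x) - lam) * g x))))
  \<le> (L2norm M (%x. mag_laplace A1 f x + (of_real (V1 x) - lam) * f x)
    * L2norm M (%x. mag_laplace (%x. - A1 x) g x + (of_real (V1 x) - lam) * g x)
   + L2norm M (%x. mag_laplace A2 f x + (of_real (V2 x) - lam) * f x)
    * L2norm M (%x. mag_laplace (%x. - A2 x) g x + (of_real (V2 x) - lam) * g x)) / \<bar>Im lam\<bar>"
proof -
 interpret m1: magnetic_problem Om sg nu rh A1 V1 lam CA CV by unfold_locales (rule A V lam)+
 interpret m2: magnetic_problem Om sg nu rh A2 V2 lam CA CV by unfold_locales (rule A V lam)+
 define P1 where "P1 x = mag_laplace (%x. - A1 x) g x + (of_real (V1 x) - lam) * g x" for x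
 define P2 where "P2 x = mag_laplace (%x. - A2 x) g x + (of_real (V2 x) - lam) * g x" for x
 have P: "in_L2 M P1" "in_L2 M P2" unfolding P1_def[abs_def] P2_def[abs_def]
  by (intro in_L2_add m1.in_L2_V m2.in_L2_V continuous_in_L2 continuous_on_mag_laplace[OF g] C_diff_minus A C_diff_cont[OF g])+
 have fL: "in_L2 M f" by (rule continuous_in_L2[OF C_diff_cont[OF smooth_C_diff[OF f]]])
 obtain u1 where u1: "in_L2 M u1" "\<bar>Im lam\<bar> * L2norm M (%x. u1 x - f x) \<le> L2norm M (%x. mag_laplace A1 f x + (of_real (V1 x) - lam) * f x)"
  "DN_map Om sg nu A1 V1 lam f g = (LINT x|sg. f x * cdot (mag_grad (%x. - A1 x) g x) (cvec (nu x))) + (LINT x|M. u1 x * P1 x)"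
  using m1.DN_map_formula[OF f g] unfolding P1_def by blast
 obtain u2 where u2: "in_L2 M u2" "\<bar>Im lam\<bar> * L2norm M (%x. u2 x - f x) \<le> L2norm M (%x. mag_laplace A2 f x + (of_real (V2 x) - lam) * f x)"
  "DN_map Om sg nu A2 V2 lam f g = (LINT x|sg. f x * cdot (mag_grad (%x. - A2 x) g x) (cvec (nu x))) + (LINT x|M. u2 x * P2 x)"
  using m2.DN_map_formula[OF f g] unfolding P2_def by blast
 have bd: "(LINT x|sg. f x * cdot (mag_grad (%x. - A1 x) g x) (cvec (nu x))) = (LINT x|sg. f x * cdot (mag_grad (%x. - A2 x) g x) (cvec (nu x)))"
  using fr by (intro LINT_cong[OF refl]) (simp add: surface_space[OF surface] mag_grad_def)
 have ib: "integrable M (%x. v x * P x)" if "in_L2 M v" "in_L2 M P" for v P :: "real^'n => complex"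
  by (rule in_L2_integrable[OF bb_mult that])
 have "(LINT x|M. f x * (P1 x - P2 x)) = (LINT x|M. f x * P1 x) - (LINT x|M. f x * P2 x)"
  using ib[OF fL P(1)] ib[OF fL P(2)] by (simp add: right_diff_distrib)
 moreover have "(LINT x|M. (u1 x - f x) * P1 x) = (LINT x|M. u1 x * P1 x) - (LINT x|M. f x * P1 x)"
  using ib[OF fL P(1)] ib[OF u1(1) P(1)] by (simp add: left_diff_distrib)
 moreover have "(LINT x|M. (u2 x - f x) * P2 x) = (LINT x|M. u2 x * P2 x) - (LINT x|M. f x * P2 x)"
  using ib[OF fL P(2)] ib[OF u2(1) P(2)] by (simp add: left_diff_distrib)
 ultimately have eq: "DN_map Om sg nu A1 V1 lam f g - DN_map Om sg nu A2 V2 lam f g - (LINT x|M. f x * (P1 x - P2 x))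
  = (LINT x|M. (u1 x - f x) * P1 x) - (LINT x|M. (u2 x - f x) * P2 x)"
  using u1(3) u2(3) bd by simp
 have est: "norm (LINT x|M. (u x - f x) * P x) \<le> q * L2norm M P / \<bar>Im lam\<bar>"
  if "in_L2 M u" "\<bar>Im lam\<bar> * L2norm M (%x. u x - f x) \<le> q" "in_L2 M P" for u P :: "real^'n => complex" and q
 proof -
  have "norm (LINT x|M. (u x - f x) * P x) \<le> 1 * (L2norm M (%x. u x - f x) * L2norm M P)"
   by (rule L2norm_bilinear[OF bb_mult in_L2_diff[OF that(1) fL] that(3)]) (simp_all add: norm_mult)
  also have "... \<le> q / \<bar>Im lam\<bar> * L2norm M P"
  proof -
   have "L2norm M (%x. u x - f x) \<le> q / \<bar>Im lam\<bar>" using that(2) lam by (simp add: pos_le_divide_eq mult.commute)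
   thus ?thesis by (simp only: mult_1_left) (intro mult_right_mono L2norm_nonneg)
  qed
  finally show ?thesis by simp
 qed
 show ?thesis
  unfolding P1_def[symmetric] P2_def[symmetric] eq
  using norm_triangle_ineq4[of "LINT x|M. (u1 x - f x) * P1 x" "LINT x|M. (u2 x - f x) * P2 x"]
   est[OF u1(1,2) P(1)] est[OF u2(1,2) P(2)] by (simp add: add_divide_distrib)
qed

end

section \<open>Conjugation with exponentials\<close>

text \<open>Conjugation by the exponential replaces \<nabla> + \<i> A by \<nabla> + \<i> W with
  \<open>W x = cgrad ph x + cvec (A x)\<close>; the right side is the expanded square.\<close>

lemma mag_laplace_exp:
 fixes a ph :: "real^'n::finite => complex"
 assumes a: "C_diff 2 a" and ph: "C_diff 2 ph" and A: "C_diff 1 A"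
 shows "mag_laplace A (%x. a x * exp (\<i> * ph x)) x = - (exp (\<i> * ph x) *
  (cdiv (cgrad a) x + 2 * \<i> * cdot (cgrad a x) (cgrad ph x + cvec (A x))
   + \<i> * a x * cdiv (%x. cgrad ph x + cvec (A x)) x
   - a x * cdot (cgrad ph x + cvec (A x)) (cgrad ph x + cvec (A x))))"
proof -
 define e where "e x = exp (\<i> * ph x)" for x
 define W where "W x = cgrad ph x + cvec (A x)" for x
 have a1: "C_diff 1 a" and ph1: "C_diff 1 ph" using C_diff_mono[OF a, of 1] C_diff_mono[OF ph, of 1] by auto
 have iph: "C_diff m ph ==> C_diff m (%x. \<i> * ph x)" for m by (rule C_diff_linear[OF bl_mult_right])
 have e1: "C_diff 1 e" unfolding e_def[abs_def] by (intro C_diff_exp iph ph1)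
 have ca: "C_diff 1 (cgrad a)" "C_diff 1 (cgrad ph)"
  by (rule C_diff_cgrad, use a ph in \<open>simp add: numeral_2_eq_2\<close>)+
 have W: "C_diff 1 W" unfolding W_def[abs_def] by (intro C_diff_add ca C_diff_cvec A)
 have ge: "cgrad e x = (\<i> * e x) *s cgrad ph x" for x
 proof -
  have "partial k e x = e x * (\<i> * partial k ph x)" for k
   unfolding e_def[abs_def] using partial_exp[OF C_diff_D[OF iph[OF ph1]], of k x]
    partial_linear[OF bl_mult_right[of \<i>] C_diff_D[OF ph1], of k x] by simp
  thus ?thesis by (simp add: vec_eq_iff algebra_simps)
 qed
 have m: "mag_grad A (%x. a x * e x) = (%x. e x *s (cgrad a x + (\<i> * a x) *s W x))"
  by (simp add: fun_eq_iff mag_grad_def cgrad_mult[OF a1 e1] ge W_def vec_eq_iff algebra_simps)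
 have iaW: "C_diff 1 (%x. (\<i> * a x) *s W x)" and ia: "C_diff 1 (%x. \<i> * a x)"
  by (intro C_diff_smult C_diff_linear[OF bl_mult_right] a1 W)+
 have gia: "cgrad (%x. \<i> * a x) x = \<i> *s cgrad a x"
  using cgrad_linear[OF bl_mult_right a1, of \<i> x] by (simp add: vec_eq_iff)
 have "cdiv (%x. e x *s (cgrad a x + (\<i> * a x) *s W x)) x
  = e x * (cdiv (cgrad a) x + (\<i> * a x * cdiv W x + \<i> * cdot (W x) (cgrad a x)))
   + \<i> * e x * cdot (cgrad a x + (\<i> * a x) *s W x) (cgrad ph x)"
  unfolding cdiv_smult[OF e1 C_diff_add[OF ca(1) iaW]] cdiv_add[OF ca(1) iaW] cdiv_smult[OF ia W] ge gia cdot_smult_right by simp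
 moreover have "cgrad ph x = W x - cvec (A x)" by (simp add: W_def)
 ultimately show ?thesis
  unfolding e_def[symmetric] W_def[symmetric] mag_laplace_def m
  by (simp add: cdot_add_left cdot_diff_right cdot_smult_left cdot_commute[of "W x" "cgrad a x"] algebra_simps)
qed

text \<open>The leading term \<open>s^2\<close> cancels because \<open>th \<bullet> th = 1\<close>.\<close>

lemma conjugated_operator:
 fixes a :: "real^'n::finite => complex" and ps :: "real^'n => real"
 assumes a: "C_diff 2 a" and ps: "C_diff 2 ps" and A: "C_diff 1 A" and th: "norm th = 1"
 defines "Z \<equiv> %x. cvec (grad ps x + A x)"
 shows "mag_laplace A (%x. a x * exp (\<i> * (s * of_real (th \<bullet> x) + of_real (ps x)))) x
   + (v - s^2) * (a x * exp (\<i> * (s * of_real (th \<bullet> x) + of_real (ps x))))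
  = exp (\<i> * (s * of_real (th \<bullet> x) + of_real (ps x))) *
   (- cdiv (cgrad a) x - 2 * \<i> * s * cdot (cgrad a x) (cvec th) - 2 * \<i> * cdot (cgrad a x) (Z x)
   - \<i> * a x * cdiv Z x + 2 * s * a x * of_real (th \<bullet> (grad ps x + A x)) + a x * cdot (Z x) (Z x) + v * a x)"
proof -
 define ph where "ph x = s * of_real (th \<bullet> x) + of_real (ps x)" for x
 have L: "bounded_linear (%x. s * complex_of_real (th \<bullet> x))"
  by (intro bl_mult_right[THEN bounded_linear_compose] bounded_linear_of_real[THEN bounded_linear_compose] bounded_linear_inner_right)
 have ph: "C_diff 2 ph" unfolding ph_def[abs_def] by (intro C_diff_add C_diff_bounded_linear[OF L] C_diff_of_real ps)
 have ps1: "C_diff 1 ps" using C_diff_mono[OF ps, of 1] by simp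
 have gz: "C_diff 1 Z"
 proof -
  have "C_diff 1 (grad ps)"
   by (rule C_diff_vec) (use ps in \<open>simp add: grad_def numeral_2_eq_2\<close>)
  thus ?thesis unfolding Z_def by (intro C_diff_cvec C_diff_add A)
 qed
 have "partial k ph x = s * of_real (th $ k) + of_real (partial k ps x)" for k x
 proof -
  have "partial k (%x. s * complex_of_real (th \<bullet> x)) x = s * of_real (th $ k)"
   using partial_eqI[OF bounded_linear_imp_has_derivative[OF L], of k x] by (simp add: inner_axis)
  thus ?thesis
   unfolding ph_def[abs_def] using partial_of_real[OF C_diff_D[OF ps1], of k x]
    partial_add[OF C_diff_D[OF C_diff_bounded_linear[OF L, of 1]] C_diff_D[OF C_diff_of_real[OF ps1]], of k x] by simp
 qed
 hence W: "(%x. cgrad ph x + cvec (A x)) = (%x. s *s cvec th + Z x)"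
  by (simp add: fun_eq_iff vec_eq_iff Z_def cvec_def grad_def)
 have "cdiv (%x. s *s cvec th + Z x) x = cdiv Z x"
  using cdiv_add[OF C_diff_const gz, of "s *s cvec th" x] by (simp add: cdiv_def)
 moreover have "cgrad ph x + cvec (A x) = s *s cvec th + Z x" using W by (rule fun_cong)
 moreover have cv: "cdot (cvec th) (cvec v) = of_real (th \<bullet> v)" for v by (simp add: cdot_def cvec_def inner_vec_def)
 moreover have "cdot (Z x) (cvec th) = of_real (th \<bullet> (grad ps x + A x))" "cdot (cvec th) (Z x) = of_real (th \<bullet> (grad ps x + A x))"
  by (simp_all only: Z_def cdot_commute[of _ "cvec th"] cv)
 moreover have "th \<bullet> th = 1" using th by (simp add: dot_square_norm)
 ultimately show ?thesis
  unfolding ph_def[symmetric] mag_laplace_exp[OF a ph A] W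
  by (simp add: cdot_add_left cdot_add_right cdot_smult_left cdot_smult_right power2_eq_square algebra_simps)
qed

section \<open>Bounds for families depending on a large parameter\<close>

text \<open>Uniform O(\<tau> powr s) on \<open>S\<close> as \<tau> tends to infinity. With
  \<open>unit\<close> as the argument type it bounds scalar quantities, so that norms and integrals
  obey the same calculus as functions.\<close>

definition unif_O :: "'a set => real => (real => 'a => 'b::real_normed_vector) => bool" where
 "unif_O S s F \<longleftrightarrow> (\<exists>C. EV ta. \<forall>x\<in>S. norm (F ta x) \<le> C * ta powr s)"

lemma unif_OI: "EV ta. \<forall>x\<in>S. norm (F ta x) \<le> C * ta powr s ==> unif_O S s F"
 unfolding unif_O_def by blast

lemma unif_OE:
 assumes "unif_O S s F"
 obtains C where "C \<ge> 0" "EV ta. \<forall>x\<in>S. norm (F ta x) \<le> C * ta powr s"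
proof -
 obtain C where "EV ta. \<forall>x\<in>S. norm (F ta x) \<le> C * ta powr s" using assms by (auto simp: unif_O_def)
 hence "EV ta. \<forall>x\<in>S. norm (F ta x) \<le> max C 0 * ta powr s"
  by eventually_elim (meson max.cobounded1 mult_right_mono order_trans powr_ge_zero)
 thus ?thesis using that[of "max C 0"] by simp
qed

lemma unif_O_cong:
 assumes "EV ta. \<forall>x\<in>S. F ta x = G ta x" "unif_O S s F"
 shows "unif_O S s G"
proof -
 obtain C where "EV ta. \<forall>x\<in>S. norm (F ta x) \<le> C * ta powr s" using assms(2) by (auto simp: unif_O_def)
 with assms(1) have "EV ta. \<forall>x\<in>S. norm (G ta x) \<le> C * ta powr s" by eventually_elim simp
 thus ?thesis by (rule unif_OI)
qed

lemma unif_O_subset: "unif_O T s F ==> S \<subseteq> T ==> unif_O S s F"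
 unfolding unif_O_def by (elim exE, rule exI, erule eventually_mono) blast

lemma unif_O_mono:
 assumes "unif_O S s F" "s \<le> t"
 shows "unif_O S t F"
proof -
 obtain C where C: "C \<ge> 0" "EV ta. \<forall>x\<in>S. norm (F ta x) \<le> C * ta powr s" using assms(1) by (rule unif_OE)
 have "EV ta. \<forall>x\<in>S. norm (F ta x) \<le> C * ta powr t"
  using C(2) eventually_ge_at_top[of 1]
 proof eventually_elim
  case (elim ta)
  hence "C * ta powr s \<le> C * ta powr t" using assms(2) C(1) by (intro mult_left_mono powr_mono) auto
  thus ?case using elim(1) order_trans by blast
 qed
 thus ?thesis by (rule unif_OI)
qed

lemma unif_O_add:
 assumes "unif_O S s F" "unif_O S s G"
 shows "unif_O S s (%ta x. F ta x + G ta x)"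
proof -
 obtain C where C: "EV ta. \<forall>x\<in>S. norm (F ta x) \<le> C * ta powr s" using assms(1) by (rule unif_OE)
 obtain D where D: "EV ta. \<forall>x\<in>S. norm (G ta x) \<le> D * ta powr s" using assms(2) by (rule unif_OE)
 from C D have "EV ta. \<forall>x\<in>S. norm (F ta x + G ta x) \<le> (C + D) * ta powr s"
 proof eventually_elim
  case (elim ta)
  show ?case
  proof
   fix x assume "x \<in> S"
   thus "norm (F ta x + G ta x) \<le> (C + D) * ta powr s"
    using norm_triangle_ineq[of "F ta x" "G ta x"] elim(1)[rule_format, of x] elim(2)[rule_format, of x]
    by (simp add: distrib_right)
  qed
 qed
 thus ?thesis by (rule unif_OI)
qed

lemma unif_O_bilinear:
 assumes B: "bounded_bilinear B" and "unif_O S s F" "unif_O S t G"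
 shows "unif_O S (s + t) (%ta x. B (F ta x) (G ta x))"
proof -
 obtain C where C: "C \<ge> 0" "EV ta. \<forall>x\<in>S. norm (F ta x) \<le> C * ta powr s" using assms(2) by (rule unif_OE)
 obtain D where D: "D \<ge> 0" "EV ta. \<forall>x\<in>S. norm (G ta x) \<le> D * ta powr t" using assms(3) by (rule unif_OE)
 obtain K where K: "K \<ge> 0" "!!a b. norm (B a b) \<le> norm a * norm b * K" using bounded_bilinear.nonneg_bounded[OF B] by blast
 from C(2) D(2) have "EV ta. \<forall>x\<in>S. norm (B (F ta x) (G ta x)) \<le> (C * D * K) * ta powr (s + t)"
 proof eventually_elim
  case (elim ta)
  show ?case
  proof
   fix x assume x: "x \<in> S"
   have "norm (B (F ta x) (G ta x)) \<le> norm (F ta x) * norm (G ta x) * K" by (rule K(2))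
   also have "... \<le> (C * ta powr s) * (D * ta powr t) * K"
    using elim x K(1) C(1) D(1) by (intro mult_right_mono mult_mono) auto
   finally show "norm (B (F ta x) (G ta x)) \<le> (C * D * K) * ta powr (s + t)" by (simp add: powr_add mult_ac)
  qed
 qed
 thus ?thesis by (rule unif_OI)
qed

lemmas unif_O_mult = unif_O_bilinear[OF bb_mult]

lemma unif_O_const: "(!!x. x \<in> S ==> norm (c x) \<le> C) ==> unif_O S 0 (%ta. c)"
 by (intro unif_OI[of S _ C] eventually_mono[OF eventually_gt_at_top[of 0]]) simp

lemma unif_O_linear:
 assumes L: "bounded_linear L" and F: "unif_O S s F"
 shows "unif_O S s (%ta x. L (F ta x))"
proof -
 obtain C where C: "EV ta. \<forall>x\<in>S. norm (F ta x) \<le> C * ta powr s" using F by (rule unif_OE)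
 obtain K where K: "K \<ge> 0" "!!a. norm (L a) \<le> norm a * K" using bounded_linear.nonneg_bounded[OF L] by blast
 from C have "EV ta. \<forall>x\<in>S. norm (L (F ta x)) \<le> (C * K) * ta powr s"
 proof eventually_elim
  case (elim ta)
  show ?case
  proof
   fix x assume x: "x \<in> S"
   have "norm (L (F ta x)) \<le> norm (F ta x) * K" by (rule K(2))
   also have "... \<le> (C * ta powr s) * K" using elim x K(1) by (intro mult_right_mono) auto
   finally show "norm (L (F ta x)) \<le> (C * K) * ta powr s" by (simp add: mult_ac)
  qed
 qed
 thus ?thesis by (rule unif_OI)
qed

lemma unif_O_minus: "unif_O S s F ==> unif_O S s (%ta x. - F ta x)"
 unfolding unif_O_def by simp

lemma unif_O_diff: "unif_O S s F ==> unif_O S s G ==> unif_O S s (%ta x. F ta x - G ta x)"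
 using unif_O_add[of S s F "%ta x. - G ta x"] unif_O_minus[of S s G] by simp

lemma unif_O_zero: "unif_O S s (%ta x. 0)"
 by (rule unif_OI[of S _ 0]) simp

lemma unif_O_sum: "(!!i. i \<in> I ==> unif_O S s (F i)) ==> unif_O S s (%ta x. \<Sum>i\<in>I. F i ta x)"
 by (induction I rule: infinite_finite_induct) (auto intro: unif_O_add unif_O_zero)

lemma unif_O_vec:
 fixes F :: "real => 'a => 'b::real_normed_vector^'n::finite"
 assumes "!!k. unif_O S s (%ta x. F ta x $ k)"
 shows "unif_O S s F"
proof -
 have "\<forall>k. \<exists>C. EV ta. \<forall>x\<in>S. norm (F ta x $ k) \<le> C * ta powr s" using assms by (simp add: unif_O_def)
 from choice[OF this] obtain C where "!!k. EV ta. \<forall>x\<in>S. norm (F ta x $ k) \<le> C k * ta powr s" by blast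
 hence "EV ta. \<forall>k. \<forall>x\<in>S. norm (F ta x $ k) \<le> C k * ta powr s" by (rule eventually_all_finite)
 hence "EV ta. \<forall>x\<in>S. norm (F ta x) \<le> (\<Sum>k\<in>UNIV. C k) * ta powr s"
 proof eventually_elim
  case (elim ta)
  show ?case
  proof
   fix x assume "x \<in> S"
   hence "(\<Sum>k\<in>UNIV. norm (F ta x $ k)) \<le> (\<Sum>k\<in>UNIV. C k * ta powr s)" using elim by (intro sum_mono) auto
   moreover have "norm (F ta x) \<le> (\<Sum>k\<in>UNIV. norm (F ta x $ k))" unfolding norm_vec_def by (rule L2_set_le_sum) simp
   ultimately show "norm (F ta x) \<le> (\<Sum>k\<in>UNIV. C k) * ta powr s" by (simp add: sum_distrib_right)
  qed
 qed
 thus ?thesis by (rule unif_OI)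
qed

lemma unif_O_tendsto_0:
 assumes "unif_O S s F" "s < 0" "x \<in> S"
 shows "((%ta. F ta x) ---> 0) at_top"
proof -
 obtain C where C: "EV ta. \<forall>x\<in>S. norm (F ta x) \<le> C * ta powr s" using assms(1) by (rule unif_OE)
 have "((%ta. C * ta powr s) ---> C * 0) at_top"
  using assms(2) by (intro tendsto_intros tendsto_neg_powr filterlim_ident)
 moreover have "EV ta. norm (F ta x) \<le> C * ta powr s"
  using C by (rule eventually_mono) (use assms(3) in blast)
 ultimately show ?thesis using Lim_null_comparison[of "%ta. F ta x" "%ta. C * ta powr s" at_top] by simp
qed

text \<open>Bounds together with derivatives, each of which costs a factor \<open>1/\<delta> = \<tau> powr (1/3)\<close>.\<close>

primrec C_bound :: "(real^'n::finite) set => nat => real => (real => real^'n => 'b::real_normed_vector) => bool" where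
 "C_bound S 0 s F \<longleftrightarrow> unif_O S s F \<and> (EV ta. continuous_on UNIV (F ta))"
| "C_bound S (Suc m) s F \<longleftrightarrow> unif_O S s F \<and> (EV ta. \<forall>x. F ta differentiable at x)
  \<and> (\<forall>k. C_bound S m (s + 1/3) (%ta. partial k (F ta)))"

lemma C_bound_unif_O: "C_bound S m s F ==> unif_O S s F"
 by (cases m) auto

lemma C_bound_continuous: "C_bound S m s F ==> EV ta. continuous_on UNIV (F ta)"
 by (cases m) (auto elim!: eventually_mono intro!: continuous_at_imp_continuous_on differentiable_imp_continuous_within)

lemma C_bound_Suc_imp: "C_bound S (Suc m) s F ==> C_bound S m s F"
proof (induction m arbitrary: s F)
 case 0
 thus ?case using C_bound_continuous[OF 0] by simp
next
 case (Suc m)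
 hence "C_bound S m (s + 1/3) (%ta. partial k (F ta))" for k by (intro Suc.IH) auto
 thus ?case using Suc.prems by simp
qed

lemma C_bound_C_diff_1:
 assumes "C_bound S (Suc m) s F"
 shows "EV ta. C_diff 1 (F ta)"
proof -
 have "EV ta. continuous_on UNIV (partial k (F ta))" for k
  using assms by (intro C_bound_continuous[of S m "s + 1/3"]) simp
 hence "EV ta. \<forall>k. continuous_on UNIV (partial k (F ta))" by (rule eventually_all_finite)
 moreover have "EV ta. \<forall>x. F ta differentiable at x" using assms by simp
 ultimately show ?thesis by eventually_elim simp
qed

lemma C_bound_cong:
 assumes "EV ta. F ta = G ta" "C_bound S m s F"
 shows "C_bound S m s G"
 using assms
proof (induction m arbitrary: s F G)
 case 0
 have "EV ta. continuous_on UNIV (F ta)" using 0(2) by simp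
 with 0(1) have "EV ta. continuous_on UNIV (G ta)" by eventually_elim simp
 moreover have "unif_O S s G" by (rule unif_O_cong[of S F]) (use 0 in \<open>auto elim: eventually_mono\<close>)
 ultimately show ?case by simp
next
 case (Suc m)
 have "EV ta. \<forall>x. F ta differentiable at x" using Suc.prems(2) by simp
 with Suc.prems(1) have "EV ta. \<forall>x. G ta differentiable at x" by eventually_elim simp
 moreover have "unif_O S s G" by (rule unif_O_cong[of S F]) (use Suc.prems in \<open>auto elim: eventually_mono\<close>)
 moreover have "C_bound S m (s + 1/3) (%ta. partial k (G ta))" for k
  by (rule Suc.IH[of "%ta. partial k (F ta)"]) (use Suc.prems in \<open>auto elim: eventually_mono\<close>)
 ultimately show ?case by simp
qed

lemma C_bound_const:
 fixes c :: "real => 'b::real_normed_vector"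
 shows "EV ta. norm (c ta) \<le> C * ta powr s ==> C_bound S m s (%ta x. c ta)"
proof (induction m arbitrary: s c C)
 case 0
 thus ?case by (auto intro!: unif_OI[of S _ C] elim: eventually_mono)
next
 case (Suc m)
 have "C_bound S m (s + 1/3) (%ta x. 0 :: 'b)" using Suc.IH[of "%_. 0" 0 "s + 1/3"] by simp
 moreover have "unif_O S s (%ta x. c ta)" using Suc.prems by (auto intro!: unif_OI[of S _ C] elim: eventually_mono)
 ultimately show ?case by simp
qed

lemma C_bound_add: "C_bound S m s F ==> C_bound S m s G ==> C_bound S m s (%ta x. F ta x + G ta x)"
proof (induction m arbitrary: s F G)
 case 0
 have "EV ta. continuous_on UNIV (F ta)" "EV ta. continuous_on UNIV (G ta)" using 0 by auto
 hence "EV ta. continuous_on UNIV (%x. F ta x + G ta x)" by eventually_elim (rule continuous_on_add)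
 thus ?case using 0 unif_O_add[of S s F G] by simp
next
 case (Suc m)
 have d: "EV ta. (\<forall>x. F ta differentiable at x) \<and> (\<forall>x. G ta differentiable at x)"
  using Suc.prems by (simp add: eventually_conj_iff)
 have "C_bound S m (s + 1/3) (%ta. partial k (%x. F ta x + G ta x))" for k
 proof (rule C_bound_cong)
  show "C_bound S m (s + 1/3) (%ta x. partial k (F ta) x + partial k (G ta) x)" using Suc by simp
  show "EV ta. (%x. partial k (F ta) x + partial k (G ta) x) = partial k (%x. F ta x + G ta x)"
   using d by eventually_elim (simp add: fun_eq_iff partial_add)
 qed
 moreover have "EV ta. \<forall>x. (%x. F ta x + G ta x) differentiable at x"
  using d by eventually_elim (simp add: differentiable_add)
 ultimately show ?case using unif_O_add[of S s F G] Suc.prems by simp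
qed

lemma C_bound_linear:
 assumes L: "bounded_linear L"
 shows "C_bound S m s F ==> C_bound S m s (%ta x. L (F ta x))"
proof (induction m arbitrary: s F)
 case 0
 hence "EV ta. continuous_on UNIV (%x. L (F ta x))"
  by (auto elim!: eventually_mono intro: bounded_linear.continuous_on[OF L])
 thus ?case using 0 unif_O_linear[OF L, of S s F] by simp
next
 case (Suc m)
 have d: "EV ta. \<forall>x. F ta differentiable at x" using Suc.prems by simp
 have "C_bound S m (s + 1/3) (%ta. partial k (%x. L (F ta x)))" for k
 proof (rule C_bound_cong)
  show "C_bound S m (s + 1/3) (%ta x. L (partial k (F ta) x))" using Suc by simp
  show "EV ta. (%x. L (partial k (F ta) x)) = partial k (%x. L (F ta x))"
   using d by eventually_elim (simp add: fun_eq_iff partial_linear[OF L])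
 qed
 moreover have "EV ta. \<forall>x. (%x. L (F ta x)) differentiable at x"
  using d unfolding differentiable_def by eventually_elim (blast intro: bounded_linear.has_derivative[OF L])
 ultimately show ?case using unif_O_linear[OF L, of S s F] Suc.prems by simp
qed

text \<open>The loss per derivative is a fixed addition to the exponent, so in the product rule it
  does not matter which factor is differentiated, and the exponents of the factors simply
  add.\<close>

lemma C_bound_bilinear:
 assumes B: "bounded_bilinear B"
 shows "C_bound S m s F ==> C_bound S m t G ==> C_bound S m (s + t) (%ta x. B (F ta x) (G ta x))"
proof (induction m arbitrary: s t F G)
 case 0
 have "EV ta. continuous_on UNIV (F ta)" "EV ta. continuous_on UNIV (G ta)" using 0 by auto
 hence "EV ta. continuous_on UNIV (%x. B (F ta x) (G ta x))"
  by eventually_elim (rule bounded_bilinear.continuous_on[OF B])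
 thus ?case using 0 unif_O_bilinear[OF B, of S s F t G] by simp
next
 case (Suc m)
 have d: "EV ta. (\<forall>x. F ta differentiable at x) \<and> (\<forall>x. G ta differentiable at x)"
  using Suc.prems by (simp add: eventually_conj_iff)
 have "C_bound S m (s + t + 1/3) (%ta. partial k (%x. B (F ta x) (G ta x)))" for k
 proof (rule C_bound_cong)
  have "C_bound S m (s + (t + 1/3)) (%ta x. B (F ta x) (partial k (G ta) x))"
   by (rule Suc.IH) (use Suc.prems C_bound_Suc_imp[of S m s F] in auto)
  moreover have "C_bound S m ((s + 1/3) + t) (%ta x. B (partial k (F ta) x) (G ta x))"
   by (rule Suc.IH) (use Suc.prems C_bound_Suc_imp[of S m t G] in auto)
  ultimately show "C_bound S m (s + t + 1/3) (%ta x. B (F ta x) (partial k (G ta) x) + B (partial k (F ta) x) (G ta x))"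
   by (intro C_bound_add) (simp_all add: add_ac)
  show "EV ta. (%x. B (F ta x) (partial k (G ta) x) + B (partial k (F ta) x) (G ta x)) = partial k (%x. B (F ta x) (G ta x))"
   using d by eventually_elim (simp add: fun_eq_iff partial_bilinear[OF B])
 qed
 moreover have "EV ta. \<forall>x. (%x. B (F ta x) (G ta x)) differentiable at x"
  using d unfolding differentiable_def by eventually_elim (blast intro: bounded_bilinear.FDERIV[OF B])
 ultimately show ?case using unif_O_bilinear[OF B, of S s F t G] Suc.prems by simp
qed

lemmas C_bound_mult = C_bound_bilinear[OF bb_mult]

text \<open>The exponential has modulus one since \<open>L\<close> is real. A derivative multiplies
  it by a derivative of \<open>L\<close>, and the induction hypothesis applies to the
  product.\<close>

lemma C_bound_exp:
 fixes L :: "real => real^'n::finite => real"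
 assumes "C_bound S m 0 L"
 shows "C_bound S m 0 (%ta x. exp (- \<i> * complex_of_real (L ta x)))"
 using assms
proof (induction m)
 case 0
 hence "EV ta. continuous_on UNIV (%x. exp (- \<i> * complex_of_real (L ta x)))"
  by (auto elim!: eventually_mono intro!: continuous_intros)
 thus ?case by (auto intro!: unif_OI[of S _ 1] eventually_mono[OF eventually_gt_at_top[of 0]])
next
 case (Suc m)
 have d: "EV ta. C_diff 1 (L ta)" by (rule C_bound_C_diff_1[OF Suc.prems])
 have C: "C_diff 1 (%x. - \<i> * complex_of_real (l x))" if "C_diff 1 l" for l :: "real^'n => real"
  by (intro C_diff_linear[OF bl_mult_right] C_diff_of_real that)
 have "C_bound S m (0 + 1/3) (%ta. partial k (%x. exp (- \<i> * complex_of_real (L ta x))))" for k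
 proof (rule C_bound_cong)
  have "C_bound S m (0 + (0 + 1/3)) (%ta x. exp (- \<i> * complex_of_real (L ta x)) * (- \<i> * complex_of_real (partial k (L ta) x)))"
   using Suc C_bound_Suc_imp[OF Suc.prems]
   by (intro C_bound_mult C_bound_linear[OF bl_mult_right] C_bound_linear[OF bounded_linear_of_real]) auto
  thus "C_bound S m (0 + 1/3) (%ta x. exp (- \<i> * complex_of_real (L ta x)) * (- \<i> * complex_of_real (partial k (L ta) x)))" by simp
  show "EV ta. (%x. exp (- \<i> * complex_of_real (L ta x)) * (- \<i> * complex_of_real (partial k (L ta) x)))
   = partial k (%x. exp (- \<i> * complex_of_real (L ta x)))"
   using d
  proof eventually_elim
   case (elim ta)
   have "partial k (%x. - \<i> * complex_of_real (L ta x)) x = - \<i> * complex_of_real (partial k (L ta) x)" for x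
    using partial_linear[OF bl_mult_right C_diff_D[OF C_diff_of_real[OF elim]], of k "- \<i>" x]
     partial_of_real[OF C_diff_D[OF elim], of k x] by simp
   thus ?case
    using partial_exp[OF C_diff_D[OF C[OF elim]], of k] by (simp add: fun_eq_iff)
  qed
 qed
 moreover have "EV ta. \<forall>x. (%x. exp (- \<i> * complex_of_real (L ta x))) differentiable at x"
  using d by eventually_elim (intro allI C_diff_D[of 1] C_diff_exp C, simp_all)
 moreover have "unif_O S 0 (%ta x. exp (- \<i> * complex_of_real (L ta x)))"
  by (auto intro!: unif_OI[of S _ 1] eventually_mono[OF eventually_gt_at_top[of 0]])
 ultimately show ?case by simp
qed

section \<open>Mollified fields and their ray integrals\<close>

lemma conv_scale_left: "conv (%y. k y / c) f x = (1 / c) *\<^sub>R conv k f x"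
proof -
 have "conv (%y. k y / c) f x = (LINT z|lebesgue. (1 / c) *\<^sub>R (k (x - z) *\<^sub>R f z))"
  unfolding conv_def by (intro LINT_cong[OF refl]) simp
 thus ?thesis by (simp only: conv_def integral_scaleR_right)
qed

text \<open>The bound without derivatives is the L^1 norm of the kernel, which rescaling preserves.
  A derivative replaces \<open>k\<close> by its partial derivative, again a smooth kernel vanishing
  outside the unit ball, with a factor 1/\<delta>; this is why the induction runs over all
  kernels.\<close>

lemma C_bound_conv:
 fixes B :: "real^'n::finite => 'b::euclidean_space"
 assumes B: "continuous_on UNIV B" "!!x. norm x > R ==> B x = 0"
 shows "smooth k ==> (!!x. norm x > 1 ==> k x = 0) ==>
  C_bound UNIV m 0 (%ta. conv (rescale k (ta powr (- 1 / 3))) B)"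
proof (induction m arbitrary: k)
 have Bi: "integrable lebesgue B" by (rule cvanish_integrable_leb[OF B])
 obtain M where M: "!!x. norm (B x) \<le> M" using cvanish_bounded[OF B] by blast
 have rC: "C_diff m (rescale k (ta powr (- 1 / 3)))" if "smooth k" for k :: "real^'n => real" and m and ta :: real
  by (rule C_diff_rescale[OF smooth_C_diff[OF that]])
 have rv: "rescale k (ta powr (- 1 / 3)) y = 0" if "!!x. norm x > 1 ==> k x = 0" "ta > 0" "norm y > ta powr (- 1 / 3)" for k :: "real^'n => real" and ta y
  by (rule rescale_vanish[of _ 1 k]) (use that in auto)
 have bd: "unif_O UNIV 0 (%ta. conv (rescale k (ta powr (- 1 / 3))) B)"
  if k: "smooth k" "!!x. norm x > 1 ==> k x = 0" for k :: "real^'n => real"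
 proof (rule unif_OI[of _ _ "M * (LINT z|lborel. \<bar>k z\<bar>)"], rule eventually_mono[OF eventually_gt_at_top[of 0]], intro ballI)
  fix ta :: real and x assume t: "ta > 0"
  have "norm (conv (rescale k (ta powr (- 1 / 3))) B x) \<le> M * (LINT z|lborel. \<bar>rescale k (ta powr (- 1 / 3)) z\<bar>)"
   by (rule conv_norm_le[of _ "ta powr (- 1 / 3)"]) (use rC[OF k(1), of 0] rv[of k ta, OF k(2) t] Bi M in simp_all)
  thus "norm (conv (rescale k (ta powr (- 1 / 3))) B x) \<le> M * (LINT z|lborel. \<bar>k z\<bar>) * ta powr 0"
   using integral_rescale(2)[of "ta powr (- 1 / 3)" k] t smooth_C_diff[OF k(1), of 0] by simp
 qed
 have cd: "C_diff m (conv (rescale k (ta powr (- 1 / 3))) B)"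
  if k: "smooth k" "!!x. norm x > 1 ==> k x = 0" "ta > 0" for k :: "real^'n => real" and m ta
  by (rule C_diff_conv[OF Bi rC[OF k(1)], of "ta powr (- 1 / 3)"]) (rule rv[of k ta, OF k(2,3)])
 {
  case 0
  have "EV ta. continuous_on UNIV (conv (rescale k (ta powr (- 1 / 3))) B)"
   using eventually_gt_at_top[of 0]
  proof eventually_elim
   case (elim ta)
   thus ?case using cd[of k ta 0, OF 0] by simp
  qed
  thus ?case using bd[of k, OF 0] by simp
 next
  case (Suc m)
  have "EV ta. \<forall>x. conv (rescale k (ta powr (- 1 / 3))) B differentiable at x"
   using eventually_gt_at_top[of 0]
  proof eventually_elim
   case (elim ta)
   thus ?case using C_diff_D[OF cd[of k ta 1, OF Suc.prems]] by simp
  qed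
  moreover have "C_bound UNIV m (0 + 1/3) (%ta. partial j (conv (rescale k (ta powr (- 1 / 3))) B))" for j
  proof (rule C_bound_cong)
   have v: "partial j k x = 0" if "norm x > 1" for x
    by (rule partial_zero_outside[of 1 k, OF Suc.prems(2) that])
   have "C_bound UNIV m (1/3 + 0) (%ta x. (ta powr (1/3)) *\<^sub>R conv (rescale (partial j k) (ta powr (- 1 / 3))) B x)"
    by (intro C_bound_bilinear[OF bounded_bilinear_scaleR] Suc.IH smooth_partial Suc.prems(1) v C_bound_const[of _ 1]) simp_all
   thus "C_bound UNIV m (0 + 1/3) (%ta x. (ta powr (1/3)) *\<^sub>R conv (rescale (partial j k) (ta powr (- 1 / 3))) B x)" by simp
   show "EV ta. (%x. (ta powr (1/3)) *\<^sub>R conv (rescale (partial j k) (ta powr (- 1 / 3))) B x)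
    = partial j (conv (rescale k (ta powr (- 1 / 3))) B)"
    using eventually_gt_at_top[of 0]
   proof eventually_elim
    case (elim ta)
    have "partial j (conv (rescale k (ta powr (- 1 / 3))) B) x = conv (partial j (rescale k (ta powr (- 1 / 3)))) B x" for x
     by (rule partial_conv(2)[OF rC[OF Suc.prems(1)] _ Bi, of "ta powr (- 1 / 3)"]) (rule rv[of k ta, OF Suc.prems(2) elim])
    also have "... x = (1 / ta powr (- 1 / 3)) *\<^sub>R conv (rescale (partial j k) (ta powr (- 1 / 3))) B x" for x
     unfolding partial_rescale[OF smooth_C_diff[OF Suc.prems(1)]] by (rule conv_scale_left)
    finally show ?case by (simp add: fun_eq_iff powr_minus_divide)
   qed
  qed
  ultimately show ?case using bd[of k, OF Suc.prems] by simp
 }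
qed

lemma conv_rescale_uniform:
 fixes B :: "real^'n::finite => 'b::euclidean_space"
 assumes B: "continuous_on UNIV B" "!!x. norm x > R ==> B x = 0"
  and k: "continuous_on UNIV k" "!!x. norm x > 1 ==> k x = 0" "(LINT y|lborel. k y) = 1" and e: "e > 0"
 shows "EV ta. \<forall>x. norm (conv (rescale k (ta powr (- 1 / 3))) B x - B x) \<le> e"
proof -
 have Bi: "integrable lebesgue B" by (rule cvanish_integrable_leb[OF B])
 define K where "K = 1 + (LINT y|lborel. \<bar>k y\<bar>)"
 have K: "K > 0" "(LINT y|lborel. \<bar>k y\<bar>) \<le> K" by (auto simp: K_def add_pos_nonneg)
 obtain d where d: "d > 0" "!!x z. norm (x - z) \<le> d ==> norm (B z - B x) \<le> e / K"
  using continuous_vanish_uniform[of B R "e / K", OF B] e K(1) by auto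
 have "((%ta::real. ta powr (- 1 / 3)) ---> 0) at_top" by (intro tendsto_neg_powr filterlim_ident) simp
 hence "\<forall>\<^sub>F ta::real in at_top. ta powr (- 1 / 3) < d" using d(1) by (rule order_tendstoD)
 thus ?thesis
  using eventually_gt_at_top[of 0]
 proof eventually_elim
  case (elim ta)
  show ?case
  proof
   fix x
   have "norm (conv (rescale k (ta powr (- 1 / 3))) B x - B x) \<le> e / K * (LINT y|lborel. \<bar>k y\<bar>)"
    by (rule conv_rescale_error[of _ k 1]) (use elim k Bi d(2) in auto)
   also have "... \<le> e / K * K" using K e by (intro mult_left_mono) auto
   finally show "norm (conv (rescale k (ta powr (- 1 / 3))) B x - B x) \<le> e" using K(1) by simp
  qed
 qed
qed

text \<open>Ray integration commutes with derivatives and is bounded in the uniform norm by the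
  diameter \<open>2 * R\<close> of the common support, so it costs no power of \<tau>.\<close>

lemma C_bound_ray:
 fixes F :: "real => real^'n::finite => 'b::euclidean_space"
 assumes th: "EV ta. norm (th ta) = 1" and S: "S \<in> sets borel" and R: "R \<ge> 0"
 shows "C_bound UNIV m s F ==> EV ta. \<forall>x. norm x > R --> F ta x = 0 ==> C_bound UNIV m s (%ta. ray S (th ta) (F ta))"
proof (induction m arbitrary: s F)
 have bd: "unif_O UNIV s (%ta. ray S (th ta) (F ta))"
  if F: "unif_O UNIV s F" "EV ta. continuous_on UNIV (F ta)" "EV ta. \<forall>x. norm x > R --> F ta x = 0"
  for s and F :: "real => real^'n => 'b"
 proof -
  obtain C where "EV ta. \<forall>x\<in>UNIV. norm (F ta x) \<le> C * ta powr s" using F(1) by (rule unif_OE)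
  hence "EV ta. \<forall>x\<in>UNIV. norm (ray S (th ta) (F ta) x) \<le> (2 * R * C) * ta powr s"
   using F(2,3) th
  proof eventually_elim
   case (elim ta)
   have "norm (ray S (th ta) (F ta) x) \<le> 2 * R * (C * ta powr s)" for x
    by (rule ray_norm_le[OF elim(4,2) _ S _ R]) (use elim in auto)
   thus ?case by (simp add: mult.assoc)
  qed
  thus ?thesis by (rule unif_OI)
 qed
 {
  case 0
  have "EV ta. continuous_on UNIV (F ta)" using 0(1) by simp
  hence "EV ta. continuous_on UNIV (ray S (th ta) (F ta))"
   using 0(2) th
  proof eventually_elim
   case (elim ta)
   have "C_diff 0 (ray S (th ta) (F ta))" by (rule C_diff_ray[OF elim(3) S, of _ _ R]) (use elim in auto)
   thus ?case by simp
  qed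
  thus ?case using bd[of s F] 0 by simp
 next
  case (Suc m)
  have c: "EV ta. C_diff 1 (F ta)" by (rule C_bound_C_diff_1[OF Suc.prems(1)])
  have p: "EV ta. (\<forall>x. ray S (th ta) (F ta) differentiable at x) \<and> (\<forall>j. ray S (th ta) (partial j (F ta)) = partial j (ray S (th ta) (F ta)))"
   using c Suc.prems(2) th
  proof eventually_elim
   case (elim ta)
   have v: "norm x > R ==> F ta x = 0" for x using elim(2) by blast
   show ?case using partial_ray[of "th ta" "F ta" R S, OF elim(3,1) v S] by (simp add: fun_eq_iff)
  qed
  have v: "EV ta. \<forall>x. norm x > R --> partial j (F ta) x = 0" for j
   using Suc.prems(2)
  proof eventually_elim
   case (elim ta)
   thus ?case using partial_zero_outside[of R "F ta"] by blast
  qed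
  have "C_bound UNIV m (s + 1/3) (%ta. partial j (ray S (th ta) (F ta)))" for j
  proof (rule C_bound_cong)
   show "C_bound UNIV m (s + 1/3) (%ta. ray S (th ta) (partial j (F ta)))"
    by (rule Suc.IH[OF _ v]) (use Suc.prems(1) in simp)
   show "EV ta. ray S (th ta) (partial j (F ta)) = partial j (ray S (th ta) (F ta))"
    using p by eventually_elim blast
  qed
  moreover have "EV ta. \<forall>x. ray S (th ta) (F ta) differentiable at x" using p by eventually_elim blast
  moreover have "unif_O UNIV s (%ta. ray S (th ta) (F ta))"
   by (rule bd[OF C_bound_unif_O[OF Suc.prems(1)] C_bound_continuous[OF Suc.prems(1)] Suc.prems(2)])
  ultimately show ?case by simp
 }
qed

text \<open>The change of the integrand contributes at most its supremum times \<open>2 * R\<close>;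
  the change of direction for the fixed limit function is \<open>ray_tendsto\<close>.\<close>

lemma ray_tendsto_uniform:
 fixes F :: "real => real^'n::finite => 'b::euclidean_space" and th :: "real => real^'n"
 assumes th: "!!t. t > T ==> norm (th t) = 1" "norm th0 = 1" "(th ---> th0) at_top"
  and F: "EV t. continuous_on UNIV (F t) \<and> (\<forall>x. norm x > R --> F t x = 0)"
  and lim: "!!e. e > 0 ==> EV t. \<forall>x. norm (F t x - f x) \<le> e"
  and f: "continuous_on UNIV f" "!!x. norm x > R ==> f x = 0" and S: "S \<in> sets borel" and R: "R > 0"
 shows "((%t. ray S (th t) (F t) x) ---> ray S th0 f x) at_top"
proof -
 have "((%t. ray S (th t) (F t) x - ray S (th t) f x) ---> 0) at_top"
 proof (rule tendstoI)
  fix e :: real assume e: "e > 0"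
  define e' where "e' = e / (4 * R)"
  have e': "e' > 0" using e R by (simp add: e'_def)
  show "EV t. dist (ray S (th t) (F t) x - ray S (th t) f x) 0 < e"
   using F lim[OF e'] eventually_gt_at_top[of T]
  proof eventually_elim
   case (elim t)
   have n: "norm (th t) = 1" by (rule th(1)[OF elim(3)])
   have c: "continuous_on UNIV (%x. F t x - f x)" using elim(1) f(1) by (intro continuous_on_diff) auto
   have v: "F t x - f x = 0" if "norm x > R" for x using elim(1) f(2)[OF that] that by simp
   have "ray S (th t) (F t) x = ray S (th t) (%x. (F t x - f x) + f x) x" by simp
   also have "... = ray S (th t) (%x. F t x - f x) x + ray S (th t) f x"
    by (rule ray_add[OF n S c _ f(1), of R]) (use v f(2) in auto)
   finally have "norm (ray S (th t) (F t) x - ray S (th t) f x) = norm (ray S (th t) (%x. F t x - f x) x)" by simp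
   also have "... \<le> 2 * R * e'"
    by (rule ray_norm_le[OF n c _ S]) (use v elim(2) R in auto)
   also have "... < e" using e R by (simp add: e'_def)
   finally show ?case by (simp add: dist_norm)
  qed
 qed
 from tendsto_add[OF this ray_tendsto[where T=T and R=R and x=x, OF th f S]] show ?thesis by simp
qed

lemma ray_inner:
 fixes f :: "real^'n::finite => 'b::euclidean_space"
 assumes "norm th = 1" "continuous_on UNIV f" "!!x. norm x > R ==> f x = 0" "S \<in> sets borel"
 shows "ray S th (%z. v \<bullet> f z) x = v \<bullet> ray S th f x"
 unfolding ray_def using integral_inner_right[OF ray_integrable[of th f R S x, OF assms], of v] by simp

lemma inner_grad: "v \<bullet> grad f x = (\<Sum>k\<in>UNIV. v $ k * partial k f x)"
 by (simp add: inner_vec_def grad_def)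

text \<open>The outer exponential cancels the inner one. What remains is the exponential of the line
  integral times the derivative of the phase along \<open>y\<close>, so the amplitude contains first
  derivatives of the line integral.\<close>

lemma amplitude_eq:
 assumes L: "C_diff 1 (line_integral th A)"
 shows "amplitude th A \<zeta> y x =
  - \<i> * of_real (y \<bullet> (\<zeta> + grad (line_integral th A) x)) * exp (- \<i> * of_real (line_integral th A x))"
proof -
 let ?L = "line_integral th A"
 define h where "h z = - \<i> * complex_of_real (?L z + \<zeta> \<bullet> z)" for z
 have bl: "bounded_linear (%z. \<zeta> \<bullet> z)" by (rule bounded_linear_inner_right)
 have s: "C_diff 1 (%z. ?L z + \<zeta> \<bullet> z)" by (intro C_diff_add L C_diff_bounded_linear[OF bl])
 have h: "C_diff 1 h" unfolding h_def[abs_def] by (intro C_diff_linear[OF bl_mult_right] C_diff_of_real s)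
 have "partial k (%z. ?L z + \<zeta> \<bullet> z) x = partial k ?L x + \<zeta> $ k" for k
  using partial_add[OF C_diff_D[OF L] C_diff_D[OF C_diff_bounded_linear[OF bl, of 1]], of k x]
   partial_eqI[OF bounded_linear_imp_has_derivative[OF bl], of k x] by (simp add: inner_axis)
 hence "partial k h x = - \<i> * of_real (partial k ?L x + \<zeta> $ k)" for k
  unfolding h_def[abs_def] using partial_linear[OF bl_mult_right C_diff_D[OF C_diff_of_real[OF s]], of k "- \<i>" x]
   partial_of_real[OF C_diff_D[OF s], of k x] by simp
 hence p: "partial k (%z. exp (h z)) x = exp (h x) * (- \<i> * of_real (partial k ?L x + \<zeta> $ k))" for k
  using partial_exp[OF C_diff_D[OF h], of k x] by simp
 have e: "exp (- \<i> * complex_of_real (?L z)) * exp (- \<i> * of_real (\<zeta> \<bullet> z)) = exp (h z)" for z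
  by (simp add: h_def exp_add[symmetric] algebra_simps)
 have "amplitude th A \<zeta> y x = exp (\<i> * of_real (\<zeta> \<bullet> x)) * (\<Sum>k\<in>UNIV. of_real (y $ k) * (exp (h x) * (- \<i> * of_real (partial k ?L x + \<zeta> $ k))))"
  unfolding amplitude_def e p ..
 also have "(\<Sum>k\<in>UNIV. of_real (y $ k) * (exp (h x) * (- \<i> * of_real (partial k ?L x + \<zeta> $ k))))
  = exp (h x) * (- \<i> * of_real (y \<bullet> (\<zeta> + grad ?L x)))"
  by (simp add: inner_vec_def grad_def sum_distrib_left algebra_simps)
 also have "exp (\<i> * of_real (\<zeta> \<bullet> x)) * (exp (h x) * (- \<i> * of_real (y \<bullet> (\<zeta> + grad ?L x))))
  = - \<i> * of_real (y \<bullet> (\<zeta> + grad ?L x)) * (exp (\<i> * of_real (\<zeta> \<bullet> x)) * exp (h x))" by simp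
 also have "exp (\<i> * of_real (\<zeta> \<bullet> x)) * exp (h x) = exp (- \<i> * of_real (?L x))"
  by (simp add: h_def exp_add[symmetric] algebra_simps)
 finally show ?thesis .
qed

text \<open>To be instantiated with the two extended potentials and with their difference. The
  radius is explicit because mollification at scale at most 1 enlarges it to
  \<open>R + 1\<close>.\<close>

locale mollified_field =
 fixes rh :: "real^'n::finite => real" and A :: "real^'n => real^'n" and R :: real
 assumes rho: "smooth rh" "!!x. norm x > 1 ==> rh x = 0" "(LINT x|lborel. rh x) = 1"
  and A: "C_diff 1 A" "!!x. norm x > R ==> A x = 0" and R: "R > 0"
begin

lemma A_moll_conv: "A_moll rh A ta = conv (rescale rh (ta powr (- 1 / 3))) A"
proof
 fix x
 have "continuous_on UNIV (%z. rescale rh (ta powr (- 1 / 3)) (x - z))"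
  by (rule continuous_on_compose2[OF C_diff_cont[OF C_diff_rescale[OF smooth_C_diff[OF rho(1), of 0]]], of UNIV "%z. x - z"])
   (auto intro!: continuous_intros)
 hence "continuous_on UNIV (%z. rescale rh (ta powr (- 1 / 3)) (x - z) *\<^sub>R A z)"
  by (intro continuous_on_scaleR C_diff_cont[OF A(1)])
 hence "(%z. rescale rh (ta powr (- 1 / 3)) (x - z) *\<^sub>R A z) \<in> borel_measurable lborel"
  by (simp add: cont_measurable)
 from integral_completion[OF this] show "A_moll rh A ta x = conv (rescale rh (ta powr (- 1 / 3))) A x"
  by (simp add: A_moll_def mollify_def conv_def rescale_def)
qed

lemma integrable_A: "integrable lebesgue A"
 by (rule cvanish_integrable_leb[OF C_diff_cont[OF A(1)] A(2)])

lemma pA: "continuous_on UNIV (partial k A)" "norm x > R ==> partial k A x = 0"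
 using C_diff_cont_partial[OF A(1)] partial_zero_outside[of R A x k, OF A(2)] by auto

lemma rescale_rho: "C_diff m (rescale rh de)" "de > 0 ==> norm y > de ==> rescale rh de y = 0"
 using C_diff_rescale[OF smooth_C_diff[OF rho(1)]] rescale_vanish[of de 1 rh y, OF _ rho(2)] by auto

lemma C_diff_A_moll: "ta > 0 ==> C_diff m (A_moll rh A ta)"
 unfolding A_moll_conv
 by (rule C_diff_conv[of A _ _ "ta powr (- 1 / 3)"])
  (rule integrable_A rescale_rho | simp)+

lemma A_moll_vanish: "ta \<ge> 1 ==> norm x > R + 1 ==> A_moll rh A ta x = 0"
proof -
 assume t: "ta \<ge> 1" "norm x > R + 1"
 have "ta powr (- 1 / 3) \<le> 1" using t(1) powr_mono[of "- 1 / 3" 0 ta] by simp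
 thus ?thesis unfolding A_moll_conv
  by (intro conv_vanish[of "ta powr (- 1 / 3)" _ R]) (use t rescale_rho(2) A(2) in auto)
qed

lemma partial_A_moll:
 assumes "ta > 0"
 shows "partial k (A_moll rh A ta) = conv (rescale rh (ta powr (- 1 / 3))) (partial k A)"
proof
 fix x
 have v: "norm y > ta powr (- 1 / 3) ==> rescale rh (ta powr (- 1 / 3)) y = 0" for y using assms by (intro rescale_rho) auto
 have "partial k (conv (rescale rh (ta powr (- 1 / 3))) A) x = conv (partial k (rescale rh (ta powr (- 1 / 3)))) A x"
  by (rule partial_conv(2)[OF rescale_rho(1) v integrable_A])
 also have "... = conv (rescale rh (ta powr (- 1 / 3))) (partial k A) x"
  by (rule conv_partial_right[OF rescale_rho(1) v A])
 finally show "partial k (A_moll rh A ta) x = conv (rescale rh (ta powr (- 1 / 3))) (partial k A) x"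
  unfolding A_moll_conv .
qed

lemma C_bound_A_moll: "C_bound UNIV m 0 (A_moll rh A)"
 unfolding A_moll_conv[abs_def] by (rule C_bound_conv[OF C_diff_cont[OF A(1)] A(2) rho(1,2)])

text \<open>The exponent is 0 and not 1/3: by \<open>partial_A_moll\<close> one derivative falls on
  the C^1 field itself and is free. This gain keeps the first derivatives of all phases
  bounded.\<close>

lemma C_bound_partial_A_moll: "C_bound UNIV m 0 (%ta. partial k (A_moll rh A ta))"
proof (rule C_bound_cong)
 show "C_bound UNIV m 0 (%ta. conv (rescale rh (ta powr (- 1 / 3))) (partial k A))" by (rule C_bound_conv[OF pA rho(1,2)])
 show "EV ta. conv (rescale rh (ta powr (- 1 / 3))) (partial k A) = partial k (A_moll rh A ta)"
  using eventually_gt_at_top[of 0] by eventually_elim (simp add: partial_A_moll)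
qed

lemma A_moll_uniform: "e > 0 ==> EV ta. \<forall>x. norm (A_moll rh A ta x - A x) \<le> e"
 unfolding A_moll_conv
 by (rule conv_rescale_uniform[OF C_diff_cont[OF A(1)] A(2) C_diff_cont[OF smooth_C_diff[OF rho(1), of 0]] rho(2,3)])

lemma partial_A_moll_uniform:
 assumes "e > 0"
 shows "EV ta. \<forall>x. norm (partial k (A_moll rh A ta) x - partial k A x) \<le> e"
proof -
 have "EV ta. \<forall>x. norm (conv (rescale rh (ta powr (- 1 / 3))) (partial k A) x - partial k A x) \<le> e"
  by (rule conv_rescale_uniform[OF pA C_diff_cont[OF smooth_C_diff[OF rho(1), of 0]] rho(2,3) assms])
 thus ?thesis using eventually_gt_at_top[of 0] by eventually_elim (simp add: partial_A_moll)
qed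

lemma A_lipschitz: "\<exists>L\<ge>0. \<forall>x z. norm (A z - A x) \<le> L * norm (z - x)"
proof -
 have "\<forall>k. \<exists>C. \<forall>x. norm (partial k A x) \<le> C"
  using cvanish_bounded[OF pA] by blast
 from choice[OF this] obtain C where C: "!!k x. norm (partial k A x) \<le> C k" by blast
 have C0: "0 \<le> C k" for k using order_trans[OF norm_ge_zero C[of k 0]] .
 have "norm (A z - A x) \<le> (\<Sum>k\<in>UNIV. C k) * norm (z - x)" for x z
 proof (rule differentiable_bound[of UNIV A "%x h. \<Sum>k\<in>UNIV. h $ k *\<^sub>R partial k A x"])
  show "(A has_derivative (%h. \<Sum>k\<in>UNIV. h $ k *\<^sub>R partial k A x)) (at x within UNIV)" for x
   by (rule has_derivative_sum_partial[OF C_diff_D[OF A(1)]]) simp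
  show "onorm (%h. \<Sum>k\<in>UNIV. h $ k *\<^sub>R partial k A x) \<le> (\<Sum>k\<in>UNIV. C k)" for x
  proof (rule onorm_bound)
   fix h :: "real^'n"
   have "norm (\<Sum>k\<in>UNIV. h $ k *\<^sub>R partial k A x) \<le> (\<Sum>k\<in>UNIV. norm h * C k)"
   proof (rule sum_norm_le)
    fix k :: 'n
    have "\<bar>h $ k\<bar> * norm (partial k A x) \<le> norm h * C k" by (rule mult_mono[OF component_le_norm_cart C]) auto
    thus "norm (h $ k *\<^sub>R partial k A x) \<le> norm h * C k" by simp
   qed
   thus "norm (\<Sum>k\<in>UNIV. h $ k *\<^sub>R partial k A x) \<le> (\<Sum>k\<in>UNIV. C k) * norm h"
    by (simp add: sum_distrib_left mult.commute[of _ "norm h"])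
  qed (use C0 in \<open>auto intro: sum_nonneg\<close>)
 qed auto
 thus ?thesis using C0 by (intro exI[of _ "\<Sum>k\<in>UNIV. C k"]) (auto intro: sum_nonneg)
qed

text \<open>The derivatives of the field are bounded, so it is Lipschitz, and mollification at scale
  \<delta> = \<tau> powr (-1/3) moves it by O(\<delta>).\<close>

lemma A_moll_error: "unif_O UNIV (-1/3) (%ta x. A x - A_moll rh A ta x)"
proof -
 obtain L where L: "L \<ge> 0" "!!x z. norm (A z - A x) \<le> L * norm (z - x)" using A_lipschitz by blast
 show ?thesis
 proof (rule unif_OI[of _ _ "L * (LINT y|lborel. \<bar>rh y\<bar>)"], rule eventually_mono[OF eventually_gt_at_top[of 0]], intro ballI)
  fix ta :: real and x assume t: "ta > 0"
  have "norm (conv (rescale rh (ta powr (- 1 / 3))) A x - A x) \<le> (L * ta powr (- 1 / 3)) * (LINT y|lborel. \<bar>rh y\<bar>)"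
  proof (rule conv_rescale_error[of _ rh 1])
   show "continuous_on UNIV rh" by (rule C_diff_cont[OF smooth_C_diff[OF rho(1), of 0]])
   show "integrable lebesgue A" by (rule integrable_A)
   fix z assume "norm (x - z) \<le> ta powr (- 1 / 3) * 1"
   hence "L * norm (z - x) \<le> L * ta powr (- 1 / 3)" using L(1) by (intro mult_left_mono) (simp_all add: norm_minus_commute)
   thus "norm (A z - A x) \<le> L * ta powr (- 1 / 3)" using L(2)[of z x] by linarith
  qed (use t rho in auto)
  thus "norm (A x - A_moll rh A ta x) \<le> L * (LINT y|lborel. \<bar>rh y\<bar>) * ta powr (- 1 / 3)"
   by (simp add: A_moll_conv norm_minus_commute mult_ac)
 qed
qed

text \<open>The direction is taken out of the integral: the mollified field does not depend on
  \<open>th\<close>, so bounds and limits for moving directions reduce to those of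
  \<open>ray\<close>.\<close>

definition pot :: "real set => real^'n => real => real^'n => real" where
 "pot S th ta x = th \<bullet> ray S th (A_moll rh A ta) x"

lemma A_moll_facts:
 assumes "ta \<ge> 1"
 shows "continuous_on UNIV (A_moll rh A ta)" "!!x. norm x > R + 1 ==> A_moll rh A ta x = 0"
  "!!x k. norm x > R + 1 ==> partial k (A_moll rh A ta) x = 0"
proof -
 show "continuous_on UNIV (A_moll rh A ta)" using C_diff_A_moll[of ta 0] assms by simp
 show v: "!!x. norm x > R + 1 ==> A_moll rh A ta x = 0" by (rule A_moll_vanish[OF assms])
 show "!!x k. norm x > R + 1 ==> partial k (A_moll rh A ta) x = 0"
  by (rule partial_zero_outside[of "R + 1" "A_moll rh A ta"]) (rule v)
qed

lemma pot_integrals: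
 assumes "ta \<ge> 1" "norm th = 1"
 shows "half_line_integral th (A_moll rh A ta) = pot {..0} th ta" "line_integral th (A_moll rh A ta) = pot UNIV th ta"
 unfolding half_line_integral_ray line_integral_ray pot_def[abs_def]
 using ray_inner[of th "A_moll rh A ta" "R + 1", OF assms(2) A_moll_facts(1,2)[OF assms(1)]] by (auto simp: fun_eq_iff)

lemma C_diff_pot:
 assumes "ta \<ge> 1" "norm th = 1" "S \<in> sets borel"
 shows "C_diff m (pot S th ta)"
 unfolding pot_def[abs_def]
 using assms(1) by (intro C_diff_inner C_diff_const C_diff_ray[OF assms(2,3), of _ _ "R + 1"] C_diff_A_moll A_moll_facts(2)[OF assms(1)]) auto

lemma partial_pot:
 assumes "ta \<ge> 1" "norm th = 1" "S \<in> sets borel"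
 shows "partial k (pot S th ta) x = th \<bullet> ray S th (partial k (A_moll rh A ta)) x"
proof -
 have C: "C_diff 1 (A_moll rh A ta)" using assms(1) by (intro C_diff_A_moll) simp
 note p = partial_ray[of th "A_moll rh A ta" "R + 1" S, OF assms(2) C A_moll_facts(2)[OF assms(1)] assms(3)]
 show ?thesis
  unfolding pot_def[abs_def] using partial_linear[OF bounded_linear_inner_right p(1), of k th x] p(2) by simp
qed

text \<open>Both parts come from \<open>ray_derivative\<close>: the half-line potential solves the
  transport equation with the mollified field on the right, and a derivative of the full-line
  potential is again a full-line integral, hence constant along \<open>th\<close>.\<close>

lemma pot_directional:
 assumes "ta \<ge> 1" "norm th = 1"
 shows "th \<bullet> grad (pot {..0} th ta) x = th \<bullet> A_moll rh A ta x"
  and "(\<Sum>j\<in>UNIV. th $ j *\<^sub>R partial j (partial k (pot UNIV th ta)) x) = 0"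
proof -
 have C: "C_diff m (A_moll rh A ta)" for m using assms(1) by (intro C_diff_A_moll) simp
 have C1: "C_diff 1 (A_moll rh A ta)" by (rule C)
 have C2: "C_diff 1 (partial k (A_moll rh A ta))" using C[of 2] by (simp add: numeral_2_eq_2)
 have "th \<bullet> grad (pot {..0} th ta) x = (\<Sum>j\<in>UNIV. th $ j * (th \<bullet> partial j (ray {..0} th (A_moll rh A ta)) x))"
  using partial_ray(2)[of th "A_moll rh A ta" "R + 1" "{..0}", OF assms(2) C1 A_moll_facts(2)[OF assms(1)]]
  by (simp add: inner_grad partial_pot[OF assms])
 also have "... = th \<bullet> (\<Sum>j\<in>UNIV. th $ j *\<^sub>R partial j (ray {..0} th (A_moll rh A ta)) x)" by (simp add: inner_sum_right)
 also have "... = th \<bullet> A_moll rh A ta x"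
  using ray_derivative(1)[of th "A_moll rh A ta" "R + 1", OF assms(2) C1 A_moll_facts(2)[OF assms(1)]] by simp
 finally show "th \<bullet> grad (pot {..0} th ta) x = th \<bullet> A_moll rh A ta x" .
 note p = partial_ray[of th "partial k (A_moll rh A ta)" "R + 1" UNIV, OF assms(2) C2 A_moll_facts(3)[OF assms(1)]]
 have "partial k (pot UNIV th ta) = (%x. th \<bullet> ray UNIV th (partial k (A_moll rh A ta)) x)"
  by (simp add: fun_eq_iff partial_pot[OF assms])
 hence "(\<Sum>j\<in>UNIV. th $ j *\<^sub>R partial j (partial k (pot UNIV th ta)) x)
  = th \<bullet> (\<Sum>j\<in>UNIV. th $ j *\<^sub>R partial j (ray UNIV th (partial k (A_moll rh A ta))) x)"
  using partial_linear[OF bounded_linear_inner_right p(1), of _ th x] by (simp add: inner_sum_right)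
 also have "... = 0"
  using ray_derivative(2)[of th "partial k (A_moll rh A ta)" "R + 1", OF assms(2) C2 A_moll_facts(3)[OF assms(1)]] by simp
 finally show "(\<Sum>j\<in>UNIV. th $ j *\<^sub>R partial j (partial k (pot UNIV th ta)) x) = 0" .
qed

lemma pot_directional_UNIV:
 assumes "ta \<ge> 1" "norm th = 1"
 shows "th \<bullet> grad (pot UNIV th ta) x = 0"
proof -
 have C1: "C_diff 1 (A_moll rh A ta)" using assms(1) by (intro C_diff_A_moll) simp
 have "th \<bullet> grad (pot UNIV th ta) x = (\<Sum>j\<in>UNIV. th $ j * (th \<bullet> partial j (ray UNIV th (A_moll rh A ta)) x))"
  using partial_ray(2)[of th "A_moll rh A ta" "R + 1" UNIV, OF assms(2) C1 A_moll_facts(2)[OF assms(1)]]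
  by (simp add: inner_grad partial_pot[OF assms])
 also have "... = th \<bullet> (\<Sum>j\<in>UNIV. th $ j *\<^sub>R partial j (ray UNIV th (A_moll rh A ta)) x)" by (simp add: inner_sum_right)
 also have "... = 0"
  using ray_derivative(2)[of th "A_moll rh A ta" "R + 1", OF assms(2) C1 A_moll_facts(2)[OF assms(1)]] by simp
 finally show ?thesis .
qed

text \<open>The directions in use are \<open>eta1\<close> and \<open>eta2\<close>: unit vectors for
  \<tau> > |\<xi>|, which is the threshold \<open>T\<close>, and convergent to \<eta>.\<close>

context
 fixes th :: "real => real^'n" and th0 :: "real^'n" and T :: real and S :: "real set"
 assumes th: "!!t. t > T ==> norm (th t) = 1" "norm th0 = 1" "(th ---> th0) at_top" and S: "S \<in> sets borel"
begin

lemma ev_norm: "EV ta. norm (th ta) = 1"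
 using eventually_gt_at_top[of T] by eventually_elim (rule th(1))

lemma ev_norm1: "EV ta. norm (th ta) \<le> 1 * ta powr 0"
 using ev_norm eventually_gt_at_top[of 0] by eventually_elim simp

lemma C_bound_pot: "C_bound UNIV m 0 (%ta. pot S (th ta) ta)"
proof -
 have v: "EV ta. \<forall>x. norm x > R + 1 --> A_moll rh A ta x = 0"
  using eventually_ge_at_top[of 1] by eventually_elim (use A_moll_vanish in blast)
 have "C_bound UNIV m (0 + 0) (%ta x. th ta \<bullet> ray S (th ta) (A_moll rh A ta) x)"
  using ev_norm1 R
  by (intro C_bound_bilinear[OF bounded_bilinear_inner] C_bound_const[of _ 1] C_bound_ray[OF ev_norm S, of "R + 1"] C_bound_A_moll v) auto
 thus ?thesis by (simp add: pot_def[abs_def])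
qed

lemma C_bound_partial_pot: "C_bound UNIV m 0 (%ta. partial k (pot S (th ta) ta))"
proof (rule C_bound_cong)
 have v: "EV ta. \<forall>x. norm x > R + 1 --> partial k (A_moll rh A ta) x = 0"
  using eventually_ge_at_top[of 1] by eventually_elim (use A_moll_facts(3) in blast)
 have "C_bound UNIV m (0 + 0) (%ta x. th ta \<bullet> ray S (th ta) (partial k (A_moll rh A ta)) x)"
  using ev_norm1 R
  by (intro C_bound_bilinear[OF bounded_bilinear_inner] C_bound_const[of _ 1] C_bound_ray[OF ev_norm S, of "R + 1"] C_bound_partial_A_moll v) auto
 thus "C_bound UNIV m 0 (%ta x. th ta \<bullet> ray S (th ta) (partial k (A_moll rh A ta)) x)" by simp
 show "EV ta. (%x. th ta \<bullet> ray S (th ta) (partial k (A_moll rh A ta)) x) = partial k (pot S (th ta) ta)"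
  using eventually_ge_at_top[of 1] ev_norm by eventually_elim (simp add: fun_eq_iff partial_pot[OF _ _ S])
qed

lemma pot_tendsto: "((%ta. pot S (th ta) ta x) ---> ray S th0 (%z. th0 \<bullet> A z) x) at_top"
proof -
 have "((%ta. ray S (th ta) (A_moll rh A ta) x) ---> ray S th0 A x) at_top"
 proof (rule ray_tendsto_uniform[where T=T, OF th _ A_moll_uniform C_diff_cont[OF A(1)] _ S, of "R + 1"])
  show "EV t. continuous_on UNIV (A_moll rh A t) \<and> (\<forall>x. norm x > R + 1 --> A_moll rh A t x = 0)"
   using eventually_ge_at_top[of 1] by eventually_elim (use A_moll_facts in blast)
 qed (use A(2) R in auto)
 from tendsto_inner[OF th(3) this] show ?thesis
  unfolding pot_def using ray_inner[of th0 A R S, OF th(2) C_diff_cont[OF A(1)] A(2) S] by simp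
qed

text \<open>Derivatives of the mollified field converge uniformly, being mollifications of the
  continuous derivatives of the field; ray integration preserves this.\<close>

lemma partial_pot_tendsto:
 "((%ta. partial k (pot S (th ta) ta) x) ---> partial k (ray S th0 (%z. th0 \<bullet> A z)) x) at_top"
proof -
 have "((%ta. ray S (th ta) (partial k (A_moll rh A ta)) x) ---> ray S th0 (partial k A) x) at_top"
 proof (rule ray_tendsto_uniform[where T=T, OF th _ partial_A_moll_uniform pA(1) _ S, where R="R + 1"])
  show "EV t. continuous_on UNIV (partial k (A_moll rh A t)) \<and> (\<forall>x. norm x > R + 1 --> partial k (A_moll rh A t) x = 0)"
   using eventually_ge_at_top[of 1]
  proof eventually_elim
   case (elim t)
   thus ?case using A_moll_facts(3)[of t _ k] C_diff_cont_partial[OF C_diff_A_moll[of t 1], of k] by auto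
  qed
 qed (use pA(2) R in auto)
 moreover have "partial k (ray S th0 (%z. th0 \<bullet> A z)) x = th0 \<bullet> ray S th0 (partial k A) x"
 proof -
  have "ray S th0 (%z. th0 \<bullet> A z) = (%x. th0 \<bullet> ray S th0 A x)"
   using ray_inner[of th0 A R S, OF th(2) C_diff_cont[OF A(1)] A(2) S] by (simp add: fun_eq_iff)
  thus ?thesis
   using partial_ray[of th0 A R S, OF th(2) A S] partial_linear[OF bounded_linear_inner_right, of "ray S th0 A" x k th0] by simp
 qed
 ultimately have "((%ta. th ta \<bullet> ray S (th ta) (partial k (A_moll rh A ta)) x) ---> partial k (ray S th0 (%z. th0 \<bullet> A z)) x) at_top"
  using tendsto_inner[OF th(3)] by simp
 moreover have "EV ta. th ta \<bullet> ray S (th ta) (partial k (A_moll rh A ta)) x = partial k (pot S (th ta) ta) x"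
  using eventually_ge_at_top[of 1] ev_norm by eventually_elim (simp add: partial_pot[OF _ _ S])
 ultimately show ?thesis by (rule Lim_transform_eventually)
qed

end

end

section \<open>Complex geometric optics solutions\<close>

lemma C_bound_sum: "(!!i. i \<in> I ==> C_bound S m s (F i)) ==> C_bound S m s (%ta x. \<Sum>i\<in>I. F i ta x)"
proof (induction I rule: infinite_finite_induct)
 case (insert i I)
 thus ?case using C_bound_add[of S m s "F i" "%ta x. \<Sum>i\<in>I. F i ta x"] by simp
qed (use C_bound_const[of "%_. 0" 0 s S m] in auto)

lemma C_bound_2_unif_O:
 fixes F :: "real => real^'n::finite => complex"
 assumes "C_bound S 2 0 F" "EV ta. C_diff 2 (F ta)"
 shows "unif_O S (1/3) (%ta. cgrad (F ta))" "unif_O S (2/3) (%ta. cdiv (cgrad (F ta)))"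
proof -
 have p: "C_bound S 1 (1/3) (%ta. partial k (F ta))" for k using assms(1) by (simp add: numeral_2_eq_2)
 show "unif_O S (1/3) (%ta. cgrad (F ta))"
  by (rule unif_O_vec) (use C_bound_unif_O[OF p] in simp)
 have "unif_O S (2/3) (%ta x. \<Sum>k\<in>UNIV. partial k (partial k (F ta)) x)"
 proof (rule unif_O_sum)
  fix k show "unif_O S (2/3) (%ta. partial k (partial k (F ta)))" using p[of k] by simp
 qed
 thus "unif_O S (2/3) (%ta. cdiv (cgrad (F ta)))"
 proof (rule unif_O_cong[rotated])
  show "EV ta. \<forall>x\<in>S. (\<Sum>k\<in>UNIV. partial k (partial k (F ta)) x) = cdiv (cgrad (F ta)) x"
   using assms(2)
  proof eventually_elim
   case (elim ta)
   have "C_diff 1 (cgrad (F ta))" by (rule C_diff_cgrad) (use elim in \<open>simp add: numeral_2_eq_2\<close>)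
   thus ?case by (simp add: cdiv_eq)
  qed
 qed
qed

text \<open>The first derivatives of the phase are bounded together with the usual loss per
  derivative, so the divergence costs a single factor \<tau> powr (1/3). The C^1 field
  \<open>B\<close> contributes bounded terms.\<close>

lemma phase_bounds:
 fixes B :: "real^'n::finite => real^'n"
 assumes p: "!!k. C_bound UNIV 1 0 (%ta. partial k (ps ta))" and C2: "EV ta. C_diff 2 (ps ta)"
  and B: "C_diff 1 B" "!!x. norm x > R ==> B x = 0"
 shows "unif_O UNIV 0 (%ta x. cvec (grad (ps ta) x + B x))"
  and "unif_O UNIV (1/3) (%ta. cdiv (%x. cvec (grad (ps ta) x + B x)))"
proof -
 obtain M where M: "!!x. norm (B x) \<le> M" using cvanish_bounded[OF C_diff_cont[OF B(1)] B(2)] by blast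
 have "unif_O UNIV 0 (%ta. grad (ps ta))"
  by (rule unif_O_vec) (use C_bound_unif_O[OF p] in \<open>simp add: grad_def\<close>)
 thus "unif_O UNIV 0 (%ta x. cvec (grad (ps ta) x + B x))"
  by (intro unif_O_linear[OF bl_cvec] unif_O_add unif_O_const[of _ B M] M)
 have pB: "unif_O UNIV (1/3) (%ta x. partial k B x $ k)" for k
 proof -
  obtain M where "!!x. norm (partial k B x) \<le> M"
   using cvanish_bounded[OF C_diff_cont_partial[OF B(1)] partial_zero_outside[of R B, OF B(2)]] by blast
  thus ?thesis by (intro unif_O_linear[OF bounded_linear_vec_nth] unif_O_mono[OF unif_O_const[of _ _ M]]) auto
 qed
 have "unif_O UNIV (1/3) (%ta x. \<Sum>k\<in>UNIV. complex_of_real (partial k (partial k (ps ta)) x + partial k B x $ k))"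
 proof (intro unif_O_sum unif_O_linear[OF bounded_linear_of_real] unif_O_add pB)
  fix k show "unif_O UNIV (1/3) (%ta. partial k (partial k (ps ta)))" using p[of k] by simp
 qed
 thus "unif_O UNIV (1/3) (%ta. cdiv (%x. cvec (grad (ps ta) x + B x)))"
 proof (rule unif_O_cong[rotated])
  show "EV ta. \<forall>x\<in>UNIV. (\<Sum>k\<in>UNIV. complex_of_real (partial k (partial k (ps ta)) x + partial k B x $ k))
   = cdiv (%x. cvec (grad (ps ta) x + B x)) x"
   using C2
  proof eventually_elim
   case (elim ta)
   have g: "C_diff 1 (partial k (ps ta))" for k using elim by (simp add: numeral_2_eq_2)
   have gr: "C_diff 1 (%x. grad (ps ta) x + B x)"
    by (intro C_diff_add B(1), rule C_diff_vec) (use g in \<open>simp add: grad_def\<close>)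
   have n: "C_diff 1 (%x. partial k (ps ta) x + B x $ k)" for k by (intro C_diff_add g C_diff_nth B(1))
   have "partial k (%x. complex_of_real (partial k (ps ta) x + B x $ k)) x
    = complex_of_real (partial k (partial k (ps ta)) x + partial k B x $ k)" for k x
   proof -
    have nB: "C_diff 1 (%x. B x $ k)" by (rule C_diff_nth[OF B(1)])
    have "partial k (%x. B x $ k) x = partial k B x $ k" by (rule partial_nth[OF C_diff_D[OF B(1)]]) simp
    thus ?thesis
     using partial_of_real[OF C_diff_D[OF n[of k]], of k x]
      partial_add[OF C_diff_D[OF g[of k]] C_diff_D[OF nB], of k x] by simp
   qed
   thus ?case
    using cdiv_eq[OF C_diff_cvec[OF gr]] by (simp add: cvec_def grad_def)
  qed
 qed
qed

text \<open>\<open>B_par\<close> normalises: its square and |\<xi>|^2 / (4 \<tau>^2) sum to 1. The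
  two directions differ by \<xi> / \<tau>, so that \<surd>\<lambda> times the difference stays
  finite and yields the frequency -\<xi> of the limit.\<close>

lemma eta_facts:
 fixes xi et :: "real^'n::finite"
 assumes e: "norm et = 1" "et \<bullet> xi = 0" and t: "ta > norm xi"
 shows "norm (eta1 xi et ta) = 1" "norm (eta2 xi et ta) = 1" "omega xi et ta \<bullet> eta2 xi et ta = 0"
  "eta1 xi et ta - eta2 xi et ta = - (1 / ta) *\<^sub>R xi"
proof -
 have t0: "ta > 0" using t norm_ge_zero le_less_trans by blast
 have "(norm xi)^2 \<le> ta^2" using t by (intro power_mono) auto
 hence "(norm xi)^2 \<le> 4 * ta^2" using zero_le_power2[of ta] by linarith
 hence "(norm xi)^2 / (4 * ta^2) \<le> 1" using t0 by (simp add: divide_le_eq)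
 hence B: "(B_par xi ta)^2 = 1 - (norm xi)^2 / (4 * ta^2)" by (simp add: B_par_def)
 have i: "et \<bullet> et = 1" "xi \<bullet> xi = (norm xi)^2" "xi \<bullet> et = 0" using e by (simp_all add: dot_square_norm inner_commute)
 have "eta1 xi et ta \<bullet> eta1 xi et ta = 1" "eta2 xi et ta \<bullet> eta2 xi et ta = 1"
  using B t0 by (simp_all add: eta1_def eta2_def inner_diff_left inner_diff_right inner_add_left inner_add_right i e field_simps power2_eq_square)
 thus "norm (eta1 xi et ta) = 1" "norm (eta2 xi et ta) = 1" by (simp_all add: norm_eq_sqrt_inner)
 show "omega xi et ta \<bullet> eta2 xi et ta = 0"
  by (simp add: omega_def eta2_def inner_diff_left inner_add_right i e)
 show "eta1 xi et ta - eta2 xi et ta = - (1 / ta) *\<^sub>R xi"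
  by (simp add: eta1_def eta2_def vec_eq_iff)
qed

lemma eta_tendsto:
 "((%ta. eta1 xi et ta) ---> et) at_top" "((%ta. eta2 xi et ta) ---> et) at_top" "((%ta. omega xi et ta) ---> xi) at_top"
proof -
 have i: "((%ta. c / (2 * ta)) ---> 0) at_top" for c :: real
  by (intro tendsto_divide_0[OF tendsto_const] filterlim_at_top_imp_at_infinity filterlim_tendsto_pos_mult_at_top[OF tendsto_const _ filterlim_ident]) simp
 have "((%ta. sqrt (1 - (norm xi / (2 * ta))^2)) ---> sqrt (1 - 0^2)) at_top" by (intro tendsto_intros i)
 hence B: "((%ta. B_par xi ta) ---> 1) at_top" by (simp add: B_par_def power_divide power_mult_distrib)
 have "((%ta. eta1 xi et ta) ---> 1 *\<^sub>R et - 0 *\<^sub>R xi) at_top" unfolding eta1_def by (intro tendsto_intros B i)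
 thus "((%ta. eta1 xi et ta) ---> et) at_top" by simp
 have "((%ta. eta2 xi et ta) ---> 1 *\<^sub>R et + 0 *\<^sub>R xi) at_top" unfolding eta2_def by (intro tendsto_intros B i)
 thus "((%ta. eta2 xi et ta) ---> et) at_top" by simp
 have "((%ta. omega xi et ta) ---> 1 *\<^sub>R xi - 0 *\<^sub>R et) at_top" unfolding omega_def by (intro tendsto_intros B i)
 thus "((%ta. omega xi et ta) ---> xi) at_top" by simp
qed

section \<open>The ansatz functions and their images under the two operators\<close>

locale cgo = boundary_setting Om sg nu rh
 for Om :: "(real^'n::finite) set" and sg nu rh +
 fixes A1 A2 :: "real^'n => real^'n" and V1 V2 :: "real^'n => real" and R CV :: real and xi et y :: "real^'n"
 assumes A1: "C_diff 1 A1" "!!x. norm x > R ==> A1 x = 0"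
  and A2: "C_diff 1 A2" "!!x. norm x > R ==> A2 x = 0" and R: "R > 0"
  and A_frontier: "!!x. x \<in> frontier Om ==> A1 x = A2 x"
  and V: "V1 \<in> borel_measurable lebesgue" "V2 \<in> borel_measurable lebesgue" "!!x. \<bar>V1 x\<bar> \<le> CV" "!!x. \<bar>V2 x\<bar> \<le> CV"
  and eta: "norm et = 1" "et \<bullet> xi = 0"
begin

lemma rho_vanish: "norm x > 1 ==> rh x = 0" by (rule supp_subset_cballD[OF rho(2)])

sublocale F1: mollified_field rh A1 R by unfold_locales (rule rho rho_vanish A1 R | assumption)+
sublocale F2: mollified_field rh A2 R by unfold_locales (rule rho rho_vanish A2 R | assumption)+
sublocale FD: mollified_field rh "%x. A2 x - A1 x" R by unfold_locales (rule rho rho_vanish R C_diff_diff A1(1) A2(1) | simp add: A1(2) A2(2) | assumption)+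

text \<open>One threshold for two purposes: \<tau> > |\<xi>| makes the directions unit vectors, and
  \<tau> \<ge> 1 keeps the mollification scale at most 1.\<close>

definition T0 :: real where "T0 = norm xi + 1"

lemma T0: "ta \<ge> T0 ==> ta \<ge> 1" "ta \<ge> T0 ==> ta > norm xi"
 using norm_ge_zero[of xi] unfolding T0_def by linarith+

abbreviation "e1 \<equiv> eta1 xi et"
abbreviation "e2 \<equiv> eta2 xi et"

lemma e_norm: "ta \<ge> T0 ==> norm (e1 ta) = 1" "ta \<ge> T0 ==> norm (e2 ta) = 1"
 using eta_facts[OF eta T0(2)] by auto

text \<open>The phases of the ansatz are \<open>- pot1\<close> and \<open>- pot2\<close>;
  \<open>L\<close> is the full-line integral in the amplitude, taken of the mollified difference of
  the potentials.\<close>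

definition pot1 :: "real => real^'n => real" where "pot1 ta = F1.pot {..0} (e1 ta) ta"
definition pot2 :: "real => real^'n => real" where "pot2 ta = F2.pot {..0} (e2 ta) ta"
definition L :: "real => real^'n => real" where "L ta = FD.pot UNIV (e2 ta) ta"

text \<open>The amplitude in the closed form of \<open>amplitude_eq\<close>, in which the
  exponentials with \<open>omega\<close> have cancelled.\<close>

definition b2 :: "real => real^'n => complex" where
 "b2 ta x = - \<i> * of_real (y \<bullet> (omega xi et ta + grad (L ta) x)) * exp (- \<i> * of_real (L ta x))"

definition E1 :: "real => real^'n => complex" where
 "E1 ta x = exp (\<i> * (sqrt_lam ta * of_real (e1 ta \<bullet> x) + of_real (- pot1 ta x)))"
definition E2 :: "real => real^'n => complex" where
 "E2 ta x = exp (\<i> * (- sqrt_lam ta * of_real (e2 ta \<bullet> x) + of_real (pot2 ta x)))"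

lemma C_diff_pots:
 assumes "ta \<ge> T0"
 shows "C_diff m (pot1 ta)" "C_diff m (pot2 ta)" "C_diff m (L ta)"
 unfolding pot1_def pot2_def L_def
 using F1.C_diff_pot[OF T0(1)[OF assms] e_norm(1)[OF assms]] F2.C_diff_pot[OF T0(1)[OF assms] e_norm(2)[OF assms]]
  FD.C_diff_pot[OF T0(1)[OF assms] e_norm(2)[OF assms]] by simp_all

lemma b2_eq: "b2 ta = (%x. - \<i> * of_real (y \<bullet> omega xi et ta + (\<Sum>k\<in>UNIV. y $ k * partial k (L ta) x)) * exp (- \<i> * of_real (L ta x)))"
 by (simp add: fun_eq_iff b2_def inner_add_right inner_grad)

lemma C_diff_b2: "ta \<ge> T0 ==> C_diff m (b2 ta)"
 unfolding b2_eq using C_diff_pots(3)[of ta "Suc m"] C_diff_pots(3)[of ta m]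
 by (intro C_diff_mult C_diff_exp C_diff_linear[OF bl_mult_right] C_diff_of_real C_diff_add C_diff_const C_diff_sum) simp_all

lemma A_moll_diff: "ta > 0 ==> A_moll rh A2 ta x - A_moll rh A1 ta x = A_moll rh (%x. A2 x - A1 x) ta x"
 unfolding F1.A_moll_conv F2.A_moll_conv FD.A_moll_conv
 using conv_diff[of "rescale rh (ta powr (- 1 / 3))" "ta powr (- 1 / 3)" A2 A1 x] F1.rescale_rho[of 0] F1.rescale_rho(2)[of "ta powr (- 1 / 3)"]
  F1.integrable_A F2.integrable_A by simp

lemma Phi_eq:
 assumes t: "ta \<ge> T0"
 shows "Phi1 rh A1 xi et ta = E1 ta" "Phi2 rh A1 A2 xi et y ta = (%x. b2 ta x * E2 ta x)"
proof -
 have p: "half_line_integral (e1 ta) (A_moll rh A1 ta) = pot1 ta" "half_line_integral (e2 ta) (A_moll rh A2 ta) = pot2 ta"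
  "line_integral (e2 ta) (A_moll rh (%x. A2 x - A1 x) ta) = L ta"
  using F1.pot_integrals[OF T0(1)[OF t] e_norm(1)[OF t]] F2.pot_integrals[OF T0(1)[OF t] e_norm(2)[OF t]]
   FD.pot_integrals[OF T0(1)[OF t] e_norm(2)[OF t]] by (simp_all add: pot1_def pot2_def L_def)
 show "Phi1 rh A1 xi et ta = E1 ta"
  by (simp add: fun_eq_iff Phi1_def E1_def p exp_add[symmetric] algebra_simps)
 have d: "(%x. A_moll rh A2 ta x - A_moll rh A1 ta x) = A_moll rh (%x. A2 x - A1 x) ta"
  using A_moll_diff T0(1)[OF t] by (simp add: fun_eq_iff)
 have b: "b2_amp rh A1 A2 xi et y ta = b2 ta"
  using amplitude_eq[of "e2 ta" "A_moll rh (%x. A2 x - A1 x) ta"] C_diff_pots(3)[OF t, of 1]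
  by (simp add: fun_eq_iff b2_amp_def d p b2_def)
 show "Phi2 rh A1 A2 xi et y ta = (%x. b2 ta x * E2 ta x)"
  by (simp add: fun_eq_iff Phi2_def E2_def p b exp_add[symmetric] algebra_simps)
qed

text \<open>\<open>L\<close> and its partial derivatives are integrals over whole lines in direction
  \<open>e2\<close>, hence constant along \<open>e2\<close>, and \<open>b2\<close> is composed of
  them and of constants. The term in which \<surd>\<lambda> multiplies the gradient of the amplitude
  therefore vanishes identically.\<close>

lemma b2_transport:
 assumes t: "ta \<ge> T0"
 shows "cdot (cgrad (b2 ta) x) (cvec (e2 ta)) = 0"
proof -
 define h where "h x = y \<bullet> omega xi et ta + (\<Sum>k\<in>UNIV. y $ k * partial k (L ta) x)" for x
 have pL: "C_diff 1 (partial k (L ta))" for k using C_diff_pots(3)[OF t, of 2] by (simp add: numeral_2_eq_2)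
 have L1: "C_diff 1 (L ta)" by (rule C_diff_pots(3)[OF t])
 have h: "C_diff 1 h" unfolding h_def[abs_def]
  by (intro C_diff_add C_diff_const C_diff_sum C_diff_linear[OF bl_mult_right] pL)
 have ph2: "partial j h x = (\<Sum>k\<in>UNIV. y $ k * partial j (partial k (L ta)) x)" for j
 proof -
  have "((%x. y \<bullet> omega xi et ta + (\<Sum>k\<in>UNIV. y $ k * partial k (L ta) x)) has_derivative
   (%v. 0 + (\<Sum>k\<in>UNIV. y $ k * frechet_derivative (partial k (L ta)) (at x) v))) (at x)"
   using C_diff_D[OF pL]
   by (intro has_derivative_add has_derivative_const has_derivative_sum has_derivative_mult_right) (simp add: frechet_derivative_works)
  from partial_eqI[OF this, of j] show ?thesis by (simp add: h_def[abs_def] partial_def)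
 qed
 have a: "C_diff 1 (%x. - \<i> * complex_of_real (L ta x))" by (intro C_diff_linear[OF bl_mult_right] C_diff_of_real L1)
 have pa: "partial j (%x. - \<i> * complex_of_real (g x)) x = - \<i> * complex_of_real (partial j g x)" if "C_diff 1 g" for g :: "real^'n => real" and j
  using partial_linear[OF bl_mult_right C_diff_D[OF C_diff_of_real[OF that]], of j "- \<i>" x]
   partial_of_real[OF C_diff_D[OF that], of j x] by simp
 have pb: "partial j (b2 ta) x = - \<i> * exp (- \<i> * of_real (L ta x)) * (of_real (partial j h x) - \<i> * of_real (h x) * of_real (partial j (L ta) x))" for j
 proof -
  have "b2 ta = (%x. (- \<i> * of_real (h x)) * exp (- \<i> * of_real (L ta x)))" by (simp add: b2_eq h_def)
  hence "partial j (b2 ta) x = (- \<i> * of_real (h x)) * (exp (- \<i> * of_real (L ta x)) * (- \<i> * of_real (partial j (L ta) x)))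
   + (- \<i> * of_real (partial j h x)) * exp (- \<i> * of_real (L ta x))"
   using partial_mult[OF C_diff_D[OF C_diff_linear[OF bl_mult_right C_diff_of_real[OF h]]] C_diff_D[OF C_diff_exp[OF a]], of j "- \<i>" x]
    partial_exp[OF C_diff_D[OF a], of j x] pa[OF h] pa[OF L1] by simp
  thus ?thesis by (simp add: algebra_simps)
 qed
 have d1: "(\<Sum>j\<in>UNIV. e2 ta $ j * partial j (L ta) x) = 0"
  using FD.pot_directional_UNIV[OF T0(1)[OF t] e_norm(2)[OF t], of x] by (simp add: L_def inner_grad)
 have "(\<Sum>j\<in>UNIV. e2 ta $ j * partial j h x) = (\<Sum>k\<in>UNIV. y $ k * (\<Sum>j\<in>UNIV. e2 ta $ j * partial j (partial k (L ta)) x))"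
  unfolding ph2 sum_distrib_left by (subst sum.swap) (simp add: mult.left_commute)
 also have "... = 0" using FD.pot_directional(2)[OF T0(1)[OF t] e_norm(2)[OF t], of _ x] by (simp add: L_def)
 finally have d2: "(\<Sum>j\<in>UNIV. e2 ta $ j * partial j h x) = 0" .
 have "cdot (cgrad (b2 ta) x) (cvec (e2 ta)) = (\<Sum>j\<in>UNIV. - \<i> * exp (- \<i> * of_real (L ta x)) * (of_real (e2 ta $ j * partial j h x)
   - \<i> * of_real (h x) * of_real (e2 ta $ j * partial j (L ta) x)))"
  by (simp add: cdot_def cvec_def pb algebra_simps)
 also have "... = - \<i> * exp (- \<i> * of_real (L ta x)) * (of_real (\<Sum>j\<in>UNIV. e2 ta $ j * partial j h x)
   - \<i> * of_real (h x) * of_real (\<Sum>j\<in>UNIV. e2 ta $ j * partial j (L ta) x))"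
  by (simp only: sum_distrib_left[symmetric] sum_subtractf of_real_sum)
 finally show ?thesis using d1 d2 by simp
qed

text \<open>What is left of the images when the exponentials are divided out. \<open>q1\<close>
  belongs to \<open>Phi1\<close>; for \<open>Phi2\<close>, \<open>q2\<close> is the one term with
  the factor \<surd>\<lambda> and \<open>r2\<close> collects the others.\<close>

definition q1 :: "(real^'n => real^'n) => (real^'n => real) => real => real^'n => complex" where
 "q1 B W ta x = - \<i> * cdiv (%x. cvec (grad (%x. - pot1 ta x) x + B x)) x + 2 * sqrt_lam ta * of_real (e1 ta \<bullet> (B x - A_moll rh A1 ta x))
  + cdot (cvec (grad (%x. - pot1 ta x) x + B x)) (cvec (grad (%x. - pot1 ta x) x + B x)) + of_real (W x)"

definition r2 :: "(real^'n => real^'n) => (real^'n => real) => real => real^'n => complex" where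
 "r2 B W ta x = - cdiv (cgrad (b2 ta)) x - 2 * \<i> * cdot (cgrad (b2 ta) x) (cvec (grad (pot2 ta) x + - B x))
  - \<i> * b2 ta x * cdiv (%x. cvec (grad (pot2 ta) x + - B x)) x
  + b2 ta x * cdot (cvec (grad (pot2 ta) x + - B x)) (cvec (grad (pot2 ta) x + - B x)) + of_real (W x) * b2 ta x"

definition q2 :: "(real^'n => real^'n) => real => real^'n => complex" where
 "q2 B ta x = 2 * sqrt_lam ta * b2 ta x * of_real (e2 ta \<bullet> (B x - A_moll rh A2 ta x))"

text \<open>The phase solves the transport equation for the mollified first potential, so the term
  with \<surd>\<lambda> contains only the difference between \<open>B\<close> and that
  mollification: small if \<open>B\<close> is the first potential, bounded if it is the
  second.\<close>

lemma conjugated_Phi1: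
 assumes t: "ta \<ge> T0" and B: "C_diff 1 B"
 shows "mag_laplace B (E1 ta) x + (of_real (W x) - (sqrt_lam ta)^2) * E1 ta x = E1 ta x * q1 B W ta x"
proof -
 have c: "C_diff 2 (%x. - pot1 ta x)" by (intro C_diff_minus C_diff_pots t)
 have g: "cgrad (%x. 1 :: complex) = (%x. 0 :: complex^'n)" by (simp add: fun_eq_iff vec_eq_iff)
 have z: "cdiv (%x. 0 :: complex^'n) x = 0" by (simp add: cdiv_def)
 have "grad (%x. - pot1 ta x) x = - grad (pot1 ta) x"
  using partial_linear[OF bounded_linear_minus[OF bounded_linear_ident] C_diff_D[OF C_diff_pots(1)[OF t, of 1]], of _ x]
  by (simp add: grad_def vec_eq_iff)
 hence d: "e1 ta \<bullet> (grad (%x. - pot1 ta x) x + B x) = e1 ta \<bullet> (B x - A_moll rh A1 ta x)"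
  using F1.pot_directional(1)[OF T0(1)[OF t] e_norm(1)[OF t], of x] by (simp add: pot1_def inner_diff_right)
 show ?thesis
  using conjugated_operator[OF C_diff_const[of 2 "1::complex"] c B e_norm(1)[OF t], of "sqrt_lam ta" x "of_real (W x)"]
  unfolding d g z E1_def[abs_def] q1_def by (simp add: g z)
qed

text \<open>\<open>conjugated_operator\<close> with - \<surd>\<lambda> in place of \<surd>\<lambda>,
  which has the same square, and with the potential - B of the transposed operator.\<close>

lemma conjugated_Phi2:
 assumes t: "ta \<ge> T0" and B: "C_diff 1 B"
 shows "mag_laplace (%x. - B x) (%x. b2 ta x * E2 ta x) x + (of_real (W x) - (sqrt_lam ta)^2) * (b2 ta x * E2 ta x)
  = E2 ta x * (r2 B W ta x + q2 B ta x)"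
proof -
 have d: "e2 ta \<bullet> (grad (pot2 ta) x + - B x) = - (e2 ta \<bullet> (B x - A_moll rh A2 ta x))"
  using F2.pot_directional(1)[OF T0(1)[OF t] e_norm(2)[OF t], of x] by (simp add: pot2_def inner_diff_right inner_add_right)
 show ?thesis
  using conjugated_operator[OF C_diff_b2[OF t, of 2] C_diff_pots(2)[OF t, of 2] C_diff_minus[OF B] e_norm(2)[OF t], of "- sqrt_lam ta" x "of_real (W x)"]
  unfolding d b2_transport[OF t] E2_def[abs_def] r2_def q2_def by (simp add: algebra_simps)
qed

end

section \<open>From uniform bounds to norms and integrals over the domain\<close>

context boundary_setting
begin

lemma unif_O_L2norm:
 fixes F :: "real => real^'n => 'b::euclidean_space"
 assumes "unif_O Om s F" "EV ta. in_L2 M (F ta)"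
 shows "unif_O UNIV s (%ta (_::unit). L2norm M (F ta))"
proof -
 obtain C where C: "C \<ge> 0" "EV ta. \<forall>x\<in>Om. norm (F ta x) \<le> C * ta powr s" using assms(1) by (rule unif_OE)
 have 1: "in_L2 M (%x. 1 :: real)" by (rule continuous_in_L2) simp
 from C(2) assms(2) have "EV ta. \<forall>u\<in>(UNIV :: unit set). norm (L2norm M (F ta)) \<le> (C * L2norm M (%x. 1 :: real)) * ta powr s"
 proof eventually_elim
  case (elim ta)
  have "L2norm M (F ta) \<le> L2norm M (%x. (C * ta powr s) *\<^sub>R (1::real))"
   by (rule L2norm_mono[OF in_L2_scaleR[OF 1] elim(2)])
    (rule AE_I2, use elim(1) C(1) in simp)
  also have "... = C * ta powr s * L2norm M (%x. 1 :: real)"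
   unfolding L2norm_scaleR using C(1) by simp
  finally show ?case by (simp add: mult_ac)
 qed
 thus ?thesis by (rule unif_OI)
qed

lemma unif_O_integral:
 fixes F :: "real => real^'n => complex"
 assumes F: "unif_O Om s F" "EV ta. in_L2 M (F ta)"
 shows "unif_O UNIV s (%ta (_::unit). LINT x|M. F ta x)"
proof -
 obtain C where "EV ta. \<forall>u\<in>(UNIV :: unit set). norm (L2norm M (F ta)) \<le> C * ta powr s"
  using unif_O_L2norm[OF F] by (rule unif_OE)
 have 1: "in_L2 M (%x. 1 :: complex)" by (rule continuous_in_L2) simp
 have "EV ta. \<forall>u\<in>(UNIV :: unit set). norm (LINT x|M. F ta x) \<le> (L2norm M (%x. 1 :: complex) * C) * ta powr s"
  using \<open>EV ta. \<forall>u\<in>UNIV. norm (L2norm M (F ta)) \<le> C * ta powr s\<close> F(2)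
 proof eventually_elim
  case (elim ta)
  have "norm (LINT x|M. 1 * F ta x) \<le> 1 * (L2norm M (%x. 1 :: complex) * L2norm M (F ta))"
   by (rule L2norm_bilinear[OF bb_mult 1 elim(2)]) (simp_all add: norm_mult)
  also have "... \<le> L2norm M (%x. 1 :: complex) * (C * ta powr s)"
   using elim(1) by (simp add: mult_left_mono)
  finally show ?case by (simp add: mult_ac)
 qed
 thus ?thesis by (rule unif_OI)
qed

lemma in_L2_operator:
 assumes B: "C_diff 1 B" and g: "C_diff 2 g" and W: "W \<in> borel_measurable lebesgue" "!!x. \<bar>W x\<bar> \<le> C"
 shows "in_L2 M (%x. mag_laplace B g x + (of_real (W x) - lam) * g x)"
proof -
 have [measurable]: "W \<in> borel_measurable lebesgue" by (rule W(1))
 have "(%x. complex_of_real (W x) - lam) \<in> borel_measurable lebesgue" by measurable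
 hence m: "(%x. complex_of_real (W x) - lam) \<in> borel_measurable M" by (rule measurable_restrict_space1)
 have "norm (complex_of_real (W x) - lam) \<le> C + norm lam" for x
  using norm_triangle_ineq4[of "of_real (W x)" lam] W(2)[of x] by simp
 hence "AE x in M. norm (complex_of_real (W x) - lam) \<le> C + norm lam" by simp
 from in_L2_mult_bounded[OF bb_mult continuous_in_L2[OF C_diff_cont[OF g]] m this]
 show ?thesis
  using in_L2_add[OF continuous_in_L2[OF continuous_on_mag_laplace[OF g B]]] by (simp add: mult.commute)
qed

end

lemma unif_O_sqrt_lam: "unif_O S 1 (%ta x. sqrt_lam ta)"
proof (rule unif_OI[of _ _ 2], rule eventually_mono[OF eventually_ge_at_top[of 1]], intro ballI)
 fix ta :: real assume "ta \<ge> 1"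
 thus "norm (sqrt_lam ta) \<le> 2 * ta powr 1"
  using norm_triangle_ineq[of "complex_of_real ta" \<i>] by (simp add: sqrt_lam_def)
qed

lemma unif_O_inverse_sqrt_lam: "unif_O S (-1) (%ta x. 1 / sqrt_lam ta)"
proof (rule unif_OI[of _ _ 1], rule eventually_mono[OF eventually_gt_at_top[of 0]], intro ballI)
 fix ta :: real assume t: "ta > 0"
 have "ta \<le> norm (sqrt_lam ta)" using complex_Re_le_cmod[of "sqrt_lam ta"] by (simp add: sqrt_lam_def)
 thus "norm (1 / sqrt_lam ta) \<le> 1 * ta powr (- 1)"
  using t by (simp add: norm_divide powr_minus_divide frac_le)
qed

lemma Im_sqrt_lam_power2: "Im ((sqrt_lam ta)^2) = 2 * ta"
 by (simp add: sqrt_lam_def power2_eq_square)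

section \<open>Orders of growth in \<tau>\<close>

context cgo
begin

lemma bounded_field:
 assumes "C_diff 1 B" "!!x. norm x > R ==> B x = 0"
 shows "unif_O UNIV 0 (%ta x. B x :: real^'n)"
 using cvanish_bounded[OF C_diff_cont[OF assms(1)] assms(2)] by (blast intro: unif_O_const)

lemma ev_T0: "EV ta. ta \<ge> T0" by (rule eventually_ge_at_top)

lemma C_bound_pots:
 "C_bound UNIV m 0 (%ta. partial k (pot1 ta))" "C_bound UNIV m 0 (%ta. partial k (pot2 ta))"
 "C_bound UNIV m 0 (%ta. partial k (L ta))" "C_bound UNIV m 0 L"
 unfolding pot1_def pot2_def L_def
 by (rule F1.C_bound_partial_pot[OF eta_facts(1)[OF eta] eta(1) eta_tendsto(1)], assumption, simp)
  (rule F2.C_bound_partial_pot[OF eta_facts(2)[OF eta] eta(1) eta_tendsto(2)], assumption, simp,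
   rule FD.C_bound_partial_pot[OF eta_facts(2)[OF eta] eta(1) eta_tendsto(2)], assumption, simp,
   rule FD.C_bound_pot[OF eta_facts(2)[OF eta] eta(1) eta_tendsto(2)], assumption, simp)

text \<open>The exponent is 0 although \<open>b2\<close> contains first derivatives of
  \<open>L\<close>: by \<open>C_bound_pots\<close> these have the same bounds as
  \<open>L\<close>.\<close>

lemma C_bound_b2: "C_bound UNIV m 0 b2"
proof -
 have om: "EV ta. norm (y \<bullet> omega xi et ta) \<le> (\<bar>y \<bullet> xi\<bar> + 1) * ta powr 0"
 proof -
  have "((%ta. norm (y \<bullet> omega xi et ta)) ---> norm (y \<bullet> xi)) at_top"
   by (intro tendsto_norm tendsto_inner tendsto_const eta_tendsto)
  hence "EV ta. norm (y \<bullet> omega xi et ta) < norm (y \<bullet> xi) + 1" by (rule order_tendstoD) simp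
  thus ?thesis using eventually_gt_at_top[of 0] by eventually_elim simp
 qed
 have "C_bound UNIV m (0 + 0) (%ta x. - \<i> * complex_of_real (y \<bullet> omega xi et ta + (\<Sum>k\<in>UNIV. y $ k * partial k (L ta) x)) * exp (- \<i> * of_real (L ta x)))"
  by (intro C_bound_mult C_bound_exp C_bound_pots C_bound_linear[OF bl_mult_right] C_bound_linear[OF bounded_linear_of_real]
    C_bound_add C_bound_sum C_bound_const[OF om])
 thus ?thesis by (simp add: b2_eq[abs_def])
qed

lemma b2_bounds:
 "unif_O UNIV 0 b2" "unif_O UNIV (1/3) (%ta. cgrad (b2 ta))" "unif_O UNIV (2/3) (%ta. cdiv (cgrad (b2 ta)))"
proof -
 have "EV ta. C_diff 2 (b2 ta)" using ev_T0 by eventually_elim (rule C_diff_b2)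
 thus "unif_O UNIV 0 b2" "unif_O UNIV (1/3) (%ta. cgrad (b2 ta))" "unif_O UNIV (2/3) (%ta. cdiv (cgrad (b2 ta)))"
  using C_bound_2_unif_O[OF C_bound_b2] C_bound_unif_O[OF C_bound_b2] by auto
qed

text \<open>The transport defect times \<surd>\<lambda> decides the order. The exponent
  \<open>t\<close> will be -1/3 for the potential whose mollification enters the phase and 0 for the
  other one.\<close>

lemma q1_bound:
 assumes B: "C_diff 1 B" "!!x. norm x > R ==> B x = 0" and W: "!!x. \<bar>W x\<bar> \<le> CV"
  and d: "unif_O UNIV t (%ta x. B x - A_moll rh A1 ta x)" and t: "t \<ge> - 1/3"
 shows "unif_O UNIV (1 + t) (q1 B W)"
proof -
 have p: "C_bound UNIV 1 0 (%ta. partial k (%x. - pot1 ta x))" for k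
 proof (rule C_bound_cong)
  show "C_bound UNIV 1 0 (%ta x. - partial k (pot1 ta) x)"
   by (rule C_bound_linear[OF bounded_linear_minus[OF bounded_linear_ident] C_bound_pots(1)])
  show "EV ta. (%x. - partial k (pot1 ta) x) = partial k (%x. - pot1 ta x)"
   using ev_T0
  proof eventually_elim
   case (elim ta)
   show ?case
    using partial_linear[OF bounded_linear_minus[OF bounded_linear_ident] C_diff_D[OF C_diff_pots(1)[OF elim, of 1]]]
    by (simp add: fun_eq_iff)
  qed
 qed
 have c: "EV ta. C_diff 2 (%x. - pot1 ta x)"
  using ev_T0 by eventually_elim (intro C_diff_minus C_diff_pots)
 note Z = phase_bounds[of "%ta x. - pot1 ta x" B R, OF p c B]
 have e: "unif_O UNIV 0 (%ta x. e1 ta)"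
  by (rule unif_OI[of _ _ 1], rule eventually_mono[OF ev_T0]) (use e_norm(1) T0(1) in force)
 have "unif_O UNIV (1 + t) (%ta x. 2 * sqrt_lam ta * of_real (e1 ta \<bullet> (B x - A_moll rh A1 ta x)))"
  using unif_O_mult[OF unif_O_linear[OF bl_mult_right unif_O_sqrt_lam]
    unif_O_linear[OF bounded_linear_of_real unif_O_bilinear[OF bounded_bilinear_inner e d]]] by simp
 moreover have "unif_O UNIV (1 + t) (%ta x. - \<i> * cdiv (%x. cvec (grad (%x. - pot1 ta x) x + B x)) x)"
  using t by (intro unif_O_linear[OF bl_mult_right] unif_O_mono[OF Z(2)]) linarith+
 moreover have "unif_O UNIV (1 + t) (%ta x. cdot (cvec (grad (%x. - pot1 ta x) x + B x)) (cvec (grad (%x. - pot1 ta x) x + B x)))"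
  using t by (intro unif_O_mono[OF unif_O_bilinear[OF bb_cdot Z(1) Z(1)]]) linarith+
 moreover have "unif_O UNIV (1 + t) (%ta x. complex_of_real (W x))"
  using t W by (intro unif_O_mono[OF unif_O_const[of _ _ CV]]) auto
 ultimately show ?thesis unfolding q1_def[abs_def] by (intro unif_O_add)
qed

text \<open>The exponent 2/3 is that of the Laplacian of \<open>b2\<close>, two derivatives at 1/3
  each; the other terms have order at most 1/3.\<close>

lemma r2_bound:
 assumes B: "C_diff 1 B" "!!x. norm x > R ==> B x = 0" and W: "!!x. \<bar>W x\<bar> \<le> CV"
 shows "unif_O UNIV (2/3) (r2 B W)"
proof -
 have c: "EV ta. C_diff 2 (pot2 ta)"
  using ev_T0 by eventually_elim (intro C_diff_pots)
 have B': "- B x = 0" if "norm x > R" for x using B(2)[OF that] by simp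
 note Z = phase_bounds[of pot2 "%x. - B x" R, OF C_bound_pots(2) c C_diff_minus[OF B(1)] B']
 have "unif_O UNIV (2/3) (%ta x. 2 * \<i> * cdot (cgrad (b2 ta) x) (cvec (grad (pot2 ta) x + - B x)))"
  by (intro unif_O_linear[OF bl_mult_right] unif_O_mono[OF unif_O_bilinear[OF bb_cdot b2_bounds(2) Z(1)]]) linarith+
 moreover have "unif_O UNIV (2/3) (%ta x. \<i> * b2 ta x * cdiv (%x. cvec (grad (pot2 ta) x + - B x)) x)"
  by (intro unif_O_mono[OF unif_O_mult[OF unif_O_linear[OF bl_mult_right b2_bounds(1)] Z(2)]]) linarith+
 moreover have "unif_O UNIV (2/3) (%ta x. b2 ta x * cdot (cvec (grad (pot2 ta) x + - B x)) (cvec (grad (pot2 ta) x + - B x)))"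
  by (intro unif_O_mono[OF unif_O_mult[OF b2_bounds(1) unif_O_bilinear[OF bb_cdot Z(1) Z(1)]]]) linarith+
 moreover have "unif_O UNIV (2/3) (%ta x. complex_of_real (W x) * b2 ta x)"
  using W by (intro unif_O_mono[OF unif_O_mult[OF unif_O_const[of _ "%x. complex_of_real (W x)" CV] b2_bounds(1)]]) auto
 ultimately show ?thesis unfolding r2_def[abs_def] by (intro unif_O_add unif_O_diff unif_O_minus b2_bounds(3))
qed

lemma q2_bound:
 assumes d: "unif_O UNIV t (%ta x. B x - A_moll rh A2 ta x)"
 shows "unif_O UNIV (1 + t) (q2 B)"
proof -
 have e: "unif_O UNIV 0 (%ta x. e2 ta)"
  by (rule unif_OI[of _ _ 1], rule eventually_mono[OF ev_T0]) (use e_norm(2) T0(1) in force)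
 show ?thesis
  unfolding q2_def[abs_def]
  using unif_O_mult[OF unif_O_mult[OF unif_O_linear[OF bl_mult_right unif_O_sqrt_lam] b2_bounds(1)]
    unif_O_linear[OF bounded_linear_of_real unif_O_bilinear[OF bounded_bilinear_inner e d]]] by simp
qed

text \<open>The imaginary part of \<surd>\<lambda> is 1 and the phases are real, so the moduli are
  the exponentials of \<open>- (e1 ta \<bullet> x)\<close> and \<open>e2 ta \<bullet> x\<close>,
  bounded on a bounded set independently of \<tau>.\<close>

lemma E_bounds: "unif_O Om 0 E1" "unif_O Om 0 E2"
proof -
 obtain r where r: "!!x. x \<in> Om ==> norm x \<le> r" using dom(2) by (auto simp: bounded_iff)
 have i: "\<bar>e \<bullet> x\<bar> \<le> r" if "norm e = 1" "x \<in> Om" for e x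
  using Cauchy_Schwarz_ineq2[of e x] r[OF that(2)] that(1) by simp
 have E: "norm (E1 ta x) \<le> exp r * ta powr 0 \<and> norm (E2 ta x) \<le> exp r * ta powr 0" if "ta \<ge> T0" "x \<in> Om" for ta x
  using i[OF e_norm(1)[OF that(1)] that(2)] i[OF e_norm(2)[OF that(1)] that(2)] T0(1)[OF that(1)]
  by (simp add: E1_def E2_def sqrt_lam_def abs_le_iff)
 show "unif_O Om 0 E1" "unif_O Om 0 E2"
  by (rule unif_OI[of _ _ "exp r"], rule eventually_mono[OF ev_T0], use E in blast)+
qed

lemma smooth_E1: "ta \<ge> T0 ==> smooth (E1 ta)" and C_diff_E2: "ta \<ge> T0 ==> C_diff m (E2 ta)"
 unfolding smooth_def E1_def[abs_def] E2_def[abs_def]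
 by (intro allI C_diff_exp C_diff_linear[OF bl_mult_right] C_diff_add C_diff_of_real C_diff_minus C_diff_pots
   C_diff_bounded_linear[OF bounded_linear_inner_right] | assumption)+

definition DN_diff :: "real => complex" where
 "DN_diff ta = DN_map Om sg nu A1 V1 ((sqrt_lam ta)^2) (E1 ta) (%x. b2 ta x * E2 ta x)
  - DN_map Om sg nu A2 V2 ((sqrt_lam ta)^2) (E1 ta) (%x. b2 ta x * E2 ta x)"

text \<open>In the difference of \<open>q2\<close> for the two potentials the mollified field
  cancels; divided by \<surd>\<lambda> and multiplied by the exponentials it is this integrand,
  which has a limit.\<close>

definition I_main :: "real => real^'n => complex" where
 "I_main ta x = E1 ta x * E2 ta x * (2 * b2 ta x * of_real (e2 ta \<bullet> (A1 x - A2 x)))"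

definition I_rem :: "real => real^'n => complex" where
 "I_rem ta x = E1 ta x * E2 ta x * (r2 A1 V1 ta x - r2 A2 V2 ta x)"

lemma C_diff_g: "ta \<ge> T0 ==> C_diff m (%x. b2 ta x * E2 ta x)"
 by (intro C_diff_mult C_diff_b2 C_diff_E2)

lemma continuous_I_main:
 assumes t: "ta \<ge> T0"
 shows "continuous_on UNIV (I_main ta)"
proof -
 have "continuous_on UNIV (E1 ta)" "continuous_on UNIV (E2 ta)" "continuous_on UNIV (b2 ta)"
  using smooth_C_diff[OF smooth_E1[OF t], of 0] C_diff_E2[OF t, of 0] C_diff_b2[OF t, of 0] by auto
 thus ?thesis unfolding I_main_def[abs_def] using C_diff_cont[OF A1(1)] C_diff_cont[OF A2(1)]
  by (intro continuous_intros)
qed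

lemma I_split:
 assumes t: "ta \<ge> T0"
 shows "E1 ta x * ((mag_laplace (%x. - A1 x) (%x. b2 ta x * E2 ta x) x + (of_real (V1 x) - (sqrt_lam ta)^2) * (b2 ta x * E2 ta x))
   - (mag_laplace (%x. - A2 x) (%x. b2 ta x * E2 ta x) x + (of_real (V2 x) - (sqrt_lam ta)^2) * (b2 ta x * E2 ta x)))
  = sqrt_lam ta * I_main ta x + I_rem ta x"
 unfolding conjugated_Phi2[OF t A1(1)] conjugated_Phi2[OF t A2(1)] I_main_def I_rem_def q2_def
 by (simp add: inner_diff_right algebra_simps)

lemma in_L2_P:
 assumes "ta \<ge> T0"
 shows "in_L2 M (%x. mag_laplace (%x. - A1 x) (%x. b2 ta x * E2 ta x) x + (of_real (V1 x) - lam) * (b2 ta x * E2 ta x))"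
  "in_L2 M (%x. mag_laplace (%x. - A2 x) (%x. b2 ta x * E2 ta x) x + (of_real (V2 x) - lam) * (b2 ta x * E2 ta x))"
 by (rule in_L2_operator[OF C_diff_minus[OF A1(1)] C_diff_g[OF assms] V(1,3)] in_L2_operator[OF C_diff_minus[OF A2(1)] C_diff_g[OF assms] V(2,4)])+

lemma in_L2_I:
 assumes t: "ta \<ge> T0"
 shows "in_L2 M (I_main ta)" "in_L2 M (I_rem ta)"
proof -
 show m: "in_L2 M (I_main ta)" by (rule continuous_in_L2[OF continuous_I_main[OF t]])
 have "in_L2 M (%x. sqrt_lam ta * I_main ta x + I_rem ta x)"
  unfolding I_split[OF t, symmetric]
  using in_L2_mult_continuous[OF bb_mult in_L2_diff[OF in_L2_P[OF t]] C_diff_cont[OF smooth_C_diff[OF smooth_E1[OF t], of 0]]]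
  by (simp add: mult.commute)
 from in_L2_diff[OF this in_L2_linear[OF bl_mult_right[of "sqrt_lam ta"] m]]
 show "in_L2 M (I_rem ta)" by simp
qed

text \<open>In both products of \<open>DN_map_difference\<close> one factor has exponent 2/3 and the
  other exponent 1, because each potential fits exactly one of the two phases. Division by Im
  \<lambda> = 2 \<tau> turns 5/3 into 2/3.\<close>

lemma DN_diff_error: "unif_O UNIV (2/3) (%ta (_::unit). DN_diff ta - (sqrt_lam ta * (LINT x|M. I_main ta x) + (LINT x|M. I_rem ta x)))"
proof -
 let ?g = "%ta x. b2 ta x * E2 ta x"
 let ?Q = "%B W ta x. mag_laplace B (E1 ta) x + (of_real (W x) - (sqrt_lam ta)^2) * E1 ta x"
 let ?P = "%B W ta x. mag_laplace (%x. - B x) (?g ta) x + (of_real (W x) - (sqrt_lam ta)^2) * ?g ta x"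
 \<comment> \<open>A potential compared with its own mollification gives -1/3; the mixed comparisons
   are only bounded.\<close>
 have d: "unif_O UNIV (-1/3) (%ta x. A1 x - A_moll rh A1 ta x)" "unif_O UNIV (-1/3) (%ta x. A2 x - A_moll rh A2 ta x)"
  "unif_O UNIV 0 (%ta x. A2 x - A_moll rh A1 ta x)" "unif_O UNIV 0 (%ta x. A1 x - A_moll rh A2 ta x)"
  using F1.A_moll_error F2.A_moll_error bounded_field[OF A1] bounded_field[OF A2]
   C_bound_unif_O[OF F1.C_bound_A_moll] C_bound_unif_O[OF F2.C_bound_A_moll] by (auto intro: unif_O_diff)
 have Q: "unif_O Om (1 + t) (?Q B W)"
  if "C_diff 1 B" "!!x. norm x > R ==> B x = 0" "!!x. \<bar>W x\<bar> \<le> CV" "unif_O UNIV t (%ta x. B x - A_moll rh A1 ta x)" "t \<ge> - 1/3" for B W t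
 proof (rule unif_O_cong)
  show "unif_O Om (1 + t) (%ta x. E1 ta x * q1 B W ta x)"
   using unif_O_mult[OF E_bounds(1) unif_O_subset[OF q1_bound[of B W t, OF that] subset_UNIV]] by simp
  show "EV ta. \<forall>x\<in>Om. E1 ta x * q1 B W ta x = ?Q B W ta x"
   using ev_T0 by eventually_elim (simp add: conjugated_Phi1[OF _ that(1)])
 qed
 have P: "unif_O Om (1 + t) (?P B W)"
  if "C_diff 1 B" "!!x. norm x > R ==> B x = 0" "!!x. \<bar>W x\<bar> \<le> CV" "unif_O UNIV t (%ta x. B x - A_moll rh A2 ta x)" "t \<ge> - 1/3" for B W t
 proof (rule unif_O_cong)
  have "unif_O UNIV (1 + t) (%ta x. r2 B W ta x + q2 B ta x)"
   using that(5) by (intro unif_O_add q2_bound[OF that(4)] unif_O_mono[OF r2_bound[of B W, OF that(1-3)]]) linarith+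
  thus "unif_O Om (1 + t) (%ta x. E2 ta x * (r2 B W ta x + q2 B ta x))"
   using unif_O_mult[OF E_bounds(2) unif_O_subset[OF _ subset_UNIV]] by fastforce
  show "EV ta. \<forall>x\<in>Om. E2 ta x * (r2 B W ta x + q2 B ta x) = ?P B W ta x"
   using ev_T0 by eventually_elim (simp add: conjugated_Phi2[OF _ that(1)])
 qed
 have L: "EV ta. in_L2 M (?Q A1 V1 ta)" "EV ta. in_L2 M (?Q A2 V2 ta)"
  "EV ta. in_L2 M (?P A1 V1 ta)" "EV ta. in_L2 M (?P A2 V2 ta)"
  by (rule eventually_mono[OF ev_T0], intro in_L2_P in_L2_operator[OF A1(1) smooth_C_diff[OF smooth_E1] V(1,3)]
    in_L2_operator[OF A2(1) smooth_C_diff[OF smooth_E1] V(2,4)], assumption)+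
 have 1: "unif_O UNIV (2/3 + 1) (%ta (_::unit). L2norm M (?Q A1 V1 ta) * L2norm M (?P A1 V1 ta))"
  using unif_O_mult[OF unif_O_L2norm[OF Q[OF A1 V(3) d(1)] L(1)] unif_O_L2norm[OF P[OF A1 V(3) d(4)] L(3)]] by simp
 have 2: "unif_O UNIV (2/3 + 1) (%ta (_::unit). L2norm M (?Q A2 V2 ta) * L2norm M (?P A2 V2 ta))"
  using unif_O_mult[OF unif_O_L2norm[OF Q[OF A2 V(4) d(3)] L(2)] unif_O_L2norm[OF P[OF A2 V(4) d(2)] L(4)]] by (simp add: add.commute)
 obtain C where C: "EV ta. \<forall>u\<in>(UNIV::unit set). norm (L2norm M (?Q A1 V1 ta) * L2norm M (?P A1 V1 ta)
   + L2norm M (?Q A2 V2 ta) * L2norm M (?P A2 V2 ta)) \<le> C * ta powr (2/3 + 1)"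
  using unif_O_add[OF 1 2] by (rule unif_OE)
 obtain c1 where c1: "!!x. norm (A1 x) \<le> c1" using cvanish_bounded[OF C_diff_cont[OF A1(1)] A1(2)] by blast
 obtain c2 where c2: "!!x. norm (A2 x) \<le> c2" using cvanish_bounded[OF C_diff_cont[OF A2(1)] A2(2)] by blast
 have c: "norm (A1 x) \<le> max c1 c2" "norm (A2 x) \<le> max c1 c2" for x using c1[of x] c2[of x] by auto
 have "EV ta. \<forall>u\<in>(UNIV::unit set). norm (DN_diff ta - (sqrt_lam ta * (LINT x|M. I_main ta x) + (LINT x|M. I_rem ta x))) \<le> (C / 2) * ta powr (2/3)"
  using C ev_T0
 proof eventually_elim
  case (elim ta)
  have t: "ta > 0" using T0(1)[OF elim(2)] by simp
  have "(LINT x|M. E1 ta x * (?P A1 V1 ta x - ?P A2 V2 ta x)) = sqrt_lam ta * (LINT x|M. I_main ta x) + (LINT x|M. I_rem ta x)"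
   unfolding I_split[OF elim(2)]
   using L2_imp_integrable[OF in_L2_I(1)[OF elim(2)] finite_dom] L2_imp_integrable[OF in_L2_I(2)[OF elim(2)] finite_dom] by simp
  moreover have "Im ((sqrt_lam ta)^2) \<noteq> 0" using t by (simp add: Im_sqrt_lam_power2)
  ultimately have "norm (DN_diff ta - (sqrt_lam ta * (LINT x|M. I_main ta x) + (LINT x|M. I_rem ta x)))
   \<le> (L2norm M (?Q A1 V1 ta) * L2norm M (?P A1 V1 ta) + L2norm M (?Q A2 V2 ta) * L2norm M (?P A2 V2 ta)) / \<bar>Im ((sqrt_lam ta)^2)\<bar>"
   unfolding DN_diff_def using DN_map_difference[OF A1(1) A2(1) c A_frontier V _ smooth_E1[OF elim(2)] C_diff_g[OF elim(2)], of "(sqrt_lam ta)^2"] by simp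
  also have "... \<le> (C * ta powr (2/3 + 1)) / (2 * ta)"
   unfolding Im_sqrt_lam_power2 using elim(1) t by (simp add: divide_right_mono)
  also have "... = (C / 2) * ta powr (2/3)" using t by (simp only: powr_add powr_one) simp
  finally show ?case by simp
 qed
 thus ?thesis by (rule unif_OI)
qed

section \<open>Pointwise limits and passage to the limit under the integral\<close>

lemma b2_tendsto:
 "((%ta. b2 ta x) ---> amplitude et (%x. A2 x - A1 x) xi y x) at_top"
proof -
 let ?L = "ray UNIV et (%z. et \<bullet> (A2 z - A1 z))"
 have "C_diff 1 (%z. et \<bullet> (A2 z - A1 z))" by (intro C_diff_inner C_diff_const C_diff_diff A1 A2)
 hence C: "C_diff 1 ?L" by (rule C_diff_ray[OF eta(1), where R=R, rotated]) (simp_all add: A1 A2)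
 have "((%ta. L ta x) ---> ?L x) at_top"
  unfolding L_def by (rule FD.pot_tendsto[OF eta_facts(2)[OF eta] eta(1) eta_tendsto(2)]) simp_all
 moreover have "((%ta. partial k (L ta) x) ---> partial k ?L x) at_top" for k
  unfolding L_def by (rule FD.partial_pot_tendsto[OF eta_facts(2)[OF eta] eta(1) eta_tendsto(2)]) simp_all
 ultimately have "((%ta. b2 ta x) ---> - \<i> * of_real (y \<bullet> xi + (\<Sum>k\<in>UNIV. y $ k * partial k ?L x)) * exp (- \<i> * of_real (?L x))) at_top"
  unfolding b2_eq by (intro tendsto_intros eta_tendsto)
 moreover have "line_integral et (%x. A2 x - A1 x) = ?L" by (rule line_integral_ray)
 ultimately show ?thesis
  using amplitude_eq[of et "%x. A2 x - A1 x" xi y x] C by (simp add: inner_add_right inner_grad)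
qed

text \<open>By the difference of the directions the oscillating factors combine to the exponential
  of - \<i> (1 + \<i> / \<tau>) \<xi> \<bullet> x. The half-line integrals of the two potentials
  converge separately, and their limits subtract to the half-line integral of the
  difference.\<close>

lemma phase_tendsto:
 "((%ta. E1 ta x * E2 ta x) ---> exp (- \<i> * of_real (xi \<bullet> x)) * exp (\<i> * of_real (half_line_integral et (%x. A2 x - A1 x) x))) at_top"
proof -
 let ?r = "%A. ray {..0} et (%z. et \<bullet> A z) x"
 have c: "continuous_on UNIV A1" "continuous_on UNIV A2" using C_diff_cont A1(1) A2(1) by blast+
 have p: "((%ta. pot1 ta x) ---> ?r A1) at_top" "((%ta. pot2 ta x) ---> ?r A2) at_top"
  unfolding pot1_def pot2_def
  by (rule F1.pot_tendsto[OF eta_facts(1)[OF eta] eta(1) eta_tendsto(1)], assumption, simp,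
    rule F2.pot_tendsto[OF eta_facts(2)[OF eta] eta(1) eta_tendsto(2)], assumption, simp)
 have "?r A2 = ray {..0} et (%z. et \<bullet> (A2 z - A1 z) + et \<bullet> A1 z) x" by (simp add: inner_diff_right)
 also have "... = ?r (%z. A2 z - A1 z) + ?r A1"
  by (rule ray_add[OF eta(1), where R=R]) (auto intro!: continuous_intros c simp: A1 A2)
 finally have r: "?r A2 - ?r A1 = half_line_integral et (%x. A2 x - A1 x) x" by (simp add: half_line_integral_ray)
 have "((%ta. \<i> / complex_of_real ta) ---> 0) at_top"
  by (intro tendsto_divide_0[OF tendsto_const] filterlim_of_real_at_infinity)
 hence "((%ta. exp (- \<i> * ((1 + \<i> / of_real ta) * of_real (xi \<bullet> x))) * exp (\<i> * of_real (pot2 ta x - pot1 ta x)))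
  ---> exp (- \<i> * ((1 + 0) * of_real (xi \<bullet> x))) * exp (\<i> * of_real (?r A2 - ?r A1))) at_top"
  by (intro tendsto_intros p)
 hence "((%ta. exp (- \<i> * ((1 + \<i> / of_real ta) * of_real (xi \<bullet> x))) * exp (\<i> * of_real (pot2 ta x - pot1 ta x)))
  ---> exp (- \<i> * of_real (xi \<bullet> x)) * exp (\<i> * of_real (half_line_integral et (%x. A2 x - A1 x) x))) at_top"
  by (simp add: r)
 moreover have "EV ta. exp (- \<i> * ((1 + \<i> / of_real ta) * of_real (xi \<bullet> x))) * exp (\<i> * of_real (pot2 ta x - pot1 ta x)) = E1 ta x * E2 ta x"
  using ev_T0
 proof eventually_elim
  case (elim ta)
  have t: "ta > 0" using T0(1)[OF elim] by simp
  have "e1 ta \<bullet> x - e2 ta \<bullet> x = - (xi \<bullet> x) / ta"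
   using eta_facts(4)[OF eta T0(2)[OF elim]] by (simp add: inner_diff_left[symmetric])
  hence e: "e1 ta \<bullet> x = e2 ta \<bullet> x - (xi \<bullet> x) / ta" by simp
  have "- \<i> * ((1 + \<i> / of_real ta) * of_real (xi \<bullet> x)) + \<i> * of_real (pot2 ta x - pot1 ta x)
   = \<i> * (sqrt_lam ta * of_real (e1 ta \<bullet> x) + of_real (- pot1 ta x)) + \<i> * (- sqrt_lam ta * of_real (e2 ta \<bullet> x) + of_real (pot2 ta x))"
   unfolding e sqrt_lam_def using t by (simp add: field_simps)
  thus ?case by (simp only: E1_def E2_def exp_add[symmetric])
 qed
 ultimately show ?thesis by (rule Lim_transform_eventually)
qed

lemma I_main_tendsto:
 "((%ta. LINT x|M. I_main ta x) ---> 2 * (LINT x|M. of_real (et \<bullet> (A1 x - A2 x)) * exp (- \<i> * of_real (xi \<bullet> x))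
   * amplitude et (%x. A2 x - A1 x) xi y x * exp (\<i> * of_real (half_line_integral et (%x. A2 x - A1 x) x)))) at_top"
proof -
 define J where "J x = of_real (et \<bullet> (A1 x - A2 x)) * exp (- \<i> * of_real (xi \<bullet> x))
   * amplitude et (%x. A2 x - A1 x) xi y x * exp (\<i> * of_real (half_line_integral et (%x. A2 x - A1 x) x))" for x
 \<comment> \<open>Setting the integrand to zero below \<open>T0\<close> makes it measurable for
   every \<tau>, as dominated convergence along \<open>at_top\<close> demands.\<close>
 define s where "s ta = (if ta \<ge> T0 then I_main ta else (%x. 0))" for ta
 have lim: "((%ta. I_main ta x) ---> 2 * J x) at_top" for x
 proof -
  have "((%ta. I_main ta x) ---> exp (- \<i> * of_real (xi \<bullet> x)) * exp (\<i> * of_real (half_line_integral et (%x. A2 x - A1 x) x))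
   * (2 * amplitude et (%x. A2 x - A1 x) xi y x * of_real (et \<bullet> (A1 x - A2 x)))) at_top"
   unfolding I_main_def by (intro tendsto_intros phase_tendsto b2_tendsto eta_tendsto)
  thus ?thesis by (simp add: J_def mult_ac)
 qed
 have e: "unif_O Om 0 (%ta x. e2 ta)"
  by (rule unif_OI[of _ _ 1], rule eventually_mono[OF ev_T0]) (use e_norm(2) T0(1) in force)
 have "unif_O Om 0 (%ta x. A1 x - A2 x)"
  by (intro unif_O_diff unif_O_subset[OF bounded_field[OF A1]] unif_O_subset[OF bounded_field[OF A2]] subset_UNIV)
 from unif_O_mult[OF unif_O_mult[OF E_bounds] unif_O_mult[OF unif_O_linear[OF bl_mult_right unif_O_subset[OF b2_bounds(1) subset_UNIV]]
    unif_O_linear[OF bounded_linear_of_real unif_O_bilinear[OF bounded_bilinear_inner e this]]]]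
 have "unif_O Om 0 I_main" unfolding I_main_def[abs_def] by simp
 then obtain C where C: "EV ta. \<forall>x\<in>Om. norm (I_main ta x) \<le> C * ta powr 0" by (rule unif_OE)
 have sm: "s ta \<in> borel_measurable M" for ta
  using measurable_dom[OF continuous_I_main[of ta]] by (simp add: s_def)
 have slim: "((%ta. s ta x) ---> 2 * J x) at_top" for x
  by (rule Lim_transform_eventually[OF lim]) (use ev_T0 in eventually_elim, simp add: s_def)
 have Jm: "(%x. 2 * J x) \<in> borel_measurable M"
 proof (rule borel_measurable_LIMSEQ_metric)
  show "s (real n) \<in> borel_measurable M" for n by (rule sm)
  show "(%n. s (real n) x) ----> 2 * J x" for x by (rule filterlim_compose[OF slim filterlim_real_sequentially])
 qed
 have "((%ta. LINT x|M. s ta x) ---> (LINT x|M. 2 * J x)) at_top"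
 proof (rule integral_dominated_convergence_at_top[where w="%_. C"])
  show "integrable M (%_. C)" using finite_dom by (rule finite_measure.integrable_const)
  show "EV ta. AE x in M. norm (s ta x) \<le> C"
   using C ev_T0 eventually_gt_at_top[of 0]
  proof eventually_elim
   case (elim ta)
   thus ?case by (intro AE_I2) (simp add: s_def)
  qed
 qed (simp_all add: slim sm Jm)
 moreover have "EV ta. (LINT x|M. s ta x) = (LINT x|M. I_main ta x)"
  using ev_T0 by eventually_elim (simp add: s_def)
 ultimately have "((%ta. LINT x|M. I_main ta x) ---> (LINT x|M. 2 * J x)) at_top" by (rule Lim_transform_eventually)
 thus ?thesis by (simp add: J_def[abs_def])
qed

text \<open>The error of \<open>DN_diff_error\<close> and the integral of \<open>I_rem\<close> both
  have order 2/3; division by \<surd>\<lambda> leaves order -1/3, so only the integral of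
  \<open>I_main\<close> contributes.\<close>

theorem DN_diff_tendsto:
 "((%ta. DN_diff ta / sqrt_lam ta) ---> 2 * (LINT x|M. of_real (et \<bullet> (A1 x - A2 x)) * exp (- \<i> * of_real (xi \<bullet> x))
   * amplitude et (%x. A2 x - A1 x) xi y x * exp (\<i> * of_real (half_line_integral et (%x. A2 x - A1 x) x)))) at_top"
proof -
 have "unif_O Om (2/3) I_rem"
  using unif_O_mult[OF unif_O_mult[OF E_bounds] unif_O_diff[OF unif_O_subset[OF r2_bound[of A1 V1, OF A1 V(3)] subset_UNIV]
    unif_O_subset[OF r2_bound[of A2 V2, OF A2 V(4)] subset_UNIV]]] by (simp add: I_rem_def[abs_def])
 from unif_O_integral[OF this] have "unif_O UNIV (2/3) (%ta (_::unit). LINT x|M. I_rem ta x)"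
  using eventually_mono[OF ev_T0 in_L2_I(2)] by simp
 from unif_O_mult[OF unif_O_add[OF DN_diff_error this] unif_O_inverse_sqrt_lam]
 have "unif_O UNIV (-1/3) (%ta (_::unit). (DN_diff ta - sqrt_lam ta * (LINT x|M. I_main ta x)) / sqrt_lam ta)"
  by simp
 from unif_O_tendsto_0[OF this, of "()"]
 have "((%ta. (DN_diff ta - sqrt_lam ta * (LINT x|M. I_main ta x)) / sqrt_lam ta) ---> 0) at_top" by simp
 moreover have "sqrt_lam ta \<noteq> 0" for ta by (simp add: sqrt_lam_def complex_eq_iff)
 ultimately have "((%ta. DN_diff ta / sqrt_lam ta - (LINT x|M. I_main ta x)) ---> 0) at_top" by (simp add: diff_divide_distrib)
 from tendsto_add[OF this I_main_tendsto] show ?thesis by simp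
qed

end

section \<open>The limit\<close>

text \<open>The glued field equals \<open>B\<close> on the domain and \<open>A\<close> on the open
  set \<open>W\<close>, which consists of a neighbourhood of the boundary and the exterior. These
  two open sets cover the space, so differentiability and continuity of the derivatives are checked
  on each separately.\<close>

lemma C_diff_1_extension:
 fixes A B :: "real^'n::finite => real^'n"
 assumes Om: "open Om" and B: "C1_closure Om B" "!!x. x \<in> Om ==> F x = B x"
  and A: "C_diff 1 A" "!!x. x \<notin> Om ==> F x = A x"
  and U: "open U" "frontier Om \<subseteq> U" "!!x. x \<in> U ==> F x = A x"
 shows "C_diff 1 F"
proof -
 obtain D :: "real^'n => ((real^'n) \<Rightarrow>\<^sub>L (real^'n))" where D: "continuous_on (closure Om) D"
  "!!x. x \<in> Om ==> (B has_derivative blinfun_apply (D x)) (at x)" using B(1) by (auto simp: C1_closure_def)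
 define W where "W = U \<union> - closure Om"
 have W: "open W" "!!x. x \<in> W ==> F x = A x"
  using U A(2) closure_subset[of Om] by (auto simp: W_def open_Compl)
 have cover: "Om \<union> W = UNIV" using U(2) Om by (auto simp: W_def frontier_def interior_open)
 have FD: "(F has_derivative blinfun_apply (D x)) (at x)" if "x \<in> Om" for x
  using has_derivative_transform_within_open[OF D(2)[OF that] Om that, of F] B(2) by simp
 have FA: "(F has_derivative frechet_derivative A (at x)) (at x)" if "x \<in> W" for x
 proof (rule has_derivative_transform_within_open[OF _ W(1) that])
  show "(A has_derivative frechet_derivative A (at x)) (at x)"
   using C_diff_D[OF A(1), of x] by (simp add: frechet_derivative_works)
 qed (use W(2) in simp)
 have "continuous_on Om (partial k F)" for k
 proof -
  have "continuous_on Om (%x. blinfun_apply (D x) (axis k 1))"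
   by (intro continuous_intros continuous_on_subset[OF D(1)] closure_subset)
  thus ?thesis by (rule continuous_on_eq) (simp add: partial_eqI[OF FD])
 qed
 moreover have "continuous_on W (partial k F)" for k
 proof -
  have "continuous_on W (partial k A)" by (rule continuous_on_subset[OF C_diff_cont_partial[OF A(1)]]) simp
  thus ?thesis by (rule continuous_on_eq) (simp only: partial_eqI[OF FA] partial_def[of _ A])
 qed
 ultimately have "continuous_on UNIV (partial k F)" for k
  using continuous_on_open_Un[OF Om W(1), of "partial k F"] cover by simp
 moreover have "F differentiable at x" for x
  using FD[of x] FA[of x] cover by (auto simp: differentiable_def)
 ultimately show ?thesis by simp
qed

theorem proposition3p4:
  fixes \<Omega> \<Omega>1 \<Omega>t U1 :: "(real^'n::finite) set"
    and \<sigma> :: "(real^'n) measure" and \<nu> :: "real^'n \<Rightarrow> real^'n"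
    and A1 A2 At1 At2 A :: "real^'n \<Rightarrow> real^'n"
    and V1 V2 \<rho> :: "real^'n \<Rightarrow> real"
    and \<xi> \<eta> y :: "real^'n"
    and S1 S2 :: "real \<Rightarrow> complex"
    and b :: "real^'n \<Rightarrow> complex" and \<psi> :: "real^'n \<Rightarrow> real"
  assumes dim: "CARD('n) \<ge> 2"
    and domain: "C11_domain \<Omega>" "bounded \<Omega>" "connected \<Omega>" "\<Omega> \<noteq> {}" "connected (- \<Omega>)"
    and normal: "outward_unit_normal \<Omega> \<nu>"
    and surface: "surface_measure \<Omega> \<sigma>"
    and Omega1: "open U1" "frontier \<Omega> \<subseteq> U1" "\<Omega>1 = U1 \<inter> \<Omega>" "\<Omega>1 \<subset> \<Omega>"
    and V: "in_Linfty \<Omega> V1" "in_Linfty \<Omega> V2"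
    and A12: "C1_closure \<Omega> A1" "C1_closure \<Omega> A2" "\<forall>x\<in>\<Omega>1. A1 x = A2 x"
    and Omegat: "open \<Omega>t" "bounded \<Omega>t" "closure \<Omega> \<subseteq> \<Omega>t"
    and At1: "C_diff 1 At1" "compact (supp At1)" "supp At1 \<subseteq> \<Omega>t" "\<forall>x\<in>\<Omega>. At1 x = A1 x"
    and At2: "\<forall>x\<in>\<Omega>. At2 x = A2 x" "\<forall>x\<in>\<Omega>t - \<Omega>. At2 x = At1 x" "\<forall>x. x \<notin> \<Omega>t \<longrightarrow> At2 x = 0"
    and mollifier: "smooth \<rho>" "\<forall>x. \<rho> x \<ge> 0" "supp \<rho> \<subseteq> cball 0 1" "(LINT x|lborel. \<rho> x) = 1"
    and A_def: "\<forall>x. A x = (if x \<in> \<Omega> then A2 x - A1 x else 0)"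
    and xi: "\<xi> \<noteq> 0"
    and eta: "norm \<eta> = 1" "\<eta> \<bullet> \<xi> = 0"
    and y: "norm y = 1" "y \<bullet> \<eta> = 0"
    and S1_def: "\<forall>\<tau>>norm \<xi>. S1 \<tau> =
        DN_map \<Omega> \<sigma> \<nu> A1 V1 ((sqrt_lam \<tau>)\<^sup>2) (Phi1 \<rho> At1 \<xi> \<eta> \<tau>) (Phi2 \<rho> At1 At2 \<xi> \<eta> y \<tau>)"
    and S2_def: "\<forall>\<tau>>norm \<xi>. S2 \<tau> =
        DN_map \<Omega> \<sigma> \<nu> A2 V2 ((sqrt_lam \<tau>)\<^sup>2) (Phi1 \<rho> At1 \<xi> \<eta> \<tau>) (Phi2 \<rho> At1 At2 \<xi> \<eta> y \<tau>)"
    and b_def: "b = amplitude \<eta> A \<xi> y"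
    and psi_def: "\<forall>x. \<psi> x = half_line_integral \<eta> A x"
  shows "((\<lambda>\<tau>. (S1 \<tau> - S2 \<tau>) / sqrt_lam \<tau>) \<longlongrightarrow>
           2 * (LINT x|lebesgue_on \<Omega>.
                  of_real (\<eta> \<bullet> (A1 x - A2 x)) * exp (- \<i> * of_real (\<xi> \<bullet> x))
                  * b x * exp (\<i> * of_real (\<psi> x)))) at_top"
proof -
 have O: "open \<Omega>" using domain(1) by (simp add: C11_domain_def)
 interpret bs: boundary_setting \<Omega> \<sigma> \<nu> \<rho>
  by unfold_locales (rule domain(1) domain(2) surface normal mollifier)+
 have At1_out: "At1 x = 0" if "x \<notin> \<Omega>t" for x using not_in_supp[of x At1] At1(3) that by blast
 have out: "At2 x = At1 x" if "x \<notin> \<Omega>" for x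
  using At2(2,3) At1_out that by (cases "x \<in> \<Omega>t") auto
 \<comment> \<open>Near the boundary the extensions coincide: inside by equality of the potentials
   on \<Omega>1, outside by construction. This makes \<open>At2\<close> of class C^1 across the
   boundary.\<close>
 have inU: "At2 x = At1 x" if "x \<in> U1" for x
  using out Omega1(3) A12(3) At1(4) At2(1) that by (cases "x \<in> \<Omega>") auto
 have At2C: "C_diff 1 At2"
  by (rule C_diff_1_extension[OF O A12(2) _ At1(1) out Omega1(1,2) inU]) (use At2(1) in auto)
 obtain R1 where R1: "R1 > 0" "!!x. norm x > R1 ==> At1 x = 0" using compact_supp_vanish[OF At1(2)] by blast
 obtain R2 where R2: "!!x. x \<in> \<Omega> ==> norm x \<le> R2" using domain(2) by (auto simp: bounded_iff)
 \<comment> \<open>Outside \<Omega> the extensions agree, so beyond the radius of \<Omega> and that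
   of the support of \<open>At1\<close> both vanish.\<close>
 define R where "R = max R1 R2"
 have R: "R > 0" using R1(1) by (simp add: R_def)
 have v1: "At1 x = 0" if "norm x > R" for x using R1(2) that by (simp add: R_def)
 have v2: "At2 x = 0" if "norm x > R" for x
 proof -
  have "x \<notin> \<Omega>" using R2[of x] that by (auto simp: R_def)
  thus ?thesis using out v1[OF that] by simp
 qed
 have fr: "At1 x = At2 x" if "x \<in> frontier \<Omega>" for x
  using out[of x] that O by (auto simp: frontier_def interior_open)
 \<comment> \<open>The locale \<open>cgo\<close> asks for electric potentials bounded at every
   point, while \<open>in_Linfty\<close> bounds them almost everywhere on \<Omega>; suitable
   representatives are passed to it.\<close>
 obtain W1 C1 where W1: "W1 \<in> borel_measurable lebesgue" "!!x. \<bar>W1 x\<bar> \<le> C1" "V1 \<in> borel_measurable (lebesgue_on \<Omega>)" "AE x in lebesgue_on \<Omega>. V1 x = W1 x"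
  using bs.in_Linfty_representative[OF V(1)] by blast
 obtain W2 C2 where W2: "W2 \<in> borel_measurable lebesgue" "!!x. \<bar>W2 x\<bar> \<le> C2" "V2 \<in> borel_measurable (lebesgue_on \<Omega>)" "AE x in lebesgue_on \<Omega>. V2 x = W2 x"
  using bs.in_Linfty_representative[OF V(2)] by blast
 have W: "\<bar>W1 x\<bar> \<le> max C1 C2" "\<bar>W2 x\<bar> \<le> max C1 C2" for x using W1(2)[of x] W2(2)[of x] by auto
 interpret cgo \<Omega> \<sigma> \<nu> \<rho> At1 At2 W1 W2 R "max C1 C2" \<xi> \<eta> y
  by unfold_locales (rule At1(1) At2C v1 v2 R fr W1(1) W2(1) W eta | assumption)+
 obtain c1 where c1: "!!x. norm (At1 x) \<le> c1" using cvanish_bounded[of At1 R, OF C_diff_cont[OF At1(1)] v1] by blast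
 obtain c2 where c2: "!!x. norm (At2 x) \<le> c2" using cvanish_bounded[of At2 R, OF C_diff_cont[OF At2C] v2] by blast
 \<comment> \<open>\<open>DN_map_cong\<close> replaces the given coefficients by extensions and
   representatives, and \<open>Phi_eq\<close> identifies the ansatz functions.\<close>
 have S: "S1 \<tau> - S2 \<tau> = DN_diff \<tau>" if t: "\<tau> \<ge> T0" for \<tau>
 proof -
  have Im: "Im ((sqrt_lam \<tau>)^2) \<noteq> 0" using T0(1)[OF t] by (simp add: Im_sqrt_lam_power2)
  have m: "magnetic_problem \<Omega> \<sigma> \<nu> \<rho> At1 W1 ((sqrt_lam \<tau>)^2) c1 C1" "magnetic_problem \<Omega> \<sigma> \<nu> \<rho> At2 W2 ((sqrt_lam \<tau>)^2) c2 C2"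
   by (unfold_locales, (rule At1(1) At2C c1 c2 W1(1,2) W2(1,2) Im)+)+
  have "A1 x = At1 x" "A2 x = At2 x" if "x \<in> \<Omega>" for x using At1(4) At2(1) that by auto
  thus ?thesis
   using S1_def S2_def T0(2)[OF t] magnetic_problem.DN_map_cong[OF m(1) _ W1(3,4), of A1] magnetic_problem.DN_map_cong[OF m(2) _ W2(3,4), of A2]
   by (simp add: DN_diff_def Phi_eq[OF t])
 qed
 have A: "A = (%x. At2 x - At1 x)"
 proof
  show "A x = At2 x - At1 x" for x using A_def At1(4) At2(1) out[of x] by (cases "x \<in> \<Omega>") auto
 qed
 have p: "\<psi> = half_line_integral \<eta> A" using psi_def by (simp add: fun_eq_iff)
 have "(LINT x|lebesgue_on \<Omega>. of_real (\<eta> \<bullet> (A1 x - A2 x)) * exp (- \<i> * of_real (\<xi> \<bullet> x)) * b x * exp (\<i> * of_real (\<psi> x)))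
  = (LINT x|lebesgue_on \<Omega>. of_real (\<eta> \<bullet> (At1 x - At2 x)) * exp (- \<i> * of_real (\<xi> \<bullet> x)) * b x * exp (\<i> * of_real (\<psi> x)))"
  using At1(4) At2(1) by (intro LINT_cong[OF refl]) simp
 with DN_diff_tendsto have "((%\<tau>. DN_diff \<tau> / sqrt_lam \<tau>) ---> 2 * (LINT x|lebesgue_on \<Omega>.
   of_real (\<eta> \<bullet> (A1 x - A2 x)) * exp (- \<i> * of_real (\<xi> \<bullet> x)) * b x * exp (\<i> * of_real (\<psi> x)))) at_top"
  by (simp add: b_def p A)
 moreover have "\<forall>\<^sub>F \<tau> in at_top. DN_diff \<tau> / sqrt_lam \<tau> = (S1 \<tau> - S2 \<tau>) / sqrt_lam \<tau>"
  using ev_T0 by eventually_elim (simp add: S)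
 ultimately show ?thesis by (rule Lim_transform_eventually)
qed

end
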